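(* Let $q\in(0,1)$ and $\tau\in\mathbb{R}$. (a) Let $\mathcal{K}_{\tau;-}$ be the integral operator on $L^2(\Gamma_\infty)$, $(\mathcal{K}_{\tau;-}f)(z)=\frac1{2\pi i}\int_{\Gamma_\infty}\mathcal{K}_{\tau;-}(z,w)f(w)\,dw$, where $\Gamma_\infty=\{-1-yi:y\in\mathbb{R}\}$ is oriented downward and $$\mathcal{K}_{\tau;-}(z,w)=\frac{e^{w^2/2+\tau w}}{w-qz}.$$ Then for all $\zeta\in\mathbb{C}$, $$\det(I+\zeta\mathcal{K}_{\tau;-})=\det\left(I+\zeta\hat K\chi_{(\tau(1+q)/(1-q),\infty)}\right),$$ where $\hat K$ is the operator on $L^2(\mathbb{R})$ with kernel $$\hat K(z,z')=\frac1{\sqrt{2\pi}(1+q)}\,e^{-\frac{1+q^2}{(1+q)^2}\frac{z^2+z'^2}4+\frac q{(1+q)^2}zz'}$$ and $\chi_{(a,\infty)}$ is multiplication by the indicator function of $(a,\infty)$. (b) For every fixed $m\ge1$, the limiting distribution of the $m$-th rightmost particle $x_m$ in the $q$-TAZRP with step initial condition and all $b_k=1$ is, under proper scaling, the same as the limiting distribution of the $m$-th leftmost particle $x_m^{\mathrm{ASEP}}$ in the ASEP with step initial condition, right jumping rate $q/(1+q)$ and left jumping rate $1/(1+q)$. Explicitly, with $\gamma=\frac{1-q}{1+q}$, $$\lim_{n\to\infty}\mathbb{P}_{0^\infty}\left(x_m(n-\tau\sqrt n)>n\right)=\lim_{t\to\infty}\mathbb{P}\left(\frac{x_m^{\ma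thrm{ASEP}}(t/\gamma)+t}{\gamma^{1/2}t^{1/2}}\le-\frac{\tau(1+q)}{1-q}\right).$$
   Context: $q$-TAZRP: let $(a_x)_{x\in\mathbb{Z}}$ be positive numbers and $b_x=(1-q)a_x$. In the $q$-TAZRP on $\mathbb{Z}$, for each site $x$ occupied by $k\ge1$ particles, one particle jumps from $x$ to $x+1$ at rate $a_x(1-q^k)$, all exponential clocks being independent; if $x$ is occupied by infinitely many particles the rate is $a_x$. In its step initial condition $0^\infty$, infinitely many particles labelled $1,2,3,\dots$ all sit at site $0$ at time $0$ and all other sites are empty; among the particles at a site the one with smallest label jumps and becomes the one with largest label at $x+1$, so $x_m(t)$ is the position of the $m$-th rightmost particle. $\mathbb{P}_{0^\infty}$ is the law of this process. ASEP: particles on $\mathbb{Z}$, at most one per site; each particle independently attempts to jump one step to the right at rate $p_R$ and one step to the left at rate $p_L$, and the jump is suppressed if the target site is occupied. The step initial condition is that exactly the sites $1,2,3,\dots$ are occupied at time $0$; $x_m^{\mathrm{ASEP}}(t)$ is the position of the $m$-th leftmost particle. Determinants are Fredholm determinants. *)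

theory Defs
  imports
    "HOL-Probability.Probability"
    "Jordan_Normal_Form.Determinant"
begin

section \<open>Fredholm determinants\<close>

text \<open>
  \<open>fredholm_det M K\<close> is $\det(I + K)$ for the integral operator on $L^2(M)$ with kernel \<open>K\<close>,
  given by the Fredholm series
  $\sum_n \frac{1}{n!} \int \det (K(x_i, x_j))_{i,j<n} \, dM(x_0) \cdots dM(x_{n-1})$.
  Since the Bochner integral and \<open>suminf\<close> are total, a value of \<open>fredholm_det\<close> is meaningful only
  together with \<open>fredholm_convergent\<close>.
\<close>

definition fredholm_minor :: "('a \<Rightarrow> 'a \<Rightarrow> complex) \<Rightarrow> nat \<Rightarrow> (nat \<Rightarrow> 'a) \<Rightarrow> complex" where
  "fredholm_minor K n x = Determinant.det (Matrix.mat n n (\<lambda>(i, j). K (x i) (x j)))"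

definition fredholm_term :: "'a measure \<Rightarrow> ('a \<Rightarrow> 'a \<Rightarrow> complex) \<Rightarrow> nat \<Rightarrow> complex" where
  "fredholm_term M K n = (LINT x|PiM {..<n} (\<lambda>_. M). fredholm_minor K n x) / fact n"

definition fredholm_convergent :: "'a measure \<Rightarrow> ('a \<Rightarrow> 'a \<Rightarrow> complex) \<Rightarrow> bool" where
  "fredholm_convergent M K \<longleftrightarrow>
     (\<forall>n. integrable (PiM {..<n} (\<lambda>_. M)) (fredholm_minor K n)) \<and>
     summable (\<lambda>n. norm (fredholm_term M K n))"

definition fredholm_det :: "'a measure \<Rightarrow> ('a \<Rightarrow> 'a \<Rightarrow> complex) \<Rightarrow> complex" where
  "fredholm_det M K = (\<Sum>n. fredholm_term M K n)"

text \<open>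
  For a curve \<open>\<Gamma>\<close> parametrised by the real line, the operator
  $(\mathcal{K} f)(z) = \frac{1}{2 \pi i} \int_\Gamma \mathcal{K}(z, w) f(w) \, dw$ becomes, after
  $w = \Gamma(t)$, $dw = \Gamma'(t) \, dt$, the operator with the following kernel with respect to
  Lebesgue measure. For \<open>contour_infty\<close> the parametrisation has unit speed, so it identifies
  the two $L^2$ spaces.
\<close>

definition contour_kernel :: "(real \<Rightarrow> complex) \<Rightarrow> (complex \<Rightarrow> complex \<Rightarrow> complex) \<Rightarrow> real \<Rightarrow> real \<Rightarrow> complex" where
  "contour_kernel \<Gamma> K s t =
     K (\<Gamma> s) (\<Gamma> t) * vector_derivative \<Gamma> (at t) / (2 * complex_of_real pi * \<i>)"

definition contour_infty :: "real \<Rightarrow> complex" where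
  "contour_infty y = - 1 - complex_of_real y * \<i>"

definition K_minus :: "real \<Rightarrow> real \<Rightarrow> complex \<Rightarrow> complex \<Rightarrow> complex" where
  "K_minus q \<tau> z w =
     exp (w\<^sup>2 / 2 + complex_of_real \<tau> * w) / (w - complex_of_real q * z)"

definition K_hat :: "real \<Rightarrow> real \<Rightarrow> real \<Rightarrow> real" where
  "K_hat q z z' = 1 / (sqrt (2 * pi) * (1 + q)) *
     exp (- ((1 + q\<^sup>2) / (1 + q)\<^sup>2) * ((z\<^sup>2 + z'\<^sup>2) / 4) + q / (1 + q)\<^sup>2 * z * z')"


section \<open>Markov jump processes driven by exponential clocks\<close>

text \<open>
  In state \<open>s\<close> every move \<open>e\<close> with \<open>rate s e > 0\<close> carries an independent exponential clock of rate
  \<open>rate s e\<close>; the move whose clock rings first is executed. By memorylessness all clocks may be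
  restarted after each jump, so the process is driven by an i.i.d. family \<open>\<omega> (n, e)\<close> of rate-1
  exponential variables: the clock of \<open>e\<close> after the \<open>n\<close>-th jump shows \<open>\<omega> (n, e) / rate s e\<close>.

  The construction presupposes that in each reachable state the set of moves of positive rate is
  finite and nonempty, and that almost surely there are finitely many jumps in bounded time.
  Both processes below satisfy this from their step initial conditions.
\<close>

definition clocks :: "(nat \<times> 'e \<Rightarrow> real) measure" where
  "clocks = PiM UNIV (\<lambda>_. density lborel (\<lambda>t. ennreal (exponential_density 1 t)))"

text \<open>Time of the \<open>n\<close>-th jump and state immediately after it.\<close>

primrec jump_chain ::
  "('s \<Rightarrow> 'e \<Rightarrow> real) \<Rightarrow> ('e \<Rightarrow> 's \<Rightarrow> 's) \<Rightarrow> 's \<Rightarrow> (nat \<times> 'e \<Rightarrow> real) \<Rightarrow> nat \<Rightarrow> real \<times> 's"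
where
  "jump_chain rate move s0 \<omega> 0 = (0, s0)"
| "jump_chain rate move s0 \<omega> (Suc n) =
     (let (t, s) = jump_chain rate move s0 \<omega> n;
          e = arg_min_on (\<lambda>e. \<omega> (n, e) / rate s e) {e. rate s e > 0}
      in (t + \<omega> (n, e) / rate s e, move e s))"

definition jump_process ::
  "('s \<Rightarrow> 'e \<Rightarrow> real) \<Rightarrow> ('e \<Rightarrow> 's \<Rightarrow> 's) \<Rightarrow> 's \<Rightarrow> real \<Rightarrow> (nat \<times> 'e \<Rightarrow> real) \<Rightarrow> 's"
where
  "jump_process rate move s0 t \<omega> =
     snd (jump_chain rate move s0 \<omega> (LEAST n. t < fst (jump_chain rate move s0 \<omega> (Suc n))))"


section \<open>The $q$-TAZRP\<close>

text \<open>
  A state gives the position \<open>x m\<close> of the particle labelled \<open>m\<close>, for \<open>m \<ge> 1\<close>; the label 0 is not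
  used. A move is the site from which a particle jumps. From the step initial condition
  \<open>x 1 \<ge> x 2 \<ge> \<dots>\<close> is preserved, so \<open>x m\<close> is the \<open>m\<close>-th rightmost particle, and a particle
  arriving at a site automatically has the largest label there.
\<close>

definition labels_at :: "(nat \<Rightarrow> int) \<Rightarrow> int \<Rightarrow> nat set" where
  "labels_at x y = {m. 1 \<le> m \<and> x m = y}"

definition qtazrp_rate :: "real \<Rightarrow> (int \<Rightarrow> real) \<Rightarrow> (nat \<Rightarrow> int) \<Rightarrow> int \<Rightarrow> real" where
  "qtazrp_rate q a x y =
     (if labels_at x y = {} then 0
      else if finite (labels_at x y) then a y * (1 - q ^ card (labels_at x y))
      else a y)"

definition qtazrp_move :: "int \<Rightarrow> (nat \<Rightarrow> int) \<Rightarrow> (nat \<Rightarrow> int)" where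
  "qtazrp_move y x = x((LEAST m. m \<in> labels_at x y) := y + 1)"

definition qtazrp_step :: "nat \<Rightarrow> int" where
  "qtazrp_step m = 0"

definition qtazrp ::
  "real \<Rightarrow> (int \<Rightarrow> real) \<Rightarrow> nat \<Rightarrow> real \<Rightarrow> (nat \<times> int \<Rightarrow> real) \<Rightarrow> int"
where
  "qtazrp q a m t \<omega> = jump_process (qtazrp_rate q a) qtazrp_move qtazrp_step t \<omega> m"


section \<open>The ASEP\<close>

text \<open>
  Again \<open>x m\<close> is the position of particle \<open>m \<ge> 1\<close>, label 0 being unused. A move is a particle
  together with a direction. Attempted jumps to occupied sites have no effect and get rate 0.
  Exclusion preserves \<open>x 1 < x 2 < \<dots>\<close>, so \<open>x m\<close> is the \<open>m\<close>-th leftmost particle.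
\<close>

datatype direction = Leftward | Rightward

fun offset :: "direction \<Rightarrow> int" where
  "offset Leftward = - 1"
| "offset Rightward = 1"

definition asep_rate :: "real \<Rightarrow> real \<Rightarrow> (nat \<Rightarrow> int) \<Rightarrow> nat \<times> direction \<Rightarrow> real" where
  "asep_rate pR pL x = (\<lambda>(m, d).
     if 1 \<le> m \<and> x m + offset d \<notin> x ` {1..}
     then (case d of Leftward \<Rightarrow> pL | Rightward \<Rightarrow> pR) else 0)"

definition asep_move :: "nat \<times> direction \<Rightarrow> (nat \<Rightarrow> int) \<Rightarrow> (nat \<Rightarrow> int)" where
  "asep_move = (\<lambda>(m, d) x. x(m := x m + offset d))"

definition asep_step :: "nat \<Rightarrow> int" where
  "asep_step m = int m"

definition asep ::
  "real \<Rightarrow> real \<Rightarrow> nat \<Rightarrow> real \<Rightarrow> (nat \<times> nat \<times> direction \<Rightarrow> real) \<Rightarrow> int"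
where
  "asep pR pL m t \<omega> = jump_process (asep_rate pR pL) asep_move asep_step t \<omega> m"

end

theory Submission
  imports Defs "Jordan_Normal_Form.Schur_Decomposition" "HOL-Complex_Analysis.Complex_Analysis" "HOL-Real_Asymp.Real_Asymp"
begin

text \<open>
  (a) With \<open>1 / (q z - w) = \<integral> exp (- u (q z - w)) du\<close>, taken over a half line, the contour operator
  becomes a product \<open>AB\<close> of two operators on the line, and a Gaussian integral evaluates \<open>BA\<close> to
  the cut-off of \<open>K_hat\<close>. The identity \<open>det (I + AB) = det (I + BA)\<close> holds for every term of
  the Fredholm series by Fubini's theorem, and Hadamard's inequality gives convergence.

  (b) Let \<open>N\<close> be the number of particles that have passed a given level. By Markov duality the
  expectations of \<open>q ^ (k N)\<close> (for the ASEP: of products over \<open>k\<close> neighbouring levels) are values of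
  the semigroup of a system of \<open>k\<close> dual particles. In the diffusive scaling both dual systems are compared,
  by the maximum principle, with the same function: a \<open>k\<close>-fold nested contour integral \<open>V\<close> which solves the
  heat equation and whose integrand contains the factors \<open>1 / (z i - q z j)\<close>, so that the boundary condition
  for adjacent particles holds by antisymmetry. The error at collisions is of lower order than the
  drift of an exponential barrier function. Hence all these expectations converge to limits
  common to both processes. Since \<open>q ^ N\<close> lives on a discrete set, the indicator of \<open>m \<le> N\<close> is a
  uniform limit of polynomials in \<open>q ^ N\<close>, and the tail probabilities converge as well.
\<close>

section \<open>Markov generators and the maximum principle\<close>

text \<open>The shared object is \<open>V\<close>, which depends on \<open>q\<close> and
  \<open>k\<close> only. On it the two scaled generators differ from a drift plus the heat operator
  by \<open>O(h ^ 3)\<close> in the bulk and \<open>O(h ^ 2)\<close> at collisions. Two obstacles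
  shape the argument. At time 0, \<open>V\<close> is an indicator only while the last coordinate
  stays outside a bounded window; inside, nothing but a bound is available. Averaging over
  \<open>J\<close> translates with disjoint windows reduces the damage to \<open>Vmax k / J\<close>,
  and translates in the two directions give upper and lower solutions that differ by a small shift.
  That this shift is harmless requires continuity of the limit in the level, and here the q-TAZRP
  itself is the source: its first moment is a Poisson distribution function, whose weights are at
  most a constant over the square root of time, and higher moments inherit the modulus of
  continuity. The common limit in (b) is then produced by a Cauchy argument and carries no formula;
  in particular the determinants of (a) do not enter it.\<close>

locale markov_generator =
  fixes Mv :: "'m set" and r :: "'s \<Rightarrow> 'm \<Rightarrow> real" and mv :: "'m \<Rightarrow> 's \<Rightarrow> 's"
    and X :: "'s set" and c :: real
  assumes finite_moves: "finite Mv"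
    and rate_nonneg: "y \<in> X \<Longrightarrow> m \<in> Mv \<Longrightarrow> 0 \<le> r y m"
    and rate_le: "y \<in> X \<Longrightarrow> (\<Sum>m\<in>Mv. r y m) \<le> c"
    and c_pos: "0 < c"
    and move_closed: "y \<in> X \<Longrightarrow> m \<in> Mv \<Longrightarrow> 0 < r y m \<Longrightarrow> mv m y \<in> X"
begin

definition gen :: "('s \<Rightarrow> 'b::real_vector) \<Rightarrow> 's \<Rightarrow> 'b" where
  "gen f y = (\<Sum>m\<in>Mv. r y m *\<^sub>R (f (mv m y) - f y))"

lemma gen_real: "gen f y = (\<Sum>m\<in>Mv. r y m * f (mv m y)) - (\<Sum>m\<in>Mv. r y m) * f y" for f :: "'s \<Rightarrow> real"
  by (simp add: gen_def sum_subtractf sum_distrib_right right_diff_distrib)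

lemma gen_cong:
  assumes "\<And>y. y \<in> X \<Longrightarrow> f y = g y" "y \<in> X"
  shows "gen f y = gen g y"
proof -
  have "r y m *\<^sub>R (f (mv m y) - f y) = r y m *\<^sub>R (g (mv m y) - g y)" if "m \<in> Mv" for m
    using assms move_closed[OF assms(2) that] rate_nonneg[OF assms(2) that]
    by (cases "r y m = 0") auto
  then show ?thesis unfolding gen_def by (intro sum.cong) auto
qed

lemma gen_add: "gen (\<lambda>y. f y + g y) y = gen f y + gen g y"
  unfolding gen_def by (simp add: sum.distrib[symmetric] algebra_simps)

lemma gen_scale: "gen (\<lambda>y. a * f y) y = a * gen f y" for f :: "'s \<Rightarrow> real"
  unfolding gen_def by (simp add: sum_distrib_left algebra_simps)

lemma gen_diff: "gen (\<lambda>y. f y - g y) y = gen f y - gen g y"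
  unfolding gen_def by (simp add: sum_subtractf[symmetric] algebra_simps)

lemma gen_const [simp]: "gen (\<lambda>y. a) y = 0"
  unfolding gen_def by simp

lemma gen_sum: "gen (\<lambda>y. \<Sum>i\<in>A. f i y) y = (\<Sum>i\<in>A. gen (f i) y)"
  unfolding gen_def sum_subtractf[symmetric] scaleR_sum_right by (rule sum.swap)

text \<open>Iterating the differential inequality improves the lower bound \<open>- M * \<omega>\<close> by a factor
  \<open>L * s / n\<close> in the \<open>n\<close>-th step.\<close>

lemma maximum_principle:
  fixes w w' :: "real \<Rightarrow> 's \<Rightarrow> real" and \<omega> :: "'s \<Rightarrow> real"
  assumes cont: "\<And>y. y \<in> X \<Longrightarrow> continuous_on {0..T} (\<lambda>s. w s y)"
    and der: "\<And>s y. y \<in> X \<Longrightarrow> 0 < s \<Longrightarrow> s < T \<Longrightarrow> ((\<lambda>s. w s y) has_real_derivative w' s y) (at s)"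
    and super: "\<And>s y. y \<in> X \<Longrightarrow> 0 < s \<Longrightarrow> s < T \<Longrightarrow> gen (w s) y \<le> w' s y"
    and init: "\<And>y. y \<in> X \<Longrightarrow> 0 \<le> w 0 y"
    and weight: "\<And>y. y \<in> X \<Longrightarrow> 0 \<le> \<omega> y"
      "\<And>y. y \<in> X \<Longrightarrow> (\<Sum>m\<in>Mv. r y m * \<omega> (mv m y)) \<le> K * \<omega> y"
    and bound: "\<And>s y. y \<in> X \<Longrightarrow> 0 \<le> s \<Longrightarrow> s \<le> T \<Longrightarrow> - M * \<omega> y \<le> w s y"
    and "0 \<le> M" "0 \<le> K"
    and y: "y \<in> X" "0 \<le> s" "s \<le> T"
  shows "0 \<le> w s y"
proof -
  define L where "L = K + c"
  have L0: "0 \<le> L" using c_pos \<open>0 \<le> K\<close> by (simp add: L_def)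
  \<comment> \<open>The state space may be infinite and \<open>w\<close> unbounded, so a minimum
    need not be attained; improving a lower bound again and again replaces the usual argument at a
    minimum point.\<close>
  have main: "- (M * (L * s) ^ n / fact n * \<omega> y) \<le> w s y" if "y \<in> X" "0 \<le> s" "s \<le> T" for n s y
    using that
  proof (induction n arbitrary: s y)
    case 0
    then show ?case using bound[of y s] by simp
  next
    case (Suc n)
    define b where "b = (\<lambda>u::real. M * (L * u) ^ Suc n / fact (Suc n) * \<omega> y)"
    \<comment> \<open>Since the total rate is at most \<open>c\<close>, the integrating factor turns
      the coefficient of \<open>w u y\<close> into \<open>c - ?R\<close>, which is nonnegative; a
      lower bound for \<open>w\<close> then passes through every term.\<close>
    define \<phi> where "\<phi> = (\<lambda>u. exp (c * u) * (w u y + b u))"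
    have "\<phi> 0 \<le> \<phi> s"
    proof (rule DERIV_nonneg_imp_increasing_open[OF \<open>0 \<le> s\<close>])
      show "continuous_on {0..s} \<phi>"
        unfolding \<phi>_def b_def
        by (intro continuous_intros continuous_on_subset[OF cont[OF \<open>y \<in> X\<close>]]) (use Suc.prems in auto)
      fix u assume u: "0 < u" "u < s"
      have uT: "u < T" using u Suc.prems by auto
      have db: "(b has_real_derivative M * L * (L * u) ^ n / fact n * \<omega> y) (at u)"
        unfolding b_def
        by (rule derivative_eq_intros refl | simp add: field_simps del: fact_Suc)+
          (simp add: field_simps)
      have D: "(\<phi> has_real_derivative
          exp (c * u) * (c * (w u y + b u) + (w' u y + M * L * (L * u) ^ n / fact n * \<omega> y))) (at u)"
        unfolding \<phi>_def
        by (rule derivative_eq_intros refl db der[OF \<open>y \<in> X\<close> u(1) uT] | simp add: algebra_simps)+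
      have b0: "0 \<le> b u" unfolding b_def using weight(1)[OF \<open>y \<in> X\<close>] L0 u \<open>0 \<le> M\<close> by simp
      define B where "B = M * (L * u) ^ n / fact n"
      have B0: "0 \<le> B" unfolding B_def using L0 u \<open>0 \<le> M\<close> by simp
      let ?R = "\<Sum>m\<in>Mv. r y m"
      have "- (B * (\<Sum>m\<in>Mv. r y m * \<omega> (mv m y))) \<le> (\<Sum>m\<in>Mv. r y m * w u (mv m y))"
        unfolding sum_distrib_left sum_negf[symmetric]
      proof (rule sum_mono)
        fix m assume m: "m \<in> Mv"
        show "- (B * (r y m * \<omega> (mv m y))) \<le> r y m * w u (mv m y)"
        proof (cases "r y m = 0")
          case False
          then have r: "0 < r y m" using rate_nonneg[OF \<open>y \<in> X\<close> m] by simp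
          have "- (B * \<omega> (mv m y)) \<le> w u (mv m y)"
            using Suc.IH[OF move_closed[OF \<open>y \<in> X\<close> m r], of u] u uT by (simp add: B_def)
          then have "r y m * (- (B * \<omega> (mv m y))) \<le> r y m * w u (mv m y)"
            using r by (intro mult_left_mono) auto
          then show ?thesis by (simp add: algebra_simps)
        qed simp
      qed
      moreover have "B * (\<Sum>m\<in>Mv. r y m * \<omega> (mv m y)) \<le> B * (K * \<omega> y)"
        by (rule mult_left_mono[OF weight(2)[OF \<open>y \<in> X\<close>] B0])
      moreover have "(c - ?R) * (- (B * \<omega> y)) \<le> (c - ?R) * w u y"
        using Suc.IH[OF \<open>y \<in> X\<close>, of u] u uT rate_le[OF \<open>y \<in> X\<close>]
        by (intro mult_left_mono) (auto simp: B_def)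
      moreover have "0 \<le> ?R * (B * \<omega> y)"
        using rate_nonneg[OF \<open>y \<in> X\<close>] B0 weight(1)[OF \<open>y \<in> X\<close>]
        by (intro mult_nonneg_nonneg sum_nonneg) auto
      moreover have "(\<Sum>m\<in>Mv. r y m * w u (mv m y)) - ?R * w u y \<le> w' u y"
        using super[OF \<open>y \<in> X\<close> u(1) uT] by (simp add: gen_real)
      ultimately have "0 \<le> c * w u y + w' u y + (K + c) * (B * \<omega> y)"
        by (simp add: algebra_simps)
      moreover have "M * L * (L * u) ^ n / fact n * \<omega> y = (K + c) * (B * \<omega> y)"
        by (simp add: B_def L_def)
      ultimately have "0 \<le> c * (w u y + b u) + (w' u y + M * L * (L * u) ^ n / fact n * \<omega> y)"
        using mult_nonneg_nonneg[OF less_imp_le[OF c_pos] b0] by (simp add: distrib_left)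
      then show "\<exists>d. (\<phi> has_real_derivative d) (at u) \<and> 0 \<le> d"
        using D by (metis exp_ge_zero mult_nonneg_nonneg)
    qed
    moreover have "0 \<le> \<phi> 0" using init[OF \<open>y \<in> X\<close>] by (simp add: \<phi>_def b_def)
    ultimately have "0 \<le> exp (c * s) * (w s y + b s)" by (simp add: \<phi>_def)
    then have "0 \<le> w s y + b s" by (simp add: zero_le_mult_iff)
    then show ?case by (simp add: b_def)
  qed
  have "(\<lambda>n. - (M * ((L * s) ^ n / fact n) * \<omega> y)) \<longlonglongrightarrow> - (M * 0 * \<omega> y)"
    using summable_LIMSEQ_zero[OF summable_exp[of "L * s"]]
    by (intro tendsto_intros) (simp add: field_simps)
  then have "(\<lambda>n. - (M * ((L * s) ^ n / fact n) * \<omega> y)) \<longlonglongrightarrow> 0" by simp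
  then show ?thesis
    by (rule LIMSEQ_le_const2) (use main[OF y] in \<open>auto simp: field_simps\<close>)
qed

section \<open>Uniformisation: the semigroup of a bounded generator\<close>

definition step :: "('s \<Rightarrow> real) \<Rightarrow> 's \<Rightarrow> real" where
  "step f y = f y + gen f y / c"

text \<open>As the total rate is at most \<open>c\<close>, \<open>step\<close> is an average with
  nonnegative weights, and the semigroup of \<open>gen\<close> is the Poisson mixture, with
  parameter \<open>c * s\<close>, of its powers. The sum is kept as a power series in
  \<open>s\<close>, so that it can be differentiated termwise.\<close>

definition evol :: "('s \<Rightarrow> real) \<Rightarrow> real \<Rightarrow> 's \<Rightarrow> real" where
  "evol f s y = exp (- (c * s)) * (\<Sum>n. ((step ^^ n) f y * c ^ n / fact n) * s ^ n)"

lemma step_cong: "(\<And>y. y \<in> X \<Longrightarrow> f y = g y) \<Longrightarrow> y \<in> X \<Longrightarrow> step f y = step g y"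
  using gen_cong[of f g y] by (simp add: step_def)

lemma step_power_cong: "(\<And>y. y \<in> X \<Longrightarrow> f y = g y) \<Longrightarrow> y \<in> X \<Longrightarrow> (step ^^ n) f y = (step ^^ n) g y"
  by (induction n arbitrary: y) (auto intro: step_cong)

lemma step_bounds:
  assumes "\<And>y. y \<in> X \<Longrightarrow> a \<le> f y" "\<And>y. y \<in> X \<Longrightarrow> f y \<le> b" "y \<in> X"
  shows "a \<le> step f y" "step f y \<le> b"
proof -
  let ?R = "\<Sum>m\<in>Mv. r y m"
  have eq: "step f y = ((c - ?R) * f y + (\<Sum>m\<in>Mv. r y m * f (mv m y))) / c"
    using c_pos by (simp add: step_def gen_real field_simps)
  have m1: "r y m * a \<le> r y m * f (mv m y)" "r y m * f (mv m y) \<le> r y m * b" if m: "m \<in> Mv" for m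
    using rate_nonneg[OF assms(3) m] move_closed[OF assms(3) m] assms(1,2)
    by (cases "r y m = 0"; auto intro!: mult_left_mono)+
  have "?R * a \<le> (\<Sum>m\<in>Mv. r y m * f (mv m y))" "(\<Sum>m\<in>Mv. r y m * f (mv m y)) \<le> ?R * b"
    unfolding sum_distrib_right by (intro sum_mono m1; simp)+
  moreover have "(c - ?R) * a \<le> (c - ?R) * f y" "(c - ?R) * f y \<le> (c - ?R) * b"
    using rate_le[OF assms(3)] assms by (intro mult_left_mono; simp)+
  ultimately have "c * a \<le> (c - ?R) * f y + (\<Sum>m\<in>Mv. r y m * f (mv m y))"
      "(c - ?R) * f y + (\<Sum>m\<in>Mv. r y m * f (mv m y)) \<le> c * b"
    by (simp_all add: algebra_simps)
  then show "a \<le> step f y" "step f y \<le> b"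
    unfolding eq using c_pos by (simp_all add: field_simps)
qed

lemma step_power_bounds:
  assumes "\<And>y. y \<in> X \<Longrightarrow> a \<le> f y" "\<And>y. y \<in> X \<Longrightarrow> f y \<le> b" "y \<in> X"
  shows "a \<le> (step ^^ n) f y" "(step ^^ n) f y \<le> b"
proof -
  have "\<forall>y\<in>X. a \<le> (step ^^ n) f y \<and> (step ^^ n) f y \<le> b"
  proof (induction n)
    case (Suc n)
    then show ?case using step_bounds[of a "(step ^^ n) f" b] by simp
  qed (use assms(1,2) in auto)
  then show "a \<le> (step ^^ n) f y" "(step ^^ n) f y \<le> b" using assms(3) by auto
qed

lemma step_sum:
  "step (\<lambda>y. \<Sum>i\<in>A. a i * f i y) y = (\<Sum>i\<in>A. a i * step (f i) y)"
  by (simp add: step_def gen_sum gen_scale sum.distrib sum_divide_distrib algebra_simps)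

lemma step_power_sum:
  "(step ^^ n) (\<lambda>y. \<Sum>i\<in>A. a i * f i y) = (\<lambda>y. \<Sum>i\<in>A. a i * (step ^^ n) (f i) y)"
  by (induction n) (auto simp: step_sum)

lemma evol_summable:
  assumes "\<And>y. y \<in> X \<Longrightarrow> \<bar>f y\<bar> \<le> B" "y \<in> X"
  shows "summable (\<lambda>n. ((step ^^ n) f y * c ^ n / fact n) * s ^ n)"
proof (rule summable_comparison_test')
  show "summable (\<lambda>n. B * ((c * \<bar>s\<bar>) ^ n / fact n))"
    using summable_exp[of "c * \<bar>s\<bar>"] by (intro summable_mult) (simp add: field_simps)
  fix n :: nat
  have "\<bar>(step ^^ n) f y\<bar> \<le> B"
    using step_power_bounds[of "-B" f B y n] assms by (simp add: abs_le_iff minus_le_iff)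
  then have "\<bar>(step ^^ n) f y\<bar> * ((c * \<bar>s\<bar>) ^ n / fact n) \<le> B * ((c * \<bar>s\<bar>) ^ n / fact n)"
    using c_pos by (intro mult_right_mono) auto
  then show "norm (((step ^^ n) f y * c ^ n / fact n) * s ^ n) \<le> B * ((c * \<bar>s\<bar>) ^ n / fact n)"
    using c_pos by (simp add: abs_mult power_abs power_mult_distrib)
qed

lemma evol_0: "evol f 0 y = f y"
  using powser_zero[of "\<lambda>n. (step ^^ n) f y * c ^ n / fact n"] by (simp add: evol_def)

lemma evol_cong:
  "(\<And>y. y \<in> X \<Longrightarrow> f y = g y) \<Longrightarrow> y \<in> X \<Longrightarrow> evol f s y = evol g s y"
  using step_power_cong[of f g y] by (simp add: evol_def)

lemma evol_sum:
  assumes "\<And>i y. i \<in> A \<Longrightarrow> y \<in> X \<Longrightarrow> \<bar>f i y\<bar> \<le> B" "y \<in> X"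
  shows "evol (\<lambda>y. \<Sum>i\<in>A. a i * f i y) s y = (\<Sum>i\<in>A. a i * evol (f i) s y)"
proof -
  have "(\<Sum>n. ((step ^^ n) (\<lambda>y. \<Sum>i\<in>A. a i * f i y) y * c ^ n / fact n) * s ^ n)
    = (\<Sum>n. \<Sum>i\<in>A. a i * (((step ^^ n) (f i) y * c ^ n / fact n) * s ^ n))"
    by (simp only: step_power_sum sum_distrib_right sum_divide_distrib) (simp add: mult_ac)
  also have "\<dots> = (\<Sum>i\<in>A. \<Sum>n. a i * (((step ^^ n) (f i) y * c ^ n / fact n) * s ^ n))"
    by (intro suminf_sum summable_mult evol_summable[of _ B]) (use assms in auto)
  also have "\<dots> = (\<Sum>i\<in>A. a i * (\<Sum>n. ((step ^^ n) (f i) y * c ^ n / fact n) * s ^ n))"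
    by (intro sum.cong refl suminf_mult evol_summable[of _ B]) (use assms in auto)
  finally show ?thesis by (simp add: evol_def sum_distrib_left mult_ac)
qed

lemma evol_bounds:
  assumes "\<And>y. y \<in> X \<Longrightarrow> a \<le> f y" "\<And>y. y \<in> X \<Longrightarrow> f y \<le> b" "y \<in> X" "0 \<le> s"
  shows "a \<le> evol f s y" "evol f s y \<le> b"
proof -
  define B where "B = max \<bar>a\<bar> \<bar>b\<bar>"
  have B: "\<bar>f y\<bar> \<le> B" if "y \<in> X" for y using assms(1,2)[OF that] by (auto simp: B_def)
  note S = evol_summable[of f B, OF B assms(3), of s]
  have E: "(\<lambda>n. d * ((c * s) ^ n / fact n)) sums (d * exp (c * s))" for d
    using exp_converges[of "c * s"] by (intro sums_mult) (simp add: field_simps)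
  have e: "exp (- (c * s)) * (d * exp (c * s)) = d" for d :: real by (simp add: exp_minus)
  have *: "((step ^^ n) f y * c ^ n / fact n) * s ^ n = (step ^^ n) f y * ((c * s) ^ n / fact n)" for n
    by (simp add: power_mult_distrib)
  have "a * exp (c * s) \<le> (\<Sum>n. ((step ^^ n) f y * c ^ n / fact n) * s ^ n)"
    by (rule sums_le[OF _ E summable_sums[OF S]], unfold *, intro mult_right_mono step_power_bounds)
      (use assms c_pos in auto)
  moreover have "(\<Sum>n. ((step ^^ n) f y * c ^ n / fact n) * s ^ n) \<le> b * exp (c * s)"
    by (rule sums_le[OF _ summable_sums[OF S] E], unfold *, intro mult_right_mono step_power_bounds)
      (use assms c_pos in auto)
  ultimately have "exp (- (c * s)) * (a * exp (c * s)) \<le> evol f s y"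
      "evol f s y \<le> exp (- (c * s)) * (b * exp (c * s))"
    unfolding evol_def by (auto intro!: mult_left_mono)
  then show "a \<le> evol f s y" "evol f s y \<le> b" by (simp_all only: e)
qed

lemma evol_has_derivative:
  assumes "\<And>y. y \<in> X \<Longrightarrow> \<bar>f y\<bar> \<le> B" "y \<in> X"
  shows "((\<lambda>s. evol f s y) has_real_derivative evol (gen f) s y) (at s)"
proof -
  let ?a = "\<lambda>n. (step ^^ n) f y * c ^ n / fact n"
  have Sb: "\<bar>step f y\<bar> \<le> B" if "y \<in> X" for y
    using step_bounds[of "-B" f B y] assms(1) that by (simp add: abs_le_iff minus_le_iff)
  have d: "((\<lambda>s. \<Sum>n. ?a n * s ^ n) has_real_derivative (\<Sum>n. diffs ?a n * s ^ n)) (at s)"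
    by (rule termdiffs_strong_converges_everywhere) (rule evol_summable[OF assms])
  have diffs: "diffs ?a n = c * ((step ^^ n) (step f) y * c ^ n / fact n)" for n
    by (simp add: diffs_def funpow_swap1 del: of_nat_Suc)
  have "(\<Sum>n. diffs ?a n * s ^ n) = c * (\<Sum>n. ((step ^^ n) (step f) y * c ^ n / fact n) * s ^ n)"
    unfolding diffs mult.assoc[of c] by (rule suminf_mult) (rule evol_summable[OF Sb assms(2)])
  then have d': "((\<lambda>s. \<Sum>n. ?a n * s ^ n) has_real_derivative
      c * (\<Sum>n. ((step ^^ n) (step f) y * c ^ n / fact n) * s ^ n)) (at s)"
    using d by simp
  have "((\<lambda>s. evol f s y) has_real_derivative - c * evol f s y + c * evol (step f) s y) (at s)"
    unfolding evol_def
    by (rule derivative_eq_intros refl d' | simp add: algebra_simps)+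
  moreover have "evol (gen f) s y = - c * evol f s y + c * evol (step f) s y"
  proof -
    \<comment> \<open>\<open>gen f\<close> is \<open>c\<close> times the difference of
      \<open>step f\<close> and \<open>f\<close>; indexing the two summands by Booleans puts it into
      the form to which \<open>evol_sum\<close> applies.\<close>
    have "gen f = (\<lambda>y. \<Sum>i\<in>{False, True}. (if i then c else - c) * (if i then step f else f) y)"
      using c_pos by (auto simp: step_def field_simps)
    then have "evol (gen f) s y
      = evol (\<lambda>y. \<Sum>i\<in>{False, True}. (if i then c else - c) * (if i then step f else f) y) s y"
      by simp
    also have "\<dots> = (\<Sum>i\<in>{False, True}. (if i then c else - c) * evol (if i then step f else f) s y)"
      by (rule evol_sum[of _ _ B]) (use assms Sb in auto)
    finally show ?thesis by simp
  qed
  ultimately show ?thesis by simp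
qed

text \<open>\<open>gen\<close> is \<open>c\<close> times the difference of \<open>step\<close> and
  the identity, hence commutes with the powers of \<open>step\<close>; it remains to exchange the
  finite sum over the moves with the series. With \<open>evol_has_derivative\<close> this gives the
  equation to which the maximum principle is applied.\<close>

lemma evol_gen:
  assumes "\<And>y. y \<in> X \<Longrightarrow> \<bar>f y\<bar> \<le> B" "y \<in> X"
  shows "evol (gen f) s y = gen (evol f s) y"
proof -
  let ?a = "\<lambda>n m. (r y m * (step ^^ n) f (mv m y)) * c ^ n / fact n"
  have mv: "r y m * evol f s (mv m y) = exp (- (c * s)) * (\<Sum>n. ?a n m * s ^ n)"
    if m: "m \<in> Mv" for m
  proof (cases "r y m = 0")
    case False
    then have "mv m y \<in> X" using move_closed[OF assms(2) m] rate_nonneg[OF assms(2) m] by simp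
    note * = evol_summable[of f B, OF assms(1) this, of s]
    have "r y m * (\<Sum>n. ((step ^^ n) f (mv m y) * c ^ n / fact n) * s ^ n)
      = (\<Sum>n. r y m * (((step ^^ n) f (mv m y) * c ^ n / fact n) * s ^ n))"
      by (rule suminf_mult[OF *, symmetric])
    then show ?thesis by (simp add: evol_def mult_ac)
  qed simp
  have sm: "summable (\<lambda>n. ?a n m * s ^ n)" if m: "m \<in> Mv" for m
  proof (cases "r y m = 0")
    case False
    then have "mv m y \<in> X" using move_closed[OF assms(2) m] rate_nonneg[OF assms(2) m] by simp
    from summable_mult[OF evol_summable[of f B, OF assms(1) this, of s], of "r y m"]
    show ?thesis by (simp add: mult_ac)
  qed simp
  let ?R = "\<Sum>m\<in>Mv. r y m"
  have "gen (evol f s) y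
    = exp (- (c * s)) * ((\<Sum>m\<in>Mv. \<Sum>n. ?a n m * s ^ n)
       - ?R * (\<Sum>n. ((step ^^ n) f y * c ^ n / fact n) * s ^ n))"
    by (simp add: gen_real mv sum_distrib_left right_diff_distrib) (simp add: evol_def)
  also have "(\<Sum>m\<in>Mv. \<Sum>n. ?a n m * s ^ n)
     = (\<Sum>n. \<Sum>m\<in>Mv. ?a n m * s ^ n)"
    by (rule suminf_sum[symmetric]) (rule sm)
  also have "?R * (\<Sum>n. ((step ^^ n) f y * c ^ n / fact n) * s ^ n)
     = (\<Sum>n. ?R * (((step ^^ n) f y * c ^ n / fact n) * s ^ n))"
    by (rule suminf_mult[symmetric]) (rule evol_summable[OF assms])
  also have "(\<Sum>n. \<Sum>m\<in>Mv. ?a n m * s ^ n)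
      - (\<Sum>n. ?R * (((step ^^ n) f y * c ^ n / fact n) * s ^ n))
     = (\<Sum>n. (\<Sum>m\<in>Mv. ?a n m * s ^ n)
         - ?R * (((step ^^ n) f y * c ^ n / fact n) * s ^ n))"
    by (intro suminf_diff summable_sum summable_mult sm evol_summable[OF assms])
  also have "\<dots> = (\<Sum>n. (gen ((step ^^ n) f) y * c ^ n / fact n) * s ^ n)"
    by (intro suminf_cong, simp only: gen_real sum_distrib_right[symmetric] sum_divide_distrib[symmetric])
      (simp add: left_diff_distrib diff_divide_distrib)
  also have "\<dots> = (\<Sum>n. ((step ^^ n) (gen f) y * c ^ n / fact n) * s ^ n)"
  proof -
    have "gen f = (\<lambda>y. \<Sum>i\<in>{False, True}. (if i then c else - c) * (if i then step f else f) y)"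
      using c_pos by (auto simp: step_def field_simps)
    then have "(step ^^ n) (gen f) y = c * (step ^^ n) (step f) y - c * (step ^^ n) f y" for n
      by (simp only: step_power_sum) simp
    moreover have "gen ((step ^^ n) f) y = c * (step ^^ n) (step f) y - c * (step ^^ n) f y" for n
      unfolding funpow_swap1[symmetric] using c_pos by (simp add: step_def field_simps)
    ultimately show ?thesis by simp
  qed
  finally show ?thesis unfolding evol_def[of "gen f"] by (rule sym)
qed

end

section \<open>Jump processes driven by exponential clocks\<close>

lemma (in prob_space) indep_var_integral:
  fixes g :: "'b \<times> 'b \<Rightarrow> real"
  assumes ind: "indep_var S X T Y" and g[measurable]: "g \<in> borel_measurable (S \<Otimes>\<^sub>M T)"
    and bd: "\<And>z. \<bar>g z\<bar> \<le> B"
  shows "expectation (\<lambda>w. g (X w, Y w)) = expectation (\<lambda>w. expectation (\<lambda>w'. g (X w, Y w')))"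
proof -
  have X[measurable]: "X \<in> measurable M S" and Y[measurable]: "Y \<in> measurable M T"
    using indep_var_rv1[OF ind] indep_var_rv2[OF ind] .
  interpret X: prob_space "distr M S X" by (rule prob_space_distr) simp
  interpret Y: prob_space "distr M T Y" by (rule prob_space_distr) simp
  interpret XY: pair_prob_space "distr M S X" "distr M T Y" ..
  have int: "integrable (distr M S X \<Otimes>\<^sub>M distr M T Y) g"
    by (rule XY.P.integrable_const_bound[of _ B]) (use bd in auto)
  have "expectation (\<lambda>w. g (X w, Y w)) = integral\<^sup>L (distr M (S \<Otimes>\<^sub>M T) (\<lambda>x. (X x, Y x))) g"
    by (subst integral_distr) auto
  also have "\<dots> = integral\<^sup>L (distr M S X \<Otimes>\<^sub>M distr M T Y) g"
    using ind unfolding indep_var_distribution_eq by simp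
  also have "\<dots> = (LINT x|distr M S X. LINT y|distr M T Y. g (x, y))"
    by (rule XY.integral_fst'[OF int, symmetric])
  also have "\<dots> = expectation (\<lambda>w. LINT y|distr M T Y. g (X w, y))"
    by (rule integral_distr) (auto intro!: Y.borel_measurable_lebesgue_integral)
  also have "\<dots> = expectation (\<lambda>w. expectation (\<lambda>w'. g (X w, Y w')))"
    by (intro Bochner_Integration.integral_cong refl integral_distr) (use X in \<open>auto dest: measurable_space\<close>)
  finally show ?thesis .
qed

text \<open>Condition on \<open>Y e\<close>: the minimum of the other variables is exponential with
  the sum of their rates, so its tail merges with the density of \<open>Y e\<close> into one
  exponential with the full sum. The test function \<open>p\<close> carries the law of the winning
  time along.\<close>

lemma (in prob_space) exponential_race:
  fixes Y :: "'i \<Rightarrow> 'a \<Rightarrow> real" and p :: "real \<Rightarrow> real"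
  assumes F: "finite F" "e \<in> F" and r: "\<And>i. i \<in> F \<Longrightarrow> 0 < r i"
    and Y: "\<And>i. i \<in> F \<Longrightarrow> distributed M lborel (Y i) (exponential_density (r i))"
    and ind: "indep_vars (\<lambda>i. borel) Y F"
    and p[measurable]: "p \<in> borel_measurable borel" and bd: "\<And>x. \<bar>p x\<bar> \<le> B"
  shows "expectation (\<lambda>w. if \<forall>i\<in>F - {e}. Y e w < Y i w then p (Y e w) else 0)
    = (LINT t|lborel. indicator {0..} t * (r e * exp (- (\<Sum>i\<in>F. r i) * t) * p t))"
proof -
  have re: "0 < r e" using r F by simp
  note Ye = Y[OF F(2)]
  have mY[measurable]: "Y e \<in> borel_measurable M" using distributed_measurable[OF Ye] by simp
  define G where "G t = prob {w \<in> space M. \<forall>i\<in>F - {e}. t < Y i w}" for t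
  have mF: "Y i \<in> borel_measurable M" if "i \<in> F" for i using distributed_measurable[OF Y[OF that]] by simp
  have G: "G t = exp (- (\<Sum>i\<in>F - {e}. r i) * t)" if "0 \<le> t" for t
  proof (cases "F - {e} = {}")
    case True
    then show ?thesis unfolding G_def True by (simp add: prob_space)
  next
    case False
    have D: "distributed M lborel (\<lambda>x. Min ((\<lambda>i. Y i x) ` (F - {e}))) (exponential_density (\<Sum>i\<in>F - {e}. r i))"
      using F False r Y by (intro exponential_distributed_Min indep_vars_subset[OF ind]) auto
    have pos: "0 < (\<Sum>i\<in>F - {e}. r i)" using F False r by (intro sum_pos) auto
    have "G t = prob {w \<in> space M. t < Min ((\<lambda>i. Y i w) ` (F - {e}))}"
      unfolding G_def using F False by (intro arg_cong[where f=prob]) auto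
    also have "\<dots> = exp (- t * (\<Sum>i\<in>F - {e}. r i))"
      by (rule exponential_distributedD_gt[OF D that pos])
    finally show ?thesis by (simp add: mult.commute)
  qed
  have "expectation (\<lambda>w. if \<forall>i\<in>F - {e}. Y e w < Y i w then p (Y e w) else 0)
    = expectation (\<lambda>w. p (Y e w) * G (Y e w))"
  proof (cases "F - {e} = {}")
    case True
    then show ?thesis unfolding G_def True by (simp add: prob_space)
  next
    case False
    let ?m = "\<lambda>w. Min ((\<lambda>i. Y i w) ` (F - {e}))"
    let ?g = "\<lambda>(y, z). if y < z then p y else 0 :: real"
    have I: "indep_var borel (Y e) borel ?m"
      by (rule indep_vars_Min) (use F ind in \<open>auto simp: insert_absorb\<close>)
    have m: "?m \<in> borel_measurable M" using indep_var_rv2[OF I] .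
    have "expectation (\<lambda>w. if \<forall>i\<in>F - {e}. Y e w < Y i w then p (Y e w) else 0)
      = expectation (\<lambda>w. ?g (Y e w, ?m w))"
      using F False by (intro Bochner_Integration.integral_cong) auto
    also have "\<dots> = expectation (\<lambda>w. expectation (\<lambda>w'. ?g (Y e w, ?m w')))"
      by (rule indep_var_integral[OF I, of _ B]) (use bd order_trans[OF abs_ge_zero bd] in auto)
    also have "\<dots> = expectation (\<lambda>w. p (Y e w) * G (Y e w))"
    proof (intro Bochner_Integration.integral_cong refl)
      fix w
      have "expectation (\<lambda>w'. ?g (Y e w, ?m w'))
        = expectation (\<lambda>w'. p (Y e w) * indicator {w \<in> space M. Y e w0 < ?m w} w')"
        if "w0 = w" for w0
        using that by (intro Bochner_Integration.integral_cong) (auto simp: indicator_def)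
      from this[OF refl] have "expectation (\<lambda>w'. ?g (Y e w, ?m w'))
        = p (Y e w) * prob {w' \<in> space M. Y e w < ?m w'}"
        using m by simp
      also have "{w' \<in> space M. Y e w < ?m w'} = {w' \<in> space M. \<forall>i\<in>F - {e}. Y e w < Y i w'}"
        using F False by auto
      finally show "expectation (\<lambda>w'. ?g (Y e w, ?m w'))
        = p (Y e w) * G (Y e w)" by (simp add: G_def)
    qed
    finally show ?thesis .
  qed
  also have "\<dots> = (LINT t|lborel. exponential_density (r e) t * (p t * G t))"
  proof (rule distributed_integral[OF Ye, symmetric])
    \<comment> \<open>The explicit form of \<open>G\<close> holds for \<open>0 \<le> t\<close> only;
      monotonicity gives measurability on the whole line.\<close>
    have "mono (\<lambda>t. - G t)"
    proof (intro monoI)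
      fix s t :: real assume "s \<le> t"
      have "{w \<in> space M. \<forall>i\<in>F - {e}. s < Y i w} \<in> events"
        using F mF by (intro sets.sets_Collect_finite_All) auto
      then have "G t \<le> G s"
        unfolding G_def by (intro finite_measure_mono) (auto intro: le_less_trans[OF \<open>s \<le> t\<close>])
      then show "- G s \<le> - G t" by simp
    qed
    then have "(\<lambda>t. - (- G t)) \<in> borel_measurable borel"
      by (intro borel_measurable_uminus borel_measurable_mono)
    then show "(\<lambda>x. p x * G x) \<in> borel_measurable lborel" by simp
  qed (use re in \<open>auto simp: exponential_density_def\<close>)
  also have "\<dots> = (LINT t|lborel. indicator {0..} t * (r e * exp (- (\<Sum>i\<in>F. r i) * t) * p t))"
  proof (intro Bochner_Integration.integral_cong refl)
    fix t :: real
    have "(\<Sum>i\<in>F. r i) = r e + (\<Sum>i\<in>F - {e}. r i)" using F by (rule sum.remove)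
    then show "exponential_density (r e) t * (p t * G t)
      = indicator {0..} t * (r e * exp (- (\<Sum>i\<in>F. r i) * t) * p t)"
      by (auto simp: exponential_density_def G exp_add[symmetric] algebra_simps indicator_def)
  qed
  finally show ?thesis .
qed

lemma has_bochner_integral_exp:
  assumes "0 < a"
  shows "has_bochner_integral lborel (\<lambda>t. indicator {0..} t * exp (- a * t) :: real) (1 / a)"
proof -
  interpret E: prob_space "density lborel (exponential_density a)"
    using assms by (rule prob_space_exponential_density)
  have "(\<integral>\<^sup>+ t. ennreal (exponential_density a t) \<partial>lborel) = ennreal 1"
    using E.emeasure_space_1 by (simp add: emeasure_density)
  then have "has_bochner_integral lborel (exponential_density a) 1"
    using assms by (intro has_bochner_integral_nn_integral) (auto simp: exponential_density_nonneg)
  then have "has_bochner_integral lborel (\<lambda>t. 1 / a * exponential_density a t) (1 / a * 1)"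
    by (intro has_bochner_integral_mult_right)
  moreover have "1 / a * exponential_density a t = indicator {0..} t * exp (- a * t)" for t
    using assms by (auto simp: exponential_density_def indicator_def mult.commute)
  ultimately show ?thesis by simp
qed

abbreviation unit_exponential :: "real measure" where
  "unit_exponential \<equiv> density lborel (\<lambda>t. ennreal (exponential_density 1 t))"

section \<open>The space of clocks and the embedded jump chain\<close>

lemma prob_space_clocks: "prob_space (clocks :: (nat \<times> 'e \<Rightarrow> real) measure)"
  unfolding clocks_def by (intro prob_space_PiM prob_space_exponential_density) simp

lemma sets_clocks: "sets (clocks :: (nat \<times> 'e \<Rightarrow> real) measure) = sets (PiM UNIV (\<lambda>_. borel))"
  unfolding clocks_def by (intro sets_PiM_cong) auto

lemma space_clocks [simp]: "space clocks = UNIV"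
  using sets_eq_imp_space_eq[OF sets_clocks] by (simp add: space_PiM)

lemma measurable_clock: "(\<lambda>w. w i) \<in> borel_measurable clocks"
  by (subst measurable_cong_sets[OF sets_clocks refl]) (rule measurable_component_singleton, simp)

lemma clock_distributed: "distributed clocks lborel (\<lambda>w. w i) (exponential_density 1)"
proof -
  have "distr clocks unit_exponential (\<lambda>w. w i) = unit_exponential"
    unfolding clocks_def by (rule distr_PiM_component) (auto intro: prob_space_exponential_density)
  then have "distr clocks lborel (\<lambda>w. w i) = unit_exponential"
    by (subst distr_cong[of _ clocks lborel unit_exponential, OF refl]) auto
  then show ?thesis
    using measurable_clock[of i] unfolding distributed_def by (auto simp: exponential_density_def)
qed

lemma clocks_indep: "prob_space.indep_vars clocks (\<lambda>_. borel) (\<lambda>i w. w i) UNIV"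
proof -
  interpret prob_space clocks by (rule prob_space_clocks)
  have eq: "distr clocks borel (\<lambda>w. w i) = unit_exponential" for i :: "nat \<times> 'a"
    using distributed_distr_eq_density[OF clock_distributed[of i]]
    by (subst distr_cong[of _ clocks borel lborel, OF refl]) auto
  have restr: "(\<lambda>x. restrict x UNIV) = (\<lambda>x::nat \<times> 'a \<Rightarrow> real. x)" by (simp add: fun_eq_iff)
  show ?thesis
    by (subst indep_vars_iff_distr_eq_PiM', simp, rule measurable_clock, unfold eq restr)
      (simp add: distr_id2 sets_clocks clocks_def[symmetric])
qed

text \<open>\<open>lev\<close> measures how far a state is from the initial one. It grows by at most
  one per jump and bounds the total rate linearly, so the rate after n jumps is \<open>O(n)\<close>;
  this is what excludes explosion. Countability of \<open>X\<close> lets measurability be checked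
  state by state.\<close>

locale jump_system =
  fixes rate :: "'s \<Rightarrow> 'e \<Rightarrow> real" and move :: "'e \<Rightarrow> 's \<Rightarrow> 's" and s0 :: 's
    and X :: "'s set" and lev :: "'s \<Rightarrow> nat" and C :: real
  assumes countable_states: "countable X" and s0: "s0 \<in> X"
    and move_closed: "s \<in> X \<Longrightarrow> 0 < rate s e \<Longrightarrow> move e s \<in> X"
    and finite_enabled: "s \<in> X \<Longrightarrow> finite {e. 0 < rate s e}"
    and enabled_nonempty: "s \<in> X \<Longrightarrow> {e. 0 < rate s e} \<noteq> {}"
    and lev_move: "s \<in> X \<Longrightarrow> 0 < rate s e \<Longrightarrow> lev (move e s) \<le> Suc (lev s)"
    and total_le: "s \<in> X \<Longrightarrow> (\<Sum>e | 0 < rate s e. rate s e) \<le> C * (lev s + 1)"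
    and C_pos: "0 < C"
begin

definition enabled :: "'s \<Rightarrow> 'e set" where "enabled s = {e. 0 < rate s e}"

definition winner :: "'s \<Rightarrow> ('e \<Rightarrow> real) \<Rightarrow> 'e" where
  "winner s v = arg_min_on (\<lambda>e. v e / rate s e) (enabled s)"

definition hold :: "'s \<Rightarrow> ('e \<Rightarrow> real) \<Rightarrow> real" where
  "hold s v = v (winner s v) / rate s (winner s v)"

definition total :: "'s \<Rightarrow> real" where "total s = (\<Sum>e\<in>enabled s. rate s e)"

definition T :: "nat \<Rightarrow> (nat \<times> 'e \<Rightarrow> real) \<Rightarrow> real" where
  "T n w = fst (jump_chain rate move s0 w n)"

definition S :: "nat \<Rightarrow> (nat \<times> 'e \<Rightarrow> real) \<Rightarrow> 's" where
  "S n w = snd (jump_chain rate move s0 w n)"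

abbreviation row :: "nat \<Rightarrow> (nat \<times> 'e \<Rightarrow> real) \<Rightarrow> 'e \<Rightarrow> real" where
  "row n w \<equiv> (\<lambda>e. w (n, e))"

lemmas [measurable] = measurable_clock

lemma T_0: "T 0 w = 0" and S_0: "S 0 w = s0"
  by (simp_all add: T_def S_def)

lemma T_Suc: "T (Suc n) w = T n w + hold (S n w) (row n w)"
  and S_Suc: "S (Suc n) w = move (winner (S n w) (row n w)) (S n w)"
  by (simp_all add: T_def S_def hold_def winner_def enabled_def Let_def split_beta)

lemma winner_least:
  assumes "s \<in> X"
  shows "winner s v \<in> enabled s" "e \<in> enabled s \<Longrightarrow> hold s v \<le> v e / rate s e"
proof -
  have "finite (enabled s)" "enabled s \<noteq> {}"
    using finite_enabled[OF assms] enabled_nonempty[OF assms] by (simp_all add: enabled_def)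
  from arg_min_if_finite[OF this, of "\<lambda>e. v e / rate s e"]
  show "winner s v \<in> enabled s" "e \<in> enabled s \<Longrightarrow> hold s v \<le> v e / rate s e"
    unfolding winner_def hold_def by (auto simp: not_less)
qed

lemma S_in: "S n w \<in> X"
proof (induction n)
  case (Suc n)
  then show ?case using winner_least(1)[OF Suc] move_closed by (auto simp: S_Suc enabled_def)
qed (simp add: S_0 s0)

lemma lev_S: "lev (S n w) \<le> lev s0 + n"
proof (induction n)
  case (Suc n)
  have "0 < rate (S n w) (winner (S n w) (row n w))"
    using winner_least(1)[OF S_in] by (simp add: enabled_def)
  from lev_move[OF S_in this] Suc show ?case by (simp add: S_Suc)
qed (simp add: S_0)

lemma chain_cong:
  assumes "\<And>m e. m < n \<Longrightarrow> w (m, e) = w' (m, e)"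
  shows "T n w = T n w' \<and> S n w = S n w'"
  using assms by (induction n) (simp_all add: T_0 S_0 T_Suc S_Suc)

text \<open>\<open>arg_min_on\<close> resolves ties by a choice operator about which nothing is
  known. The choice depends on \<open>v\<close> only through the set \<open>A v\<close> of
  minimisers, and this set-valued map has finitely many values, each taken on a measurable
  event.\<close>

lemma winner_measurable:
  assumes "s \<in> X"
  shows "winner s \<in> measurable (PiM UNIV (\<lambda>_. borel)) (count_space (enabled s))"
proof -
  have fin: "finite (enabled s)" using finite_enabled[OF assms] by (simp add: enabled_def)
  let ?N = "PiM UNIV (\<lambda>_. borel) :: ('e \<Rightarrow> real) measure"
  define A where "A v = {x \<in> enabled s. \<forall>y\<in>enabled s. \<not> v y / rate s y < v x / rate s x}" for v
  have w: "winner s v = (SOME x. x \<in> A v)" for v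
    unfolding winner_def arg_min_on_def arg_min_def is_arg_min_def A_def by (intro arg_cong[where f=Eps]) auto
  have comp[measurable]: "(\<lambda>v. v x) \<in> borel_measurable ?N" for x
    by (rule measurable_component_singleton) simp
  have cmp: "{v \<in> space ?N. \<not> v y / rate s y < v x / rate s x} \<in> sets ?N" for x y
    by measurable
  have finP: "finite (Pow (enabled s))" using fin by simp
  have A_sub: "A v \<subseteq> enabled s" for v by (auto simp: A_def)
  have pre: "A -` {M} \<inter> space ?N \<in> sets ?N" if "M \<subseteq> enabled s" for M
  proof -
    have "A v = M \<longleftrightarrow> (\<forall>x\<in>enabled s. x \<in> M \<longleftrightarrow> x \<in> A v)" for v
      using that A_sub[of v] by blast
    then have "A -` {M} \<inter> space ?N = {v \<in> space ?N. \<forall>x\<in>enabled s. x \<in> M \<longleftrightarrow> x \<in> A v}"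
      by blast
    also have "\<dots> = {v \<in> space ?N. \<forall>x\<in>enabled s. x \<in> M \<longleftrightarrow> (\<forall>y\<in>enabled s. \<not> v y / rate s y < v x / rate s x)}"
      by (intro Collect_cong conj_cong ball_cong refl) (simp add: A_def)
    also have "\<dots> \<in> sets ?N"
    proof (intro sets.sets_Collect_finite_All fin)
      fix x
      have all: "{v \<in> space ?N. \<forall>y\<in>enabled s. \<not> v y / rate s y < v x / rate s x} \<in> sets ?N"
        by (intro sets.sets_Collect_finite_All fin cmp)
      show "{v \<in> space ?N. x \<in> M \<longleftrightarrow> (\<forall>y\<in>enabled s. \<not> v y / rate s y < v x / rate s x)} \<in> sets ?N"
        using all sets.sets_Collect_neg[OF all] by (cases "x \<in> M") simp_all
    qed
    finally show ?thesis .
  qed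
  have "A \<in> measurable ?N (count_space (Pow (enabled s)))"
    unfolding measurable_count_space_eq2[OF finP] using pre A_sub by blast
  then have "(\<lambda>v. SOME x. x \<in> A v) \<in> measurable ?N (count_space UNIV)"
    by (rule measurable_compose) simp
  then have "winner s \<in> measurable ?N (count_space UNIV)" unfolding w[abs_def] .
  moreover have "countable (enabled s)" using fin by (rule countable_finite)
  ultimately show ?thesis
    unfolding measurable_count_space_eq_countable[OF \<open>countable (enabled s)\<close>]
    using winner_least(1)[OF assms] measurable_sets[of "winner s" ?N "count_space UNIV"] by auto
qed

lemma hold_measurable:
  assumes "s \<in> X"
  shows "hold s \<in> borel_measurable (PiM UNIV (\<lambda>_. borel))"
  unfolding hold_def
  by (rule measurable_compose_countable'[OF _ winner_measurable[OF assms]])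
    (use finite_enabled[OF assms] in \<open>auto simp: enabled_def intro: countable_finite\<close>)

lemma row_measurable:
  assumes "{n} \<times> UNIV \<subseteq> I"
  shows "row n \<in> measurable (PiM I (\<lambda>_. borel)) (PiM UNIV (\<lambda>_. borel :: real measure))"
proof (rule measurable_PiM_single')
  fix e
  have "(n, e) \<in> I" using assms by auto
  then show "(\<lambda>w. w (n, e)) \<in> measurable (PiM I (\<lambda>_. borel)) (borel :: real measure)"
    by (rule measurable_component_singleton)
qed auto

text \<open>The index set \<open>I\<close> is left open because the chain is needed on the family of
  all clocks and also on the first \<open>n\<close> rows alone, which are independent of row
  \<open>n\<close>.\<close>

lemma chain_measurable:
  assumes "{..<n} \<times> UNIV \<subseteq> I"
  shows "S n \<in> measurable (PiM I (\<lambda>_. borel)) (count_space X) \<and>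
    T n \<in> borel_measurable (PiM I (\<lambda>_. borel))"
  using assms
proof (induction n)
  case 0
  then show ?case using s0 by (simp add: S_0[abs_def] T_0[abs_def])
next
  case (Suc n)
  let ?N = "PiM I (\<lambda>_. borel) :: (nat \<times> 'e \<Rightarrow> real) measure"
  have sub: "{n} \<times> UNIV \<subseteq> I" "{..<n} \<times> UNIV \<subseteq> I" using Suc.prems by auto
  note row = row_measurable[OF sub(1)]
  have IH: "S n \<in> measurable ?N (count_space X)" "T n \<in> borel_measurable ?N"
    using Suc.IH[OF sub(2)] by auto
  have "(\<lambda>w. move (winner (S n w) (row n w)) (S n w)) \<in> measurable ?N (count_space X)"
  proof (rule measurable_compose_countable'[OF _ IH(1) countable_states])
    fix s assume s: "s \<in> X"
    show "(\<lambda>w. move (winner s (row n w)) s) \<in> measurable ?N (count_space X)"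
      by (rule measurable_compose[OF measurable_compose[OF row winner_measurable[OF s]]])
        (use s move_closed in \<open>auto simp: enabled_def\<close>)
  qed
  moreover have "(\<lambda>w. hold (S n w) (row n w)) \<in> borel_measurable ?N"
    by (rule measurable_compose_countable'[OF _ IH(1) countable_states])
      (rule measurable_compose[OF row hold_measurable])
  ultimately show ?case using IH by (simp add: S_Suc[abs_def] T_Suc[abs_def])
qed

lemma S_measurable: "S n \<in> measurable clocks (count_space X)"
  and T_measurable [measurable]: "T n \<in> borel_measurable clocks"
  using chain_measurable[of n UNIV] by (simp_all add: measurable_cong_sets[OF sets_clocks refl])

sublocale prob_space "clocks :: (nat \<times> 'e \<Rightarrow> real) measure" by (rule prob_space_clocks)

text \<open>\<open>T n\<close> and \<open>S n\<close> are functions of the rows before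
  \<open>n\<close>, so row \<open>n\<close> may be replaced by an independent copy while the past is
  kept fixed. This is the Markov property in the form used below.\<close>

lemma step_expectation:
  fixes H :: "real \<Rightarrow> 's \<Rightarrow> ('e \<Rightarrow> real) \<Rightarrow> real"
  assumes H: "\<And>s. s \<in> X \<Longrightarrow> (\<lambda>(t, v). H t s v) \<in> borel_measurable (borel \<Otimes>\<^sub>M PiM UNIV (\<lambda>_. borel))"
    and bd: "\<And>t s v. s \<in> X \<Longrightarrow> \<bar>H t s v\<bar> \<le> B"
  shows "expectation (\<lambda>w. H (T n w) (S n w) (row n w))
    = expectation (\<lambda>w. expectation (\<lambda>w'. H (T n w) (S n w) (row n w')))"
proof -
  let ?A = "{..<n} \<times> (UNIV :: 'e set)" and ?B = "{n} \<times> (UNIV :: 'e set)"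
  let ?NA = "PiM ?A (\<lambda>_. borel) :: (nat \<times> 'e \<Rightarrow> real) measure"
  let ?NB = "PiM ?B (\<lambda>_. borel) :: (nat \<times> 'e \<Rightarrow> real) measure"
  have ind: "indep_var ?NA (\<lambda>w. restrict w ?A) ?NB (\<lambda>w. restrict w ?B)"
    using indep_var_restrict[OF clocks_indep, of ?A ?B] by auto
  let ?g = "\<lambda>z. H (T n (fst z)) (S n (fst z)) (row n (snd z))"
  have mS: "(\<lambda>z. S n (fst z)) \<in> measurable (?NA \<Otimes>\<^sub>M ?NB) (count_space X)"
    using chain_measurable[of n ?A] by (intro measurable_compose[OF measurable_fst]) auto
  have mT: "(\<lambda>z. T n (fst z)) \<in> borel_measurable (?NA \<Otimes>\<^sub>M ?NB)"
    using chain_measurable[of n ?A] by (intro measurable_compose[OF measurable_fst]) auto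
  have mr: "(\<lambda>z. row n (snd z)) \<in> measurable (?NA \<Otimes>\<^sub>M ?NB) (PiM UNIV (\<lambda>_. borel))"
    by (rule measurable_compose[OF measurable_snd row_measurable]) auto
  have g: "?g \<in> borel_measurable (?NA \<Otimes>\<^sub>M ?NB)"
  proof (rule measurable_compose_countable'[OF _ mS countable_states])
    fix s assume "s \<in> X"
    from measurable_compose[OF measurable_Pair[OF mT mr] H[OF this]]
    show "(\<lambda>z. H (T n (fst z)) s (row n (snd z))) \<in> borel_measurable (?NA \<Otimes>\<^sub>M ?NB)" by simp
  qed
  have TS: "T n (restrict w ?A) = T n w" "S n (restrict w ?A) = S n w" for w
    using chain_cong[of n "restrict w ?A" w] by auto
  show ?thesis
    using indep_var_integral[OF ind g, of B] bd S_in by (simp add: TS)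
qed

lemma scaled_clock_distributed:
  fixes i :: "nat \<times> 'e"
  assumes "0 < r"
  shows "distributed clocks lborel (\<lambda>w. w i / r) (exponential_density r)"
  unfolding exponential_distributed_iff[OF assms]
proof (intro conjI allI impI)
  fix a :: real assume "0 \<le> a"
  then have "prob {w \<in> space clocks. w i \<le> a * r} = 1 - exp (- (a * r) * 1)"
    using assms by (intro exponential_distributedD_le[OF clock_distributed]) auto
  then show "prob {w \<in> space clocks. w i / r \<le> a} = 1 - exp (- a * r)"
    using assms by (simp add: field_simps)
qed measurable

lemma total_pos: "s \<in> X \<Longrightarrow> 0 < total s"
  using finite_enabled enabled_nonempty by (auto simp: total_def enabled_def intro!: sum_pos)

lemma race_total:
  assumes s: "s \<in> X"
  shows "(\<Sum>e\<in>enabled s. LINT t|lborel. indicator {0..} t * (rate s e * exp (- total s * t))) = 1"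
  using has_bochner_integral_integral_eq[OF has_bochner_integral_exp[OF total_pos[OF s]]] total_pos[OF s]
  by (simp add: mult.left_commute[of "indicator _ _"] sum_divide_distrib[symmetric] flip: total_def)

lemma race_expectation:
  assumes s: "s \<in> X" and p: "\<And>e. p e \<in> borel_measurable borel" and bd: "\<And>e x. \<bar>p e x\<bar> \<le> B"
  shows "expectation (\<lambda>w. p (winner s (row n w)) (hold s (row n w)))
    = (\<Sum>e\<in>enabled s. LINT t|lborel. indicator {0..} t * (rate s e * exp (- total s * t) * p e t))"
proof -
  let ?F = "enabled s"
  have fin: "finite ?F" using finite_enabled[OF s] by (simp add: enabled_def)
  define Y where "Y i w = w (n, i) / rate s i" for i and w :: "nat \<times> 'e \<Rightarrow> real"
  define first where "first e w \<longleftrightarrow> (\<forall>i\<in>?F - {e}. Y e w < Y i w)" for e w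
  have pos: "0 < rate s i" if "i \<in> ?F" for i using that by (simp add: enabled_def)
  have D: "distributed clocks lborel (Y i) (exponential_density (rate s i))" if "i \<in> ?F" for i
    unfolding Y_def by (rule scaled_clock_distributed[OF pos[OF that]])
  have "indep_vars (\<lambda>i. PiM {(n, i)} (\<lambda>_. borel)) (\<lambda>i w. restrict w {(n, i)}) ?F"
    by (rule indep_vars_restrict[OF clocks_indep]) (auto simp: disjoint_family_on_def)
  from indep_vars_compose2[OF this, of "\<lambda>i f. f (n, i)" "\<lambda>_. borel"]
  have "indep_vars (\<lambda>_. borel) (\<lambda>i w. w (n, i)) ?F" by simp
  then have ind: "indep_vars (\<lambda>_. borel) Y ?F"
    unfolding Y_def by (rule indep_vars_compose2[where Y="\<lambda>i x. x / rate s i"]) auto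
  have mY[measurable]: "Y i \<in> borel_measurable clocks" for i unfolding Y_def by measurable
  have "Measurable.pred clocks (first e)" for e
    unfolding first_def using fin by (intro pred_intros_finite) (auto intro: borel_measurable_pred_less)
  then have mfirst: "{w. first e w} \<in> events" for e by (simp add: pred_def)
  have E: "expectation (\<lambda>w. \<Sum>e\<in>?F. if first e w then g e (Y e w) else 0)
      = (\<Sum>e\<in>?F. LINT t|lborel. indicator {0..} t * (rate s e * exp (- total s * t) * g e t))"
    if g: "\<And>e. g e \<in> borel_measurable borel" "\<And>e x. \<bar>g e x\<bar> \<le> B" for g B
  proof (subst Bochner_Integration.integral_sum)
    show "integrable clocks (\<lambda>w. if first e w then g e (Y e w) else 0)" for e
      using g(2) order_trans[OF abs_ge_zero g(2)] measurable_compose[OF mY g(1)] mfirst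
      by (intro integrable_const_bound[of _ B] measurable_If) auto
  qed (unfold first_def total_def, intro sum.cong refl exponential_race[OF fin _ pos D ind g], auto)
  have sum: "(\<Sum>e\<in>?F. if first e w then g e else 0) = g e'" if "e' \<in> ?F" "first e' w" for g w e'
  proof -
    have "first e w \<longleftrightarrow> e = e'" if "e \<in> ?F" for e
      using that \<open>e' \<in> ?F\<close> \<open>first e' w\<close> unfolding first_def by (metis DiffI less_asym singletonD)
    then have "(\<Sum>e\<in>?F. if first e w then g e else 0) = (\<Sum>e\<in>?F. if e = e' then g e else 0)"
      by (intro sum.cong) auto
    then show ?thesis using fin \<open>e' \<in> ?F\<close> by simp
  qed
  \<comment> \<open>The race integrals for the test function 1 sum to one, so a strict winner exists
    almost surely; ties are excluded without computing their probability.\<close>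
  have "prob {w \<in> space clocks. \<exists>e\<in>?F. first e w} = expectation (\<lambda>w. \<Sum>e\<in>?F. if first e w then 1 else 0)"
  proof -
    have "(\<Sum>e\<in>?F. if first e w then 1 else 0) = (indicator {w \<in> space clocks. \<exists>e\<in>?F. first e w} w :: real)"
      for w using sum[of _ w "\<lambda>_. 1"] by (cases "\<exists>e\<in>?F. first e w") (auto intro!: sum.neutral)
    then show ?thesis by simp
  qed
  also have "\<dots> = 1" using race_total[OF s] by (subst E[of "\<lambda>_ _. 1" 1]) auto
  finally have "AE w in clocks. \<exists>e\<in>?F. first e w"
    using fin mfirst by (subst (asm) prob_Collect_eq_1) (auto simp: Collect_bex_eq)
  then have "expectation (\<lambda>w. p (winner s (row n w)) (hold s (row n w)))
    = expectation (\<lambda>w. \<Sum>e\<in>?F. if first e w then p e (Y e w) else 0)"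
  proof (intro integral_cong_AE)
    have m2: "(\<lambda>w. winner s (row n w)) \<in> measurable clocks (count_space ?F)"
      "(\<lambda>w. hold s (row n w)) \<in> borel_measurable clocks"
      using measurable_compose[OF row_measurable[of n UNIV] winner_measurable[OF s]]
        measurable_compose[OF row_measurable[of n UNIV] hold_measurable[OF s]]
      by (simp_all add: measurable_cong_sets[OF sets_clocks refl])
    show "(\<lambda>w. p (winner s (row n w)) (hold s (row n w))) \<in> borel_measurable clocks"
      by (rule measurable_compose_countable'[OF _ m2(1)])
        (use fin in \<open>auto intro!: measurable_compose[OF m2(2) p] countable_finite\<close>)
    show "(\<lambda>w. \<Sum>e\<in>?F. if first e w then p e (Y e w) else 0) \<in> borel_measurable clocks"
      by (intro borel_measurable_sum measurable_If measurable_compose[OF mY p]) (auto simp: mfirst)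
    assume "AE w in clocks. \<exists>e\<in>?F. first e w"
    then show "AE w in clocks. p (winner s (row n w)) (hold s (row n w))
        = (\<Sum>e\<in>?F. if first e w then p e (Y e w) else 0)"
    proof eventually_elim
      case (elim w)
      then obtain e where e: "e \<in> ?F" "first e w" by blast
      have "Y (winner s (row n w)) w \<le> Y e w"
        using winner_least(2)[OF s e(1), of "row n w"] by (simp add: Y_def hold_def)
      then have "winner s (row n w) = e"
        using winner_least(1)[OF s, of "row n w"] e unfolding first_def
        by (metis DiffI not_le singletonD)
      then show ?case using sum[OF e, of "\<lambda>e. p e (Y e w)"] by (simp add: hold_def Y_def)
    qed
  qed
  also have "\<dots> = (\<Sum>e\<in>?F. LINT t|lborel. indicator {0..} t * (rate s e * exp (- total s * t) * p e t))"
    using E[OF p bd] .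
  finally show ?thesis .
qed

section \<open>Non-explosion of the jump chain\<close>

lemma hold_nonneg: "AE w in clocks. \<forall>n. 0 \<le> hold (S n w) (row n w)"
proof -
  have "AE w in clocks. 0 < w i" for i :: "nat \<times> 'e"
  proof -
    have "prob {w \<in> space clocks. w i \<le> 0} = 0"
      using exponential_distributedD_le[OF clock_distributed[of i], of 0] by simp
    moreover have "{w \<in> space clocks. w i \<le> 0} \<in> events" by measurable
    ultimately show ?thesis by (subst (asm) prob_Collect_eq_0) (auto simp: not_le)
  qed
  then have "AE w in clocks. \<forall>n. \<forall>s\<in>X. \<forall>e\<in>enabled s. 0 < w (n, e)"
    using finite_enabled
    by (intro AE_all_countable[THEN iffD2] allI AE_ball_countable'[OF _ countable_states] AE_finite_allI)
      (auto simp: enabled_def)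
  then show ?thesis
  proof eventually_elim
    case (elim w)
    show ?case
    proof
      fix n
      have "winner (S n w) (row n w) \<in> enabled (S n w)" by (rule winner_least(1)[OF S_in])
      moreover from this have "0 < w (n, winner (S n w) (row n w))" using elim S_in by blast
      ultimately show "0 \<le> hold (S n w) (row n w)" by (simp add: hold_def enabled_def)
    qed
  qed
qed

text \<open>Given the state, the holding time is exponential with parameter \<open>total\<close>,
  and its Laplace transform at 1 is \<open>total / (total + 1)\<close>. This increases with
  \<open>total\<close>, so the linear bound on the rates yields the factor.\<close>

lemma laplace_T_Suc:
  "expectation (\<lambda>w. exp (- T (Suc n) w)) \<le>
    (1 - 1 / (C * (lev s0 + n + 1) + 1)) * expectation (\<lambda>w. exp (- T n w))"
  and laplace_T_integrable: "integrable clocks (\<lambda>w. exp (- T n w))"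
proof -
  have Tpos: "AE w in clocks. \<forall>n. 0 \<le> T n w"
    using hold_nonneg
  proof eventually_elim
    case (elim w)
    have "0 \<le> T n w" for n by (induction n) (use elim in \<open>auto simp: T_0 T_Suc\<close>)
    then show ?case by simp
  qed
  show int: "integrable clocks (\<lambda>w. exp (- T n w))" for n
    by (rule integrable_const_bound[of _ 1]) (use Tpos in auto)
  define \<rho> where "\<rho> = 1 - 1 / (C * (lev s0 + n + 1) + 1)"
  \<comment> \<open>The truncations by \<open>max 0\<close> change nothing almost surely, but make
    \<open>H\<close> bounded for all arguments, as \<open>step_expectation\<close> demands.\<close>
  define H where "H t s v = exp (- max 0 t) * exp (- max 0 (hold s v))" for t s v
  have "expectation (\<lambda>w. exp (- T (Suc n) w)) = expectation (\<lambda>w. H (T n w) (S n w) (row n w))"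
  proof (rule integral_cong_AE)
    show "(\<lambda>w. H (T n w) (S n w) (row n w)) \<in> borel_measurable clocks"
    proof -
      have "(\<lambda>w. exp (- max 0 (T n w)) * exp (- max 0 (T (Suc n) w - T n w))) \<in> borel_measurable clocks"
        by measurable
      then show ?thesis by (simp add: H_def T_Suc)
    qed
    show "AE w in clocks. exp (- T (Suc n) w) = H (T n w) (S n w) (row n w)"
      using hold_nonneg Tpos
    proof eventually_elim
      case (elim w)
      then have "max 0 (hold (S n w) (row n w)) = hold (S n w) (row n w)" "max 0 (T n w) = T n w"
        by (simp_all add: max_def)
      then show ?case unfolding H_def T_Suc by (simp add: exp_add[symmetric])
    qed
  qed measurable
  also have "\<dots> = expectation (\<lambda>w. expectation (\<lambda>w'. H (T n w) (S n w) (row n w')))"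
  proof (rule step_expectation[where B=1])
    fix s assume "s \<in> X"
    note [measurable] = hold_measurable[OF this]
    show "(\<lambda>(t, v). H t s v) \<in> borel_measurable (borel \<Otimes>\<^sub>M Pi\<^sub>M UNIV (\<lambda>_. borel))"
      unfolding H_def by measurable
  qed (auto simp: H_def intro!: mult_le_one)
  also have "\<dots> = expectation (\<lambda>w. exp (- max 0 (T n w)) * (total (S n w) / (total (S n w) + 1)))"
  proof (intro Bochner_Integration.integral_cong refl)
    fix w :: "nat \<times> 'e \<Rightarrow> real"
    let ?s = "S n w"
    let ?R = "total ?s"
    have R: "0 < ?R" by (rule total_pos[OF S_in])
    have "expectation (\<lambda>w'. exp (- max 0 (hold ?s (row n w'))))
      = (\<Sum>e\<in>enabled ?s. LINT t|lborel. indicator {0..} t * (rate ?s e * exp (- ?R * t) * exp (- max 0 t)))"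
      by (rule race_expectation[OF S_in, of "\<lambda>_ x. exp (- max 0 x)" 1]) auto
    also have "\<dots> = (\<Sum>e\<in>enabled ?s. rate ?s e * (1 / (?R + 1)))"
    proof (intro sum.cong refl)
      fix e
      have eq: "indicator {0..} t * (rate ?s e * exp (- ?R * t) * exp (- max 0 t))
        = rate ?s e * (indicator {0..} t * exp (- (?R + 1) * t))" for t
        by (auto simp: indicator_def exp_add[symmetric] algebra_simps)
      show "(LINT t|lborel. indicator {0..} t * (rate ?s e * exp (- ?R * t) * exp (- max 0 t)))
        = rate ?s e * (1 / (?R + 1))"
        unfolding eq using has_bochner_integral_integral_eq[OF has_bochner_integral_exp[of "?R + 1"]] R by simp
    qed
    finally show "expectation (\<lambda>w'. H (T n w) ?s (row n w')) = exp (- max 0 (T n w)) * (?R / (?R + 1))"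
      by (simp add: H_def total_def sum_divide_distrib)
  qed
  also have "\<dots> \<le> expectation (\<lambda>w. \<rho> * exp (- T n w))"
  proof (rule integral_mono_AE)
    have frac: "total (S n w) / (total (S n w) + 1) \<le> \<rho>" for w
    proof -
      have R: "0 < total (S n w)" by (rule total_pos[OF S_in])
      have "real (lev (S n w)) + 1 \<le> real (lev s0 + n + 1)"
        using lev_S[of n w] by simp
      then have "C * (real (lev (S n w)) + 1) \<le> C * real (lev s0 + n + 1)"
        using C_pos by (intro mult_left_mono) auto
      moreover have "total (S n w) \<le> C * (real (lev (S n w)) + 1)"
        using total_le[OF S_in, of n w] by (simp add: total_def enabled_def add.commute)
      ultimately have "total (S n w) \<le> C * (lev s0 + n + 1)" by linarith
      then have "1 / (C * (lev s0 + n + 1) + 1) \<le> 1 / (total (S n w) + 1)"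
        using R by (intro divide_left_mono mult_pos_pos) auto
      moreover have "total (S n w) / (total (S n w) + 1) = 1 - 1 / (total (S n w) + 1)"
        using R by (simp add: field_simps)
      ultimately show ?thesis by (simp add: \<rho>_def)
    qed
    have tm: "total (S n w) / (total (S n w) + 1) \<in> {0..1}" for w
      using total_pos[OF S_in, of n w] by simp
    have "(\<lambda>w. total (S n w)) \<in> borel_measurable clocks"
      by (rule measurable_compose[OF S_measurable]) simp
    note [measurable] = this
    show "integrable clocks (\<lambda>w. exp (- max 0 (T n w)) * (total (S n w) / (total (S n w) + 1)))"
    proof (rule integrable_const_bound[where B=1])
      have "norm (exp (- max 0 (T n w)) * q) \<le> 1" if "q \<in> {0..1}" for w and q :: real
        using that by (auto simp: abs_mult intro!: mult_le_one)
      then show "AE w in clocks. norm (exp (- max 0 (T n w)) * (total (S n w) / (total (S n w) + 1))) \<le> 1"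
        using tm by blast
    qed measurable
    show "integrable clocks (\<lambda>w. \<rho> * exp (- T n w))" using int by simp
    show "AE w in clocks. exp (- max 0 (T n w)) * (total (S n w) / (total (S n w) + 1)) \<le> \<rho> * exp (- T n w)"
      using Tpos
    proof eventually_elim
      case (elim w)
      then have "max 0 (T n w) = T n w" by (simp add: max_def)
      then show ?case using mult_right_mono[OF frac[of w], of "exp (- T n w)"] by (simp add: mult.commute)
    qed
  qed
  finally show "expectation (\<lambda>w. exp (- T (Suc n) w)) \<le>
    (1 - 1 / (C * (lev s0 + n + 1) + 1)) * expectation (\<lambda>w. exp (- T n w))"
    by (simp add: \<rho>_def)
qed

text \<open>The product of the factors is at most the exponential of a negative multiple of the
  harmonic sum, which diverges. \<open>D\<close> is chosen so that
  \<open>C * (lev s0 + n + 1) + 1 \<le> D * (n + 1)\<close> for every \<open>n\<close>.\<close>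

lemma laplace_T_tendsto_0: "(\<lambda>n. expectation (\<lambda>w. exp (- T n w))) \<longlonglongrightarrow> 0"
proof -
  define D where "D = C * (lev s0 + 1) + 1"
  have D: "0 < D" using C_pos by (simp add: D_def add_pos_pos)
  have bound: "expectation (\<lambda>w. exp (- T n w)) \<le> exp (- harm n / D)" for n
  proof (induction n)
    case 0
    then show ?case by (simp add: T_0 harm_def prob_space)
  next
    case (Suc n)
    have "C * (lev s0 + n + 1) + 1 \<le> D * (n + 1)"
      using C_pos by (simp add: D_def algebra_simps)
    moreover have "0 < C * (lev s0 + n + 1) + 1" using C_pos by (intro add_nonneg_pos mult_nonneg_nonneg) auto
    ultimately have "1 / (D * (n + 1)) \<le> 1 / (C * (lev s0 + n + 1) + 1)"
      by (intro divide_left_mono mult_pos_pos) (use D in auto)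
    then have "1 - 1 / (C * (lev s0 + n + 1) + 1) \<le> 1 + (- (1 / (D * (n + 1))))" by simp
    also have "\<dots> \<le> exp (- (1 / (D * (n + 1))))" by (rule exp_ge_add_one_self)
    finally have le: "1 - 1 / (C * (lev s0 + n + 1) + 1) \<le> exp (- (1 / (D * (n + 1))))" .
    have "0 \<le> expectation (\<lambda>w. exp (- T n w))" by simp
    then have "expectation (\<lambda>w. exp (- T (Suc n) w)) \<le> exp (- (1 / (D * (n + 1)))) * exp (- harm n / D)"
      by (intro order_trans[OF laplace_T_Suc] mult_mono[OF le Suc]) auto
    also have "\<dots> = exp (- harm (Suc n) / D)"
      by (simp add: exp_add[symmetric] harm_Suc add_divide_distrib diff_divide_distrib inverse_eq_divide mult.commute)
    finally show ?case .
  qed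
  have "filterlim (\<lambda>n. harm n / D) at_top sequentially"
    using filterlim_tendsto_pos_mult_at_top[OF tendsto_const[of "inverse D"] _ harm_at_top] D
    by (simp add: divide_inverse mult.commute)
  then have "(\<lambda>n. exp (- (harm n / D))) \<longlonglongrightarrow> 0"
    by (intro filterlim_compose[OF exp_at_bot] filterlim_uminus_at_bot_at_top[THEN filterlim_compose])
  then show ?thesis
    by (rule tendsto_sandwich[OF _ _ tendsto_const, rotated 2]) (use bound in auto)
qed

lemma prob_T_le_tendsto_0: "(\<lambda>n. prob {w. T n w \<le> t}) \<longlonglongrightarrow> 0"
proof (rule tendsto_sandwich[OF _ _ tendsto_const])
  show "\<forall>\<^sub>F n in sequentially. prob {w. T n w \<le> t} \<le> exp t * expectation (\<lambda>w. exp (- T n w))"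
  proof (intro always_eventually allI)
    fix n
    have m: "{w \<in> space clocks. T n w \<le> t} \<in> events" by measurable
    have "prob {w. T n w \<le> t} = expectation (\<lambda>w. indicator {w. T n w \<le> t} w)"
      using m by simp
    also have "\<dots> \<le> expectation (\<lambda>w. exp t * exp (- T n w))"
    proof (rule integral_mono)
      show "integrable clocks (\<lambda>w. indicator {w. T n w \<le> t} w :: real)"
        using m by (intro integrable_real_indicator) (auto simp: emeasure_eq_measure)
      show "integrable clocks (\<lambda>w. exp t * exp (- T n w))"
        by (intro integrable_mult_right laplace_T_integrable)
    qed (auto simp: indicator_def exp_add[symmetric])
    finally show "prob {w. T n w \<le> t} \<le> exp t * expectation (\<lambda>w. exp (- T n w))" by simp
  qed
  show "(\<lambda>n. exp t * expectation (\<lambda>w. exp (- T n w))) \<longlonglongrightarrow> 0"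
    using tendsto_mult_right_zero[OF laplace_T_tendsto_0] .
qed auto

text \<open>Decomposition at the first jump: for a solution \<open>u\<close> of the backward
  equation, the integrand over the time of this jump, summed over the moves, is the exact derivative
  of \<open>- exp (- ?R * x) * (u (h - x) s - u 0 s)\<close>.\<close>

lemma one_step:
  fixes u :: "real \<Rightarrow> 's \<Rightarrow> real"
  assumes der: "\<And>s h. s \<in> X \<Longrightarrow>
      ((\<lambda>h. u h s) has_real_derivative (\<Sum>e\<in>enabled s. rate s e * (u h (move e s) - u h s))) (at h)"
    and bd: "\<And>s h. s \<in> X \<Longrightarrow> 0 \<le> h \<Longrightarrow> \<bar>u h s\<bar> \<le> B"
    and s: "s \<in> X" and h: "0 \<le> h"
  shows "expectation (\<lambda>w. if hold s (row n w) \<le> h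
    then u (h - hold s (row n w)) (move (winner s (row n w)) s) else u 0 s) = u h s"
proof -
  let ?F = "enabled s" and ?R = "total s"
  have fin: "finite ?F" using finite_enabled[OF s] by (simp add: enabled_def)
  have R: "0 < ?R" by (rule total_pos[OF s])
  have mX: "move e s \<in> X" if "e \<in> ?F" for e using that move_closed[OF s] by (simp add: enabled_def)
  have cont: "continuous_on A (\<lambda>x. u (h - x) s')" if "s' \<in> X" for s' A
  proof -
    have "continuous_on UNIV (\<lambda>x. u x s')"
      by (rule continuous_at_imp_continuous_on) (use DERIV_isCont[OF der[OF that]] in auto)
    then have "continuous_on UNIV ((\<lambda>x. u x s') \<circ> (\<lambda>x. h - x))"
      by (intro continuous_on_compose continuous_intros) (auto intro: continuous_on_subset)
    then show ?thesis by (auto simp: comp_def intro: continuous_on_subset)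
  qed
  \<comment> \<open>The default \<open>u 0 s\<close> for moves that are not enabled keeps
    \<open>p\<close> bounded and measurable for every \<open>e\<close>. In \<open>d\<close> the
    value \<open>u 0 s\<close>, taken when no jump happens up to time \<open>h\<close>, is
    subtracted, which confines the integral to \<open>{0..h}\<close>.\<close>
  define p where "p e x = (if x \<le> h \<and> e \<in> ?F then u (h - x) (move e s) else u 0 s)" for e x
  define d where "d e x = rate s e * exp (- ?R * x) * (u (h - x) (move e s) - u 0 s)" for e x
  have id: "integrable lborel (\<lambda>t. d e t * indicator {0..h} t)" if e: "e \<in> ?F" for e
  proof -
    have "continuous_on {0..h} (d e)" unfolding d_def by (intro continuous_intros cont mX e)
    then show ?thesis
      using borel_integrable_atLeastAtMost'[of 0 h "d e"] by (simp add: set_integrable_def mult.commute)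
  qed
  have "expectation (\<lambda>w. if hold s (row n w) \<le> h
      then u (h - hold s (row n w)) (move (winner s (row n w)) s) else u 0 s)
    = expectation (\<lambda>w. p (winner s (row n w)) (hold s (row n w)))"
    using winner_least(1)[OF s] by (simp add: p_def)
  also have "\<dots> = (\<Sum>e\<in>?F. LINT t|lborel. indicator {0..} t * (rate s e * exp (- ?R * t) * p e t))"
  proof (rule race_expectation[OF s, of _ B])
    fix e
    show "p e \<in> borel_measurable borel"
    proof (cases "e \<in> ?F")
      case True
      have [measurable]: "(\<lambda>x. u (h - x) (move e s)) \<in> borel_measurable borel"
        by (rule borel_measurable_continuous_onI[OF cont[OF mX[OF True]]])
      show ?thesis unfolding p_def by measurable
    qed (simp add: p_def[abs_def])
    show "\<bar>p e x\<bar> \<le> B" for x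
      using bd[OF s, of 0] bd[OF mX, of e "h - x"] by (auto simp: p_def)
  qed
  also have "\<dots> = (\<Sum>e\<in>?F. (LINT t|lborel. indicator {0..} t * (rate s e * exp (- ?R * t)) * u 0 s)
      + (LINT t|lborel. d e t * indicator {0..h} t))"
  proof (intro sum.cong refl)
    fix e assume e: "e \<in> ?F"
    have i1: "integrable lborel (\<lambda>t. indicator {0..} t * (rate s e * exp (- ?R * t)) * u 0 s)"
      using integrable_mult_right[OF integrable.intros[OF has_bochner_integral_exp[OF R]], of "rate s e * u 0 s"]
      by (simp add: mult_ac)
    show "(LINT t|lborel. indicator {0..} t * (rate s e * exp (- ?R * t) * p e t))
      = (LINT t|lborel. indicator {0..} t * (rate s e * exp (- ?R * t)) * u 0 s)
        + (LINT t|lborel. d e t * indicator {0..h} t)"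
      unfolding Bochner_Integration.integral_add[OF i1 id[OF e], symmetric]
      by (intro Bochner_Integration.integral_cong refl)
        (use e in \<open>auto simp: p_def d_def indicator_def algebra_simps\<close>)
  qed
  also have "\<dots> = u 0 s * (\<Sum>e\<in>?F. LINT t|lborel. indicator {0..} t * (rate s e * exp (- ?R * t)))
      + (\<Sum>e\<in>?F. LINT t|lborel. d e t * indicator {0..h} t)"
    by (simp add: sum.distrib sum_distrib_left mult.commute)
  also have "\<dots> = u 0 s + (\<Sum>e\<in>?F. LINT t|lborel. d e t * indicator {0..h} t)"
    by (simp only: race_total[OF s] mult_1_right)
  also have "(\<Sum>e\<in>?F. LINT t|lborel. d e t * indicator {0..h} t)
      = (LINT t|lborel. (\<Sum>e\<in>?F. d e t) * indicator {0..h} t)"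
    using id by (simp add: sum_distrib_right)
  also have "\<dots> = - exp (- ?R * h) * (u (h - h) s - u 0 s) - (- exp (- ?R * 0) * (u (h - 0) s - u 0 s))"
  proof (rule integral_FTC_Icc_real[OF h])
    fix x
    have du: "((\<lambda>x. u (h - x) s) has_real_derivative
        - (\<Sum>e\<in>?F. rate s e * (u (h - x) (move e s) - u (h - x) s))) (at x)"
    proof -
      have "((\<lambda>x. h - x) has_real_derivative - 1) (at x)" by (auto intro!: derivative_eq_intros)
      from DERIV_chain2[where f="\<lambda>h. u h s" and g="\<lambda>x. h - x" and x=x and s=UNIV, OF der[OF s] this]
      show ?thesis by simp
    qed
    have "(\<Sum>e\<in>?F. d e x) = exp (- ?R * x) * (\<Sum>e\<in>?F. rate s e * (u (h - x) (move e s) - u 0 s))"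
      by (simp add: d_def sum_distrib_left mult_ac)
    also have "(\<Sum>e\<in>?F. rate s e * (u (h - x) (move e s) - u 0 s))
      = (\<Sum>e\<in>?F. rate s e * (u (h - x) (move e s) - u (h - x) s)) + ?R * (u (h - x) s - u 0 s)"
      unfolding total_def sum_distrib_right sum.distrib[symmetric] by (simp add: algebra_simps)
    finally have eq: "(\<Sum>e\<in>?F. d e x) = exp (- ?R * x) *
      ((\<Sum>e\<in>?F. rate s e * (u (h - x) (move e s) - u (h - x) s)) + ?R * (u (h - x) s - u 0 s))" .
    show "((\<lambda>x. - exp (- ?R * x) * (u (h - x) s - u 0 s)) has_real_derivative (\<Sum>e\<in>?F. d e x)) (at x)"
      unfolding eq by (rule derivative_eq_intros du refl | simp add: algebra_simps)+
    have "continuous_on UNIV (\<lambda>x. \<Sum>e\<in>?F. d e x)"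
      unfolding d_def by (intro continuous_intros cont mX)
    then show "isCont (\<lambda>x. \<Sum>e\<in>?F. d e x) x" by (simp add: continuous_on_eq_continuous_at)
  qed
  finally show ?thesis by simp
qed

text \<open>Iterating \<open>one_step\<close> splits \<open>u t s0\<close> into the contributions of
  exactly m jumps before \<open>t\<close>, for m below n, and a remainder that lives on the event
  \<open>T n w \<le> t\<close>. Non-explosion sends the remainder to zero.\<close>

theorem expectation_jump_process:
  fixes u :: "real \<Rightarrow> 's \<Rightarrow> real"
  assumes der: "\<And>s h. s \<in> X \<Longrightarrow>
      ((\<lambda>h. u h s) has_real_derivative (\<Sum>e\<in>enabled s. rate s e * (u h (move e s) - u h s))) (at h)"
    and bd: "\<And>s h. s \<in> X \<Longrightarrow> 0 \<le> h \<Longrightarrow> \<bar>u h s\<bar> \<le> B"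
    and t: "0 \<le> t"
  shows "expectation (\<lambda>w. u 0 (jump_process rate move s0 t w)) = u t s0"
    and "(\<lambda>w. jump_process rate move s0 t w) \<in> measurable clocks (count_space UNIV)"
proof -
  have B0: "0 \<le> B" using bd[OF s0, of 0] by simp
  define N where "N w = (LEAST n. t < T (Suc n) w)" for w
  have jp: "jump_process rate move s0 t w = S (N w) w" for w
    by (simp add: jump_process_def S_def N_def T_def)
  have N[measurable]: "N \<in> measurable clocks (count_space UNIV)"
    unfolding N_def by measurable
  have JX: "(\<lambda>w. S (N w) w) \<in> measurable clocks (count_space X)"
    by (rule measurable_compose_countable'[OF S_measurable N]) auto
  then have J: "(\<lambda>w. S (N w) w) \<in> measurable clocks (count_space UNIV)"
    using measurable_compose[OF JX, of "\<lambda>s. s" "count_space UNIV"] by simp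
  then show "(\<lambda>w. jump_process rate move s0 t w) \<in> measurable clocks (count_space UNIV)"
    by (simp add: jp[abs_def])
  have mu: "(\<lambda>x. u (g x) s) \<in> borel_measurable K" if "g \<in> borel_measurable K" "s \<in> X" for g K s
  proof -
    have "continuous_on UNIV (\<lambda>x. u x s)"
      by (rule continuous_at_imp_continuous_on) (use DERIV_isCont[OF der[OF that(2)]] in auto)
    from measurable_compose[OF that(1) borel_measurable_continuous_onI[OF this]] show ?thesis .
  qed
  define a where "a n = expectation (\<lambda>w. if T n w \<le> t then u (t - T n w) (S n w) else 0)" for n
  define b where "b n = expectation (\<lambda>w. if T n w \<le> t \<and> t < T (Suc n) w then u 0 (S n w) else 0)" for n
  have ma: "(\<lambda>w. if T n w \<le> t then u (t - T n w) (S n w) else 0) \<in> borel_measurable clocks" for n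
  proof -
    have "(\<lambda>w. u (t - T n w) (S n w)) \<in> borel_measurable clocks"
      by (rule measurable_compose_countable'[OF _ S_measurable countable_states]) (auto intro: mu)
    then show ?thesis by measurable
  qed
  have mf: "(\<lambda>w. u 0 (S n w)) \<in> borel_measurable clocks" for n
    by (rule measurable_compose[OF S_measurable]) simp
  have mb: "(\<lambda>w. if T n w \<le> t \<and> t < T (Suc n) w then u 0 (S n w) else 0) \<in> borel_measurable clocks" for n
    using mf[of n] by measurable
  have ia: "integrable clocks (\<lambda>w. if T n w \<le> t then u (t - T n w) (S n w) else 0)" for n
    by (rule integrable_const_bound[OF _ ma, where B=B]) (use bd[OF S_in] B0 in auto)
  have ib: "integrable clocks (\<lambda>w. if T n w \<le> t \<and> t < T (Suc n) w then u 0 (S n w) else 0)" for n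
    by (rule integrable_const_bound[OF _ mb, where B=B]) (use bd[OF S_in] B0 in auto)
  have step: "a n = b n + a (Suc n)" for n
  proof -
    define H where "H x s v = (if x \<le> t then
        (if hold s v \<le> t - x then u (t - x - hold s v) (move (winner s v) s) else u 0 s) else 0)" for x s v
    have "expectation (\<lambda>w. H (T n w) (S n w) (row n w))
      = expectation (\<lambda>w. expectation (\<lambda>w'. H (T n w) (S n w) (row n w')))"
    proof (rule step_expectation[where B=B])
      fix s assume s: "s \<in> X"
      note [measurable] = hold_measurable[OF s]
      have "(\<lambda>z. u (t - fst z - hold s (snd z)) (move (winner s (snd z)) s))
        \<in> borel_measurable (borel \<Otimes>\<^sub>M Pi\<^sub>M UNIV (\<lambda>_. borel))"
        by (rule measurable_compose_countable'[OF _ measurable_compose[OF measurable_snd winner_measurable[OF s]]])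
          (use s finite_enabled[OF s] move_closed[OF s] in \<open>auto simp: enabled_def intro!: mu countable_finite\<close>)
      then show "(\<lambda>(x, v). H x s v) \<in> borel_measurable (borel \<Otimes>\<^sub>M Pi\<^sub>M UNIV (\<lambda>_. borel))"
        unfolding H_def split_beta by measurable
      show "\<bar>H x s v\<bar> \<le> B" for x v
        using winner_least(1)[OF s, of v] bd[OF s, of 0] B0 move_closed[OF s]
        by (auto simp: H_def enabled_def intro!: bd)
    qed
    also have "\<dots> = a n"
      unfolding a_def
    proof (intro Bochner_Integration.integral_cong refl)
      fix w
      show "expectation (\<lambda>w'. H (T n w) (S n w) (row n w'))
        = (if T n w \<le> t then u (t - T n w) (S n w) else 0)"
        using one_step[OF der bd S_in, of "t - T n w" n w n] by (simp add: H_def)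
    qed
    finally have "a n = expectation (\<lambda>w. H (T n w) (S n w) (row n w))" ..
    also have "\<dots> = expectation (\<lambda>w. (if T n w \<le> t \<and> t < T (Suc n) w then u 0 (S n w) else 0)
      + (if T (Suc n) w \<le> t then u (t - T (Suc n) w) (S (Suc n) w) else 0))"
    proof (rule integral_cong_AE)
      have eq: "H (T n w) (S n w) (row n w) = (if T n w \<le> t then
        (if T (Suc n) w \<le> t then u (t - T (Suc n) w) (S (Suc n) w) else u 0 (S n w)) else 0)" for w
        by (simp add: H_def T_Suc S_Suc algebra_simps)
      have "(\<lambda>w. if T n w \<le> t then (if T (Suc n) w \<le> t then
          (if T (Suc n) w \<le> t then u (t - T (Suc n) w) (S (Suc n) w) else 0)
          else u 0 (S n w)) else 0) \<in> borel_measurable clocks"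
        using ma[of "Suc n"] mf[of n] by measurable
      then show "(\<lambda>w. H (T n w) (S n w) (row n w)) \<in> borel_measurable clocks"
        unfolding eq by (rule measurable_cong[THEN iffD1, rotated]) auto
      show "(\<lambda>w. (if T n w \<le> t \<and> t < T (Suc n) w then u 0 (S n w) else 0)
        + (if T (Suc n) w \<le> t then u (t - T (Suc n) w) (S (Suc n) w) else 0)) \<in> borel_measurable clocks"
        by (intro borel_measurable_add mb ma)
      show "AE w in clocks. H (T n w) (S n w) (row n w)
        = (if T n w \<le> t \<and> t < T (Suc n) w then u 0 (S n w) else 0)
        + (if T (Suc n) w \<le> t then u (t - T (Suc n) w) (S (Suc n) w) else 0)"
        using hold_nonneg
      proof eventually_elim
        case (elim w)
        then have "T n w \<le> T (Suc n) w" by (simp add: T_Suc)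
        then show ?case unfolding eq by auto
      qed
    qed
    also have "\<dots> = b n + a (Suc n)"
      unfolding a_def b_def by (rule Bochner_Integration.integral_add[OF ib ia])
    finally show ?thesis .
  qed
  have "a 0 = (\<Sum>m<n. b m) + a n" for n
  proof (induction n)
    case (Suc n)
    then show ?case using step[of n] by simp
  qed simp
  moreover have "a 0 = u t s0" using t prob_space by (simp add: a_def T_0 S_0)
  ultimately have sum_b: "u t s0 = (\<Sum>m<n. b m) + a n" for n by metis
  let ?E = "expectation (\<lambda>w. u 0 (jump_process rate move s0 t w))"
  have iJ: "integrable clocks (\<lambda>w. u 0 (S (N w) w))"
    by (rule integrable_const_bound[of _ B])
      (use bd[OF S_in] measurable_compose[OF JX, of "u 0" borel] in auto)
  have T_le_m: "{w. T n w \<le> t} \<in> events" for n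
  proof -
    have "{w \<in> space clocks. T n w \<le> t} \<in> events" by measurable
    then show ?thesis by simp
  qed
  have iP: "integrable clocks (\<lambda>w. B * indicator {w. T n w \<le> t} w)" for n
    using T_le_m by (intro integrable_mult_right integrable_real_indicator) (auto simp: emeasure_eq_measure)
  \<comment> \<open>If all jump times are at most \<open>t\<close>, the \<open>LEAST\<close> in the
    process is an unspecified number. This event is contained in \<open>T n w \<le> t\<close>, as is
    that of the remainder \<open>a n\<close>; the two errors give the factor 2.\<close>
  have close: "\<bar>?E - u t s0\<bar> \<le> 2 * B * prob {w. T n w \<le> t}" for n
  proof -
    have "\<bar>a n\<bar> \<le> expectation (\<lambda>w. \<bar>if T n w \<le> t then u (t - T n w) (S n w) else 0\<bar>)"
      unfolding a_def by (rule integral_abs_bound)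
    also have "\<dots> \<le> expectation (\<lambda>w. B * indicator {w. T n w \<le> t} w)"
      using bd[OF S_in] by (intro integral_mono ia iP integrable_abs) (auto simp: indicator_def)
    also have "\<dots> = B * prob {w. T n w \<le> t}" using T_le_m by simp
    finally have 1: "\<bar>a n\<bar> \<le> B * prob {w. T n w \<le> t}" .
    let ?b = "\<lambda>w. \<Sum>m<n. if T m w \<le> t \<and> t < T (Suc m) w then u 0 (S m w) else 0"
    have "(\<Sum>m<n. b m) = expectation ?b"
      unfolding b_def by (rule Bochner_Integration.integral_sum[symmetric]) (rule ib)
    then have "\<bar>?E - (\<Sum>m<n. b m)\<bar> = \<bar>expectation (\<lambda>w. u 0 (S (N w) w) - ?b w)\<bar>"
      using iJ ib by (simp add: jp)
    also have "\<dots> \<le> expectation (\<lambda>w. \<bar>u 0 (S (N w) w) - ?b w\<bar>)"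
      by (rule integral_abs_bound)
    also have "\<dots> \<le> expectation (\<lambda>w. B * indicator {w. T n w \<le> t} w)"
    proof (rule integral_mono_AE)
      show "integrable clocks (\<lambda>w. \<bar>u 0 (S (N w) w) - ?b w\<bar>)"
        using iJ ib by (intro integrable_abs Bochner_Integration.integrable_diff Bochner_Integration.integrable_sum) auto
      show "AE w in clocks. \<bar>u 0 (S (N w) w) - ?b w\<bar> \<le> B * indicator {w. T n w \<le> t} w"
        using hold_nonneg
      proof eventually_elim
        case (elim w)
        have mono: "T i w \<le> T j w" if "i \<le> j" for i j
          by (rule lift_Suc_mono_le[of "\<lambda>n. T n w", OF _ that]) (use elim in \<open>simp add: T_Suc\<close>)
        let ?P = "\<lambda>m. T m w \<le> t \<and> t < T (Suc m) w"
        have N: "?P m \<longleftrightarrow> m = N w" if "T n w > t \<or> ?P m" for m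
        proof -
          have ex: "\<exists>m. t < T (Suc m) w"
            using that mono[of n "Suc n"] by (auto intro: less_le_trans)
          have PN: "?P (N w)"
          proof
            show "t < T (Suc (N w)) w" unfolding N_def using ex by (rule LeastI_ex)
            show "T (N w) w \<le> t"
            proof (cases "N w")
              case (Suc k)
              then have "\<not> t < T (Suc k) w"
                using not_less_Least[of k "\<lambda>n. t < T (Suc n) w"] by (simp add: N_def)
              then show ?thesis using Suc by simp
            qed (use t in \<open>simp add: T_0\<close>)
          qed
          have "m = N w" if m: "?P m"
            using m PN mono[of "Suc m" "N w"] mono[of "Suc (N w)" m] by (cases m "N w" rule: linorder_cases) auto
          then show ?thesis using PN by blast
        qed
        show ?case
        proof (cases "T n w \<le> t")
          case False
          then have gt: "t < T n w" by simp
          have "N w < n"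
          proof (rule ccontr)
            assume "\<not> N w < n"
            then have "T n w \<le> T (N w) w" by (intro mono) simp
            then show False using N[of "N w"] gt by auto
          qed
          have "?b w = (\<Sum>m<n. if m = N w then u 0 (S (N w) w) else 0)"
            using N gt by (intro sum.cong refl) auto
          also have "\<dots> = u 0 (S (N w) w)" using \<open>N w < n\<close> by simp
          finally show ?thesis using False by simp
        next
          case True
          have "?b w = 0"
          proof (intro sum.neutral ballI)
            fix m assume "m \<in> {..<n}"
            then have "T (Suc m) w \<le> T n w" by (intro mono) simp
            then show "(if ?P m then u 0 (S m w) else 0) = 0" using True by auto
          qed
          then show ?thesis using True bd[OF S_in, of 0 "N w" w] by simp
        qed
      qed
    qed (rule iP)
    also have "\<dots> = B * prob {w. T n w \<le> t}" using T_le_m by simp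
    finally show ?thesis using 1 sum_b[of n] by linarith
  qed
  have "(\<lambda>n. 2 * B * prob {w. T n w \<le> t}) \<longlonglongrightarrow> 0"
    by (intro tendsto_mult_right_zero prob_T_le_tendsto_0)
  then have "\<bar>?E - u t s0\<bar> \<le> 0"
    by (rule LIMSEQ_le_const) (use close in auto)
  then show "?E = u t s0" by simp
qed

end

section \<open>Duality for the $q$-TAZRP\<close>

lemma (in markov_generator) evol_diff:
  assumes "\<And>y. y \<in> X \<Longrightarrow> \<bar>f y\<bar> \<le> B" "\<And>y. y \<in> X \<Longrightarrow> \<bar>g y\<bar> \<le> B" "y \<in> X"
  shows "evol (\<lambda>y. f y - g y) s y = evol f s y - evol g s y"
proof -
  have "evol (\<lambda>y. \<Sum>i\<in>{False, True}. (if i then 1 else - 1) * (if i then f else g) y) s y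
    = (\<Sum>i\<in>{False, True}. (if i then 1 else - 1) * evol (if i then f else g) s y)"
    by (rule evol_sum[of _ _ B]) (use assms in auto)
  then show ?thesis by simp
qed

text \<open>For fixed \<open>y\<close> the function \<open>\<lambda>h s. G.evol (D s) h y\<close>
  solves the backward equation of the jump process: its time derivative applies the dual generator
  to \<open>D s\<close>, the duality turns this into a combination of the functions
  \<open>D (move e s)\<close>, and the dual semigroup is linear.\<close>

theorem jump_process_duality:
  assumes J: "jump_system rate move s0 X lev C" and G: "markov_generator Mv r mv Y c"
    and bd: "\<And>s y. s \<in> X \<Longrightarrow> y \<in> Y \<Longrightarrow> \<bar>D s y\<bar> \<le> B"
    and dual: "\<And>s y. s \<in> X \<Longrightarrow> y \<in> Y \<Longrightarrow>
      (\<Sum>e | 0 < rate s e. rate s e * (D (move e s) y - D s y)) = markov_generator.gen Mv r mv (D s) y"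
    and t: "0 \<le> t" and y: "y \<in> Y"
  shows "integral\<^sup>L clocks (\<lambda>w. D (jump_process rate move s0 t w) y) = markov_generator.evol Mv r mv c (D s0) t y"
    and "jump_process rate move s0 t \<in> measurable clocks (count_space UNIV)"
proof -
  interpret J: jump_system rate move s0 X lev C by (rule J)
  interpret G: markov_generator Mv r mv Y c by (rule G)
  have der: "((\<lambda>h. G.evol (D s) h y) has_real_derivative
      (\<Sum>e\<in>J.enabled s. rate s e * (G.evol (D (move e s)) h y - G.evol (D s) h y))) (at h)"
    if s: "s \<in> X" for s h
  proof -
    have mX: "move e s \<in> X" if "e \<in> J.enabled s" for e
      using that J.move_closed[OF s] by (simp add: J.enabled_def)
    have "G.evol (G.gen (D s)) h y = G.evol (\<lambda>y. \<Sum>e\<in>J.enabled s. rate s e * (D (move e s) y - D s y)) h y"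
      by (rule G.evol_cong[OF _ y]) (simp add: dual[OF s, symmetric] J.enabled_def)
    also have "\<dots> = (\<Sum>e\<in>J.enabled s. rate s e * G.evol (\<lambda>y. D (move e s) y - D s y) h y)"
    proof (rule G.evol_sum[OF _ y])
      fix e y assume "e \<in> J.enabled s" "y \<in> Y"
      then show "\<bar>D (move e s) y - D s y\<bar> \<le> 2 * B"
        using bd[OF mX, of e y] bd[OF s, of y] by linarith
    qed
    also have "\<dots> = (\<Sum>e\<in>J.enabled s. rate s e * (G.evol (D (move e s)) h y - G.evol (D s) h y))"
      by (intro sum.cong refl arg_cong2[where f="(*)"] G.evol_diff[where B=B, OF _ _ y] bd s mX)
    finally show ?thesis using G.evol_has_derivative[of "D s" B y h, OF bd[OF s] y] by simp
  qed
  have evb: "\<bar>G.evol (D s) h y\<bar> \<le> B" if "s \<in> X" "0 \<le> h" for s h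
  proof -
    have "- B \<le> D s z" "D s z \<le> B" if "z \<in> Y" for z using bd[OF \<open>s \<in> X\<close> that] by linarith+
    then show ?thesis using G.evol_bounds[of "- B" "D s" B y h] y that(2) by (simp add: abs_le_iff minus_le_iff)
  qed
  show "integral\<^sup>L clocks (\<lambda>w. D (jump_process rate move s0 t w) y) = G.evol (D s0) t y"
    using J.expectation_jump_process(1)[OF der evb t] by (simp add: G.evol_0)
  show "jump_process rate move s0 t \<in> measurable clocks (count_space UNIV)"
    using J.expectation_jump_process(2)[OF der evb t] .
qed

text \<open>Such a function is determined by its graph over the places where it differs from
  \<open>d\<close>, and this graph is a finite subset of a countable type.\<close>

lemma countable_finite_perturbations:
  "countable {x :: nat \<Rightarrow> 'a::countable. finite {m. x m \<noteq> d m}}"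
proof -
  let ?g = "\<lambda>x. {(m, x m) |m. x m \<noteq> d m}"
  have "x m = y m" if "?g x = ?g y" for x y :: "nat \<Rightarrow> 'a" and m
  proof (cases "x m = d m \<and> y m = d m")
    case False
    then have "(m, x m) \<in> ?g x \<or> (m, y m) \<in> ?g y" by auto
    then have "(m, x m) \<in> ?g y \<or> (m, y m) \<in> ?g x" using that by blast
    then show "x m = y m" by auto
  qed simp
  then have "inj ?g" by (intro injI ext) blast
  have "finite (?g x)" if "finite {m. x m \<noteq> d m}" for x :: "nat \<Rightarrow> 'a"
    using finite_imageI[OF that, of "\<lambda>m. (m, x m)"] by (simp add: setcompr_eq_image)
  then have "?g ` {x. finite {m. x m \<noteq> d m}} \<subseteq> {A. finite A}" by blast
  then have "countable (?g ` {x. finite {m. x m \<noteq> d m}})"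
    by (rule countable_subset) (rule countable_Collect_finite)
  then show ?thesis
    by (rule countable_image_inj_on) (rule inj_on_subset[OF \<open>inj ?g\<close> subset_UNIV])
qed

section \<open>The q-TAZRP and its dual cluster system\<close>

locale q_parameter =
  fixes q :: real
  assumes q_pos: "0 < q" and q_less_1: "q < 1"
begin

definition taz_rate :: "(nat \<Rightarrow> int) \<Rightarrow> int \<Rightarrow> real" where
  "taz_rate = qtazrp_rate q (\<lambda>_. 1 / (1 - q))"

definition taz_states :: "(nat \<Rightarrow> int) set" where
  "taz_states = {x. x 0 = 0 \<and> (\<forall>i j. 1 \<le> i \<longrightarrow> i \<le> j \<longrightarrow> x j \<le> x i) \<and> (\<forall>m. 0 \<le> x m) \<and> finite {m. x m \<noteq> 0}}"

definition taz_count :: "(nat \<Rightarrow> int) \<Rightarrow> int \<Rightarrow> nat" where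
  "taz_count x y = card {m. 1 \<le> m \<and> y \<le> x m}"

text \<open>Infinitely many particles lie at or to the right of a level \<open>y \<le> 0\<close>, so
  the value 0 stands for \<open>q\<close> with an infinite exponent; \<open>card\<close> of an
  infinite set is 0 and would give 1 instead.\<close>

definition taz_Q :: "(nat \<Rightarrow> int) \<Rightarrow> int \<Rightarrow> real" where
  "taz_Q x y = (if y \<le> 0 then 0 else q ^ taz_count x y)"

definition taz_dual :: "nat \<Rightarrow> (nat \<Rightarrow> int) \<Rightarrow> (nat \<Rightarrow> int) \<Rightarrow> real" where
  "taz_dual k x n = (\<Prod>j<k. taz_Q x (n j))"

definition weak_chamber :: "nat \<Rightarrow> (nat \<Rightarrow> int) set" where
  "weak_chamber k = {n. \<forall>i j. i \<le> j \<longrightarrow> j < k \<longrightarrow> n j \<le> n i}"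

definition cluster_size :: "nat \<Rightarrow> (nat \<Rightarrow> int) \<Rightarrow> int \<Rightarrow> nat" where
  "cluster_size k n v = card {j. j < k \<and> n j = v}"

definition cluster_end :: "nat \<Rightarrow> (nat \<Rightarrow> int) \<Rightarrow> nat \<Rightarrow> bool" where
  "cluster_end k n j \<longleftrightarrow> Suc j < k \<longrightarrow> n (Suc j) \<noteq> n j"

text \<open>The dual particles again form a q-TAZRP, moving downwards: a block of size c releases
  one particle at rate \<open>(1 - q ^ c) / (1 - q)\<close>. The last index of the block is the one
  that leaves, which preserves the weak chamber.\<close>

definition taz_dual_rate :: "nat \<Rightarrow> (nat \<Rightarrow> int) \<Rightarrow> nat \<Rightarrow> real" where
  "taz_dual_rate k n j = (if cluster_end k n j then (1 - q ^ cluster_size k n (n j)) / (1 - q) else 0)"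

definition down :: "nat \<Rightarrow> (nat \<Rightarrow> int) \<Rightarrow> nat \<Rightarrow> int" where
  "down j n = n(j := n j - 1)"

lemma taz_statesD:
  assumes "x \<in> taz_states"
  shows "1 \<le> i \<Longrightarrow> i \<le> j \<Longrightarrow> x j \<le> x i" "0 \<le> x m" "finite {m. x m \<noteq> 0}" "x 0 = 0"
  using assms by (simp_all add: taz_states_def)

lemma taz_rate_eq: "taz_rate x y = (if labels_at x y = {} then 0
   else if finite (labels_at x y) then (1 - q ^ card (labels_at x y)) / (1 - q) else 1 / (1 - q))"
  by (simp add: taz_rate_def qtazrp_rate_def)

lemma taz_rate_pos_iff: "0 < taz_rate x y \<longleftrightarrow> labels_at x y \<noteq> {}"
  using q_pos q_less_1 by (auto simp: taz_rate_eq power_less_one_iff card_gt_0_iff)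

lemma taz_rate_le: "taz_rate x y \<le> 1 / (1 - q)"
  using q_pos q_less_1 by (auto simp: taz_rate_eq divide_right_mono)

lemma taz_enabled_subset:
  assumes "x \<in> taz_states"
  shows "{y. 0 < taz_rate x y} \<subseteq> insert 0 (x ` {m. x m \<noteq> 0})"
  by (auto simp: taz_rate_pos_iff labels_at_def)

lemma taz_move_label:
  assumes x: "x \<in> taz_states" and y: "labels_at x y \<noteq> {}"
  obtains l where "1 \<le> l" "x l = y" "qtazrp_move y x = x(l := y + 1)" "\<And>i. 1 \<le> i \<Longrightarrow> i < l \<Longrightarrow> y < x i"
proof
  let ?l = "LEAST m. m \<in> labels_at x y"
  have l: "?l \<in> labels_at x y" using y by (metis LeastI ex_in_conv)
  then show "1 \<le> ?l" "x ?l = y" by (auto simp: labels_at_def)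
  show "qtazrp_move y x = x(?l := y + 1)" by (simp add: qtazrp_move_def)
  fix i assume i: "1 \<le> i" "i < ?l"
  then have "x i \<noteq> y" using not_less_Least[OF i(2)] by (auto simp: labels_at_def)
  moreover have "x ?l \<le> x i" using x i by (auto simp: taz_states_def)
  ultimately show "y < x i" using \<open>x ?l = y\<close> by simp
qed

lemma taz_move_closed:
  assumes x: "x \<in> taz_states" and y: "labels_at x y \<noteq> {}"
  shows "qtazrp_move y x \<in> taz_states"
proof -
  from taz_move_label[OF x y] obtain l where l: "1 \<le> l" "x l = y" "qtazrp_move y x = x(l := y + 1)"
    "\<And>i. 1 \<le> i \<Longrightarrow> i < l \<Longrightarrow> y < x i" by metis
  have "0 \<le> y" using x l(2) by (auto simp: taz_states_def)
  have "{m. (x(l := y + 1)) m \<noteq> 0} \<subseteq> insert l {m. x m \<noteq> 0}" by auto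
  then have "finite {m. (x(l := y + 1)) m \<noteq> 0}"
    by (rule finite_subset) (use taz_statesD(3)[OF x] in simp)
  moreover have "(x(l := y + 1)) j \<le> (x(l := y + 1)) i" if "1 \<le> i" "i \<le> j" for i j
  proof -
    have "x j \<le> x i" using taz_statesD(1)[OF x that] .
    moreover have "y + 1 \<le> x i" if "j = l" "i \<noteq> l" using l(4)[of i] that \<open>1 \<le> i\<close> \<open>i \<le> j\<close> by simp
    ultimately show ?thesis using l(2) by (cases "i = l") simp_all
  qed
  moreover have "0 \<le> (x(l := y + 1)) m" for m using taz_statesD(2)[OF x] \<open>0 \<le> y\<close> by simp
  ultimately show ?thesis
    using taz_statesD(4)[OF x] l(1) unfolding l(3) taz_states_def by simp
qed

text \<open>The occupied sites are among the origin and the positions of displaced particles, each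
  with rate at most \<open>1 / (1 - q)\<close>; a jump displaces at most one further
  particle.\<close>

lemma taz_jump_system:
  "jump_system taz_rate qtazrp_move qtazrp_step taz_states (\<lambda>x. card {m. x m \<noteq> 0}) (1 / (1 - q))"
proof
  show "countable taz_states"
    by (rule countable_subset[OF _ countable_finite_perturbations[of "\<lambda>_. 0"]]) (auto simp: taz_states_def)
  show "qtazrp_step \<in> taz_states" by (simp add: taz_states_def qtazrp_step_def)
  show "0 < 1 / (1 - q)" using q_less_1 by simp
  fix x assume x: "x \<in> taz_states"
  then have fin: "finite {m. x m \<noteq> 0}" by (simp add: taz_states_def)
  show "finite {e. 0 < taz_rate x e}"
    by (rule finite_subset[OF taz_enabled_subset[OF x]]) (use fin in simp)
  have "1 \<in> labels_at x (x 1)" by (simp add: labels_at_def)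
  then show "{e. 0 < taz_rate x e} \<noteq> {}" by (auto simp: taz_rate_pos_iff)
  have "card {e. 0 < taz_rate x e} \<le> card (insert 0 (x ` {m. x m \<noteq> 0}))"
    by (rule card_mono[OF _ taz_enabled_subset[OF x]]) (use fin in simp)
  also have "\<dots> \<le> Suc (card {m. x m \<noteq> 0})"
    using card_insert_le_m1 card_image_le[OF fin, of x] fin by (simp add: card_insert_if)
  finally have cd: "card {e. 0 < taz_rate x e} \<le> Suc (card {m. x m \<noteq> 0})" .
  have "(\<Sum>e | 0 < taz_rate x e. taz_rate x e) \<le> of_nat (card {e. 0 < taz_rate x e}) * (1 / (1 - q))"
    by (rule sum_bounded_above) (rule taz_rate_le)
  also have "\<dots> \<le> real (Suc (card {m. x m \<noteq> 0})) * (1 / (1 - q))"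
    using cd q_less_1 by (intro mult_right_mono) auto
  finally show "(\<Sum>e | 0 < taz_rate x e. taz_rate x e) \<le> 1 / (1 - q) * real (card {m. x m \<noteq> 0} + 1)"
    by (simp add: mult.commute)
  fix y assume "0 < taz_rate x y"
  then have y: "labels_at x y \<noteq> {}" by (simp add: taz_rate_pos_iff)
  show "qtazrp_move y x \<in> taz_states" by (rule taz_move_closed[OF x y])
  from taz_move_label[OF x y] obtain l where "qtazrp_move y x = x(l := y + 1)" by metis
  then have "{m. qtazrp_move y x m \<noteq> 0} \<subseteq> insert l {m. x m \<noteq> 0}" by auto
  then have "card {m. qtazrp_move y x m \<noteq> 0} \<le> card (insert l {m. x m \<noteq> 0})"
    using fin by (intro card_mono) auto
  also have "\<dots> \<le> Suc (card {m. x m \<noteq> 0})" using fin by (simp add: card_insert_if)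
  finally show "card {m. qtazrp_move y x m \<noteq> 0} \<le> Suc (card {m. x m \<noteq> 0})" .
qed

lemma taz_count_finite:
  assumes "x \<in> taz_states" "1 \<le> y"
  shows "finite {m. 1 \<le> m \<and> y \<le> x m}"
  by (rule finite_subset[of _ "{m. x m \<noteq> 0}"]) (use assms in \<open>auto simp: taz_states_def\<close>)

lemma taz_Q_move:
  assumes x: "x \<in> taz_states" and z: "labels_at x z \<noteq> {}"
  shows "taz_Q (qtazrp_move z x) y = (if y = z + 1 then q else 1) * taz_Q x y"
proof (cases "y \<le> 0")
  case False
  from taz_move_label[OF x z] obtain l where l: "1 \<le> l" "x l = z" "qtazrp_move z x = x(l := z + 1)" by metis
  note fin = taz_count_finite[OF x, of y]
  show ?thesis
  proof (cases "y = z + 1")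
    case True
    have "{m. 1 \<le> m \<and> y \<le> (x(l := z + 1)) m} = insert l {m. 1 \<le> m \<and> y \<le> x m}"
      using l True by auto
    moreover have "l \<notin> {m. 1 \<le> m \<and> y \<le> x m}" using l True by auto
    ultimately show ?thesis using False True fin by (simp add: taz_Q_def taz_count_def l)
  next
    case ne: False
    have "{m. 1 \<le> m \<and> y \<le> (x(l := z + 1)) m} = {m. 1 \<le> m \<and> y \<le> x m}"
      using l ne by auto
    then show ?thesis using False ne by (simp add: taz_Q_def taz_count_def l)
  qed
qed (simp add: taz_Q_def)

text \<open>The number of particles at \<open>v - 1\<close> is the difference of two counts, so
  multiplication by the rate acts on \<open>taz_Q x\<close> as a discrete derivative. At
  \<open>v = 1\<close> that number is infinite, in agreement with
  \<open>taz_Q x 0 = 0\<close>.\<close>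

lemma taz_rate_Q:
  assumes x: "x \<in> taz_states" and v: "1 \<le> v"
  shows "taz_rate x (v - 1) * taz_Q x v = (taz_Q x v - taz_Q x (v - 1)) / (1 - q)"
proof (cases "v = 1")
  case True
  have "infinite {m. x m = 0}"
  proof
    assume "finite {m. x m = 0}"
    moreover have "finite {m. x m \<noteq> 0}" using x by (simp add: taz_states_def)
    ultimately have "finite ({m. x m = 0} \<union> {m. x m \<noteq> 0})" by simp
    moreover have "{m. x m = 0} \<union> {m. x m \<noteq> 0} = (UNIV :: nat set)" by auto
    ultimately show False by simp
  qed
  moreover have "{m. x m = 0} \<subseteq> insert 0 (labels_at x 0)" by (auto simp: labels_at_def Suc_le_eq)
  ultimately have "infinite (labels_at x 0)" by (metis finite_insert finite_subset)
  then have "taz_rate x 0 = 1 / (1 - q)" by (auto simp: taz_rate_eq)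
  then show ?thesis using True by (simp add: taz_Q_def)
next
  case False
  then have v1: "1 \<le> v - 1" using v by simp
  let ?A = "labels_at x (v - 1)" and ?B = "{m. 1 \<le> m \<and> v \<le> x m}"
  have un: "{m. 1 \<le> m \<and> v - 1 \<le> x m} = ?A \<union> ?B" and dis: "?A \<inter> ?B = {}"
    by (auto simp: labels_at_def)
  have finA: "finite ?A" using taz_count_finite[OF x v1] unfolding un by simp
  have finB: "finite ?B" using taz_count_finite[OF x v] .
  have "taz_count x (v - 1) = card ?A + taz_count x v"
    unfolding taz_count_def un by (rule card_Un_disjoint[OF finA finB dis])
  then have Q: "taz_Q x (v - 1) = q ^ card ?A * taz_Q x v"
    using v v1 by (simp add: taz_Q_def power_add)
  have "taz_rate x (v - 1) = (1 - q ^ card ?A) / (1 - q)"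
    using finA by (simp add: taz_rate_eq)
  then show ?thesis by (simp add: Q left_diff_distrib)
qed

lemma geometric_sum_le: "(1 - q ^ m) / (1 - q) \<le> real m"
proof -
  have "(1 - q ^ m) / (1 - q) = (\<Sum>i<m. q ^ i)"
    using q_less_1 by (simp add: one_diff_power_eq)
  also have "\<dots> \<le> of_nat (card {..<m}) * 1"
    using q_pos q_less_1 by (intro sum_bounded_above) (simp add: power_le_one)
  finally show ?thesis by simp
qed

text \<open>Translates between the two descriptions of a block: by its site, as in the action of the
  q-TAZRP on the dual function, and by its mobile particle, as in the dual generator.\<close>

lemma cluster_end_bij:
  assumes n: "n \<in> weak_chamber k"
  shows "bij_betw n {j. j < k \<and> cluster_end k n j} (n ` {..<k})"
proof (rule bij_betwI')
  fix i j assume ij: "i \<in> {j. j < k \<and> cluster_end k n j}" "j \<in> {j. j < k \<and> cluster_end k n j}"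
  have *: "n j < n i" if "i < j" "j < k" "cluster_end k n i" for i j
  proof -
    have "n j \<le> n (Suc i)" "n (Suc i) \<le> n i" using n that by (auto simp: weak_chamber_def)
    moreover have "n (Suc i) \<noteq> n i" using that by (auto simp: cluster_end_def)
    ultimately show ?thesis by simp
  qed
  show "n i = n j \<longleftrightarrow> i = j"
    using *[of i j] *[of j i] ij by (cases i j rule: linorder_cases) auto
next
  fix v assume "v \<in> n ` {..<k}"
  then obtain i where i: "i < k" "n i = v" by auto
  let ?A = "{j. j < k \<and> n j = v}"
  have A: "finite ?A" "?A \<noteq> {}" using i by auto
  let ?j = "Max ?A"
  have j: "?j \<in> ?A" by (rule Max_in[OF A])
  have "n (Suc ?j) \<noteq> n ?j" if "Suc ?j < k"
  proof
    assume "n (Suc ?j) = n ?j"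
    then have "Suc ?j \<in> ?A" using j that by simp
    then have "Suc ?j \<le> ?j" by (rule Max_ge[OF A(1)])
    then show False by simp
  qed
  then show "\<exists>j\<in>{j. j < k \<and> cluster_end k n j}. v = n j"
    using j by (intro bexI[of _ ?j]) (auto simp: cluster_end_def)
qed auto

lemma sum_cluster_size:
  assumes "n \<in> weak_chamber k"
  shows "(\<Sum>j | j < k \<and> cluster_end k n j. cluster_size k n (n j)) = k"
proof -
  have "(\<Sum>j | j < k \<and> cluster_end k n j. cluster_size k n (n j)) = (\<Sum>v\<in>n ` {..<k}. cluster_size k n v)"
    by (rule sum.reindex_bij_betw[OF cluster_end_bij[OF assms]])
  also have "\<dots> = (\<Sum>v\<in>n ` {..<k}. \<Sum>j | j \<in> {..<k} \<and> n j = v. 1)"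
    by (simp add: cluster_size_def)
  also have "\<dots> = (\<Sum>j<k. 1)" by (rule sum.image_gen[symmetric]) simp
  finally show ?thesis by simp
qed

text \<open>A block moves at rate at most its size, and the sizes add up to \<open>k\<close>; this
  is the uniform bound on the rates which uniformisation needs.\<close>

lemma taz_dual_generator:
  assumes k: "1 \<le> k"
  shows "markov_generator {..<k} (taz_dual_rate k) down (weak_chamber k) (real k)"
proof
  fix n assume n: "n \<in> weak_chamber k"
  have le: "taz_dual_rate k n j \<le> (if cluster_end k n j then cluster_size k n (n j) else 0)" for j
    using geometric_sum_le by (simp add: taz_dual_rate_def)
  have "(\<Sum>j<k. taz_dual_rate k n j) \<le> (\<Sum>j<k. real (if cluster_end k n j then cluster_size k n (n j) else 0))"
    using le by (intro sum_mono) auto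
  also have "\<dots> = real (\<Sum>j | j \<in> {..<k} \<and> cluster_end k n j. cluster_size k n (n j))"
    by (subst sum.inter_filter) auto
  also have "\<dots> = real k" using sum_cluster_size[OF n] by simp
  finally show "(\<Sum>j<k. taz_dual_rate k n j) \<le> real k" .
  fix j assume j: "j \<in> {..<k}"
  show "0 \<le> taz_dual_rate k n j"
    using q_pos q_less_1 by (simp add: taz_dual_rate_def power_le_one)
  assume "0 < taz_dual_rate k n j"
  then have e: "cluster_end k n j" by (simp add: taz_dual_rate_def split: if_splits)
  have "n i \<le> n j - 1" if "j < i" "i < k" for i
  proof -
    have "n i \<le> n (Suc j)" "n (Suc j) \<le> n j" using n that by (auto simp: weak_chamber_def)
    moreover have "n (Suc j) \<noteq> n j" using that e by (auto simp: cluster_end_def)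
    ultimately show ?thesis by simp
  qed
  then have after: "n i \<le> n j - 1" if "j < i" "i < k" for i using that by simp
  have mono: "n i' \<le> n i" if "i \<le> i'" "i' < k" for i i' using n that by (simp add: weak_chamber_def)
  have "down j n i' \<le> down j n i" if "i \<le> i'" "i' < k" for i i'
    using mono[OF that] after[of i'] that by (auto simp: down_def)
  then show "down j n \<in> weak_chamber k" by (simp add: weak_chamber_def)
qed (use k in auto)

text \<open>A jump from z to z + 1 changes only the factors at level z + 1 and multiplies the dual
  function by \<open>q\<close> to the size of the block there. By \<open>taz_rate_Q\<close> this
  becomes, block by block, the effect of lowering one dual particle.\<close>

theorem taz_duality:
  assumes x: "x \<in> taz_states" and n: "n \<in> weak_chamber k" and k: "1 \<le> k"
  shows "(\<Sum>z | 0 < taz_rate x z. taz_rate x z * (taz_dual k (qtazrp_move z x) n - taz_dual k x n))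
    = markov_generator.gen {..<k} (taz_dual_rate k) down (taz_dual k x) n"
proof -
  interpret G: markov_generator "{..<k}" "taz_dual_rate k" down "weak_chamber k" "real k"
    by (rule taz_dual_generator[OF k])
  let ?D = "taz_dual k x n"
  define g where "g v = taz_rate x (v - 1) * ((q ^ cluster_size k n v - 1) * ?D)" for v
  have fin: "finite {z. 0 < taz_rate x z}"
    by (rule finite_subset[OF taz_enabled_subset[OF x]]) (use x in \<open>auto simp: taz_states_def\<close>)
  have mv: "taz_dual k (qtazrp_move z x) n = q ^ cluster_size k n (z + 1) * ?D" if "0 < taz_rate x z" for z
  proof -
    have "taz_dual k (qtazrp_move z x) n = (\<Prod>j<k. (if n j = z + 1 then q else 1) * taz_Q x (n j))"
      using that by (simp add: taz_dual_def taz_Q_move[OF x] taz_rate_pos_iff)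
    also have "\<dots> = (\<Prod>j<k. if n j = z + 1 then q else 1) * ?D" by (simp add: prod.distrib taz_dual_def)
    also have "(\<Prod>j<k. if n j = z + 1 then q else 1) = (\<Prod>j | j \<in> {..<k} \<and> n j = z + 1. q)"
      by (rule prod.inter_filter[symmetric]) simp
    finally show ?thesis by (simp add: cluster_size_def)
  qed
  have "(\<Sum>z | 0 < taz_rate x z. taz_rate x z * (taz_dual k (qtazrp_move z x) n - ?D))
     = (\<Sum>z | 0 < taz_rate x z. g (z + 1))"
    by (intro sum.cong refl) (simp add: mv g_def algebra_simps)
  \<comment> \<open>Occupied sites with no dual block one step to their right, and blocks with an
    empty site one step to their left, contribute zero; passing through the union exchanges the two
    index sets.\<close>
  also have "\<dots> = (\<Sum>z\<in>{z. 0 < taz_rate x z} \<union> (\<lambda>v. v - 1) ` (n ` {..<k}). g (z + 1))"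
  proof (rule sum.mono_neutral_left)
    have "taz_rate x z = 0" if "\<not> 0 < taz_rate x z" for z
      using that unfolding taz_rate_pos_iff by (simp add: taz_rate_eq)
    then show "\<forall>i\<in>({z. 0 < taz_rate x z} \<union> (\<lambda>v. v - 1) ` n ` {..<k}) - {z. 0 < taz_rate x z}. g (i + 1) = 0"
      by (auto simp: g_def)
  qed (use fin in auto)
  also have "\<dots> = (\<Sum>z\<in>(\<lambda>v. v - 1) ` (n ` {..<k}). g (z + 1))"
  proof (rule sum.mono_neutral_right)
    have "cluster_size k n (z + 1) = 0" if "z \<notin> (\<lambda>v. v - 1) ` n ` {..<k}" for z
      using that by (force simp: cluster_size_def image_iff)
    then show "\<forall>i\<in>({z. 0 < taz_rate x z} \<union> (\<lambda>v. v - 1) ` n ` {..<k}) - (\<lambda>v. v - 1) ` n ` {..<k}. g (i + 1) = 0"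
      by (auto simp: g_def)
  qed (use fin in auto)
  also have "\<dots> = (\<Sum>v\<in>n ` {..<k}. g v)"
    by (subst sum.reindex) (auto simp: inj_on_def)
  also have "\<dots> = (\<Sum>j | j < k \<and> cluster_end k n j. g (n j))"
    by (rule sum.reindex_bij_betw[OF cluster_end_bij[OF n], symmetric])
  also have "\<dots> = (\<Sum>j<k. if cluster_end k n j then g (n j) else 0)"
    by (subst sum.inter_filter[symmetric]) auto
  also have "\<dots> = (\<Sum>j<k. taz_dual_rate k n j *\<^sub>R (taz_dual k x (down j n) - ?D))"
  proof (intro sum.cong refl)
    fix j assume j: "j \<in> {..<k}"
    define P where "P = (\<Prod>i\<in>{..<k} - {j}. taz_Q x (n i))"
    have D: "?D = taz_Q x (n j) * P"
      unfolding taz_dual_def P_def using j by (intro prod.remove) auto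
    have D': "taz_dual k x (down j n) = taz_Q x (n j - 1) * P"
    proof -
      have "taz_dual k x (down j n) = taz_Q x (down j n j) * (\<Prod>i\<in>{..<k} - {j}. taz_Q x (down j n i))"
        unfolding taz_dual_def using j by (intro prod.remove) auto
      also have "(\<Prod>i\<in>{..<k} - {j}. taz_Q x (down j n i)) = P"
        unfolding P_def by (intro prod.cong) (auto simp: down_def)
      finally show ?thesis by (simp only: down_def fun_upd_same)
    qed
    show "(if cluster_end k n j then g (n j) else 0) = taz_dual_rate k n j *\<^sub>R (taz_dual k x (down j n) - ?D)"
    proof (cases "1 \<le> n j")
      case True
      have "taz_rate x (n j - 1) * ?D = (taz_Q x (n j) - taz_Q x (n j - 1)) / (1 - q) * P"
        unfolding D mult.assoc[symmetric] taz_rate_Q[OF x True] ..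
      then have "taz_rate x (n j - 1) * ((c - 1) * ?D)
        = (c - 1) * ((taz_Q x (n j) - taz_Q x (n j - 1)) / (1 - q) * P)" for c
        by (subst mult.left_commute) simp
      moreover have "(c - 1) * ((a - b) / (1 - q) * P) = (1 - c) / (1 - q) * (b * P - a * P)" for a b c
        by (simp add: algebra_simps diff_divide_distrib add_divide_distrib)
      ultimately show ?thesis unfolding g_def taz_dual_rate_def D' by (simp add: D)
    next
      case False
      then have "taz_Q x (n j) = 0" "taz_Q x (n j - 1) = 0" by (simp_all add: taz_Q_def)
      then show ?thesis by (simp add: g_def D D')
    qed
  qed
  finally show ?thesis by (simp add: G.gen_def)
qed

end

section \<open>Duality for the ASEP\<close>

context q_parameter begin

definition al :: real where "al = 1 / (1 + q)"
definition be :: real where "be = q / (1 + q)"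

lemma al_be: "0 < al" "0 < be" "al + be = 1" "be = q * al"
  using q_pos by (simp_all add: al_def be_def add_divide_distrib[symmetric])

text \<open>This balance makes a bond with both ends occupied contribute nothing to the free dual
  generator, as exclusion demands, and it cancels the suppressed jumps of adjacent dual
  particles.\<close>

lemma al_be_balance: "al * (q - 1) + be * (1 / q - 1) = 0"
proof -
  have "be * (1 / q) = al" using q_pos al_be(4) by simp
  then show ?thesis using al_be(4) by (simp add: algebra_simps)
qed

abbreviation as_rate :: "(nat \<Rightarrow> int) \<Rightarrow> nat \<times> direction \<Rightarrow> real" where
  "as_rate \<equiv> asep_rate be al"

definition as_states :: "(nat \<Rightarrow> int) set" where
  "as_states = {x. x 0 = 0 \<and> (\<forall>i j. 1 \<le> i \<longrightarrow> i < j \<longrightarrow> x i < x j) \<and> finite {m. x m \<noteq> int m}}"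

definition as_count :: "(nat \<Rightarrow> int) \<Rightarrow> int \<Rightarrow> nat" where
  "as_count x u = card {m. 1 \<le> m \<and> x m \<le> u}"

text \<open>The level is reflected: particles up to \<open>- y\<close> are counted. Thus
  \<open>as_Q x\<close> is increasing for states \<open>x\<close>, and the dual particles drift
  downwards, just as for the q-TAZRP.\<close>

definition as_Q :: "(nat \<Rightarrow> int) \<Rightarrow> int \<Rightarrow> real" where
  "as_Q x y = q ^ as_count x (- y)"

definition as_dual :: "nat \<Rightarrow> (nat \<Rightarrow> int) \<Rightarrow> (nat \<Rightarrow> int) \<Rightarrow> real" where
  "as_dual k x y = (\<Prod>j<k. as_Q x (y j))"

definition strict_chamber :: "nat \<Rightarrow> (nat \<Rightarrow> int) set" where
  "strict_chamber k = {y. \<forall>i j. i < j \<longrightarrow> j < k \<longrightarrow> y j < y i}"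

definition as_dual_rate :: "nat \<Rightarrow> (nat \<Rightarrow> int) \<Rightarrow> nat \<times> bool \<Rightarrow> real" where
  "as_dual_rate k y = (\<lambda>(j, b). if b then (if 0 < j \<and> y (j - 1) = y j + 1 then 0 else be)
     else (if Suc j < k \<and> y (Suc j) = y j - 1 then 0 else al))"

definition hop :: "nat \<times> bool \<Rightarrow> (nat \<Rightarrow> int) \<Rightarrow> nat \<Rightarrow> int" where
  "hop = (\<lambda>(j, b) y. y(j := if b then y j + 1 else y j - 1))"

lemma as_statesD:
  assumes "x \<in> as_states"
  shows "1 \<le> i \<Longrightarrow> i < j \<Longrightarrow> x i < x j" "finite {m. x m \<noteq> int m}" "x 0 = 0"
  using assms by (simp_all add: as_states_def)

lemma as_states_inj: "x \<in> as_states \<Longrightarrow> 1 \<le> i \<Longrightarrow> 1 \<le> j \<Longrightarrow> x i = x j \<Longrightarrow> i = j"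
  using as_statesD(1)[of x i j] as_statesD(1)[of x j i] by (cases i j rule: linorder_cases) auto

lemma UNIV_direction: "(UNIV :: direction set) = {Leftward, Rightward}"
  using direction.exhaust by blast

lemma as_rate_pos_iff: "0 < as_rate x (m, d) \<longleftrightarrow> 1 \<le> m \<and> x m + offset d \<notin> x ` {1..}"
  using al_be by (cases d) (auto simp: asep_rate_def)

lemma as_rate_eq: "0 < as_rate x (m, d) \<Longrightarrow> as_rate x (m, d) = (case d of Leftward \<Rightarrow> al | Rightward \<Rightarrow> be)"
  by (auto simp: asep_rate_def split: if_splits)

text \<open>A particle that sits, together with its two neighbours, where the initial state puts it
  is blocked on both sides; particle 1, which has no left neighbour, is the exception. Hence the
  enabled moves are controlled by the displaced particles.\<close>

lemma as_enabled_subset: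
  assumes x: "x \<in> as_states"
  defines "B \<equiv> {m. x m \<noteq> int m}"
  shows "{e. 0 < as_rate x e} \<subseteq> (insert 1 (B \<union> Suc ` B \<union> (\<lambda>m. m - 1) ` B)) \<times> {Leftward, Rightward}"
proof
  fix e' assume e': "e' \<in> {e. 0 < as_rate x e}"
  obtain m d where md: "e' = (m, d)" by (cases e')
  have e: "0 < as_rate x (m, d)" using e' md by simp
  have "m \<in> insert 1 (B \<union> Suc ` B \<union> (\<lambda>m. m - 1) ` B)"
  proof (rule ccontr)
    assume "m \<notin> insert 1 (B \<union> Suc ` B \<union> (\<lambda>m. m - 1) ` B)"
    then have m1: "m \<noteq> 1" and mB: "m \<notin> B" and m2: "m \<notin> Suc ` B" and m3: "m \<notin> (\<lambda>m. m - 1) ` B"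
      by auto
    from mB have xm: "x m = int m" by (simp add: B_def)
    have m: "2 \<le> m" using e m1 by (auto simp: as_rate_pos_iff)
    have "m - 1 \<notin> B" using m2 m by (force simp: image_iff)
    then have a: "x (m - 1) = x m - 1" using xm m by (simp add: B_def of_nat_diff)
    have "m + 1 \<notin> B" using m3 by (force simp: image_iff)
    then have b: "x (m + 1) = x m + 1" using xm by (simp add: B_def)
    have "x m + offset d \<in> x ` {1..}"
    proof (cases d)
      case Leftward
      then have "x m + offset d = x (m - 1)" using a by simp
      then show ?thesis using m by (auto intro!: imageI)
    next
      case Rightward
      then have "x m + offset d = x (m + 1)" using b by simp
      then show ?thesis by (auto intro!: imageI)
    qed
    then show False using e by (simp add: as_rate_pos_iff)
  qed
  then show "e' \<in> insert 1 (B \<union> Suc ` B \<union> (\<lambda>m. m - 1) ` B) \<times> {Leftward, Rightward}"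
    unfolding md using UNIV_direction by blast
qed

lemma as_move_closed:
  assumes x: "x \<in> as_states" and e: "0 < as_rate x (m, d)"
  shows "asep_move (m, d) x \<in> as_states"
proof -
  have m: "1 \<le> m" and free: "x m + offset d \<notin> x ` {1..}" using e by (auto simp: as_rate_pos_iff)
  have ne: "x i \<noteq> x m + offset d" if "1 \<le> i" for i using free that by force
  have "{i. (x(m := x m + offset d)) i \<noteq> int i} \<subseteq> insert m {i. x i \<noteq> int i}" by auto
  then have "finite {i. (x(m := x m + offset d)) i \<noteq> int i}"
    by (rule finite_subset) (use as_statesD(2)[OF x] in simp)
  moreover have "(x(m := x m + offset d)) i < (x(m := x m + offset d)) j" if "1 \<le> i" "i < j" for i j
    using as_statesD(1)[OF x that] ne[of i] ne[of j] that by (cases d) (auto split: if_splits)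
  ultimately show ?thesis
    using as_statesD(3)[OF x] m unfolding as_states_def asep_move_def by simp
qed

text \<open>The constant 6 counts two directions for each displaced particle and for its two
  neighbours, at rate at most 1; the moves of particle 1 are covered by the summand 1 in
  \<open>card ?B + 1\<close>.\<close>

lemma as_jump_system:
  "jump_system as_rate asep_move asep_step as_states (\<lambda>x. card {m. x m \<noteq> int m}) 6"
proof
  show "countable as_states"
    by (rule countable_subset[OF _ countable_finite_perturbations[of int]]) (auto simp: as_states_def)
  show "asep_step \<in> as_states" by (simp add: as_states_def asep_step_def)
  fix x assume x: "x \<in> as_states"
  let ?B = "{m. x m \<noteq> int m}"
  have fin: "finite ?B" by (rule as_statesD(2)[OF x])
  let ?E = "(insert 1 (?B \<union> Suc ` ?B \<union> (\<lambda>m. m - 1) ` ?B)) \<times> {Leftward, Rightward}"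
  have finE: "finite ?E" using fin by simp
  show finen: "finite {e. 0 < as_rate x e}"
    by (rule finite_subset[OF as_enabled_subset[OF x] finE])
  have "x 1 \<le> x i" if "1 \<le> i" for i
    using as_statesD(1)[OF x, of 1 i] that by (cases "i = 1") auto
  then have "x 1 - 1 \<notin> x ` {1..}" by force
  then have "0 < as_rate x (1, Leftward)" by (simp add: as_rate_pos_iff)
  then show "{e. 0 < as_rate x e} \<noteq> {}" by blast
  have cE: "card ?E \<le> 2 * (1 + 3 * card ?B)"
  proof -
    have "card (?B \<union> Suc ` ?B \<union> (\<lambda>m. m - 1) ` ?B) \<le> card ?B + card ?B + card ?B"
      by (intro order_trans[OF card_Un_le] add_mono card_image_le fin order_refl)
    then have "card (insert 1 (?B \<union> Suc ` ?B \<union> (\<lambda>m. m - 1) ` ?B)) \<le> 1 + 3 * card ?B"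
      using card_insert_le_m1[of "1 + 3 * card ?B"] fin by (simp add: card_insert_if)
    moreover have "card (A \<times> {Leftward, Rightward}) = card A * 2" for A :: "nat set"
      by (simp add: card_cartesian_product)
    ultimately show ?thesis by (simp only: mult.commute[of 2] mult_le_mono1)
  qed
  have "as_rate x e \<le> 1" for e
    using al_be by (cases e) (auto simp: asep_rate_def split: direction.split)
  then have "(\<Sum>e | 0 < as_rate x e. as_rate x e) \<le> of_nat (card {e. 0 < as_rate x e}) * 1"
    by (rule sum_bounded_above)
  also have "card {e. 0 < as_rate x e} \<le> 2 * (1 + 3 * card ?B)"
    using card_mono[OF finE as_enabled_subset[OF x]] cE by simp
  finally show "(\<Sum>e | 0 < as_rate x e. as_rate x e) \<le> 6 * real (card ?B + 1)"
    by simp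
  fix e :: "nat \<times> direction" assume e: "0 < as_rate x e"
  obtain m d where md: "e = (m, d)" by (cases e)
  show "asep_move e x \<in> as_states" using as_move_closed[OF x] e by (simp add: md)
  have "{i. asep_move e x i \<noteq> int i} \<subseteq> insert m ?B" by (auto simp: asep_move_def md)
  then have "card {i. asep_move e x i \<noteq> int i} \<le> card (insert m ?B)"
    using fin by (intro card_mono) auto
  also have "\<dots> \<le> Suc (card ?B)" using fin by (simp add: card_insert_if)
  finally show "card {i. asep_move e x i \<noteq> int i} \<le> Suc (card ?B)" .
qed simp

lemma as_count_finite:
  assumes "x \<in> as_states"
  shows "finite {m. 1 \<le> m \<and> x m \<le> u}"
  by (rule finite_subset[of _ "{m. x m \<noteq> int m} \<union> {..nat u}"]) (use as_statesD(2)[OF assms] in auto)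

lemma as_count_Suc:
  assumes x: "x \<in> as_states"
  shows "as_count x (u + 1) = as_count x u + (if u + 1 \<in> x ` {1..} then 1 else 0)"
proof (cases "u + 1 \<in> x ` {1..}")
  case True
  then obtain m where m: "1 \<le> m" "x m = u + 1" by auto
  have "{i. 1 \<le> i \<and> x i \<le> u + 1} = insert m {i. 1 \<le> i \<and> x i \<le> u}"
  proof (intro equalityI subsetI)
    fix i assume i: "i \<in> {i. 1 \<le> i \<and> x i \<le> u + 1}"
    show "i \<in> insert m {i. 1 \<le> i \<and> x i \<le> u}"
      using i as_states_inj[OF x, of i m] m by (cases "x i = u + 1") auto
  qed (use m in auto)
  moreover have "m \<notin> {i. 1 \<le> i \<and> x i \<le> u}" using m by simp
  ultimately show ?thesis using True as_count_finite[OF x] by (simp add: as_count_def)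
next
  case False
  then have "{i. 1 \<le> i \<and> x i \<le> u + 1} = {i. 1 \<le> i \<and> x i \<le> u}" by force
  then show ?thesis using False by (simp add: as_count_def)
qed

lemma as_count_move:
  assumes x: "x \<in> as_states" and e: "0 < as_rate x (m, d)"
  shows "q ^ as_count (asep_move (m, d) x) u =
    (case d of Leftward \<Rightarrow> if x m = u + 1 then q else 1 | Rightward \<Rightarrow> if x m = u then 1 / q else 1) * q ^ as_count x u"
proof -
  have m: "1 \<le> m" using e by (auto simp: as_rate_pos_iff)
  note fin = as_count_finite[OF x]
  show ?thesis
  proof (cases d)
    case Leftward
    show ?thesis
    proof (cases "x m = u + 1")
      case True
      have "{i. 1 \<le> i \<and> (x(m := x m - 1)) i \<le> u} = insert m {i. 1 \<le> i \<and> x i \<le> u}"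
        using m True by auto
      moreover have "m \<notin> {i. 1 \<le> i \<and> x i \<le> u}" using True by simp
      ultimately show ?thesis using True Leftward fin by (simp add: as_count_def asep_move_def)
    next
      case False
      have "{i. 1 \<le> i \<and> (x(m := x m - 1)) i \<le> u} = {i. 1 \<le> i \<and> x i \<le> u}"
        using m False by auto
      then show ?thesis using False Leftward by (simp add: as_count_def asep_move_def)
    qed
  next
    case Rightward
    show ?thesis
    proof (cases "x m = u")
      case True
      have "{i. 1 \<le> i \<and> x i \<le> u} = insert m {i. 1 \<le> i \<and> (x(m := x m + 1)) i \<le> u}"
        using m True by auto
      moreover have "m \<notin> {i. 1 \<le> i \<and> (x(m := x m + 1)) i \<le> u}" using True by simp
      moreover have "finite {i. 1 \<le> i \<and> (x(m := x m + 1)) i \<le> u}"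
        by (rule finite_subset[OF _ fin[of u]]) auto
      ultimately have "as_count x u = Suc (as_count (asep_move (m, d) x) u)"
        using Rightward by (simp add: as_count_def asep_move_def)
      then show ?thesis using True Rightward q_pos by simp
    next
      case False
      have "{i. 1 \<le> i \<and> (x(m := x m + 1)) i \<le> u} = {i. 1 \<le> i \<and> x i \<le> u}"
        using m False by auto
      then show ?thesis using False Rightward by (simp add: as_count_def asep_move_def)
    qed
  qed
qed

lemma as_dual_generator:
  assumes k: "1 \<le> k"
  shows "markov_generator ({..<k} \<times> UNIV) (as_dual_rate k) hop (strict_chamber k) (real k)"
proof
  fix y assume y: "y \<in> strict_chamber k"
  have "(\<Sum>m\<in>{..<k} \<times> UNIV. as_dual_rate k y m) = (\<Sum>j<k. \<Sum>b\<in>UNIV. as_dual_rate k y (j, b))"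
    by (simp add: sum.cartesian_product)
  also have "\<dots> \<le> (\<Sum>j<k. 1)"
    by (rule sum_mono) (use al_be in \<open>auto simp: UNIV_bool as_dual_rate_def\<close>)
  finally show "(\<Sum>m\<in>{..<k} \<times> UNIV. as_dual_rate k y m) \<le> real k" by simp
  fix m :: "nat \<times> bool" assume m: "m \<in> {..<k} \<times> UNIV"
  obtain j b where jb: "m = (j, b)" by (cases m)
  show "0 \<le> as_dual_rate k y m" using al_be by (auto simp: as_dual_rate_def jb)
  assume pos: "0 < as_dual_rate k y m"
  have mono: "y i' < y i" if "i < i'" "i' < k" for i i' using y that by (simp add: strict_chamber_def)
  have j: "j < k" using m jb by simp
  have up: "y j + 1 < y i" if "b" "i < j" for i
  proof -
    have "y j < y (j - 1)" "y (j - 1) \<noteq> y j + 1" using mono[of "j - 1" j] pos that j by (auto simp: as_dual_rate_def jb split: if_splits)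
    moreover have "y (j - 1) \<le> y i" 
    proof -
      consider "i = j - 1" | "i < j - 1" using \<open>i < j\<close> by linarith
      then show ?thesis using mono[of i "j - 1"] less_imp_diff_less[OF j, of 1] by cases auto
    qed
    ultimately show ?thesis by simp
  qed
  have dn: "y i < y j - 1" if "\<not> b" "j < i" "i < k" for i
  proof -
    have "y (Suc j) < y j" "y (Suc j) \<noteq> y j - 1" using mono[of j "Suc j"] pos that by (auto simp: as_dual_rate_def jb split: if_splits)
    moreover have "y i \<le> y (Suc j)" using mono[of "Suc j" i] that by (cases "i = Suc j") auto
    ultimately show ?thesis by simp
  qed
  have "hop m y i' < hop m y i" if "i < i'" "i' < k" for i i'
    using mono[OF that] up[of i] dn[of i'] that by (cases b) (auto simp: hop_def jb)
  then show "hop m y \<in> strict_chamber k" by (simp add: strict_chamber_def)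
qed (use k in auto)

text \<open>The generator is that of free particles minus the jumps suppressed by exclusion, grouped
  by adjacent pairs. Only the second sum sees the boundary of the chamber; the duality and the
  scaling limit both treat it on its own.\<close>

lemma as_dual_gen:
  fixes f :: "(nat \<Rightarrow> int) \<Rightarrow> 'b::real_vector"
  assumes "y \<in> strict_chamber k"
  shows "markov_generator.gen ({..<k} \<times> UNIV) (as_dual_rate k) hop f y
    = (\<Sum>j<k. al *\<^sub>R (f (hop (j, False) y) - f y) + be *\<^sub>R (f (hop (j, True) y) - f y))
    - (\<Sum>i | Suc i < k \<and> y (Suc i) = y i - 1.
        al *\<^sub>R (f (hop (i, False) y) - f y) + be *\<^sub>R (f (hop (Suc i, True) y) - f y))"
proof (cases "k = 0")
  case True
  have "finite ({..<0::nat} \<times> (UNIV :: bool set))" by simp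
  have "markov_generator ({..<k} \<times> UNIV) (as_dual_rate k) hop (strict_chamber k) 1"
    by (unfold_locales) (auto simp: True)
  then interpret G: markov_generator "{..<k} \<times> UNIV" "as_dual_rate k" hop "strict_chamber k" 1 .
  show ?thesis unfolding G.gen_def by (simp add: True)
next
  case False
  interpret G: markov_generator "{..<k} \<times> UNIV" "as_dual_rate k" hop "strict_chamber k" "real k"
    by (rule as_dual_generator) (use False in simp)
  let ?d = "\<lambda>j. al *\<^sub>R (f (hop (j, False) y) - f y)" and ?u = "\<lambda>j. be *\<^sub>R (f (hop (j, True) y) - f y)"
  let ?B = "{i. Suc i < k \<and> y (Suc i) = y i - 1}"
  have "G.gen f y = (\<Sum>j<k. \<Sum>b\<in>UNIV. as_dual_rate k y (j, b) *\<^sub>R (f (hop (j, b) y) - f y))"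
    unfolding G.gen_def by (simp add: sum.cartesian_product)
  also have "\<dots> = (\<Sum>j<k. (?d j + ?u j) - ((if j \<in> ?B then ?d j else 0)
      + (if j \<in> Suc ` ?B then ?u j else 0)))"
  proof (intro sum.cong refl)
    fix j assume "j \<in> {..<k}"
    then have "(0 < j \<and> y (j - 1) = y j + 1) \<longleftrightarrow> j \<in> Suc ` ?B"
      by (cases j) auto
    then show "(\<Sum>b\<in>UNIV. as_dual_rate k y (j, b) *\<^sub>R (f (hop (j, b) y) - f y))
      = (?d j + ?u j) - ((if j \<in> ?B then ?d j else 0) + (if j \<in> Suc ` ?B then ?u j else 0))"
      by (simp add: UNIV_bool as_dual_rate_def)
  qed
  also have "\<dots> = (\<Sum>j<k. ?d j + ?u j) - ((\<Sum>j<k. if j \<in> ?B then ?d j else 0)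
      + (\<Sum>j<k. if j \<in> Suc ` ?B then ?u j else 0))"
    by (simp add: sum_subtractf sum.distrib)
  also have "(\<Sum>j<k. if j \<in> ?B then ?d j else 0) = (\<Sum>j\<in>?B. ?d j)"
    by (subst sum.inter_restrict[symmetric]) (auto intro!: sum.cong)
  also have "(\<Sum>j<k. if j \<in> Suc ` ?B then ?u j else 0) = (\<Sum>j\<in>Suc ` ?B. ?u j)"
    by (subst sum.inter_restrict[symmetric]) (auto intro!: sum.cong)
  also have "\<dots> = (\<Sum>i\<in>?B. ?u (Suc i))" by (subst sum.reindex) auto
  finally show ?thesis by (simp add: sum.distrib)
qed

lemma strict_chamber_inj:
  "y \<in> strict_chamber k \<Longrightarrow> i < k \<Longrightarrow> j < k \<Longrightarrow> y i = y j \<Longrightarrow> i = j"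
  unfolding strict_chamber_def by (cases i j rule: linorder_cases) fastforce+

text \<open>Only jumps over the bond between u and u + 1 change the count at u. The levels in a
  strict chamber are distinct, so a jump changes at most one factor of the product and the free dual
  generator can be matched level by level; the suppressed pairs cancel by
  \<open>al_be_balance\<close>.\<close>

theorem as_duality:
  assumes x: "x \<in> as_states" and y: "y \<in> strict_chamber k"
  shows "(\<Sum>e | 0 < as_rate x e. as_rate x e * (as_dual k (asep_move e x) y - as_dual k x y))
    = markov_generator.gen ({..<k} \<times> UNIV) (as_dual_rate k) hop (as_dual k x) y"
proof -
  let ?D = "as_dual k x y" and ?E = "{e. 0 < as_rate x e}"
  let ?occ = "\<lambda>u. u \<in> x ` {1..}"
  have finE: "finite ?E"
    by (rule finite_subset[OF as_enabled_subset[OF x]]) (use as_statesD(2)[OF x] in simp)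
  define h where "h u e = (case e of (m, d) \<Rightarrow> case d of Leftward \<Rightarrow> if x m = u + 1 then q - 1 else 0
      | Rightward \<Rightarrow> if x m = u then 1 / q - 1 else 0)" for u and e :: "nat \<times> direction"
  have mv: "as_dual k (asep_move e x) y - ?D = (\<Sum>j<k. h (- y j) e * ?D)" if e: "e \<in> ?E" for e
  proof -
    obtain m d where md: "e = (m, d)" by (cases e)
    let ?c = "\<lambda>j. 1 + h (- y j) e"
    have "as_dual k (asep_move e x) y = (\<Prod>j<k. ?c j * as_Q x (y j))"
      unfolding as_dual_def as_Q_def
      by (intro prod.cong refl) (use as_count_move[OF x, of m d] e in \<open>simp add: md h_def split: direction.split\<close>)
    also have "\<dots> = (\<Prod>j<k. ?c j) * ?D" by (simp add: prod.distrib as_dual_def)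
    also have "(\<Prod>j<k. ?c j) = 1 + (\<Sum>j<k. h (- y j) e)"
    proof (cases "\<exists>j<k. h (- y j) e \<noteq> 0")
      case True
      then obtain i where i: "i < k" "h (- y i) e \<noteq> 0" by auto
      have z: "h (- y j) e = 0" if "j < k" "j \<noteq> i" for j
        using strict_chamber_inj[OF y that(1) i(1)] that i(2)
        by (auto simp: h_def md split: direction.splits if_splits)
      have "(\<Prod>j<k. ?c j) = ?c i * (\<Prod>j\<in>{..<k} - {i}. ?c j)" using i by (intro prod.remove) auto
      also have "(\<Prod>j\<in>{..<k} - {i}. ?c j) = 1" using z by (intro prod.neutral) auto
      finally have p: "(\<Prod>j<k. ?c j) = ?c i" by simp
      have "(\<Sum>j<k. h (- y j) e) = h (- y i) e + (\<Sum>j\<in>{..<k} - {i}. h (- y j) e)"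
        using i by (intro sum.remove) auto
      also have "(\<Sum>j\<in>{..<k} - {i}. h (- y j) e) = 0" using z by (intro sum.neutral) auto
      finally show ?thesis using p by simp
    qed simp
    finally show ?thesis by (simp add: algebra_simps sum_distrib_left)
  qed
  \<comment> \<open>If exactly one end of the bond between \<open>u\<close> and \<open>u + 1\<close>
    is occupied, one move crosses it. Otherwise no move does, and the right-hand side vanishes as
    well, by the balance when both ends are occupied.\<close>
  have loc: "(\<Sum>e\<in>?E. as_rate x e * h u e)
    = al * (q ^ (if ?occ (u + 1) then 1 else 0) - 1) + be * ((1 / q) ^ (if ?occ u then 1 else 0) - 1)" for u
  proof -
    have zero: "h u e = 0" if "e \<in> ?E" "\<not> (?occ (u + 1) \<and> \<not> ?occ u \<and> snd e = Leftward \<and> x (fst e) = u + 1)"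
      "\<not> (?occ u \<and> \<not> ?occ (u + 1) \<and> snd e = Rightward \<and> x (fst e) = u)" for e
    proof -
      obtain m d where md: "e = (m, d)" by (cases e)
      have m: "1 \<le> m" and free: "x m + offset d \<notin> x ` {1..}"
        using that(1) by (auto simp: md as_rate_pos_iff)
      have occ: "?occ (x m)" using m by (intro imageI) simp
      show ?thesis
      proof (cases d)
        case Leftward
        have "x m \<noteq> u + 1"
        proof
          assume "x m = u + 1"
          then show False using that(2) occ free Leftward md by simp
        qed
        then show ?thesis by (simp add: md h_def Leftward)
      next
        case Rightward
        have "x m \<noteq> u"
        proof
          assume "x m = u"
          then show False using that(3) occ free Rightward md by simp
        qed
        then show ?thesis by (simp add: md h_def Rightward)
      qed
    qed
    consider "?occ (u + 1) = ?occ u" | "?occ (u + 1)" "\<not> ?occ u" | "\<not> ?occ (u + 1)" "?occ u" by blast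
    then show ?thesis
    proof cases
      case 1
      then have "(\<Sum>e\<in>?E. as_rate x e * h u e) = 0"
        using zero by (intro sum.neutral) auto
      then show ?thesis using 1 al_be_balance by auto
    next
      case 2
      then obtain m where m: "1 \<le> m" "x m = u + 1" by auto
      have en: "(m, Leftward) \<in> ?E" using m 2 by (simp add: as_rate_pos_iff)
      have "(\<Sum>e\<in>?E. as_rate x e * h u e) = (\<Sum>e\<in>{(m, Leftward)}. as_rate x e * h u e)"
      proof (rule sum.mono_neutral_right[OF finE])
        show "\<forall>e\<in>?E - {(m, Leftward)}. as_rate x e * h u e = 0"
        proof
          fix e assume e: "e \<in> ?E - {(m, Leftward)}"
          obtain m' d where md: "e = (m', d)" by (cases e)
          have "1 \<le> m'" using e by (simp add: md as_rate_pos_iff)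
          then have "h u e = 0" using zero[of e] e 2 as_states_inj[OF x \<open>1 \<le> m'\<close> m(1)] m(2)
            by (auto simp: md)
          then show "as_rate x e * h u e = 0" by simp
        qed
      qed (use en in auto)
      also have "\<dots> = al * (q - 1)" using en as_rate_eq[of x m Leftward] m by (simp add: h_def)
      finally show ?thesis using 2 by simp
    next
      case 3
      then obtain m where m: "1 \<le> m" "x m = u" by auto
      have en: "(m, Rightward) \<in> ?E" using m 3 by (simp add: as_rate_pos_iff)
      have "(\<Sum>e\<in>?E. as_rate x e * h u e) = (\<Sum>e\<in>{(m, Rightward)}. as_rate x e * h u e)"
      proof (rule sum.mono_neutral_right[OF finE])
        show "\<forall>e\<in>?E - {(m, Rightward)}. as_rate x e * h u e = 0"
        proof
          fix e assume e: "e \<in> ?E - {(m, Rightward)}"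
          obtain m' d where md: "e = (m', d)" by (cases e)
          have "1 \<le> m'" using e by (simp add: md as_rate_pos_iff)
          then have "h u e = 0" using zero[of e] e 3 as_states_inj[OF x \<open>1 \<le> m'\<close> m(1)] m(2)
            by (auto simp: md)
          then show "as_rate x e * h u e = 0" by simp
        qed
      qed (use en in auto)
      also have "\<dots> = be * (1 / q - 1)" using en as_rate_eq[of x m Rightward] m by (simp add: h_def)
      finally show ?thesis using 3 by simp
    qed
  qed
  have dn: "as_dual k x (hop (j, False) y) = q ^ (if ?occ (- y j + 1) then 1 else 0) * ?D" if j: "j < k" for j
  proof -
    have "as_dual k x (hop (j, False) y) = as_Q x (y j - 1) * (\<Prod>i\<in>{..<k} - {j}. as_Q x (hop (j, False) y i))"
      unfolding as_dual_def using j by (subst prod.remove[of _ j]) (auto simp: hop_def)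
    also have "(\<Prod>i\<in>{..<k} - {j}. as_Q x (hop (j, False) y i)) = (\<Prod>i\<in>{..<k} - {j}. as_Q x (y i))"
      by (intro prod.cong) (auto simp: hop_def)
    also have "as_Q x (y j - 1) = q ^ (if ?occ (- y j + 1) then 1 else 0) * as_Q x (y j)"
      using as_count_Suc[OF x, of "- y j"] by (simp add: as_Q_def)
    finally show ?thesis unfolding as_dual_def using j by (subst (2) prod.remove[of _ j]) (auto simp: mult.assoc)
  qed
  have up: "as_dual k x (hop (j, True) y) = (1 / q) ^ (if ?occ (- y j) then 1 else 0) * ?D" if j: "j < k" for j
  proof -
    have "as_dual k x (hop (j, True) y) = as_Q x (y j + 1) * (\<Prod>i\<in>{..<k} - {j}. as_Q x (hop (j, True) y i))"
      unfolding as_dual_def using j by (subst prod.remove[of _ j]) (auto simp: hop_def)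
    also have "(\<Prod>i\<in>{..<k} - {j}. as_Q x (hop (j, True) y i)) = (\<Prod>i\<in>{..<k} - {j}. as_Q x (y i))"
      by (intro prod.cong) (auto simp: hop_def)
    also have "as_Q x (y j + 1) = (1 / q) ^ (if ?occ (- y j) then 1 else 0) * as_Q x (y j)"
      using as_count_Suc[OF x, of "- y j - 1"] q_pos by (simp add: as_Q_def)
    finally show ?thesis unfolding as_dual_def using j by (subst (2) prod.remove[of _ j]) (auto simp: mult.assoc)
  qed
  have "(\<Sum>e\<in>?E. as_rate x e * (as_dual k (asep_move e x) y - ?D))
    = (\<Sum>e\<in>?E. \<Sum>j<k. as_rate x e * h (- y j) e * ?D)"
    by (intro sum.cong refl) (simp add: mv sum_distrib_left mult.assoc)
  also have "\<dots> = (\<Sum>j<k. \<Sum>e\<in>?E. as_rate x e * h (- y j) e * ?D)" by (rule sum.swap)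
  also have "\<dots> = (\<Sum>j<k. (al * (q ^ (if ?occ (- y j + 1) then 1 else 0) - 1)
      + be * ((1 / q) ^ (if ?occ (- y j) then 1 else 0) - 1)) * ?D)"
    by (simp only: sum_distrib_right[symmetric] loc)
  also have "\<dots> = (\<Sum>j<k. al *\<^sub>R (as_dual k x (hop (j, False) y) - ?D) + be *\<^sub>R (as_dual k x (hop (j, True) y) - ?D))"
    by (intro sum.cong refl) (simp add: dn up algebra_simps)
  also have "\<dots> = markov_generator.gen ({..<k} \<times> UNIV) (as_dual_rate k) hop (as_dual k x) y"
  proof -
    have "al *\<^sub>R (as_dual k x (hop (i, False) y) - ?D) + be *\<^sub>R (as_dual k x (hop (Suc i, True) y) - ?D) = 0"
      if "Suc i < k" "y (Suc i) = y i - 1" for i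
    proof -
      \<comment> \<open>The two suppressed jumps of an adjacent pair both depend on the occupation
        of this one site, so the balance applies to their sum.\<close>
      have "- y (Suc i) = - y i + 1" using that by simp
      then have "al *\<^sub>R (as_dual k x (hop (i, False) y) - ?D) + be *\<^sub>R (as_dual k x (hop (Suc i, True) y) - ?D)
        = (if ?occ (- y i + 1) then al * (q - 1) + be * (1 / q - 1) else 0) * ?D"
        using that(1) by (simp add: dn up algebra_simps)
      then show ?thesis by (simp only: al_be_balance if_cancel mult_zero_left)
    qed
    then have "(\<Sum>i | Suc i < k \<and> y (Suc i) = y i - 1.
        al *\<^sub>R (as_dual k x (hop (i, False) y) - ?D) + be *\<^sub>R (as_dual k x (hop (Suc i, True) y) - ?D)) = 0"
      by (intro sum.neutral) auto
    then show ?thesis unfolding as_dual_gen[OF y] by simp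
  qed
  finally show ?thesis .
qed

end

section \<open>Integrals over vertical lines\<close>

lemma integrable_inverse_square: "integrable lborel (\<lambda>y::real. 1 / (1 + y\<^sup>2))"
  using integrable_inverse_1_plus_square
  by (simp add: set_integrable_def einterval_eq_UNIV field_simps)

lemma integrable_decay:
  fixes f :: "real \<Rightarrow> complex"
  assumes "f \<in> borel_measurable lborel" "\<And>y. norm (f y) \<le> C / (1 + y\<^sup>2)"
  shows "integrable lborel f"
proof (rule Bochner_Integration.integrable_bound)
  show "integrable lborel (\<lambda>y. C * (1 / (1 + y\<^sup>2)))" by (intro integrable_mult_right integrable_inverse_square)
  have "0 \<le> C" using assms(2)[of 0] norm_ge_zero[of "f 0"] by (simp del: norm_ge_zero)
  then show "AE y in lborel. norm (f y) \<le> norm (C * (1 / (1 + y\<^sup>2)))"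
    using assms(2) by (simp add: abs_mult)
qed (rule assms(1))

lemma integral_symmetric_limit:
  fixes f :: "real \<Rightarrow> complex"
  assumes "integrable lborel f"
  shows "(\<lambda>n. LINT y|lborel. indicator {- real n..real n} y *\<^sub>R f y) \<longlonglongrightarrow> (LINT y|lborel. f y)"
proof (rule integral_dominated_convergence[where w="\<lambda>y. norm (f y)"])
  have "(\<lambda>n. indicator {- real n..real n} y *\<^sub>R f y) \<longlonglongrightarrow> f y" for y
  proof (rule tendsto_eventually)
    obtain N :: nat where N: "\<bar>y\<bar> \<le> real N" using real_arch_simple by blast
    show "\<forall>\<^sub>F n in sequentially. indicator {- real n..real n} y *\<^sub>R f y = f y"
      using eventually_ge_at_top[of N]
    proof eventually_elim
      case (elim n)
      then have "\<bar>y\<bar> \<le> real n" using N by simp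
      then show ?case by (simp add: indicator_def abs_le_iff minus_le_iff)
    qed
  qed
  then show "AE y in lborel. (\<lambda>n. indicator {- real n..real n} y *\<^sub>R f y) \<longlonglongrightarrow> f y" by simp
  show "(\<lambda>y. indicator {- real n..real n} y *\<^sub>R f y) \<in> borel_measurable lborel" for n
    using assms by measurable
qed (use assms in \<open>auto simp: indicator_def\<close>)

text \<open>The difference of the two vertical integrals is the limit of the integrals over the boundary
  of tall rectangles; the horizontal sides vanish in the limit.\<close>

lemma vertical_line_residue:
  fixes g :: "complex \<Rightarrow> complex"
  assumes hol: "g holomorphic_on {z. a < Re z \<and> Re z < b}" and ab: "a < c'" "c' < p" "p < c" "c < b"
    and bd: "\<And>z. c' \<le> Re z \<Longrightarrow> Re z \<le> c \<Longrightarrow> 1 \<le> \<bar>Im z\<bar> \<or> Re z = c \<or> Re z = c' \<Longrightarrow>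
      norm (g z / (z - of_real p)) \<le> C / (1 + (Im z)\<^sup>2)"
  shows "(LINT y|lborel. g (Complex c y) / (Complex c y - of_real p))
    - (LINT y|lborel. g (Complex c' y) / (Complex c' y - of_real p)) = 2 * pi * g (of_real p)"
proof -
  let ?S = "{z. a < Re z \<and> Re z < b}"
  define f where "f z = g z / (z - of_real p)" for z
  have openS: "open ?S"
    using open_Int[OF open_halfspace_Re_gt[of a] open_halfspace_Re_lt[of b]] by (simp add: Collect_conj_eq)
  have convS: "convex ?S"
    using convex_Int[OF convex_halfspace_Re_gt[of a] convex_halfspace_Re_lt[of b]] by (simp add: Collect_conj_eq)
  have contf: "continuous_on (?S - {of_real p}) f"
    unfolding f_def using holomorphic_on_imp_continuous_on[OF hol]
    by (intro continuous_intros) (auto intro: continuous_on_subset)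
  have vert: "continuous_on A (\<lambda>y. f (Complex x y))" if "x = c \<or> x = c'" for x A
  proof -
    have "continuous_on A (\<lambda>y. Complex x y)"
      by (intro continuous_intros)
    then show ?thesis
      by (rule continuous_on_compose2[OF contf]) (use that ab in \<open>auto simp: complex_eq_iff\<close>)
  qed
  have bound: "norm (f z) \<le> C / (1 + (Im z)\<^sup>2)"
    if "c' \<le> Re z" "Re z \<le> c" "1 \<le> \<bar>Im z\<bar> \<or> Re z = c \<or> Re z = c'" for z
    using bd[OF that] by (auto simp: f_def)
  have int: "integrable lborel (\<lambda>y. f (Complex x y))" if x: "x = c \<or> x = c'" for x
  proof (rule integrable_decay)
    show "(\<lambda>y. f (Complex x y)) \<in> borel_measurable lborel"
      using borel_measurable_continuous_onI[OF vert[OF x]] by simp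
    show "norm (f (Complex x y)) \<le> C / (1 + y\<^sup>2)" for y
      using bound[of "Complex x y"] x ab by (auto simp: complex_eq_iff)
  qed
  have C0: "0 \<le> C"
    using bound[of "of_real c"] norm_ge_zero[of "f (of_real c)"] ab by (simp add: order_trans del: norm_ge_zero)
  define D where "D R = (LINT y|lborel. indicator {- R..R} y *\<^sub>R f (Complex c y))
    - (LINT y|lborel. indicator {- R..R} y *\<^sub>R f (Complex c' y))" for R :: real
  have approx: "norm (D R - 2 * pi * g (of_real p)) \<le> 2 * (C / (1 + R\<^sup>2) * (c - c'))" if R1: "1 \<le> R" for R
  proof -
    have R: "0 < R" using R1 by simp
    define a1 a2 a3 a4 where "a1 = Complex c' (- R)" and "a2 = Complex c (- R)"
      and "a3 = Complex c R" and "a4 = Complex c' R"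
    have rp: "rectpath a1 a3 = linepath a1 a2 +++ linepath a2 a3 +++ linepath a3 a4 +++ linepath a4 a1"
      by (simp add: rectpath_def a1_def a2_def a3_def a4_def Let_def)
    have img: "path_image (rectpath a1 a3) = cbox a1 a3 - box a1 a3"
      using R ab by (intro path_image_rectpath_cbox_minus_box) (auto simp: a1_def a3_def)
    have inbox: "of_real p \<in> box a1 a3" using R ab by (auto simp: in_box_complex_iff a1_def a3_def)
    have sub: "path_image (rectpath a1 a3) \<subseteq> ?S - {of_real p}"
      unfolding img using inbox ab by (auto simp: in_cbox_complex_iff a1_def a3_def)
    have "((\<lambda>w. g w / (w - of_real p)) has_contour_integral
        complex_of_real (2 * pi) * \<i> * winding_number (rectpath a1 a3) (of_real p) * g (of_real p)) (rectpath a1 a3)"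
      by (rule Cauchy_integral_formula_convex_simple[OF convS hol _ _ sub])
        (use openS ab in \<open>auto simp: interior_open\<close>)
    then have tot: "contour_integral (rectpath a1 a3) f = 2 * pi * \<i> * g (of_real p)"
      unfolding winding_number_rectpath[OF inbox] f_def[abs_def] by (simp add: contour_integral_unique)
    have segs: "closed_segment a1 a2 \<subseteq> ?S - {of_real p}" "closed_segment a2 a3 \<subseteq> ?S - {of_real p}"
      "closed_segment a3 a4 \<subseteq> ?S - {of_real p}" "closed_segment a4 a1 \<subseteq> ?S - {of_real p}"
      using sub unfolding rp by (simp_all add: path_image_join)
    have ci: "f contour_integrable_on linepath a1 a2" "f contour_integrable_on linepath a2 a3"
      "f contour_integrable_on linepath a3 a4" "f contour_integrable_on linepath a4 a1"
      using segs by (intro contour_integrable_continuous_linepath continuous_on_subset[OF contf]; simp)+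
    have split: "contour_integral (rectpath a1 a3) f = contour_integral (linepath a1 a2) f
      + (contour_integral (linepath a2 a3) f + (contour_integral (linepath a3 a4) f + contour_integral (linepath a4 a1) f))"
      unfolding rp using ci by (simp add: contour_integral_join)
    have vint: "((\<lambda>y. f (Complex x y)) has_integral (LINT y|lborel. indicator {- R..R} y *\<^sub>R f (Complex x y))) {- R..R}"
      if "x = c \<or> x = c'" for x
    proof -
      have "set_integrable lborel {- R..R} (\<lambda>y. f (Complex x y))"
        by (rule borel_integrable_atLeastAtMost'[OF vert[OF that]])
      from set_borel_integral_eq_integral[OF this] show ?thesis
        by (simp add: set_lebesgue_integral_def has_integral_iff)
    qed
    have s23: "contour_integral (linepath a2 a3) f = \<i> * (LINT y|lborel. indicator {- R..R} y *\<^sub>R f (Complex c y))"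
      by (rule contour_integral_unique, subst has_contour_integral_linepath_same_Re_iff[where a="- R" and b=R and c=c])
        (use R vint[of c] in \<open>auto simp: a2_def a3_def mult.assoc[symmetric]\<close>)
    have "contour_integral (linepath a1 a4) f = \<i> * (LINT y|lborel. indicator {- R..R} y *\<^sub>R f (Complex c' y))"
      by (rule contour_integral_unique, subst has_contour_integral_linepath_same_Re_iff[where a="- R" and b=R and c=c'])
        (use R vint[of c'] in \<open>auto simp: a1_def a4_def mult.assoc[symmetric]\<close>)
    then have s41: "contour_integral (linepath a4 a1) f = - \<i> * (LINT y|lborel. indicator {- R..R} y *\<^sub>R f (Complex c' y))"
      using contour_integral_reversepath[of "linepath a1 a4" f] by simp
    have hor: "norm (contour_integral (linepath u v) f) \<le> C / (1 + R\<^sup>2) * norm (v - u)"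
      if "u \<in> {a1, a2, a3, a4}" "v \<in> {a1, a2, a3, a4}" "Im u = Im v" "f contour_integrable_on linepath u v" for u v
    proof (rule contour_integral_bound_linepath[OF that(4)])
      show "0 \<le> C / (1 + R\<^sup>2)" using C0 by simp
      fix x assume x: "x \<in> closed_segment u v"
      have im: "Im x = Im u" using x that(3) by (auto simp: closed_segment_same_Im)
      have "Re x \<in> closed_segment (Re u) (Re v)" using x that(3) by (auto simp: closed_segment_same_Im)
      then have re: "c' \<le> Re x" "Re x \<le> c"
        using that(1,2) ab by (auto simp: a1_def a2_def a3_def a4_def closed_segment_eq_real_ivl split: if_splits)
      have "(Im u)\<^sup>2 = R\<^sup>2" "1 \<le> \<bar>Im u\<bar>" using that(1) R1 by (auto simp: a1_def a2_def a3_def a4_def)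
      then show "norm (f x) \<le> C / (1 + R\<^sup>2)"
        using bound[OF re] im by (auto simp: complex_eq_iff)
    qed
    have n: "norm (a2 - a1) = c - c'" "norm (a4 - a3) = c - c'"
      using ab by (simp_all add: a1_def a2_def a3_def a4_def cmod_def)
    have h1: "norm (contour_integral (linepath a1 a2) f) \<le> C / (1 + R\<^sup>2) * (c - c')"
      using hor[of a1 a2] ci(1) n by (simp add: a1_def a2_def)
    have h2: "norm (contour_integral (linepath a3 a4) f) \<le> C / (1 + R\<^sup>2) * (c - c')"
      using hor[of a3 a4] ci(3) n by (simp add: a3_def a4_def)
    have "\<i> * (D R - 2 * pi * g (of_real p))
      = - contour_integral (linepath a1 a2) f - contour_integral (linepath a3 a4) f"
      using split tot unfolding s23 s41 D_def by (simp add: algebra_simps)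
    then have "norm (\<i> * (D R - 2 * pi * g (of_real p)))
      = norm (- contour_integral (linepath a1 a2) f - contour_integral (linepath a3 a4) f)" by simp
    also have "\<dots> \<le> norm (contour_integral (linepath a1 a2) f) + norm (contour_integral (linepath a3 a4) f)"
      by (metis norm_minus_cancel norm_triangle_ineq4)
    finally show ?thesis using h1 h2 by (simp add: norm_mult)
  qed
  have "(\<lambda>n. D (real n)) \<longlonglongrightarrow> (LINT y|lborel. f (Complex c y)) - (LINT y|lborel. f (Complex c' y))"
    unfolding D_def by (intro tendsto_diff integral_symmetric_limit int) auto
  moreover have "(\<lambda>n. D (real n)) \<longlonglongrightarrow> 2 * pi * g (of_real p)"
  proof (rule LIM_zero_cancel, rule Lim_null_comparison)
    show "\<forall>\<^sub>F n in sequentially. norm (D (real n) - 2 * pi * g (of_real p)) \<le> 2 * (C / (1 + (real n)\<^sup>2) * (c - c'))"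
      using eventually_ge_at_top[of 1] by eventually_elim (rule approx, simp)
    show "(\<lambda>n. 2 * (C / (1 + (real n)\<^sup>2) * (c - c'))) \<longlonglongrightarrow> 0"
      by real_asymp
  qed
  ultimately show ?thesis unfolding f_def by (rule LIMSEQ_unique)
qed

text \<open>Reduces to \<open>vertical_line_residue\<close> by an artificial pole at the midpoint
  \<open>p\<close>: the numerator \<open>f z * (z - p)\<close> vanishes there, so the residue is
  zero.\<close>

lemma vertical_line_shift:
  fixes f :: "complex \<Rightarrow> complex"
  assumes hol: "f holomorphic_on {z. a < Re z \<and> Re z < b}" and ab: "a < c'" "c' < c" "c < b"
    and bd: "\<And>z. c' \<le> Re z \<Longrightarrow> Re z \<le> c \<Longrightarrow> norm (f z) \<le> C / (1 + (Im z)\<^sup>2)"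
  shows "(LINT y|lborel. f (Complex c y)) = (LINT y|lborel. f (Complex c' y))"
proof -
  define p where "p = (c + c') / 2"
  have p: "c' < p" "p < c" using ab by (simp_all add: p_def)
  let ?g = "\<lambda>z. f z * (z - of_real p)"
  have eq: "?g z / (z - of_real p) = f z" if "z \<noteq> of_real p" for z using that by simp
  have ne: "Complex x y \<noteq> of_real p" if "x \<noteq> p" for x y using that by (auto simp: complex_eq_iff)
  have "(LINT y|lborel. ?g (Complex c y) / (Complex c y - of_real p))
    - (LINT y|lborel. ?g (Complex c' y) / (Complex c' y - of_real p)) = 2 * pi * ?g (of_real p)"
  proof (rule vertical_line_residue[where C=C])
    show "?g holomorphic_on {z. a < Re z \<and> Re z < b}" by (intro holomorphic_intros hol)
    show "norm (?g z / (z - of_real p)) \<le> C / (1 + (Im z)\<^sup>2)"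
      if "c' \<le> Re z" "Re z \<le> c" "1 \<le> \<bar>Im z\<bar> \<or> Re z = c \<or> Re z = c'" for z
    proof -
      have "z \<noteq> of_real p" using that(3) p by auto
      then show ?thesis using bd[OF that(1,2)] eq[of z] by simp
    qed
  qed (use ab p in auto)
  then show ?thesis using p by (simp add: eq ne)
qed

section \<open>Integrals over products of vertical lines\<close>

interpretation lborel_product: product_sigma_finite "\<lambda>_::nat. lborel :: real measure" ..

abbreviation lpow :: "nat set \<Rightarrow> (nat \<Rightarrow> real) measure" where
  "lpow I \<equiv> PiM I (\<lambda>_. lborel)"

definition pt :: "(nat \<Rightarrow> real) \<Rightarrow> (nat \<Rightarrow> real) \<Rightarrow> nat \<Rightarrow> complex" where
  "pt c y j = Complex (c j) (y j)"

lemma pt_sel [simp]: "Re (pt c y j) = c j" "Im (pt c y j) = y j"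
  by (simp_all add: pt_def)

lemma pt_upd: "pt (c(i := u)) (y(i := v)) = (pt c y)(i := Complex u v)"
  by (auto simp: pt_def)

lemma pt_upd_same: "pt c (y(i := v)) = (pt c y)(i := Complex (c i) v)"
  by (auto simp: pt_def)

definition decay :: "nat set \<Rightarrow> (nat \<Rightarrow> real) \<Rightarrow> real" where
  "decay I y = (\<Prod>j\<in>I. 1 / (1 + (y j)\<^sup>2))"

lemma decay_nonneg: "0 \<le> decay I y"
  unfolding decay_def by (intro prod_nonneg) simp

lemma decay_insert: "finite I \<Longrightarrow> i \<notin> I \<Longrightarrow> decay (insert i I) y = 1 / (1 + (y i)\<^sup>2) * decay I y"
  by (simp add: decay_def)

definition line_const :: real where "line_const = (LINT y|lborel. 1 / (1 + y\<^sup>2))"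

lemma line_const_nonneg: "0 \<le> line_const"
  unfolding line_const_def by (intro integral_nonneg_AE) simp

lemma integrable_decay_power: "finite I \<Longrightarrow> integrable (lpow I) (decay I)"
  and integral_decay_power: "finite I \<Longrightarrow> integral\<^sup>L (lpow I) (decay I) = line_const ^ card I"
  unfolding decay_def[abs_def] line_const_def
  using lborel_product.product_integrable_prod[of I "\<lambda>_ y. 1 / (1 + y\<^sup>2)"]
    lborel_product.product_integral_prod[of I "\<lambda>_ y. 1 / (1 + y\<^sup>2)"] integrable_inverse_square
  by auto

lemma
  fixes F :: "(nat \<Rightarrow> real) \<Rightarrow> complex"
  assumes I: "finite I" and F: "F \<in> borel_measurable (lpow I)"
    and bd: "\<And>y. norm (F y) \<le> C * decay I y"
  shows integrable_decay_bound: "integrable (lpow I) F"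
    and integral_decay_bound: "norm (integral\<^sup>L (lpow I) F) \<le> C * line_const ^ card I"
proof -
  show int: "integrable (lpow I) F"
  proof (rule Bochner_Integration.integrable_bound)
    show "integrable (lpow I) (\<lambda>y. C * decay I y)"
      by (intro integrable_mult_right integrable_decay_power I)
    have "norm (F y) \<le> norm (C * decay I y)" for y
      by (rule order_trans[OF bd]) (simp only: real_norm_def abs_ge_self)
    then show "AE y in lpow I. norm (F y) \<le> norm (C * decay I y)" by simp
  qed (rule F)
  have "norm (integral\<^sup>L (lpow I) F) \<le> (LINT y|lpow I. norm (F y))"
    by (rule integral_norm_bound)
  also have "\<dots> \<le> (LINT y|lpow I. C * decay I y)"
    by (intro integral_mono integrable_norm int integrable_mult_right integrable_decay_power I bd)
  also have "\<dots> = C * line_const ^ card I" by (simp add: integral_decay_power I)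
  finally show "norm (integral\<^sup>L (lpow I) F) \<le> C * line_const ^ card I" .
qed

definition lint :: "nat set \<Rightarrow> (nat \<Rightarrow> real) \<Rightarrow> ((nat \<Rightarrow> complex) \<Rightarrow> complex) \<Rightarrow> complex" where
  "lint I c F = (LINT y|lpow I. F (pt c y))"

lemma lint_insert:
  assumes "finite I" "i \<notin> I" "integrable (lpow (insert i I)) (\<lambda>y. F (pt c y))"
  shows "lint (insert i I) c F = (LINT y|lpow I. LINT u|lborel. F ((pt c y)(i := Complex (c i) u)))"
  unfolding lint_def lborel_product.product_integral_insert[OF assms] by (simp add: pt_upd_same)

text \<open>Fubini's theorem isolates coordinate \<open>i\<close>, whose line is then moved for each
  fixed choice of the other heights. The product form of the bound makes the whole integrand
  integrable both before and after the move.\<close>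

lemma lint_shift_less:
  assumes I: "finite I" "i \<in> I" and ab: "a < c'" "c' < c i" "c i < b"
    and meas: "\<And>c. (\<lambda>y. F (pt c y)) \<in> borel_measurable (lpow I)"
    and hol: "\<And>y. (\<lambda>z. F ((pt c y)(i := z))) holomorphic_on {z. a < Re z \<and> Re z < b}"
    and bd: "\<And>y z. c' \<le> Re z \<Longrightarrow> Re z \<le> c i \<Longrightarrow>
      norm (F ((pt c y)(i := z))) \<le> C * decay (I - {i}) y / (1 + (Im z)\<^sup>2)"
  shows "lint I c F = lint I (c(i := c')) F"
proof -
  define J where "J = I - {i}"
  have J: "finite J" "i \<notin> J" "I = insert i J" using I by (auto simp: J_def)
  have dec: "decay I y = 1 / (1 + (y i)\<^sup>2) * decay J y" for y
    unfolding J(3) by (rule decay_insert[OF J(1,2)])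
  have int: "integrable (lpow (insert i J)) (\<lambda>y. F (pt (c(i := u)) y))" if "c' \<le> u" "u \<le> c i" for u
    unfolding J(3)[symmetric]
  proof (rule integrable_decay_bound[OF I(1) meas])
    fix y
    have "pt (c(i := u)) y = (pt c y)(i := Complex u (y i))" by (auto simp: pt_def)
    then show "norm (F (pt (c(i := u)) y)) \<le> C * decay I y"
      using bd[of "Complex u (y i)" y] that by (simp add: dec J_def[symmetric])
  qed
  have "lint I c F = (LINT y|lpow J. LINT u|lborel. F ((pt c y)(i := Complex (c i) u)))"
    unfolding J(3) by (rule lint_insert[OF J(1,2)]) (use int[of "c i"] ab in simp)
  also have "\<dots> = (LINT y|lpow J. LINT u|lborel. F ((pt c y)(i := Complex c' u)))"
    by (rule Bochner_Integration.integral_cong[OF refl], rule vertical_line_shift[OF hol ab])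
      (rule bd[folded J_def])
  also have "\<dots> = (LINT y|lpow J. LINT u|lborel. F ((pt (c(i := c')) y)(i := Complex c' u)))"
  proof -
    have "(pt (c(i := c')) y)(i := Complex c' u) = (pt c y)(i := Complex c' u)" for y u
      by (auto simp: pt_def)
    then show ?thesis by simp
  qed
  also have "\<dots> = lint I (c(i := c')) F"
    unfolding J(3) using lint_insert[OF J(1,2) int[of c']] ab by (simp only: fun_upd_same order_refl less_imp_le)
  finally show ?thesis .
qed

text \<open>Since the pole at \<open>z i = 0\<close> lies between the two lines, the bound is asked
  only on the lines themselves and for \<open>1 \<le> \<bar>Im z\<bar>\<close>; this covers all
  sides of the tall rectangles.\<close>

lemma lint_residue:
  assumes I: "finite I" "i \<in> I" and ab: "a < c'" "c' < 0" "0 < c i" "c i < b"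
    and meas: "\<And>c. (\<lambda>y. F (pt c y)) \<in> borel_measurable (lpow I)"
    and FG: "\<And>z. z i \<noteq> 0 \<Longrightarrow> F z = G z / z i"
    and hol: "\<And>y. (\<lambda>z. G ((pt c y)(i := z))) holomorphic_on {z. a < Re z \<and> Re z < b}"
    and bd: "\<And>y z. c' \<le> Re z \<Longrightarrow> Re z \<le> c i \<Longrightarrow> 1 \<le> \<bar>Im z\<bar> \<or> Re z = c i \<or> Re z = c' \<Longrightarrow>
      norm (F ((pt c y)(i := z))) \<le> C * decay (I - {i}) y / (1 + (Im z)\<^sup>2)"
  shows "lint I c F = lint I (c(i := c')) F + 2 * pi * lint (I - {i}) c (\<lambda>z. G (z(i := 0)))"
proof -
  let ?L = "\<lambda>y x. LINT u|lborel. F ((pt c y)(i := Complex x u))"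
  define J where "J = I - {i}"
  have J: "finite J" "i \<notin> J" "I = insert i J" using I by (auto simp: J_def)
  have dec: "decay I y = 1 / (1 + (y i)\<^sup>2) * decay J y" for y
    unfolding J(3) by (rule decay_insert[OF J(1,2)])
  have int: "integrable (lpow (insert i J)) (\<lambda>y. F (pt (c(i := u)) y))" if "u = c' \<or> u = c i" for u
    unfolding J(3)[symmetric]
  proof (rule integrable_decay_bound[OF I(1) meas])
    fix y
    have "pt (c(i := u)) y = (pt c y)(i := Complex u (y i))" by (auto simp: pt_def)
    then show "norm (F (pt (c(i := u)) y)) \<le> C * decay I y"
      using bd[of "Complex u (y i)" y] that ab by (auto simp: dec J_def[symmetric])
  qed
  have eq: "(pt (c(i := c')) y)(i := Complex c' u) = (pt c y)(i := Complex c' u)" for y u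
    by (auto simp: pt_def)
  have inner: "(LINT u|lborel. F ((pt c y)(i := Complex (c i) u))) - (LINT u|lborel. F ((pt c y)(i := Complex c' u)))
    = 2 * pi * G ((pt c y)(i := 0))" for y
  proof -
    let ?g = "\<lambda>z. G ((pt c y)(i := z))"
    have Fz: "F ((pt c y)(i := z)) = ?g z / (z - of_real 0)" if "z \<noteq> 0" for z
      using FG[of "(pt c y)(i := z)"] that by simp
    have ne: "Complex (c i) u \<noteq> 0" "Complex c' u \<noteq> 0" for u using ab by (auto simp: complex_eq_iff)
    have "(LINT u|lborel. ?g (Complex (c i) u) / (Complex (c i) u - of_real 0))
      - (LINT u|lborel. ?g (Complex c' u) / (Complex c' u - of_real 0)) = 2 * pi * ?g (of_real 0)"
    proof (rule vertical_line_residue[OF hol ab(1,2,3,4)])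
      fix z assume z: "c' \<le> Re z" "Re z \<le> c i" "1 \<le> \<bar>Im z\<bar> \<or> Re z = c i \<or> Re z = c'"
      then have "z \<noteq> 0" using ab by auto
      then show "norm (?g z / (z - of_real 0)) \<le> C * decay J y / (1 + (Im z)\<^sup>2)"
        using bd[OF z, of y] Fz[of z] by (simp add: J_def)
    qed
    then show ?thesis using Fz ne by simp
  qed
  have l1: "lint I c F = (LINT y|lpow J. LINT u|lborel. F ((pt c y)(i := Complex (c i) u)))"
    unfolding J(3) by (rule lint_insert[OF J(1,2)]) (use int[of "c i"] in simp)
  have l2: "lint I (c(i := c')) F = (LINT y|lpow J. LINT u|lborel. F ((pt c y)(i := Complex c' u)))"
    unfolding J(3) using lint_insert[OF J(1,2) int[of c', OF disjI1[OF refl]]] by (simp only: eq fun_upd_same)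
  have i1: "integrable (lpow J) (\<lambda>y. LINT u|lborel. F ((pt c y)(i := Complex x u)))" if "x = c' \<or> x = c i" for x
  proof -
    have m: "(\<lambda>(y, u). F (pt (c(i := x)) (y(i := u)))) \<in> borel_measurable (lpow J \<Otimes>\<^sub>M lborel)"
      using measurable_compose[OF measurable_add_dim meas[of "c(i := x)", unfolded J(3)]]
      by (simp add: split_beta')
    have mu: "(\<lambda>u. F ((pt c y)(i := Complex x u))) \<in> borel_measurable lborel" if "y \<in> space (lpow J)" for y
      using measurable_compose[OF measurable_Pair1'[OF that] m] by (simp add: pt_upd)
    have b: "norm (F ((pt c y)(i := Complex x u))) \<le> C * decay J y / (1 + u\<^sup>2)" for y u
      using bd[of "Complex x u" y] that ab by (auto simp: J_def)
    \<comment> \<open>Measurability in \<open>u\<close> is known only for \<open>y\<close> in the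
      space of the product measure, while \<open>integrable_decay_bound\<close> asks for a bound at
      every \<open>y\<close>; the indicator bridges this.\<close>
    have "integrable (lpow J) (\<lambda>y. indicator (space (lpow J)) y *\<^sub>R (?L y x))"
    proof (rule integrable_decay_bound[OF J(1)])
      show "(\<lambda>y. indicator (space (lpow J)) y *\<^sub>R (?L y x)) \<in> borel_measurable (lpow J)"
        using lborel.borel_measurable_lebesgue_integral[OF m] by (simp add: pt_upd)
      fix y
      have nb: "norm (?L y x) \<le> C * decay J y * line_const"
        if y: "y \<in> space (lpow J)"
      proof -
        have "norm (?L y x) \<le> (LINT u|lborel. norm (F ((pt c y)(i := Complex x u))))"
          by (rule integral_norm_bound)
        also have "\<dots> \<le> (LINT u|lborel. C * decay J y * (1 / (1 + u\<^sup>2)))"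
        proof (intro integral_mono integrable_norm integrable_decay[OF mu[OF y] b] integrable_mult_right integrable_inverse_square)
          show "norm (F ((pt c y)(i := Complex x u))) \<le> C * decay J y * (1 / (1 + u\<^sup>2))" for u
            using b[of y u] by simp
        qed
        also have "\<dots> = C * decay J y * line_const" unfolding line_const_def by (rule integral_mult_right_zero)
        finally show ?thesis .
      qed
      have "0 \<le> C * decay J y"
        using order_trans[OF norm_ge_zero b[of y 0]] by simp
      then have "0 \<le> C * decay J y * line_const" using line_const_nonneg by (rule mult_nonneg_nonneg)
      then show "norm (indicator (space (lpow J)) y *\<^sub>R (?L y x))
        \<le> (C * line_const) * decay J y"
        using nb by (auto simp: indicator_def mult_ac)
    qed
    then show ?thesis by (rule Bochner_Integration.integrable_cong[THEN iffD1, OF refl, rotated]) simp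
  qed
  have "lint I c F - lint I (c(i := c')) F = (LINT y|lpow J. 2 * pi * G ((pt c y)(i := 0)))"
    unfolding l1 l2 Bochner_Integration.integral_diff[OF i1[of "c i"] i1[of c'], simplified, symmetric]
    by (simp add: inner)
  also have "\<dots> = 2 * pi * lint J c (\<lambda>z. G (z(i := 0)))" by (simp add: lint_def)
  finally show ?thesis by (simp add: J_def algebra_simps)
qed

text \<open>Lebesgue measure on the product is invariant under exchanging two coordinates; because
  the abscissas agree, exchanging the heights exchanges the points on the lines.\<close>

lemma lint_swap:
  assumes I: "finite I" "i \<in> I" "j \<in> I" and c: "c i = c j"
    and meas: "(\<lambda>y. F (pt c y)) \<in> borel_measurable (lpow I)"
  shows "lint I c (\<lambda>z. F (z \<circ> Transposition.transpose i j)) = lint I c F"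
proof -
  let ?\<tau> = "Transposition.transpose i j"
  let ?T = "\<lambda>y. restrict (y \<circ> ?\<tau>) I"
  have tI: "?\<tau> k \<in> I \<longleftrightarrow> k \<in> I" for k using I by (auto simp: Transposition.transpose_def)
  have mT: "?T \<in> measurable (lpow I) (lpow I)"
    by (rule measurable_restrict) (use tI in \<open>auto intro: measurable_component_singleton\<close>)
  have "distr (lpow I) (lpow I) ?T = lpow I"
  proof (rule lborel_product.PiM_eqI[OF I(1)])
    fix A :: "nat \<Rightarrow> real set" assume A: "\<And>k. k \<in> I \<Longrightarrow> A k \<in> sets lborel"
    have "?T -` (Pi\<^sub>E I A) \<inter> space (lpow I) = Pi\<^sub>E I (\<lambda>k. A (?\<tau> k))"
    proof (intro equalityI subsetI)
      fix y assume y: "y \<in> ?T -` (Pi\<^sub>E I A) \<inter> space (lpow I)"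
      then have "y (?\<tau> k) \<in> A k" if "k \<in> I" for k using that by (auto simp: PiE_iff)
      then have "y k \<in> A (?\<tau> k)" if "k \<in> I" for k using that tI by (metis Transposition.transpose_involutory)
      then show "y \<in> Pi\<^sub>E I (\<lambda>k. A (?\<tau> k))" using y by (auto simp: PiE_iff space_PiM)
    next
      fix y assume y: "y \<in> Pi\<^sub>E I (\<lambda>k. A (?\<tau> k))"
      then have "y (?\<tau> k) \<in> A k" if "k \<in> I" for k
        using that tI by (metis PiE_mem Transposition.transpose_involutory)
      then show "y \<in> ?T -` (Pi\<^sub>E I A) \<inter> space (lpow I)"
        using y by (auto simp: PiE_iff space_PiM)
    qed
    then have "emeasure (distr (lpow I) (lpow I) ?T) (Pi\<^sub>E I A)
      = emeasure (lpow I) (Pi\<^sub>E I (\<lambda>k. A (?\<tau> k)))"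
      using A I(1) by (subst emeasure_distr[OF mT]) (auto intro!: sets_PiM_I_finite)
    also have "\<dots> = (\<Prod>k\<in>I. emeasure lborel (A (?\<tau> k)))"
      using A tI I(1) by (intro lborel_product.emeasure_PiM) auto
    also have "\<dots> = (\<Prod>k\<in>I. emeasure lborel (A k))"
      by (rule prod.reindex_bij_witness[of _ ?\<tau> ?\<tau>]) (use tI in auto)
    finally show "emeasure (distr (lpow I) (lpow I) ?T) (Pi\<^sub>E I A) = (\<Prod>k\<in>I. emeasure lborel (A k))" .
  qed simp
  then have "lint I c F = (LINT y|distr (lpow I) (lpow I) ?T. F (pt c y))"
    by (simp add: lint_def)
  also have "\<dots> = (LINT y|lpow I. F (pt c (?T y)))"
    by (rule integral_distr[OF mT meas])
  also have "\<dots> = (LINT y|lpow I. F (pt c y \<circ> ?\<tau>))"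
  proof (rule Bochner_Integration.integral_cong[OF refl])
    fix y assume y: "y \<in> space (lpow I)"
    have "?\<tau> k = k" if "k \<notin> I" for k using that I by (auto simp: Transposition.transpose_def)
    moreover have "y k = undefined" if "k \<notin> I" for k using y that by (auto simp: space_PiM PiE_iff extensional_def)
    ultimately have "?T y = y \<circ> ?\<tau>" by (auto simp: restrict_def fun_eq_iff)
    moreover have "c (?\<tau> k) = c k" for k using c by (auto simp: Transposition.transpose_def)
    ultimately have "pt c (?T y) = pt c y \<circ> ?\<tau>" by (auto simp: pt_def fun_eq_iff)
    then show "F (pt c (?T y)) = F (pt c y \<circ> ?\<tau>)" by simp
  qed
  finally show ?thesis by (simp add: lint_def)
qed

section \<open>Nested contour integrals\<close>

definition shc :: "complex \<Rightarrow> complex" where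
  "shc z = (if z = 0 then 1 else sinh z / z)"

lemma shc_holomorphic: "shc holomorphic_on S"
proof -
  have "(\<lambda>z. if z = 0 then deriv sinh 0 else (sinh z - sinh 0) / (z - 0)) holomorphic_on (UNIV :: complex set)"
  proof (rule pole_lemma)
    have "(\<lambda>z::complex. sinh z) holomorphic_on UNIV"
      unfolding sinh_field_def by (intro holomorphic_intros) auto
    then show "sinh holomorphic_on (UNIV :: complex set)" by simp
  qed simp
  moreover have "deriv sinh 0 = (1::complex)"
    by (rule DERIV_imp_deriv) (auto intro!: derivative_eq_intros)
  then have "(\<lambda>z. if z = 0 then deriv sinh 0 else (sinh z - sinh 0) / (z - 0)) = shc"
    by (auto simp: fun_eq_iff shc_def)
  ultimately have "shc holomorphic_on UNIV" by simp
  then show ?thesis by (rule holomorphic_on_subset) simp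
qed

lemma shc_measurable [measurable]: "shc \<in> borel_measurable borel"
  by (intro borel_measurable_continuous_onI holomorphic_on_imp_continuous_on shc_holomorphic)

lemma norm_shc_le:
  assumes "z \<noteq> 0"
  shows "norm (shc z) \<le> exp \<bar>Re z\<bar> / norm z"
proof -
  have "norm (sinh z) \<le> (norm (exp z) + norm (exp (- z))) / 2"
    unfolding sinh_field_def norm_divide by (intro order_trans[OF divide_right_mono[OF norm_triangle_ineq4]]) auto
  also have "\<dots> \<le> (exp \<bar>Re z\<bar> + exp \<bar>Re z\<bar>) / 2"
    unfolding norm_exp_eq_Re by (intro divide_right_mono add_mono) auto
  finally show ?thesis using assms by (simp add: shc_def norm_divide divide_right_mono)
qed

text \<open>\<open>sinh z / z\<close> is the two-sided Laplace transform of the uniform distribution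
  on [-1, 1], and \<open>1 / z\<close> that of the indicator of a half line. So \<open>gk p\<close>
  represents the indicator smoothed by \<open>p\<close> convolutions: it decays with the power
  \<open>p + 1\<close> along vertical lines, and the smoothing is confined to [-p, p].\<close>

definition gk :: "nat \<Rightarrow> complex \<Rightarrow> complex" where
  "gk p z = shc z ^ p / z"

lemma norm_gk_le:
  assumes "1 \<le> norm z"
  shows "norm (gk p z) \<le> exp (p * \<bar>Re z\<bar>) * 2 ^ (p + 1) / (1 + norm z) ^ (p + 1)"
proof -
  have z: "z \<noteq> 0" "0 < norm z" using assms by auto
  have "norm (gk p z) = norm (shc z) ^ p / norm z" by (simp add: gk_def norm_divide norm_power)
  also have "\<dots> \<le> (exp \<bar>Re z\<bar> / norm z) ^ p / norm z"
    by (intro divide_right_mono power_mono norm_shc_le z) auto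
  also have "\<dots> = exp (p * \<bar>Re z\<bar>) / norm z ^ (p + 1)"
    by (simp add: power_divide exp_of_nat_mult[symmetric])
  also have "\<dots> \<le> exp (p * \<bar>Re z\<bar>) * 2 ^ (p + 1) / (1 + norm z) ^ (p + 1)"
  proof -
    have "(1 + norm z) ^ (p + 1) \<le> (2 * norm z) ^ (p + 1)"
      using assms by (intro power_mono) auto
    then have "exp (p * \<bar>Re z\<bar>) * (1 + norm z) ^ (p + 1) \<le> exp (p * \<bar>Re z\<bar>) * (2 ^ (p + 1) * norm z ^ (p + 1))"
      unfolding power_mult_distrib[symmetric] by (rule mult_left_mono) simp
    moreover have "0 < norm z ^ (p + 1)" "0 < (1 + norm z) ^ (p + 1)"
      using z by (intro zero_less_power; simp add: add_pos_nonneg)+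
    ultimately show ?thesis by (simp add: field_simps del: power_Suc)
  qed
  finally show ?thesis .
qed

definition pairs :: "nat set \<Rightarrow> (nat \<times> nat) set" where
  "pairs I = {(a, b). a \<in> I \<and> b \<in> I \<and> a < b}"

lemma finite_pairs: "finite I \<Longrightarrow> finite (pairs I)"
  by (rule finite_subset[of _ "I \<times> I"]) (auto simp: pairs_def)

definition gexp :: "real \<Rightarrow> (nat \<Rightarrow> real) \<Rightarrow> nat set \<Rightarrow> (nat \<Rightarrow> complex) \<Rightarrow> complex" where
  "gexp t X I z = exp (\<Sum>j\<in>I. of_real t * (z j)\<^sup>2 / 2 + of_real (X j) * z j)"

lemma norm_gexp_le:
  assumes "0 \<le> t"
  shows "norm (gexp t X I z) \<le> exp (\<Sum>j\<in>I. t * (Re (z j))\<^sup>2 / 2 + X j * Re (z j))"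
proof -
  have "Re (of_real t * (z j)\<^sup>2 / 2 + of_real (X j) * z j) \<le> t * (Re (z j))\<^sup>2 / 2 + X j * Re (z j)" for j
    using assms by (simp add: power2_eq_square right_diff_distrib)
  then show ?thesis unfolding gexp_def norm_exp_eq_Re by (simp add: Re_sum sum_mono)
qed

lemma norm_diff_le_prod: "norm (u - w) \<le> (1 + norm u) * (1 + norm w)" for u w :: complex
proof -
  have "0 \<le> norm u * norm w" by simp
  moreover have "(1 + norm u) * (1 + norm w) = 1 + norm u + norm w + norm u * norm w" by (simp add: algebra_simps)
  ultimately show ?thesis using norm_triangle_ineq4[of u w] by linarith
qed

section \<open>The nested integral and its boundary condition\<close>

context q_parameter begin

definition cross :: "(nat \<times> nat) set \<Rightarrow> (nat \<Rightarrow> complex) \<Rightarrow> complex" where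
  "cross Q z = (\<Prod>(a, b)\<in>Q. (z a - z b) / (z a - of_real q * z b))"

definition kern :: "nat \<Rightarrow> nat set \<Rightarrow> real \<Rightarrow> (nat \<Rightarrow> real) \<Rightarrow> (nat \<Rightarrow> complex) \<Rightarrow> complex" where
  "kern p I t X z = cross (pairs I) z * (\<Prod>j\<in>I. gk p (z j)) * gexp t X I z"

text \<open>The quotient is \<open>1 - (1 - q) * w / (u - q * w)\<close>, which grows in
  \<open>w\<close> only; a factor of a pair thus costs one power of the second variable.\<close>

lemma norm_cross_factor_le:
  fixes u w :: complex
  assumes "1 \<le> norm (u - of_real q * w)"
  shows "norm ((u - w) / (u - of_real q * w)) \<le> 1 + norm w"
proof -
  have nz: "u - of_real q * w \<noteq> 0" using assms by auto
  have "(u - w) / (u - of_real q * w) = 1 - of_real (1 - q) * w / (u - of_real q * w)"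
  proof -
    have "(u - w) / (u - of_real q * w) = ((u - of_real q * w) - of_real (1 - q) * w) / (u - of_real q * w)"
      by (simp add: algebra_simps)
    then show ?thesis unfolding diff_divide_distrib[of "u - of_real q * w"] using nz by simp
  qed
  then have "norm ((u - w) / (u - of_real q * w)) \<le> 1 + norm (of_real (1 - q) * w / (u - of_real q * w))"
    by (metis norm_one norm_triangle_ineq4)
  also have "norm (of_real (1 - q) * w / (u - of_real q * w)) = (1 - q) * (norm w / norm (u - of_real q * w))"
    using q_less_1
    by (simp only: norm_mult norm_divide norm_of_real abs_of_pos diff_gt_0_iff_gt times_divide_eq_right)
  also have "\<dots> \<le> 1 * (norm w / 1)"
    using q_pos q_less_1 assms by (intro mult_mono divide_left_mono) auto
  finally show ?thesis by simp
qed

text \<open>Count powers of \<open>1 + norm (z j)\<close>: the cross factors cost at most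
  \<open>card I\<close>, the polynomial factor \<open>M\<close> costs 4, integrability in the
  imaginary part 2, and \<open>gk\<close> supplies \<open>p + 1\<close>. This is the origin of
  \<open>card I + 5 \<le> p\<close>.\<close>

lemma kern_bound:
  assumes I: "finite I" and Q: "Q \<subseteq> pairs I" and p: "card I + 5 \<le> p" and t: "0 \<le> t"
    and z: "\<And>j. j \<in> I \<Longrightarrow> 1 \<le> norm (z j)"
    and zz: "\<And>a b. (a, b) \<in> Q \<Longrightarrow> 1 \<le> norm (z a - of_real q * z b)"
    and M: "norm M \<le> m * (\<Prod>j\<in>I. (1 + norm (z j)) ^ 4)"
  shows "norm (cross Q z * (\<Prod>j\<in>I. gk p (z j)) * M * gexp t X I z) \<le>
    m * 2 ^ ((p + 1) * card I) * exp (\<Sum>j\<in>I. p * \<bar>Re (z j)\<bar> + t * (Re (z j))\<^sup>2 / 2 + X j * Re (z j)) *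
    (\<Prod>j\<in>I. 1 / (1 + (Im (z j))\<^sup>2))"
proof -
  let ?S = "\<Sum>j\<in>I. t * (Re (z j))\<^sup>2 / 2 + X j * Re (z j)"
  define w where "w j = 1 + norm (z j)" for j
  have w1: "1 \<le> w j" for j by (simp add: w_def)
  have w0: "0 < w j" for j using w1[of j] by linarith
  have wne: "w j \<noteq> 0" for j using w0[of j] by simp
  have P4: "0 < (\<Prod>j\<in>I. w j ^ 4)" by (intro prod_pos zero_less_power w0)
  have m: "0 \<le> m"
    using order_trans[OF norm_ge_zero M] P4 by (simp add: w_def zero_le_mult_iff)
  have c1: "norm (cross Q z) \<le> (\<Prod>j\<in>I. w j ^ card I)"
  proof -
    have "norm (cross Q z) = (\<Prod>(a, b)\<in>Q. norm ((z a - z b) / (z a - of_real q * z b)))"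
      unfolding cross_def by (simp add: prod_norm[symmetric] split_beta')
    also have "\<dots> \<le> (\<Prod>(a, b)\<in>Q. w b)"
      by (intro prod_mono) (use zz norm_cross_factor_le in \<open>auto simp: w_def split_beta' norm_divide\<close>)
    also have "\<dots> \<le> (\<Prod>(a, b)\<in>I \<times> I. w b)"
      using I Q w1 w0 by (intro prod_mono2) (auto simp: pairs_def split_beta' less_imp_le wne)
    also have "\<dots> = (\<Prod>a\<in>I. \<Prod>b\<in>I. w b)" by (rule prod.cartesian_product[symmetric])
    also have "\<dots> = (\<Prod>j\<in>I. w j ^ card I)" using I by (simp add: prod_power_distrib wne)
    finally show ?thesis .
  qed
  have c2: "norm (\<Prod>j\<in>I. gk p (z j)) \<le> (\<Prod>j\<in>I. exp (p * \<bar>Re (z j)\<bar>) * 2 ^ (p + 1) / w j ^ (p + 1))"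
    unfolding prod_norm[symmetric] w_def by (intro prod_mono conjI norm_ge_zero norm_gk_le z)
  have "norm (cross Q z * (\<Prod>j\<in>I. gk p (z j)) * M * gexp t X I z)
    \<le> (\<Prod>j\<in>I. w j ^ card I) * (\<Prod>j\<in>I. exp (p * \<bar>Re (z j)\<bar>) * 2 ^ (p + 1) / w j ^ (p + 1))
      * (m * (\<Prod>j\<in>I. w j ^ 4)) * exp ?S"
    unfolding norm_mult
    by (intro mult_mono mult_nonneg_nonneg c1 c2 norm_gexp_le t)
      (use M w0 m in \<open>auto intro!: prod_nonneg mult_nonneg_nonneg divide_nonneg_nonneg simp: w_def less_imp_le\<close>)
  also have "\<dots> = m * exp ?S *
      (\<Prod>j\<in>I. w j ^ card I * (exp (p * \<bar>Re (z j)\<bar>) * 2 ^ (p + 1) / w j ^ (p + 1)) * w j ^ 4)"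
    by (simp only: prod.distrib mult_ac)
  also have "\<dots> \<le> m * exp ?S *
      (\<Prod>j\<in>I. exp (p * \<bar>Re (z j)\<bar>) * 2 ^ (p + 1) * (1 / (1 + (Im (z j))\<^sup>2)))"
  proof (intro mult_left_mono prod_mono conjI mult_nonneg_nonneg m)
    fix j assume "j \<in> I"
    have "w j ^ card I * w j ^ 4 * w j ^ 2 \<le> w j ^ (p + 1)"
      unfolding power_add[symmetric] using w1 p by (intro power_increasing) auto
    have "1 + (Im (z j))\<^sup>2 \<le> w j ^ 2"
    proof -
      have "(Im (z j))\<^sup>2 \<le> (norm (z j))\<^sup>2" using power_mono[OF abs_Im_le_cmod[of "z j"], of 2] by simp
      moreover have "w j ^ 2 = 1 + 2 * norm (z j) + (norm (z j))\<^sup>2" by (simp add: w_def power2_sum)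
      ultimately show ?thesis using norm_ge_zero[of "z j"] by linarith
    qed
    have le: "w j ^ card I * w j ^ 4 * (1 + (Im (z j))\<^sup>2) \<le> w j ^ (p + 1)"
    proof -
      have "0 \<le> w j ^ card I * w j ^ 4" using w0[of j] by simp
      from mult_left_mono[OF \<open>1 + (Im (z j))\<^sup>2 \<le> w j ^ 2\<close> this] show ?thesis
        using \<open>w j ^ card I * w j ^ 4 * w j ^ 2 \<le> w j ^ (p + 1)\<close> by linarith
    qed
    have pos: "0 < 1 + (Im (z j))\<^sup>2" by (simp add: add_pos_nonneg)
    have "w j ^ card I * w j ^ 4 / w j ^ (p + 1) \<le> 1 / (1 + (Im (z j))\<^sup>2)"
      using le pos w0[of j] by (simp add: divide_le_eq le_divide_eq del: power_Suc)
    then have "exp (p * \<bar>Re (z j)\<bar>) * 2 ^ (p + 1) * (w j ^ card I * w j ^ 4 / w j ^ (p + 1))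
      \<le> exp (p * \<bar>Re (z j)\<bar>) * 2 ^ (p + 1) * (1 / (1 + (Im (z j))\<^sup>2))"
      by (intro mult_left_mono) auto
    then show "w j ^ card I * (exp (p * \<bar>Re (z j)\<bar>) * 2 ^ (p + 1) / w j ^ (p + 1)) * w j ^ 4
      \<le> exp (p * \<bar>Re (z j)\<bar>) * 2 ^ (p + 1) * (1 / (1 + (Im (z j))\<^sup>2))"
      by (simp add: mult_ac del: power_Suc)
  qed (use w0 in \<open>auto simp: less_imp_le\<close>)
  also have "\<dots> = m * 2 ^ ((p + 1) * card I) * exp (\<Sum>j\<in>I. p * \<bar>Re (z j)\<bar> + t * (Re (z j))\<^sup>2 / 2 + X j * Re (z j)) *
    (\<Prod>j\<in>I. 1 / (1 + (Im (z j))\<^sup>2))"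
  proof -
    have e: "(\<Prod>j\<in>I. exp (p * \<bar>Re (z j)\<bar>)) = exp (\<Sum>j\<in>I. p * \<bar>Re (z j)\<bar>)"
      by (rule exp_sum[OF I, symmetric])
    have c: "(\<Prod>j\<in>I. 2 ^ (p + 1)) = (2 ^ ((p + 1) * card I) :: real)"
      by (simp only: prod_constant power_mult)
    have s: "(\<Sum>j\<in>I. p * \<bar>Re (z j)\<bar> + t * (Re (z j))\<^sup>2 / 2 + X j * Re (z j))
      = (\<Sum>j\<in>I. p * \<bar>Re (z j)\<bar>) + ?S"
      by (simp only: sum.distrib add.assoc)
    show ?thesis unfolding prod.distrib e c s exp_add by (simp only: mult_ac)
  qed
  finally show ?thesis .
qed

lemma pt_measurable [measurable (raw)]:
  "j \<in> I \<Longrightarrow> (\<lambda>y. pt c y j) \<in> borel_measurable (lpow I)"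
proof -
  assume j: "j \<in> I"
  have "(\<lambda>u. Complex (c j) u) \<in> borel_measurable borel"
    by (intro borel_measurable_continuous_onI continuous_intros)
  then have "(\<lambda>u. Complex (c j) u) \<in> borel_measurable lborel" by simp
  from measurable_compose[OF measurable_component_singleton[OF j] this]
  show ?thesis by (simp add: pt_def)
qed

lemma cross_measurable:
  "Q \<subseteq> pairs I \<Longrightarrow> (\<lambda>y. cross Q (pt c y)) \<in> borel_measurable (lpow I)"
  unfolding cross_def split_beta'
  by (intro borel_measurable_prod borel_measurable_divide borel_measurable_diff borel_measurable_times
      borel_measurable_const pt_measurable) (auto simp: pairs_def)

lemma gk_prod_measurable:
  "J \<subseteq> I \<Longrightarrow> (\<lambda>y. \<Prod>j\<in>J. gk p (pt c y j)) \<in> borel_measurable (lpow I)"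
  unfolding gk_def
  by (intro borel_measurable_prod borel_measurable_divide borel_measurable_power pt_measurable
      measurable_compose[OF pt_measurable shc_measurable]) auto

lemma gexp_measurable:
  "(\<lambda>y. gexp t X I (pt c y)) \<in> borel_measurable (lpow I)"
proof -
  have "(\<lambda>y. \<Sum>j\<in>I. of_real t * (pt c y j)\<^sup>2 / 2 + of_real (X j) * pt c y j) \<in> borel_measurable (lpow I)"
    by (intro borel_measurable_sum borel_measurable_add borel_measurable_divide borel_measurable_times
        borel_measurable_power borel_measurable_const pt_measurable) auto
  then show ?thesis unfolding gexp_def by measurable
qed

text \<open>\<open>q\<close> times a later abscissa is at least twice an earlier one. Hence
  \<open>z a\<close> stays to the left of \<open>q * z b\<close> for a < b, at distance at least 1
  from the pole of the pair.\<close>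

definition nest :: "nat \<Rightarrow> real" where "nest j = (2 / q) ^ j"

lemma nest_ge_1: "1 \<le> nest j"
  unfolding nest_def using q_pos q_less_1 by (intro one_le_power) (simp add: le_divide_eq)

lemma nest_less:
  assumes "a < b"
  shows "2 * nest a \<le> q * nest b"
proof -
  have "1 \<le> 2 / q" using q_pos q_less_1 by (simp add: le_divide_eq)
  then have "(2 / q) ^ Suc a \<le> (2 / q) ^ b" using assms by (intro power_increasing) auto
  then have "q * (2 / q) ^ Suc a \<le> q * nest b" unfolding nest_def using q_pos by (intro mult_left_mono) auto
  then show ?thesis using q_pos by (simp add: nest_def)
qed

lemma nest_less': "a < b \<Longrightarrow> nest a < nest b"
proof -
  assume "a < b"
  from nest_less[OF this] have "2 * nest a \<le> q * nest b" .
  also have "q * nest b \<le> 1 * nest b" using q_less_1 nest_ge_1[of b] by (intro mult_right_mono) auto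
  finally show ?thesis using nest_ge_1[of a] by linarith
qed

lemma norm_ge_Re_diff: "1 \<le> q * Re w - Re u \<Longrightarrow> 1 \<le> norm (u - of_real q * w)"
  using abs_Re_le_cmod[of "u - of_real q * w"] by simp

lemma norm_ge_Re: "1 \<le> Re w \<Longrightarrow> 1 \<le> norm w"
  using abs_Re_le_cmod[of w] by linarith

text \<open>The residue of one variable at 0 leaves a factor \<open>1 / q\<close> for each variable
  that remains and a factor \<open>2 * pi\<close>. Over all variables this constant cancels them, so
  that \<open>V\<close> equals 1 at large positions.\<close>

definition Vnorm :: "nat set \<Rightarrow> real" where
  "Vnorm I = q ^ (card I choose 2) / (2 * pi) ^ card I"

definition V :: "nat \<Rightarrow> nat set \<Rightarrow> real \<Rightarrow> (nat \<Rightarrow> real) \<Rightarrow> complex" where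
  "V p I t X = of_real (Vnorm I) * lint I nest (kern p I t X)"

lemma kern_measurable: "(\<lambda>y. kern p I t X (pt c y)) \<in> borel_measurable (lpow I)"
  unfolding kern_def
  by (intro borel_measurable_times cross_measurable gk_prod_measurable gexp_measurable) auto

definition line_bound :: "nat \<Rightarrow> nat set \<Rightarrow> real \<Rightarrow> (nat \<Rightarrow> real) \<Rightarrow> nat \<Rightarrow> real" where
  "line_bound p I t X i = 2 ^ ((p + 1) * card I) *
    exp (\<Sum>j\<in>I - {i}. p * \<bar>nest j\<bar> + t * (nest j)\<^sup>2 / 2 + X j * nest j)"

lemma line_bound_nonneg: "0 \<le> line_bound p I t X i"
  by (simp add: line_bound_def)

text \<open>The estimate while the line of variable \<open>i\<close> is being moved: the
  contribution of the point \<open>z\<close> is kept explicit, and \<open>line_bound\<close>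
  collects the variables that stay on their lines.\<close>

lemma kern_bound_upd:
  assumes I: "finite I" "i \<in> I" and Q: "Q \<subseteq> pairs I" and p: "card I + 5 \<le> p" and t: "0 \<le> t"
    and z: "1 \<le> norm z"
    and zz: "\<And>a b. (a, b) \<in> Q \<Longrightarrow> 1 \<le> q * Re (((pt nest y)(i := z)) b) - Re (((pt nest y)(i := z)) a)"
    and M: "norm M \<le> (\<Prod>j\<in>I. (1 + norm (((pt nest y)(i := z)) j)) ^ 4)"
  shows "norm (cross Q ((pt nest y)(i := z)) * (\<Prod>j\<in>I. gk p (((pt nest y)(i := z)) j)) * M *
      gexp t X I ((pt nest y)(i := z)))
    \<le> line_bound p I t X i * exp (p * \<bar>Re z\<bar> + t * (Re z)\<^sup>2 / 2 + X i * Re z) *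
      (decay (I - {i}) y / (1 + (Im z)\<^sup>2))" (is "?l \<le> _")
proof -
  let ?z = "(pt nest y)(i := z)"
  have "?l \<le> 1 * 2 ^ ((p + 1) * card I) *
      exp (\<Sum>j\<in>I. p * \<bar>Re (?z j)\<bar> + t * (Re (?z j))\<^sup>2 / 2 + X j * Re (?z j)) *
      (\<Prod>j\<in>I. 1 / (1 + (Im (?z j))\<^sup>2))"
  proof (rule kern_bound[OF I(1) Q p t])
    show "1 \<le> norm (?z j)" for j using z nest_ge_1[of j] by (auto intro: norm_ge_Re)
    show "1 \<le> norm (?z a - of_real q * ?z b)" if "(a, b) \<in> Q" for a b by (intro norm_ge_Re_diff zz that)
    show "norm M \<le> 1 * (\<Prod>j\<in>I. (1 + norm (?z j)) ^ 4)" using M by simp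
  qed
  also have "(\<Sum>j\<in>I. p * \<bar>Re (?z j)\<bar> + t * (Re (?z j))\<^sup>2 / 2 + X j * Re (?z j))
    = (p * \<bar>Re z\<bar> + t * (Re z)\<^sup>2 / 2 + X i * Re z) + (\<Sum>j\<in>I - {i}. p * \<bar>nest j\<bar> + t * (nest j)\<^sup>2 / 2 + X j * nest j)"
    using I by (subst sum.remove[of _ i]) auto
  also have "(\<Prod>j\<in>I. 1 / (1 + (Im (?z j))\<^sup>2)) = decay (I - {i}) y / (1 + (Im z)\<^sup>2)"
    using I by (subst prod.remove[of _ i]) (auto simp: decay_def)
  finally show ?thesis by (simp only: line_bound_def exp_add mult_1_left mult_ac)
qed

lemma pt_fun_upd_upd [simp]: "(pt (c(i := u)) y)(i := z) = (pt c y)(i := z)"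
  by (auto simp: pt_def)

text \<open>The witness c lets variable \<open>i\<close> travel beyond its own line, up to any line
  earlier than that of \<open>b\<close>. This freedom is used when the lines of two neighbouring
  variables are merged.\<close>

lemma upd_separated:
  assumes "a < b" "a = i \<Longrightarrow> \<exists>c<b. Re z \<le> nest c" "b = i \<Longrightarrow> nest b \<le> Re z"
  shows "1 \<le> q * Re (((pt nest y)(i := z)) b) - Re (((pt nest y)(i := z)) a)"
proof -
  obtain c where c: "c < b" "Re (((pt nest y)(i := z)) a) \<le> nest c"
    using assms(1,2) by (cases "a = i") auto
  have "q * nest b \<le> q * Re (((pt nest y)(i := z)) b)" using assms(3) q_pos by simp
  then show ?thesis using c nest_less[OF c(1)] nest_ge_1[of c] by linarith
qed

lemma upd_separated':
  assumes "a < b" "a = i \<Longrightarrow> \<exists>c<b. Re z < 3 / 2 * nest c" "b = i \<Longrightarrow> nest b / 2 < Re z"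
  shows "((pt nest y)(i := z)) a - of_real q * ((pt nest y)(i := z)) b \<noteq> 0"
proof -
  have "Re (((pt nest y)(i := z)) a) < q * Re (((pt nest y)(i := z)) b)"
  proof (cases "a = i")
    case True
    then obtain c where c: "c < b" "Re z < 3 / 2 * nest c" using assms(2) by blast
    then show ?thesis using True assms(1) nest_less[OF c(1)] nest_ge_1[of c] by simp
  next
    case False
    have "nest b / 2 < Re (((pt nest y)(i := z)) b)" using assms(3) nest_ge_1[of b] by auto
    then have "q * (nest b / 2) < q * Re (((pt nest y)(i := z)) b)" using q_pos by (rule mult_strict_left_mono)
    then show ?thesis using nest_less[OF assms(1)] False by simp
  qed
  then show ?thesis by (auto simp: complex_eq_iff)
qed

lemma upd_holomorphic: "(\<lambda>z. ((pt c y)(i := z)) j) holomorphic_on D"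
  by (cases "j = i") (auto intro!: holomorphic_intros)

lemma shc_upd_holomorphic: "(\<lambda>z. shc (((pt c y)(i := z)) j)) holomorphic_on D"
  by (rule holomorphic_on_compose[OF upd_holomorphic shc_holomorphic, unfolded o_def])

lemma pt_nest_neq_0: "pt nest y j \<noteq> 0"
proof -
  have "Re (pt nest y j) \<noteq> 0" using nest_ge_1[of j] by simp
  then show ?thesis by force
qed

lemma kern_factors_holomorphic:
  assumes "\<And>z. z \<in> D \<Longrightarrow> i \<in> J \<Longrightarrow> z \<noteq> 0"
    and "\<And>z a b. z \<in> D \<Longrightarrow> (a, b) \<in> Q \<Longrightarrow> ((pt nest y)(i := z)) a - of_real q * ((pt nest y)(i := z)) b \<noteq> 0"
  shows "(\<lambda>z. cross Q ((pt nest y)(i := z))) holomorphic_on D"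
    and "(\<lambda>z. \<Prod>j\<in>J. gk p (((pt nest y)(i := z)) j)) holomorphic_on D"
    and "(\<lambda>z. gexp t X I ((pt nest y)(i := z))) holomorphic_on D"
proof -
  have "((pt nest y)(i := z)) j \<noteq> 0" if "z \<in> D" "j \<in> J" for z j
    using that assms(1) pt_nest_neq_0 by (cases "j = i") auto
  then show "(\<lambda>z. \<Prod>j\<in>J. gk p (((pt nest y)(i := z)) j)) holomorphic_on D"
    unfolding gk_def by (intro holomorphic_intros upd_holomorphic shc_upd_holomorphic)
  show "(\<lambda>z. cross Q ((pt nest y)(i := z))) holomorphic_on D"
    unfolding cross_def split_beta' using assms(2) by (intro holomorphic_intros upd_holomorphic) auto
  show "(\<lambda>z. gexp t X I ((pt nest y)(i := z))) holomorphic_on D"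
    unfolding gexp_def by (intro holomorphic_intros upd_holomorphic) auto
qed

text \<open>Pushing the innermost or outermost contour to infinity: the next two lemmas turn the
  integral at \<open>t = 0\<close> into a smoothed indicator function of \<open>X > 0\<close> at the last coordinate.\<close>

lemma V_eq_0:
  assumes I: "finite I" and k: "k \<in> I" "\<And>j. j \<in> I \<Longrightarrow> j \<le> k" and p: "card I + 5 \<le> p"
    and X: "X k < - real p"
  shows "V p I 0 X = 0"
proof -
  let ?F = "kern p I 0 X"
  define K where "K = line_bound p I 0 X k"
  have bound: "norm (?F ((pt nest y)(k := z)))
      \<le> K * exp (p * \<bar>Re z\<bar> + X k * Re z) * decay (I - {k}) y / (1 + (Im z)\<^sup>2)"
    if "nest k \<le> Re z" for y z
  proof -
    have "1 \<le> norm z" using nest_ge_1[of k] that by (intro norm_ge_Re) auto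
    moreover have "1 \<le> q * Re (((pt nest y)(k := z)) b) - Re (((pt nest y)(k := z)) a)" if "(a, b) \<in> pairs I" for a b
      using that k(2)[of b] \<open>nest k \<le> Re z\<close> by (intro upd_separated) (auto simp: pairs_def)
    ultimately show ?thesis
      using kern_bound_upd[OF I k(1) order_refl p order_refl, of z y 1 X]
      by (simp add: kern_def K_def prod_ge_1 one_le_power)
  qed
  have le: "norm (lint I nest ?F) \<le> K * exp ((p + X k) * u) * line_const ^ card I" if u: "nest k < u" for u
  proof -
    let ?c = "nest(k := u)"
    have u1: "1 \<le> u" using nest_ge_1[of k] u by linarith
    \<comment> \<open>Variable \<open>k\<close> is never the first member of a pair, so its poles
      \<open>z a / q\<close> lie to the left of its line and none is met on the way to the
      right.\<close>
    have "lint I ?c ?F = lint I (?c(k := nest k)) ?F"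
    proof (rule lint_shift_less[OF I k(1)])
      show "nest k / 2 < nest k" "nest k < ?c k" "?c k < u + 1" using nest_ge_1[of k] u by auto
      show "(\<lambda>y. ?F (pt c y)) \<in> borel_measurable (lpow I)" for c by (rule kern_measurable)
      show "(\<lambda>z. ?F ((pt ?c y)(k := z))) holomorphic_on {z. nest k / 2 < Re z \<and> Re z < u + 1}" for y
        unfolding kern_def pt_fun_upd_upd
      proof (intro holomorphic_on_mult kern_factors_holomorphic)
        fix z a b assume z: "z \<in> {z. nest k / 2 < Re z \<and> Re z < u + 1}" and "(a, b) \<in> pairs I"
        then show "((pt nest y)(k := z)) a - of_real q * ((pt nest y)(k := z)) b \<noteq> 0"
          using k(2)[of b] by (intro upd_separated') (auto simp: pairs_def)
      qed (use nest_ge_1[of k] in auto)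
      show "norm (?F ((pt ?c y)(k := z))) \<le> (K * exp ((p + \<bar>X k\<bar>) * u)) * decay (I - {k}) y / (1 + (Im z)\<^sup>2)"
        if "nest k \<le> Re z" "Re z \<le> ?c k" for y z
      proof -
        have Rz: "0 \<le> Re z" "Re z \<le> u" using that nest_ge_1[of k] by auto
        have "p * \<bar>Re z\<bar> + X k * Re z \<le> (p + \<bar>X k\<bar>) * u"
        proof -
          have "p * \<bar>Re z\<bar> + X k * Re z \<le> (p + \<bar>X k\<bar>) * Re z" using Rz by (simp add: distrib_right mult_right_mono)
          also have "\<dots> \<le> (p + \<bar>X k\<bar>) * u" using Rz by (intro mult_left_mono) auto
          finally show ?thesis .
        qed
        then have "K * exp (p * \<bar>Re z\<bar> + X k * Re z) * (decay (I - {k}) y / (1 + (Im z)\<^sup>2))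
            \<le> K * exp ((p + \<bar>X k\<bar>) * u) * (decay (I - {k}) y / (1 + (Im z)\<^sup>2))"
          by (intro mult_right_mono mult_left_mono) (auto simp: K_def line_bound_nonneg decay_nonneg)
        then show ?thesis using bound[OF that(1), of y] by simp
      qed
    qed
    then have eq: "lint I nest ?F = lint I ?c ?F" by simp
    show ?thesis unfolding eq unfolding lint_def
    proof (rule integral_decay_bound[OF I kern_measurable])
      fix y
      have "pt ?c y = (pt nest y)(k := Complex u (y k))" by (auto simp: pt_def)
      then have "norm (?F (pt ?c y)) \<le> K * exp (p * \<bar>u\<bar> + X k * u) * decay (I - {k}) y / (1 + (y k)\<^sup>2)"
        using bound[of "Complex u (y k)" y] u by simp
      also have "decay I y = 1 / (1 + (y k)\<^sup>2) * decay (I - {k}) y"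
        using decay_insert[of "I - {k}" k y] I k(1) by (simp add: insert_absorb)
      then have "K * exp (p * \<bar>u\<bar> + X k * u) * decay (I - {k}) y / (1 + (y k)\<^sup>2) = K * exp ((p + X k) * u) * decay I y"
        using u1 by (simp add: distrib_right)
      finally show "norm (?F (pt ?c y)) \<le> K * exp ((p + X k) * u) * decay I y" .
    qed
  qed
  have "((\<lambda>u. K * exp ((p + X k) * u) * line_const ^ card I) \<longlongrightarrow> K * 0 * line_const ^ card I) at_top"
  proof (intro tendsto_intros)
    have "LIM u at_top. (p + X k) * u :> at_bot"
      using X by (intro filterlim_tendsto_neg_mult_at_bot[OF tendsto_const _ filterlim_ident]) simp
    then show "((\<lambda>u. exp ((p + X k) * u)) \<longlongrightarrow> 0) at_top" by (rule filterlim_compose[OF exp_at_bot])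
  qed
  then have "norm (lint I nest ?F) \<le> K * 0 * line_const ^ card I"
    by (rule tendsto_lowerbound[OF _ eventually_mono[OF eventually_gt_at_top[of "nest k"] le]]) (assumption, rule trivial_limit_at_top_linorder)
  then show ?thesis by (simp add: V_def)
qed

lemma pairs_min:
  assumes "i \<in> I" "\<And>j. j \<in> I \<Longrightarrow> i \<le> j"
  shows "pairs I = pairs (I - {i}) \<union> Pair i ` (I - {i})" "pairs (I - {i}) \<inter> Pair i ` (I - {i}) = {}"
proof -
  have ne: "b \<noteq> i" if "(a, b) \<in> pairs I" for a b
    using assms(2)[of a] that by (auto simp: pairs_def)
  have "(a, b) \<in> pairs I \<longleftrightarrow> (a, b) \<in> pairs (I - {i}) \<union> Pair i ` (I - {i})" for a b
    using ne[of a b] assms(1) assms(2)[of b] by (cases "a = i") (auto simp: pairs_def)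
  then show "pairs I = pairs (I - {i}) \<union> Pair i ` (I - {i})" by auto
  show "pairs (I - {i}) \<inter> Pair i ` (I - {i}) = {}" by (auto simp: pairs_def)
qed

lemma V_reduce:
  assumes I: "finite I" and i: "i \<in> I" "\<And>j. j \<in> I \<Longrightarrow> i \<le> j" and p: "card I + 5 \<le> p"
    and X: "real p < X i"
  shows "V p I 0 X = V p (I - {i}) 0 X"
proof -
  let ?F = "kern p I 0 X" and ?J = "I - {i}"
  define G where "G z = cross (pairs I) z * (shc (z i) ^ p * (\<Prod>j\<in>?J. gk p (z j))) * gexp 0 X I z" for z
  define K where "K = line_bound p I 0 X i"
  have FG: "?F z = G z / z i" for z
    unfolding kern_def G_def using I i(1) by (subst prod.remove[of I i]) (simp_all add: gk_def)
  have bound: "norm (?F ((pt nest y)(i := z)))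
      \<le> K * exp (p * \<bar>Re z\<bar> + X i * Re z) * decay ?J y / (1 + (Im z)\<^sup>2)"
    if z: "Re z \<le> nest i" "1 \<le> norm z" for y z
  proof -
    have "1 \<le> q * Re (((pt nest y)(i := z)) b) - Re (((pt nest y)(i := z)) a)" if "(a, b) \<in> pairs I" for a b
      using that i(2)[of a] z by (intro upd_separated) (auto simp: pairs_def)
    then show ?thesis
      using kern_bound_upd[OF I i(1) order_refl p order_refl z(2), of y 1 X]
      by (simp add: kern_def K_def prod_ge_1 one_le_power)
  qed
  have res: "norm (lint I nest ?F - 2 * pi * lint ?J nest (\<lambda>z. G (z(i := 0))))
      \<le> K * exp (- ((X i - p) * u)) * line_const ^ card I" if u: "1 \<le> u" for u
  proof -
    let ?c = "nest(i := - u)"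
    \<comment> \<open>Variable \<open>i\<close> is never the second member of a pair, so its poles
      \<open>q * z b\<close> lie to the right of its line and only the pole at 0 is met on the way
      to the left.\<close>
    have c1: "lint I nest ?F = lint I ?c ?F + 2 * pi * lint ?J nest (\<lambda>z. G (z(i := 0)))"
    proof (rule lint_residue[OF I i(1)])
      show "- u - 1 < - u" "- u < 0" "0 < nest i" "nest i < 3 / 2 * nest i"
        using u nest_ge_1[of i] by auto
      show "(\<lambda>y. ?F (pt c y)) \<in> borel_measurable (lpow I)" for c by (rule kern_measurable)
      show "?F z = G z / z i" for z by (rule FG)
      show "(\<lambda>z. G ((pt nest y)(i := z))) holomorphic_on {z. - u - 1 < Re z \<and> Re z < 3 / 2 * nest i}" for y
        unfolding G_def
      proof (intro holomorphic_on_mult holomorphic_on_power kern_factors_holomorphic shc_upd_holomorphic)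
        fix z a b assume z: "z \<in> {z. - u - 1 < Re z \<and> Re z < 3 / 2 * nest i}" and "(a, b) \<in> pairs I"
        then show "((pt nest y)(i := z)) a - of_real q * ((pt nest y)(i := z)) b \<noteq> 0"
          using i(2)[of a] by (intro upd_separated') (auto simp: pairs_def)
      qed auto
      show "norm (?F ((pt nest y)(i := z))) \<le> (K * exp ((p + \<bar>X i\<bar>) * (u + nest i))) * decay ?J y / (1 + (Im z)\<^sup>2)"
        if z: "- u \<le> Re z" "Re z \<le> nest i" "1 \<le> \<bar>Im z\<bar> \<or> Re z = nest i \<or> Re z = - u" for y z
      proof -
        have nz: "1 \<le> norm z"
          using z(3) abs_Im_le_cmod[of z] abs_Re_le_cmod[of z] nest_ge_1[of i] u by auto
        have Rz: "\<bar>Re z\<bar> \<le> u + nest i" using z u nest_ge_1[of i] by linarith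
        have "X i * Re z \<le> \<bar>X i\<bar> * \<bar>Re z\<bar>" by (metis abs_ge_self abs_mult)
        then have "p * \<bar>Re z\<bar> + X i * Re z \<le> (p + \<bar>X i\<bar>) * \<bar>Re z\<bar>" by (simp add: distrib_right)
        also have "\<dots> \<le> (p + \<bar>X i\<bar>) * (u + nest i)" using Rz by (intro mult_left_mono) auto
        finally have "K * exp (p * \<bar>Re z\<bar> + X i * Re z) * (decay ?J y / (1 + (Im z)\<^sup>2))
            \<le> K * exp ((p + \<bar>X i\<bar>) * (u + nest i)) * (decay ?J y / (1 + (Im z)\<^sup>2))"
          by (intro mult_right_mono mult_left_mono) (auto simp: K_def line_bound_nonneg decay_nonneg)
        then show ?thesis using bound[OF z(2) nz, of y] by simp
      qed
    qed
    have "norm (lint I ?c ?F) \<le> K * exp (- ((X i - p) * u)) * line_const ^ card I"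
      unfolding lint_def
    proof (rule integral_decay_bound[OF I kern_measurable])
      fix y
      have pe: "pt ?c y = (pt nest y)(i := Complex (- u) (y i))" by (auto simp: pt_def)
      have "1 \<le> norm (Complex (- u) (y i))" using abs_Re_le_cmod[of "Complex (- u) (y i)"] u by simp
      then have "norm (?F (pt ?c y)) \<le> K * exp (p * \<bar>- u\<bar> + X i * (- u)) * decay ?J y / (1 + (y i)\<^sup>2)"
        using bound[of "Complex (- u) (y i)" y] u nest_ge_1[of i] unfolding pe by simp
      also have "decay I y = 1 / (1 + (y i)\<^sup>2) * decay ?J y"
        using decay_insert[of ?J i y] I i(1) by (simp add: insert_absorb)
      then have "K * exp (p * \<bar>- u\<bar> + X i * (- u)) * decay ?J y / (1 + (y i)\<^sup>2) = K * exp (- ((X i - p) * u)) * decay I y"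
        using u by (simp add: left_diff_distrib)
      finally show "norm (?F (pt ?c y)) \<le> K * exp (- ((X i - p) * u)) * decay I y" .
    qed
    then show ?thesis using c1 by simp
  qed
  have "((\<lambda>u. K * exp (- ((X i - p) * u)) * line_const ^ card I) \<longlongrightarrow> K * 0 * line_const ^ card I) at_top"
  proof (intro tendsto_intros)
    have "LIM u at_top. (p - X i) * u :> at_bot"
      using X by (intro filterlim_tendsto_neg_mult_at_bot[OF tendsto_const _ filterlim_ident]) simp
    then show "((\<lambda>u. exp (- ((X i - p) * u))) \<longlongrightarrow> 0) at_top"
      using filterlim_compose[OF exp_at_bot] by (simp add: minus_mult_left)
  qed
  then have "norm (lint I nest ?F - 2 * pi * lint ?J nest (\<lambda>z. G (z(i := 0)))) \<le> K * 0 * line_const ^ card I"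
    by (rule tendsto_lowerbound[OF _ eventually_mono[OF eventually_ge_at_top[of 1] res]]) (assumption, rule trivial_limit_at_top_linorder)
  then have main: "lint I nest ?F = 2 * pi * lint ?J nest (\<lambda>z. G (z(i := 0)))" by simp
  \<comment> \<open>At \<open>z i = 0\<close> the factor of the pair formed by \<open>i\<close> and
    \<open>b\<close> equals \<open>1 / q\<close> for every \<open>b\<close>, and what is left is the
    kernel of the remaining variables.\<close>
  have Gz: "G ((pt nest y)(i := 0)) = (1 / of_real q) ^ card ?J * kern p ?J 0 X (pt nest y)" for y
  proof -
    let ?z = "(pt nest y)(i := 0)"
    have "cross (pairs I) ?z = cross (pairs ?J) ?z * cross (Pair i ` ?J) ?z"
    proof -
      have pm: "pairs I = pairs ?J \<union> Pair i ` ?J" "pairs ?J \<inter> Pair i ` ?J = {}"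
        using pairs_min[of i I] i by simp_all
      show ?thesis unfolding cross_def pm(1) using I pm(2)
        by (intro prod.union_disjoint finite_pairs) auto
    qed
    also have "cross (pairs ?J) ?z = cross (pairs ?J) (pt nest y)"
      unfolding cross_def by (intro prod.cong) (auto simp: pairs_def)
    also have "cross (Pair i ` ?J) ?z = (\<Prod>b\<in>?J. (0 - pt nest y b) / (0 - of_real q * pt nest y b))"
      unfolding cross_def by (subst prod.reindex) (auto simp: inj_on_def intro!: prod.cong)
    also have "\<dots> = (\<Prod>b\<in>?J. 1 / of_real q)" using pt_nest_neq_0 q_pos by (intro prod.cong) auto
    finally have c: "cross (pairs I) ?z = cross (pairs ?J) (pt nest y) * (1 / of_real q) ^ card ?J"
      by (simp only: prod_constant)
    have g: "(\<Prod>j\<in>?J. gk p (?z j)) = (\<Prod>j\<in>?J. gk p (pt nest y j))" by (intro prod.cong) auto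
    have "gexp 0 X I ?z = gexp 0 X ?J (pt nest y)"
      unfolding gexp_def using I i(1) by (subst sum.remove[of I i]) (auto intro!: arg_cong[where f=exp] sum.cong)
    moreover have "shc 0 = 1" by (simp add: shc_def)
    ultimately show ?thesis unfolding G_def kern_def c g by simp
  qed
  have "lint ?J nest (\<lambda>z. G (z(i := 0))) = (1 / of_real q) ^ card ?J * lint ?J nest (kern p ?J 0 X)"
    unfolding lint_def Gz by simp
  then have "V p I 0 X = of_real (Vnorm I) * (2 * pi * (1 / of_real q) ^ card ?J) * lint ?J nest (kern p ?J 0 X)"
    unfolding V_def main by simp
  also have "of_real (Vnorm I) * (2 * pi * (1 / of_real q) ^ card ?J) = complex_of_real (Vnorm ?J)"
  proof -
    obtain n where n: "card I = Suc n" using I i(1) by (metis card_Suc_Diff1)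
    then have "card ?J = n" using I i(1) by simp
    moreover have "Suc n choose 2 = n + (n choose 2)"
      by (simp add: numeral_2_eq_2)
    ultimately have "Vnorm I * (2 * pi * (1 / q) ^ card ?J) = Vnorm ?J"
      using q_pos by (simp add: Vnorm_def n power_add field_simps)
    then have "complex_of_real (Vnorm I * (2 * pi * (1 / q) ^ card ?J)) = of_real (Vnorm ?J)" by (simp only:)
    then show ?thesis by (simp only: of_real_mult of_real_power of_real_divide of_real_1 of_real_numeral of_real_eq_id id_apply)
  qed
  finally show ?thesis by (simp add: V_def)
qed

lemma V_empty: "V p {} 0 X = 1"
proof -
  have "kern p {} 0 X (pt nest y) = 1" for y by (simp add: kern_def cross_def pairs_def gexp_def)
  moreover have "Vnorm {} = 1" by (simp add: Vnorm_def binomial_eq_0)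
  ultimately show ?thesis
    by (simp add: V_def lint_def PiM_empty lebesgue_integral_count_space_finite)
qed

text \<open>Every position exceeds \<open>p\<close>, so the variables can be removed one at a time
  by \<open>V_reduce\<close>, always the innermost that is left.\<close>

lemma V_eq_1:
  assumes "finite I" "card I + 5 \<le> p" "\<And>j. j \<in> I \<Longrightarrow> real p < X j"
  shows "V p I 0 X = 1"
  using assms
proof (induction "card I" arbitrary: I)
  case 0
  then show ?case by (simp add: V_empty)
next
  case (Suc n)
  then have ne: "I \<noteq> {}" by auto
  have i: "Min I \<in> I" "\<And>j. j \<in> I \<Longrightarrow> Min I \<le> j" using Suc.prems ne by auto
  have "V p I 0 X = V p (I - {Min I}) 0 X"
    using Suc.prems i by (intro V_reduce) auto
  also have "\<dots> = 1"
    using Suc.hyps(2) Suc.prems i by (intro Suc.hyps(1)) auto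
  finally show ?case .
qed

text \<open>After cancelling the pole between the contours of \<open>z i\<close> and \<open>z (Suc i)\<close> these two contours
  can be merged, and then the integrand is antisymmetric under the exchange of the two variables.\<close>

lemma kern_boundary:
  assumes i: "Suc i < k" and p: "k + 5 \<le> p" and t: "0 \<le> t" and X: "X i = X (Suc i)"
  shows "lint {..<k} nest (\<lambda>z. kern p {..<k} t X z * (z i - of_real q * z (Suc i))) = 0"
proof -
  let ?I = "{..<k}" and ?n = "Suc i"
  have I: "finite ?I" and ii: "i \<in> ?I" "?n \<in> ?I" using i by auto
  have cI: "card ?I + 5 \<le> p" using p by simp
  \<comment> \<open>The pair \<open>(i, ?n)\<close> is taken out of the cross factor: its
    denominator cancels against \<open>z i - q * z ?n\<close>, while its numerator remains in
    \<open>F\<close> and makes \<open>F\<close> antisymmetric.\<close>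
  define Q where "Q = pairs ?I - {(i, ?n)}"
  have Qs: "Q \<subseteq> pairs ?I" by (auto simp: Q_def)
  have Qn: "a < b" "a = i \<Longrightarrow> ?n < b" if "(a, b) \<in> Q" for a b using that by (auto simp: Q_def pairs_def)
  define F where "F z = cross Q z * (\<Prod>j\<in>?I. gk p (z j)) * (z i - z ?n) * gexp t X ?I z" for z
  have meas: "(\<lambda>y. F (pt c y)) \<in> borel_measurable (lpow ?I)" for c
    unfolding F_def
    by (intro borel_measurable_times borel_measurable_diff cross_measurable[OF Qs] gk_prod_measurable
        gexp_measurable pt_measurable ii) auto
  let ?c = "nest(i := nest ?n)"
  have half: "nest i / 2 < nest i" "nest i < nest ?n" "nest ?n < 3 / 2 * nest ?n"
    using nest_ge_1[of i] nest_ge_1[of ?n] nest_less'[of i ?n] by auto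
  define K where "K = line_bound p ?I t X i * exp (p * nest ?n + t * (nest ?n)\<^sup>2 / 2 + \<bar>X i\<bar> * nest ?n)"
  have "lint ?I ?c F = lint ?I (?c(i := nest i)) F"
  proof (rule lint_shift_less[OF I ii(1)])
    show "nest i / 2 < nest i" "nest i < ?c i" "?c i < 3 / 2 * nest ?n" using half by auto
    show "(\<lambda>y. F (pt c y)) \<in> borel_measurable (lpow ?I)" for c by (rule meas)
    show "(\<lambda>z. F ((pt ?c y)(i := z))) holomorphic_on {z. nest i / 2 < Re z \<and> Re z < 3 / 2 * nest ?n}" for y
      unfolding F_def pt_fun_upd_upd
    proof (intro holomorphic_on_mult holomorphic_on_diff kern_factors_holomorphic upd_holomorphic)
      fix z a b assume "z \<in> {z. nest i / 2 < Re z \<and> Re z < 3 / 2 * nest ?n}" and ab: "(a, b) \<in> Q"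
      then show "((pt nest y)(i := z)) a - of_real q * ((pt nest y)(i := z)) b \<noteq> 0"
        using Qn[OF ab] by (intro upd_separated') auto
    qed (use nest_ge_1[of i] in auto)
    show "norm (F ((pt ?c y)(i := z))) \<le> K * decay (?I - {i}) y / (1 + (Im z)\<^sup>2)"
      if z: "nest i \<le> Re z" "Re z \<le> ?c i" for y z
    proof -
      let ?z = "(pt nest y)(i := z)"
      have Rz: "1 \<le> Re z" "Re z \<le> nest ?n" using z nest_ge_1[of i] by auto
      have *: "norm (F ?z) \<le> line_bound p ?I t X i * exp (p * \<bar>Re z\<bar> + t * (Re z)\<^sup>2 / 2 + X i * Re z) *
          (decay (?I - {i}) y / (1 + (Im z)\<^sup>2))"
        unfolding F_def
      proof (rule kern_bound_upd[OF I ii(1) Qs cI t norm_ge_Re[OF Rz(1)]])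
        show "1 \<le> q * Re (?z b) - Re (?z a)" if ab: "(a, b) \<in> Q" for a b
          using Qn[OF ab] z by (intro upd_separated) auto
        have "norm (?z i - ?z ?n) \<le> (1 + norm (?z i)) * (1 + norm (?z ?n))" by (rule norm_diff_le_prod)
        also have "\<dots> \<le> (\<Prod>j\<in>{i, ?n}. (1 + norm (?z j)) ^ 4)"
        proof -
          have "(1 + norm (?z i)) * (1 + norm (?z ?n)) \<le> (1 + norm (?z i)) ^ 4 * (1 + norm (?z ?n)) ^ 4"
            by (intro mult_mono self_le_power) auto
          then show ?thesis by simp
        qed
        also have "\<dots> \<le> (\<Prod>j\<in>?I. (1 + norm (?z j)) ^ 4)"
          using ii by (intro prod_mono2) (auto intro: one_le_power)
        finally show "norm (?z i - ?z ?n) \<le> (\<Prod>j\<in>?I. (1 + norm (?z j)) ^ 4)" .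
      qed
      have "X i * Re z \<le> \<bar>X i\<bar> * nest ?n"
        by (rule order_trans[OF abs_ge_self]) (use Rz in \<open>auto simp: abs_mult intro!: mult_left_mono\<close>)
      moreover have "(Re z)\<^sup>2 \<le> (nest ?n)\<^sup>2" using Rz by (intro power_mono) auto
      then have "t * (Re z)\<^sup>2 / 2 \<le> t * (nest ?n)\<^sup>2 / 2" using t by (intro divide_right_mono mult_left_mono) auto
      moreover have "p * \<bar>Re z\<bar> \<le> p * nest ?n" using Rz by (intro mult_left_mono) auto
      ultimately have "norm (F ?z) \<le> K * (decay (?I - {i}) y / (1 + (Im z)\<^sup>2))"
        unfolding K_def by (intro order_trans[OF *] mult_right_mono mult_left_mono)
          (auto simp: decay_nonneg line_bound_nonneg)
      then show ?thesis by simp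
    qed
  qed
  also have "?c(i := nest i) = nest" by auto
  finally have shift: "lint ?I ?c F = lint ?I nest F" .
  let ?\<tau> = "Transposition.transpose i ?n"
  have "lint ?I ?c (\<lambda>z. F (z \<circ> ?\<tau>)) = lint ?I ?c F"
    by (rule lint_swap[OF I ii _ meas]) simp
  moreover have "F (z \<circ> ?\<tau>) = - F z" for z
  proof -
    have tI: "?\<tau> j \<in> ?I \<longleftrightarrow> j \<in> ?I" for j using ii by (auto simp: Transposition.transpose_def)
    have "cross Q (z \<circ> ?\<tau>) = cross Q z"
      unfolding cross_def
    proof (rule prod.reindex_bij_witness[of _ "map_prod ?\<tau> ?\<tau>" "map_prod ?\<tau> ?\<tau>"])
      have "map_prod ?\<tau> ?\<tau> ab \<in> Q" if "ab \<in> Q" for ab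
        using that ii by (cases ab) (auto simp: Q_def pairs_def Transposition.transpose_def split: if_splits)
      then show "\<And>ab. ab \<in> Q \<Longrightarrow> map_prod ?\<tau> ?\<tau> ab \<in> Q" "\<And>ab. ab \<in> Q \<Longrightarrow> map_prod ?\<tau> ?\<tau> ab \<in> Q" by auto
    qed (auto simp: split_beta')
    moreover have "(\<Prod>j\<in>?I. gk p ((z \<circ> ?\<tau>) j)) = (\<Prod>j\<in>?I. gk p (z j))"
      by (rule prod.reindex_bij_witness[of _ ?\<tau> ?\<tau>]) (use tI in auto)
    moreover have "gexp t X ?I (z \<circ> ?\<tau>) = gexp t X ?I z"
    proof -
      have "X (?\<tau> j) = X j" for j using X by (auto simp: Transposition.transpose_def)
      then show ?thesis unfolding gexp_def
        by (intro arg_cong[where f=exp] sum.reindex_bij_witness[of _ ?\<tau> ?\<tau>]) (use tI in auto)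
    qed
    ultimately show ?thesis unfolding F_def by (simp add: algebra_simps)
  qed
  ultimately have "- lint ?I ?c F = lint ?I ?c F" by (simp add: lint_def)
  then have "lint ?I nest F = 0" using shift by (simp add: equation_minus_iff)
  moreover have "F (pt nest y) = kern p ?I t X (pt nest y) * (pt nest y i - of_real q * pt nest y ?n)" for y
  proof -
    let ?z = "pt nest y"
    have ip: "(i, ?n) \<in> pairs ?I" using i by (auto simp: pairs_def)
    have "Re (?z i) < q * Re (?z ?n)" using nest_less[of i ?n] nest_ge_1[of i] by simp
    then have nz: "?z i - of_real q * ?z ?n \<noteq> 0" by (auto simp: complex_eq_iff)
    have "cross (pairs ?I) ?z = (?z i - ?z ?n) / (?z i - of_real q * ?z ?n) * cross Q ?z"
      unfolding cross_def Q_def by (subst prod.remove[OF finite_pairs[OF I] ip]) simp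
    then show ?thesis using nz by (simp add: kern_def F_def)
  qed
  ultimately show ?thesis by (simp add: lint_def)
qed

end

section \<open>Remainder estimates for the exponential\<close>

lemma norm_exp_diff_le: "norm (exp w - 1) \<le> norm w * (1 + norm (exp w))" for w :: complex
proof -
  have "norm (exp w - exp 0) \<le> (1 + norm (exp w)) * norm (w - 0)"
  proof (rule field_differentiable_bound[OF convex_closed_segment[of 0 w]])
    show "(exp has_field_derivative exp z) (at z within closed_segment 0 w)" for z :: complex
      by (rule has_field_derivative_at_within[OF DERIV_exp])
    fix z assume "z \<in> closed_segment 0 w"
    then obtain u where u: "0 \<le> u" "u \<le> 1" "z = u *\<^sub>R w" by (auto simp: in_segment)
    have "Re z \<le> max 0 (Re w)" using u by (auto simp: max_def mult_le_cancel_right1 mult_nonneg_nonpos mult_left_le_one_le)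
    then have "exp (Re z) \<le> exp (max 0 (Re w))" by simp
    also have "\<dots> \<le> 1 + exp (Re w)" by (simp add: max_def)
    finally show "norm (exp z) \<le> 1 + norm (exp w)" by simp
  qed auto
  then show ?thesis by (simp add: mult.commute)
qed

text \<open>The bound is stated with \<open>exp w\<close> and \<open>exp (- w)\<close> on purpose:
  for an exponent proportional to a time increment h, a kernel at time s multiplied by them becomes
  the kernel at s + h and at s - h.\<close>

lemma norm_exp_diff2_le: "norm (exp w - 1 - w) \<le> (norm w)\<^sup>2 * (norm (exp w) + norm (exp (- w)))" for w :: complex
proof -
  have "norm (exp w - 1 - w) \<le> exp \<bar>Re w\<bar> * (norm w)\<^sup>2"
    using Taylor_exp[of w 1] by (simp add: numeral_2_eq_2 algebra_simps)
  also have "exp \<bar>Re w\<bar> \<le> norm (exp w) + norm (exp (- w))" by (simp add: abs_if)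
  finally show ?thesis by (simp add: mult.commute mult_right_mono)
qed

lemma norm_exp_diff3_le: "norm (exp w - 1 - w - w\<^sup>2 / 2) \<le> exp \<bar>Re w\<bar> * norm w ^ 3" for w :: complex
proof -
  have "norm (exp w - (\<Sum>i\<le>2. w ^ i / fact i)) \<le> exp \<bar>Re w\<bar> * norm w ^ Suc 2 / fact 2"
    by (rule Taylor_exp)
  also have "\<dots> \<le> exp \<bar>Re w\<bar> * norm w ^ 3" by (simp add: numeral_3_eq_3)
  also have "(\<Sum>i\<le>2. w ^ i / fact i) = 1 + w + w\<^sup>2 / 2" by (simp add: numeral_2_eq_2)
  finally show ?thesis by (simp add: algebra_simps)
qed

lemma has_real_derivative_quadratic:
  fixes f :: "real \<Rightarrow> real"
  assumes "0 < \<delta>" "\<And>h. \<bar>h\<bar> \<le> \<delta> \<Longrightarrow> \<bar>f (s + h) - f s - h * D\<bar> \<le> C * h\<^sup>2"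
  shows "(f has_real_derivative D) (at s)"
  unfolding DERIV_def
proof (rule LIM_zero_cancel, rule Lim_null_comparison)
  show "\<forall>\<^sub>F h in at 0. norm ((f (s + h) - f s) / h - D) \<le> C * \<bar>h\<bar>"
    unfolding eventually_at
  proof (intro exI[of _ \<delta>] conjI assms(1) ballI impI)
    fix h :: real assume h: "h \<noteq> 0 \<and> dist h 0 < \<delta>"
    then have "\<bar>f (s + h) - f s - h * D\<bar> \<le> C * h\<^sup>2" by (intro assms(2)) (simp add: dist_norm)
    moreover have "(f (s + h) - f s) / h - D = (f (s + h) - f s - h * D) / h" using h by (simp add: field_simps)
    ultimately show "norm ((f (s + h) - f s) / h - D) \<le> C * \<bar>h\<bar>"
      using h by (simp add: abs_divide divide_le_eq power2_eq_square mult.assoc)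
  qed
  show "((\<lambda>h. C * \<bar>h\<bar>) \<longlongrightarrow> 0) (at 0)" by (auto intro!: tendsto_eq_intros)
qed

text \<open>Brings a sum over the variables into the product form in which all bounds on polynomial
  factors of the kernel are stated.\<close>

lemma sum_le_card_mult_prod:
  fixes a :: "'i \<Rightarrow> real"
  assumes "finite I" "\<And>j. j \<in> I \<Longrightarrow> 1 \<le> a j"
  shows "(\<Sum>j\<in>I. a j) \<le> real (card I) * (\<Prod>j\<in>I. a j)"
proof -
  have "a j \<le> (\<Prod>j\<in>I. a j)" if "j \<in> I" for j
  proof -
    have "(\<Prod>i\<in>{j}. a i) \<le> (\<Prod>i\<in>I. a i)"
      using assms that by (intro prod_mono2) (auto intro: order_trans[OF zero_le_one])
    then show ?thesis by simp
  qed
  then show ?thesis by (rule sum_bounded_above)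
qed

section \<open>Bounds, continuity and time derivative of the nested integral\<close>

context q_parameter begin

definition kconst :: "nat \<Rightarrow> nat set \<Rightarrow> real" where
  "kconst p I = 2 ^ ((p + 1) * card I) * line_const ^ card I"

definition growth :: "nat \<Rightarrow> nat set \<Rightarrow> real \<Rightarrow> (nat \<Rightarrow> real) \<Rightarrow> real" where
  "growth p I t X = exp (\<Sum>j\<in>I. p * nest j + t * (nest j)\<^sup>2 / 2 + X j * nest j)"

lemma growth_mono:
  assumes "t \<le> t'" "\<And>j. j \<in> I \<Longrightarrow> X j \<le> X' j"
  shows "growth p I t X \<le> growth p I t' X'"
proof -
  have n: "0 \<le> nest j" for j using nest_ge_1[of j] by simp
  show ?thesis unfolding growth_def using assms n
    by (intro iffD2[OF exp_le_cancel_iff] sum_mono add_mono divide_right_mono mult_right_mono) auto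
qed

lemma Vnorm_nonneg: "0 \<le> Vnorm I"
  using q_pos by (simp add: Vnorm_def)

lemma kconst_nonneg: "0 \<le> kconst p I"
  using line_const_nonneg by (simp add: kconst_def)

context
  fixes I :: "nat set" and p :: nat and t :: real and X :: "nat \<Rightarrow> real"
    and M :: "(nat \<Rightarrow> complex) \<Rightarrow> complex" and m :: real
  assumes I: "finite I" and p: "card I + 5 \<le> p" and t: "0 \<le> t"
    and meas: "(\<lambda>y. M (pt nest y)) \<in> borel_measurable (lpow I)"
    and M: "\<And>y. norm (M (pt nest y)) \<le> m * (\<Prod>j\<in>I. (1 + norm (pt nest y j)) ^ 4)"
begin

lemma kern_mult_le:
  "norm (kern p I t X (pt nest y) * M (pt nest y)) \<le> m * 2 ^ ((p + 1) * card I) * growth p I t X * decay I y"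
proof -
  let ?z = "pt nest y"
  have "norm (cross (pairs I) ?z * (\<Prod>j\<in>I. gk p (?z j)) * M ?z * gexp t X I ?z) \<le>
    m * 2 ^ ((p + 1) * card I) * exp (\<Sum>j\<in>I. p * \<bar>Re (?z j)\<bar> + t * (Re (?z j))\<^sup>2 / 2 + X j * Re (?z j)) *
    (\<Prod>j\<in>I. 1 / (1 + (Im (?z j))\<^sup>2))"
  proof (rule kern_bound[OF I order_refl p t _ _ M])
    show "1 \<le> norm (?z j)" for j using nest_ge_1[of j] by (intro norm_ge_Re) simp
    show "1 \<le> norm (?z a - of_real q * ?z b)" if "(a, b) \<in> pairs I" for a b
      using that nest_less[of a b] nest_ge_1[of a] by (intro norm_ge_Re_diff) (auto simp: pairs_def)
  qed
  moreover have "\<bar>nest j\<bar> = nest j" for j using nest_ge_1[of j] by simp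
  ultimately show ?thesis by (simp add: kern_def growth_def decay_def mult_ac)
qed

lemma kern_mult_integrable: "integrable (lpow I) (\<lambda>y. kern p I t X (pt nest y) * M (pt nest y))"
  by (rule integrable_decay_bound[OF I borel_measurable_times[OF kern_measurable meas] kern_mult_le])

lemma lint_kern_le: "norm (lint I nest (\<lambda>z. kern p I t X z * M z)) \<le> m * kconst p I * growth p I t X"
proof -
  have "norm (lint I nest (\<lambda>z. kern p I t X z * M z)) \<le> (m * 2 ^ ((p + 1) * card I) * growth p I t X) * line_const ^ card I"
    unfolding lint_def
    by (rule integral_decay_bound[OF I borel_measurable_times[OF kern_measurable meas] kern_mult_le])
  then show ?thesis by (simp add: kconst_def mult_ac)
qed

end

lemma one_le_prod_bound: "1 \<le> (\<Prod>j\<in>I. (1 + norm (z j :: complex)) ^ n)"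
  by (intro prod_ge_1) (auto intro: one_le_power)

lemma V_le:
  assumes I: "finite I" and p: "card I + 5 \<le> p" and t: "0 \<le> t"
  shows "norm (V p I t X) \<le> Vnorm I * (kconst p I * growth p I t X)"
  using lint_kern_le[OF I p t, of "\<lambda>_. 1" 1 X] Vnorm_nonneg
  by (simp add: V_def norm_mult one_le_prod_bound mult_left_mono)

text \<open>If the last position is below \<open>- p\<close> the integral vanishes; if the first
  exceeds \<open>p\<close>, its variable is removed by \<open>V_reduce\<close>; otherwise the
  ordering puts all positions at most at \<open>p\<close>, where the growth bound is
  uniform.\<close>

lemma V_bounded:
  assumes "finite I" "card I + 5 \<le> p"
  shows "\<exists>C\<ge>0. \<forall>X. (\<forall>i\<in>I. \<forall>j\<in>I. i \<le> j \<longrightarrow> X j \<le> X i) \<longrightarrow> norm (V p I 0 X) \<le> C"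
  using assms
proof (induction "card I" arbitrary: I)
  case 0
  then show ?case by (auto simp: V_empty intro!: exI[of _ 1])
next
  case (Suc n)
  then have ne: "I \<noteq> {}" by auto
  let ?i = "Min I" and ?k = "Max I"
  have i: "?i \<in> I" "\<And>j. j \<in> I \<Longrightarrow> ?i \<le> j" and k: "?k \<in> I" "\<And>j. j \<in> I \<Longrightarrow> j \<le> ?k"
    using Suc.prems ne by auto
  have "\<exists>C\<ge>0. \<forall>X. (\<forall>i\<in>I - {?i}. \<forall>j\<in>I - {?i}. i \<le> j \<longrightarrow> X j \<le> X i) \<longrightarrow> norm (V p (I - {?i}) 0 X) \<le> C"
    using Suc.hyps(2) Suc.prems i by (intro Suc.hyps(1)) auto
  then obtain C where C: "0 \<le> C" "\<And>X. (\<forall>i\<in>I - {?i}. \<forall>j\<in>I - {?i}. i \<le> j \<longrightarrow> X j \<le> X i) \<Longrightarrow> norm (V p (I - {?i}) 0 X) \<le> C"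
    by blast
  define B where "B = Vnorm I * (kconst p I * growth p I 0 (\<lambda>_. p))"
  have B: "0 \<le> B" unfolding B_def growth_def using Vnorm_nonneg kconst_nonneg by simp
  have "norm (V p I 0 X) \<le> max B C" if X: "\<forall>i\<in>I. \<forall>j\<in>I. i \<le> j \<longrightarrow> X j \<le> X i" for X
  proof -
    consider "X ?k < - real p" | "real p < X ?i" | "- real p \<le> X ?k" "X ?i \<le> real p" by linarith
    then show ?thesis
    proof cases
      case 1
      then have "V p I 0 X = 0" using Suc.prems k by (intro V_eq_0) auto
      then show ?thesis using B by simp
    next
      case 2
      then have "V p I 0 X = V p (I - {?i}) 0 X" using Suc.prems i by (intro V_reduce) auto
      then show ?thesis using C(2)[of X] X by (simp add: le_max_iff_disj)
    next
      case 3
      have Xp: "X j \<le> p" if "j \<in> I" for j using X i that 3 by (meson order_trans)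
      have "norm (V p I 0 X) \<le> Vnorm I * (kconst p I * growth p I 0 X)"
        using Suc.prems by (intro V_le) auto
      also have "\<dots> \<le> B"
        unfolding B_def using Xp by (intro mult_left_mono growth_mono Vnorm_nonneg kconst_nonneg) auto
      finally show ?thesis by simp
    qed
  qed
  then show ?case using B by (intro exI[of _ "max B C"]) auto
qed

text \<open>Dominated convergence, with the limit time 0 included: integrability comes from the
  decay of \<open>gk\<close>, not from the Gaussian factor, whose modulus is merely bounded on the
  lines.\<close>

lemma V_tendsto:
  assumes I: "finite I" and p: "card I + 5 \<le> p" and t: "ts \<longlonglongrightarrow> t" "\<And>n. 0 \<le> ts n"
    and X: "\<And>j. j \<in> I \<Longrightarrow> (\<lambda>n. Xs n j) \<longlonglongrightarrow> X j"
  shows "(\<lambda>n. V p I (ts n) (Xs n)) \<longlonglongrightarrow> V p I t X"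
proof -
  have bdd: "\<exists>B. \<forall>n. u n \<le> B" if "u \<longlonglongrightarrow> l" for u :: "nat \<Rightarrow> real" and l
  proof -
    have "Bseq u" using that by (intro convergent_imp_Bseq convergentI)
    then obtain B where "\<And>n. norm (u n) \<le> B" unfolding Bseq_def by blast
    then show ?thesis by (intro exI[of _ B]) (auto simp: abs_le_iff)
  qed
  have "\<exists>B. \<forall>n. Xs n j \<le> B" if "j \<in> I" for j by (rule bdd[OF X[OF that]])
  then obtain B where B: "\<And>j n. j \<in> I \<Longrightarrow> Xs n j \<le> B j" by metis
  obtain S where S: "\<And>n. ts n \<le> S" using bdd[OF t(1)] by blast
  let ?w = "\<lambda>y. 2 ^ ((p + 1) * card I) * growth p I S B * decay I y"
  have "(\<lambda>n. LINT y|lpow I. kern p I (ts n) (Xs n) (pt nest y)) \<longlonglongrightarrow> (LINT y|lpow I. kern p I t X (pt nest y))"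
  proof (rule integral_dominated_convergence[where w = ?w])
    show "AE y in lpow I. (\<lambda>n. kern p I (ts n) (Xs n) (pt nest y)) \<longlonglongrightarrow> kern p I t X (pt nest y)"
      unfolding kern_def gexp_def
      by (intro AE_I2 tendsto_mult tendsto_const tendsto_exp tendsto_sum tendsto_add tendsto_divide tendsto_of_real X t) simp
    show "AE y in lpow I. norm (kern p I (ts n) (Xs n) (pt nest y)) \<le> ?w y" for n
    proof (intro AE_I2)
      fix y
      have "norm (kern p I (ts n) (Xs n) (pt nest y) * 1) \<le> 1 * 2 ^ ((p + 1) * card I) * growth p I (ts n) (Xs n) * decay I y"
        by (rule kern_mult_le[OF I p t(2)]) (simp_all add: one_le_prod_bound)
      also have "\<dots> \<le> 1 * 2 ^ ((p + 1) * card I) * growth p I S B * decay I y"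
        by (intro mult_right_mono mult_left_mono growth_mono S B) (auto simp: decay_nonneg)
      finally show "norm (kern p I (ts n) (Xs n) (pt nest y)) \<le> ?w y" by simp
    qed
  qed (auto intro!: kern_measurable integrable_mult_right integrable_decay_power I)
  then show ?thesis unfolding V_def lint_def by (rule tendsto_mult[OF tendsto_const])
qed

lemma prod_power_mono: "n \<le> n' \<Longrightarrow> (\<Prod>j\<in>I. (1 + norm (z j :: complex)) ^ n) \<le> (\<Prod>j\<in>I. (1 + norm (z j)) ^ n')"
  by (intro prod_mono conjI power_increasing) auto

lemma kern_shift_time:
  "kern p I (t + a) (\<lambda>j. X j + b) z = kern p I t X z * exp (\<Sum>j\<in>I. of_real a * (z j)\<^sup>2 / 2 + of_real b * z j)"
proof -
  have "(\<Sum>j\<in>I. of_real (t + a) * (z j)\<^sup>2 / 2 + of_real (X j + b) * z j)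
    = (\<Sum>j\<in>I. of_real t * (z j)\<^sup>2 / 2 + of_real (X j) * z j) + (\<Sum>j\<in>I. of_real a * (z j)\<^sup>2 / 2 + of_real b * z j)"
    unfolding sum.distrib[symmetric] by (intro sum.cong refl) (simp add: algebra_simps add_divide_distrib)
  then show ?thesis by (simp only: kern_def gexp_def exp_add mult.assoc)
qed

lemma exp_sum_measurable:
  "(\<lambda>y. \<Sum>j\<in>I. of_real a * (pt c y j)\<^sup>2 / 2 + of_real b * pt c y j) \<in> borel_measurable (lpow I)"
  by (intro borel_measurable_sum borel_measurable_add borel_measurable_divide borel_measurable_times
      borel_measurable_power borel_measurable_const pt_measurable) auto

text \<open>Along a moving frame both the time and the positions in \<open>V\<close> change linearly; \<open>theta\<close> is the
  resulting exponent per unit time.\<close>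

context
  fixes I :: "nat set" and p :: nat and a b :: real and X :: "nat \<Rightarrow> real"
  assumes I: "finite I" and p: "card I + 5 \<le> p" and a: "0 \<le> a"
begin

definition theta :: "(nat \<Rightarrow> complex) \<Rightarrow> complex" where
  "theta z = (\<Sum>j\<in>I. of_real a * (z j)\<^sup>2 / 2 + of_real b * z j)"

lemma theta_measurable: "(\<lambda>y. theta (pt c y)) \<in> borel_measurable (lpow I)"
  unfolding theta_def by (rule exp_sum_measurable)

lemma norm_theta_le: "norm (theta z) \<le> (a + \<bar>b\<bar>) * card I * (\<Prod>j\<in>I. (1 + norm (z j)) ^ 2)"
proof -
  have "norm (theta z) \<le> (\<Sum>j\<in>I. (a + \<bar>b\<bar>) * (1 + norm (z j)) ^ 2)"
    unfolding theta_def
  proof (rule sum_norm_le)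
    fix j
    have "norm (of_real a * (z j)\<^sup>2 / 2 + of_real b * z j) \<le> a * (norm (z j))\<^sup>2 / 2 + \<bar>b\<bar> * norm (z j)"
      using a by (intro order_trans[OF norm_triangle_ineq]) (simp add: norm_mult norm_divide norm_power)
    also have "\<dots> \<le> a * (1 + norm (z j)) ^ 2 + \<bar>b\<bar> * (1 + norm (z j)) ^ 2"
      using a by (intro add_mono order_trans[OF divide_left_mono[of 1 2]] mult_left_mono)
        (auto simp: power2_eq_square algebra_simps)
    finally show "norm (of_real a * (z j)\<^sup>2 / 2 + of_real b * z j) \<le> (a + \<bar>b\<bar>) * (1 + norm (z j)) ^ 2"
      by (simp add: distrib_right)
  qed
  also have "\<dots> = (a + \<bar>b\<bar>) * (\<Sum>j\<in>I. (1 + norm (z j)) ^ 2)" by (simp add: sum_distrib_left)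
  also have "\<dots> \<le> (a + \<bar>b\<bar>) * (card I * (\<Prod>j\<in>I. (1 + norm (z j)) ^ 2))"
    using a by (intro mult_left_mono sum_le_card_mult_prod I one_le_power) auto
  finally show ?thesis by (simp add: mult.assoc)
qed

definition Vpath :: "real \<Rightarrow> complex" where
  "Vpath s = V p I (a * s) (\<lambda>j. X j + b * s)"

definition Vpath' :: "real \<Rightarrow> complex" where
  "Vpath' s = of_real (Vnorm I) * lint I nest (\<lambda>z. kern p I (a * s) (\<lambda>j. X j + b * s) z * theta z)"

lemma kern_path: "kern p I (a * (s + h)) (\<lambda>j. X j + b * (s + h)) z
    = kern p I (a * s) (\<lambda>j. X j + b * s) z * exp (of_real h * theta z)"
proof -
  have "kern p I (a * s + a * h) (\<lambda>j. (X j + b * s) + b * h) z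
    = kern p I (a * s) (\<lambda>j. X j + b * s) z * exp (\<Sum>j\<in>I. of_real (a * h) * (z j)\<^sup>2 / 2 + of_real (b * h) * z j)"
    by (rule kern_shift_time)
  moreover have "(\<Sum>j\<in>I. of_real (a * h) * (z j)\<^sup>2 / 2 + of_real (b * h) * z j) = of_real h * theta z"
    by (simp add: theta_def sum_distrib_left algebra_simps)
  ultimately show ?thesis by (simp add: distrib_left add.assoc)
qed

lemma growth_path_le:
  assumes "0 \<le> s" "s \<le> S"
  shows "growth p I (a * s) (\<lambda>j. X j + b * s) \<le> growth p I (a * S) (\<lambda>j. X j + \<bar>b\<bar> * S)"
  using a assms by (intro growth_mono mult_left_mono add_left_mono mult_mono[of b "\<bar>b\<bar>"]) auto

lemma kern_path_integrable:
  assumes "0 \<le> s"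
  shows "integrable (lpow I) (\<lambda>y. kern p I (a * s) (\<lambda>j. X j + b * s) (pt nest y))"
    "integrable (lpow I) (\<lambda>y. kern p I (a * s) (\<lambda>j. X j + b * s) (pt nest y) * theta (pt nest y))"
proof -
  have as: "0 \<le> a * s" using a assms by simp
  have "integrable (lpow I) (\<lambda>y. kern p I (a * s) (\<lambda>j. X j + b * s) (pt nest y) * 1)"
    by (rule kern_mult_integrable[OF I p as, where m=1]) (simp_all add: one_le_prod_bound)
  then show "integrable (lpow I) (\<lambda>y. kern p I (a * s) (\<lambda>j. X j + b * s) (pt nest y))" by simp
  show "integrable (lpow I) (\<lambda>y. kern p I (a * s) (\<lambda>j. X j + b * s) (pt nest y) * theta (pt nest y))"
  proof (rule kern_mult_integrable[OF I p as theta_measurable])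
    show "norm (theta (pt nest y)) \<le> (a + \<bar>b\<bar>) * card I * (\<Prod>j\<in>I. (1 + norm (pt nest y j)) ^ 4)" for y
      using a by (intro order_trans[OF norm_theta_le] mult_left_mono prod_power_mono) auto
  qed
qed

lemma norm_theta_sq_le: "norm (theta z) ^ 2 \<le> ((a + \<bar>b\<bar>) * card I)\<^sup>2 * (\<Prod>j\<in>I. (1 + norm (z j)) ^ 4)"
proof -
  have "norm (theta z) ^ 2 \<le> ((a + \<bar>b\<bar>) * card I * (\<Prod>j\<in>I. (1 + norm (z j)) ^ 2)) ^ 2"
    by (intro power_mono norm_theta_le) simp
  also have "\<dots> = ((a + \<bar>b\<bar>) * card I)\<^sup>2 * (\<Prod>j\<in>I. (1 + norm (z j)) ^ 4)"
    by (simp only: power_mult_distrib prod_power_distrib power_mult[symmetric]) simp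
  finally show ?thesis .
qed

text \<open>The quadratic remainder is controlled by the kernels at \<open>s + h\<close> and
  \<open>s - h\<close>, whose Gaussian parameters must be nonnegative; therefore
  \<open>\<bar>h\<bar> \<le> s\<close>. For this reason the maximum principle asks for derivatives
  at interior times and for continuity on the closed interval.\<close>

lemma Vpath_has_derivative:
  assumes s: "0 < s"
  shows "((\<lambda>s. Re (Vpath s)) has_real_derivative Re (Vpath' s)) (at s)"
proof (rule has_real_derivative_quadratic[OF s])
  fix h assume h: "\<bar>h\<bar> \<le> s"
  then have sh: "0 \<le> s + h" "s + h \<le> 2 * s" "0 \<le> s + - h" "s + - h \<le> 2 * s" "0 \<le> s" "s \<le> 2 * s" using s by auto
  let ?k = "\<lambda>s y. kern p I (a * s) (\<lambda>j. X j + b * s) (pt nest y)"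
  let ?G = "growth p I (a * (2 * s)) (\<lambda>j. X j + \<bar>b\<bar> * (2 * s))"
  let ?m = "((a + \<bar>b\<bar>) * card I)\<^sup>2"
  define B where "B = ?m * 2 ^ ((p + 1) * card I) * ?G"
  have kb: "norm (?k s' y) * norm (theta (pt nest y)) ^ 2 \<le> B * decay I y" if s': "0 \<le> s'" "s' \<le> 2 * s" for s' y
  proof -
    have as: "0 \<le> a * s'" using a s' by simp
    have "norm (?k s' y * theta (pt nest y) ^ 2) \<le> ?m * 2 ^ ((p + 1) * card I) * growth p I (a * s') (\<lambda>j. X j + b * s') * decay I y"
      by (rule kern_mult_le[OF I p as, of "\<lambda>z. theta z ^ 2"])
        (use theta_measurable norm_theta_sq_le in \<open>auto simp: norm_power\<close>)
    also have "\<dots> \<le> B * decay I y"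
      unfolding B_def by (intro mult_right_mono mult_left_mono growth_path_le s') (auto simp: decay_nonneg)
    finally show ?thesis by (simp add: norm_mult norm_power)
  qed
  have pw: "norm (?k (s + h) y - ?k s y - of_real h * (?k s y * theta (pt nest y))) \<le> (2 * B * h\<^sup>2) * decay I y" for y
  proof -
    let ?th = "theta (pt nest y)"
    have "?k (s + h) y - ?k s y - of_real h * (?k s y * ?th) = ?k s y * (exp (of_real h * ?th) - 1 - of_real h * ?th)"
      unfolding kern_path by (simp add: algebra_simps)
    then have "norm (?k (s + h) y - ?k s y - of_real h * (?k s y * ?th))
      = norm (?k s y) * norm (exp (of_real h * ?th) - 1 - of_real h * ?th)" by (simp only: norm_mult)
    also have "\<dots> \<le> norm (?k s y) * ((norm (of_real h * ?th))\<^sup>2 * (norm (exp (of_real h * ?th)) + norm (exp (- (of_real h * ?th)))))"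
      by (intro mult_left_mono norm_exp_diff2_le norm_ge_zero)
    also have "\<dots> = h\<^sup>2 * (norm (?k (s + h) y) * norm ?th ^ 2 + norm (?k (s + - h) y) * norm ?th ^ 2)"
      unfolding kern_path by (simp add: norm_mult power_mult_distrib algebra_simps)
    also have "\<dots> \<le> h\<^sup>2 * (B * decay I y + B * decay I y)"
      by (intro mult_left_mono add_mono kb sh) auto
    finally show ?thesis by (simp add: algebra_simps)
  qed
  have i: "integrable (lpow I) (?k s)" "integrable (lpow I) (?k (s + h))"
    "integrable (lpow I) (\<lambda>y. ?k s y * theta (pt nest y))"
    using kern_path_integrable sh by blast+
  have "Vpath (s + h) - Vpath s - of_real h * Vpath' s
    = of_real (Vnorm I) * (LINT y|lpow I. ?k (s + h) y - ?k s y - of_real h * (?k s y * theta (pt nest y)))"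
    unfolding Vpath_def Vpath'_def V_def lint_def using i by (simp add: algebra_simps)
  also have "norm \<dots> \<le> Vnorm I * ((2 * B * h\<^sup>2) * line_const ^ card I)"
  proof -
    note Vnorm_nonneg[of I]
    moreover have "norm (LINT y|lpow I. ?k (s + h) y - ?k s y - of_real h * (?k s y * theta (pt nest y)))
      \<le> (2 * B * h\<^sup>2) * line_const ^ card I"
      by (rule integral_decay_bound[OF I _ pw]) (use i in \<open>auto dest: borel_measurable_integrable\<close>)
    ultimately show ?thesis by (simp only: norm_mult norm_of_real abs_of_nonneg mult_left_mono)
  qed
  finally have "norm (Vpath (s + h) - Vpath s - of_real h * Vpath' s) \<le> (Vnorm I * (2 * B) * line_const ^ card I) * h\<^sup>2"
    by (simp add: mult_ac)
  then show "\<bar>Re (Vpath (s + h)) - Re (Vpath s) - h * Re (Vpath' s)\<bar> \<le> (Vnorm I * (2 * B) * line_const ^ card I) * h\<^sup>2"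
    using abs_Re_le_cmod[of "Vpath (s + h) - Vpath s - of_real h * Vpath' s"] by simp
qed

lemma Vpath_continuous: "continuous_on {0..S} (\<lambda>s. Re (Vpath s))"
  unfolding continuous_on_sequentially comp_def Vpath_def
  using a by (auto intro!: tendsto_Re V_tendsto I p tendsto_intros)

end

end

section \<open>Diffusive scaling of the dual systems\<close>

text \<open>\<open>h\<close> is the lattice spacing and \<open>d h\<close> the symbol of the
  correction to free motion at a collision. By \<open>d_bound\<close> its leading part is
  \<open>- L * h * (u - q * w)\<close> times an exponential that shifts particle \<open>i\<close> by
  \<open>gap\<close>; after the shift both particles stand at the same place, where
  \<open>kern_boundary\<close> applies. \<open>gap\<close> is 0 for the q-TAZRP and 1 for the
  ASEP.\<close>

locale scaling_system = q_parameter q + markov_generator Mv r mv Y c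
  for q :: real and Mv :: "'m set" and r :: "(nat \<Rightarrow> int) \<Rightarrow> 'm \<Rightarrow> real"
    and mv :: "'m \<Rightarrow> (nat \<Rightarrow> int) \<Rightarrow> nat \<Rightarrow> int" and Y :: "(nat \<Rightarrow> int) set" and c :: real +
  fixes k gap :: nat and pdn pup W L D0 :: real
    and coll :: "(nat \<Rightarrow> int) \<Rightarrow> nat set" and wt :: "(nat \<Rightarrow> int) \<Rightarrow> nat \<Rightarrow> real"
    and d :: "real \<Rightarrow> complex \<Rightarrow> complex \<Rightarrow> complex"
  assumes jumps: "0 \<le> pdn" "0 \<le> pup" "pdn + pup = 1"
    and coll: "\<And>y i. y \<in> Y \<Longrightarrow> i \<in> coll y \<Longrightarrow> Suc i < k \<and> y i = y (Suc i) + int gap \<and> 1 \<le> wt y i \<and> wt y i \<le> W"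
    and gen_exp: "\<And>y z (h :: real). y \<in> Y \<Longrightarrow>
      gen (\<lambda>y. exp (\<Sum>j<k. of_real (h * y j) * z j)) y = exp (\<Sum>j<k. of_real (h * y j) * z j) *
        ((\<Sum>j<k. of_real pdn * (exp (- (of_real h * z j)) - 1) + of_real pup * (exp (of_real h * z j) - 1))
          - (\<Sum>i\<in>coll y. of_real (wt y i) * d h (z i) (z (Suc i))))"
    and d_bound: "\<And>(h :: real) u w. 0 < h \<Longrightarrow> h \<le> 1 \<Longrightarrow> 0 \<le> Re u \<Longrightarrow> Re u \<le> nest k \<Longrightarrow> 0 \<le> Re w \<Longrightarrow> Re w \<le> nest k \<Longrightarrow>
      norm (d h u w + of_real (L * h) * (u - of_real q * w) * exp (- (of_real (gap * h) * u)))
        \<le> D0 * h\<^sup>2 * ((1 + norm u) ^ 2 * (1 + norm w) ^ 2)"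
    and d_measurable: "\<And>h. (\<lambda>z. d h (fst z) (snd z)) \<in> borel_measurable (borel \<Otimes>\<^sub>M borel)"
    and kappa: "0 < L" and W: "1 \<le> W"
begin

abbreviation "leb \<equiv> lpow {..<k}"
abbreviation "lintk \<equiv> lint {..<k} nest"
abbreviation "Vk \<equiv> Vnorm {..<k}"
abbreviation quart :: "(nat \<Rightarrow> complex) \<Rightarrow> real" where "quart z \<equiv> (\<Prod>j<k. (1 + norm (z j)) ^ 4)"

definition v :: real where "v = pdn - pup"

definition deg :: nat where "deg = k + 5"

definition lam :: "real \<Rightarrow> complex \<Rightarrow> complex" where
  "lam h u = of_real pdn * (exp (- (of_real h * u)) - 1) + of_real pup * (exp (of_real h * u) - 1)"

definition \<theta> :: "real \<Rightarrow> (nat \<Rightarrow> complex) \<Rightarrow> complex" where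
  "\<theta> h z = (\<Sum>j<k. of_real (h\<^sup>2) * (z j)\<^sup>2 / 2 + of_real (- (v * h)) * z j)"

definition knl :: "real \<Rightarrow> real \<Rightarrow> real \<Rightarrow> (nat \<Rightarrow> int) \<Rightarrow> (nat \<Rightarrow> complex) \<Rightarrow> complex" where
  "knl h x s y z = kern deg {..<k} (h\<^sup>2 * s) (\<lambda>j. (h * y j + x) + (- (v * h)) * s) z"

text \<open>The nested integral seen from the lattice: the moving frame removes the downward drift
  of the dual particles, of speed \<open>v\<close>, and \<open>x\<close> translates the smoothed
  indicator.\<close>

definition U :: "real \<Rightarrow> real \<Rightarrow> real \<Rightarrow> (nat \<Rightarrow> int) \<Rightarrow> real" where
  "U h x s y = Re (V deg {..<k} (h\<^sup>2 * s) (\<lambda>j. (h * y j + x) + (- (v * h)) * s))"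

definition U' :: "real \<Rightarrow> real \<Rightarrow> real \<Rightarrow> (nat \<Rightarrow> int) \<Rightarrow> real" where
  "U' h x s y = Re (of_real (Vk) *
     lintk (\<lambda>z. knl h x s y z * \<theta> h z))"

section \<open>The comparison function and its residual in the dual equation\<close>

lemma deg: "finite {..<k}" "card {..<k} + 5 \<le> deg"
  by (simp_all add: deg_def)

lemma nest_le: "j < k \<Longrightarrow> nest j \<le> nest k"
  using nest_less'[of j k] by simp

lemma U_has_derivative: "0 < s \<Longrightarrow> ((\<lambda>s. U h x s y) has_real_derivative U' h x s y) (at s)"
  using Vpath_has_derivative[OF deg zero_le_power2[of h], where X = "\<lambda>j. h * y j + x" and b = "- (v * h)" and s = s]
  unfolding Vpath_def[OF deg zero_le_power2] Vpath'_def[OF deg zero_le_power2] theta_def[OF deg zero_le_power2]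
    U_def U'_def knl_def \<theta>_def by simp

lemma U_continuous: "continuous_on {0..S} (\<lambda>s. U h x s y)"
  using Vpath_continuous[OF deg zero_le_power2[of h], where X = "\<lambda>j. h * y j + x" and b = "- (v * h)" and S = S]
  unfolding Vpath_def[OF deg zero_le_power2] U_def by simp

text \<open>The dependence on positions in the growth bound of the kernel on the lines
  \<open>nest\<close>. As an exponential of the positions it is also multiplied by a number, the
  real part of \<open>nsym h y\<close>, under the generator.\<close>

definition E :: "real \<Rightarrow> real \<Rightarrow> (nat \<Rightarrow> int) \<Rightarrow> real" where
  "E h s y = exp (\<Sum>j<k. (h * y j + (- (v * h)) * s) * nest j)"

definition G :: "real \<Rightarrow> real \<Rightarrow> real" where
  "G tm R0 = kconst deg {..<k} * exp (\<Sum>j<k. deg * nest j + tm * (nest j)\<^sup>2 / 2 + R0 * nest j)"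

definition sym :: "real \<Rightarrow> (nat \<Rightarrow> int) \<Rightarrow> (nat \<Rightarrow> complex) \<Rightarrow> complex" where
  "sym h y z = (\<Sum>j<k. lam h (z j)) - (\<Sum>i\<in>coll y. of_real (wt y i) * d h (z i) (z (Suc i)))"

abbreviation "nsym h y \<equiv> sym h y (\<lambda>j. of_real (nest j))"

lemma G_nonneg: "0 \<le> G tm R0"
  by (simp add: G_def kconst_nonneg)

lemma knl_split: "knl h x s y z = kern deg {..<k} (h\<^sup>2 * s) (\<lambda>j. x + (- (v * h)) * s) z * exp (\<Sum>j<k. of_real (h * y j) * z j)"
proof -
  have "(\<Sum>j<k. of_real (h\<^sup>2 * s) * (z j)\<^sup>2 / 2 + of_real ((h * y j + x) + (- (v * h)) * s) * z j)
    = (\<Sum>j<k. of_real (h\<^sup>2 * s) * (z j)\<^sup>2 / 2 + of_real (x + (- (v * h)) * s) * z j) + (\<Sum>j<k. of_real (h * y j) * z j)"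
    unfolding sum.distrib[symmetric] by (intro sum.cong refl) (simp add: algebra_simps)
  then show ?thesis by (simp only: knl_def kern_def gexp_def exp_add mult.assoc)
qed

lemma knl_integrable:
  assumes "0 \<le> s" "(\<lambda>y. M (pt nest y)) \<in> borel_measurable (leb)"
    "\<And>u. norm (M (pt nest u)) \<le> m * quart (pt nest u)"
  shows "integrable (leb) (\<lambda>u. knl h x s y (pt nest u) * M (pt nest u))"
  unfolding knl_def by (rule kern_mult_integrable[OF deg _ assms(2,3)]) (use assms(1) in auto)

lemma knl_lint_le:
  assumes s: "0 \<le> s" "h\<^sup>2 * s \<le> tm" and x: "\<bar>x\<bar> \<le> R0"
    and M: "(\<lambda>y. M (pt nest y)) \<in> borel_measurable (leb)"
    "\<And>u. norm (M (pt nest u)) \<le> m * quart (pt nest u)" and m: "0 \<le> m"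
  shows "norm (lintk (\<lambda>z. knl h x s y z * M z)) \<le> m * (G tm R0 * E h s y)"
proof -
  have "norm (lintk (\<lambda>z. knl h x s y z * M z))
    \<le> m * kconst deg {..<k} * growth deg {..<k} (h\<^sup>2 * s) (\<lambda>j. (h * y j + x) + (- (v * h)) * s)"
    unfolding knl_def by (rule lint_kern_le[OF deg _ M]) (use s in auto)
  also have "growth deg {..<k} (h\<^sup>2 * s) (\<lambda>j. (h * y j + x) + (- (v * h)) * s)
    \<le> exp (\<Sum>j<k. (deg * nest j + tm * (nest j)\<^sup>2 / 2 + R0 * nest j) + (h * y j + (- (v * h)) * s) * nest j)"
    unfolding growth_def
  proof (intro iffD2[OF exp_le_cancel_iff] sum_mono)
    fix j
    have n: "0 \<le> nest j" using nest_ge_1[of j] by simp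
    have "h\<^sup>2 * s * (nest j)\<^sup>2 / 2 \<le> tm * (nest j)\<^sup>2 / 2" using s by (intro divide_right_mono mult_right_mono) auto
    moreover have "x * nest j \<le> R0 * nest j" using x n by (intro mult_right_mono) auto
    ultimately show "deg * nest j + h\<^sup>2 * s * (nest j)\<^sup>2 / 2 + ((h * y j + x) + (- (v * h)) * s) * nest j
      \<le> (deg * nest j + tm * (nest j)\<^sup>2 / 2 + R0 * nest j) + (h * y j + (- (v * h)) * s) * nest j"
      by (simp add: algebra_simps)
  qed
  also have "\<dots> = exp (\<Sum>j<k. deg * nest j + tm * (nest j)\<^sup>2 / 2 + R0 * nest j) * E h s y"
    by (simp only: E_def exp_add sum.distrib)
  finally show ?thesis using m kconst_nonneg by (simp add: G_def mult_left_mono mult.assoc)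
qed

lemma coll_subset: "y \<in> Y \<Longrightarrow> coll y \<subseteq> {..<k}"
proof
  fix i assume "y \<in> Y" "i \<in> coll y"
  from coll[OF this] show "i \<in> {..<k}" by simp
qed

lemma coll_finite: "y \<in> Y \<Longrightarrow> finite (coll y)"
  by (rule finite_subset[OF coll_subset finite_lessThan])

lemma d_pt_measurable:
  assumes "i < k" "j < k"
  shows "(\<lambda>y. d h (pt nest y i) (pt nest y j)) \<in> borel_measurable (leb)"
proof -
  have "i \<in> {..<k}" "j \<in> {..<k}" using assms by auto
  from measurable_Pair[OF pt_measurable[OF this(1)] pt_measurable[OF this(2)]]
  have "(\<lambda>y. (pt nest y i, pt nest y j)) \<in> leb \<rightarrow>\<^sub>M borel \<Otimes>\<^sub>M borel" .
  from measurable_compose[OF this d_measurable] show ?thesis by (simp only: fst_conv snd_conv)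
qed

text \<open>In the integral the positions enter through one exponential factor only, so the
  generator acts under the integral sign as multiplication by its symbol.\<close>

lemma gen_U:
  assumes y: "y \<in> Y" and s: "0 \<le> s"
  shows "gen (\<lambda>y. U h x s y) y = Re (of_real (Vk) * lintk (\<lambda>z. knl h x s y z * sym h y z))"
    "integrable (leb) (\<lambda>u. knl h x s y (pt nest u) * sym h y (pt nest u))"
proof -
  have i: "integrable (leb) (\<lambda>u. knl h x s y (pt nest u))" for y
    using knl_integrable[OF s, of "\<lambda>_. 1" 1] one_le_prod_bound[where I = "{..<k}" and n = 4] by simp
  have D1: "a * (b * e - b * e') = b * (a * (e - e'))" for a b e e' :: complex by (simp add: algebra_simps)
  have D2: "a *\<^sub>R (Re (n * b) - Re (n * b')) = a * Re (n * (b - b'))" for a n b b'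
    by (simp add: right_diff_distrib)
  have D3: "a * Re (of_real n * b) = Re (of_real n * (of_real a * b))" for a n b by simp
  have pw: "(\<Sum>m\<in>Mv. of_real (r y m) * (knl h x s (mv m y) z - knl h x s y z)) = knl h x s y z * sym h y z" for z
  proof -
    have "(\<Sum>m\<in>Mv. of_real (r y m) * (knl h x s (mv m y) z - knl h x s y z))
      = kern deg {..<k} (h\<^sup>2 * s) (\<lambda>j. x + (- (v * h)) * s) z * gen (\<lambda>y. exp (\<Sum>j<k. of_real (h * y j) * z j)) y"
      unfolding knl_split gen_def scaleR_conv_of_real sum_distrib_left D1 ..
    also have "gen (\<lambda>y. exp (\<Sum>j<k. of_real (h * y j) * z j)) y = exp (\<Sum>j<k. of_real (h * y j) * z j) * sym h y z"
      unfolding sym_def lam_def by (rule gen_exp[OF y])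
    finally show ?thesis unfolding knl_split by (simp only: mult.assoc)
  qed
  have "integrable (leb) (\<lambda>u. \<Sum>m\<in>Mv. of_real (r y m) * (knl h x s (mv m y) (pt nest u) - knl h x s y (pt nest u)))"
    by (intro Bochner_Integration.integrable_sum integrable_mult_right Bochner_Integration.integrable_diff i)
  then show "integrable (leb) (\<lambda>u. knl h x s y (pt nest u) * sym h y (pt nest u))" unfolding pw .
  have "gen (\<lambda>y. U h x s y) y = (\<Sum>m\<in>Mv. r y m * Re (of_real (Vk) * (LINT u|leb. knl h x s (mv m y) (pt nest u) - knl h x s y (pt nest u))))"
    unfolding gen_def U_def V_def lint_def knl_def[symmetric] Bochner_Integration.integral_diff[OF i i] D2 ..
  also have "\<dots> = Re (of_real (Vk) * (\<Sum>m\<in>Mv. of_real (r y m) * (LINT u|leb. knl h x s (mv m y) (pt nest u) - knl h x s y (pt nest u))))"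
    unfolding sum_distrib_left Re_sum D3 ..
  also have "(\<Sum>m\<in>Mv. of_real (r y m) * (LINT u|leb. knl h x s (mv m y) (pt nest u) - knl h x s y (pt nest u)))
    = (LINT u|leb. (\<Sum>m\<in>Mv. of_real (r y m) * (knl h x s (mv m y) (pt nest u) - knl h x s y (pt nest u))))"
    unfolding integral_mult_right_zero[symmetric]
    by (intro Bochner_Integration.integral_sum[symmetric] integrable_mult_right Bochner_Integration.integrable_diff i)
  also have "\<dots> = lintk (\<lambda>z. knl h x s y z * sym h y z)" unfolding pw lint_def ..
  finally show "gen (\<lambda>y. U h x s y) y = Re (of_real (Vk) * lintk (\<lambda>z. knl h x s y z * sym h y z))" .
qed

text \<open>The difference of \<open>pdn\<close> and \<open>pup\<close> gives the linear coefficient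
  \<open>- (v * h)\<close>, their sum 1 the quadratic one; what is left is the third-order remainder
  of the two exponentials.\<close>

lemma lam_approx:
  assumes h: "0 < h" "h \<le> 1" and u: "\<bar>Re u\<bar> \<le> nest k"
  shows "norm (lam h u - (of_real (h\<^sup>2) * u\<^sup>2 / 2 + of_real (- (v * h)) * u)) \<le> h ^ 3 * exp (nest k) * norm u ^ 3"
proof -
  let ?w = "of_real h * u"
  have "h * \<bar>Re u\<bar> \<le> 1 * nest k" using h u by (intro mult_mono) auto
  then have e: "exp \<bar>Re ?w\<bar> \<le> exp (nest k)" using h by (simp add: abs_mult)
  have b: "norm (exp w - 1 - w - w\<^sup>2 / 2) \<le> h ^ 3 * exp (nest k) * norm u ^ 3" if "w = ?w \<or> w = - ?w" for w
  proof -
    have "norm (exp w - 1 - w - w\<^sup>2 / 2) \<le> exp \<bar>Re w\<bar> * norm w ^ 3" by (rule norm_exp_diff3_le)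
    also have "\<dots> \<le> exp (nest k) * norm w ^ 3" using that e by (intro mult_right_mono) auto
    also have "norm w ^ 3 = h ^ 3 * norm u ^ 3" using that h by (auto simp: norm_mult power_mult_distrib)
    finally show ?thesis by (simp add: mult_ac)
  qed
  have vc: "complex_of_real v = of_real pdn - of_real pup" by (simp add: v_def)
  have p1: "complex_of_real pdn + of_real pup = 1" using jumps(3) by (metis of_real_1 of_real_add)
  have "lam h u - (of_real (h\<^sup>2) * u\<^sup>2 / 2 + of_real (- (v * h)) * u)
    = of_real pdn * (exp (- ?w) - 1 - (- ?w) - (- ?w)\<^sup>2 / 2) + of_real pup * (exp ?w - 1 - ?w - ?w\<^sup>2 / 2)
      + (of_real pdn + of_real pup - 1) * (?w\<^sup>2 / 2)"
    unfolding lam_def by (simp add: vc power_mult_distrib) (simp add: algebra_simps add_divide_distrib diff_divide_distrib)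
  also have "norm \<dots> \<le> pdn * (h ^ 3 * exp (nest k) * norm u ^ 3) + pup * (h ^ 3 * exp (nest k) * norm u ^ 3)"
    unfolding p1 using jumps b[of "- ?w"] b[of ?w]
    by (intro order_trans[OF norm_triangle_ineq] order_trans[OF add_mono[OF norm_triangle_ineq order_refl]])
      (auto simp: norm_mult intro!: add_mono mult_left_mono)
  also have "\<dots> = h ^ 3 * exp (nest k) * norm u ^ 3" using jumps(3) by (simp add: distrib_right[symmetric])
  finally show ?thesis .
qed

lemma D0_nonneg: "0 \<le> D0"
proof -
  have n: "0 \<le> nest k" using nest_ge_1[of k] by simp
  have "0 \<le> norm (d 1 0 0 + of_real (L * 1) * (0 - of_real q * 0) * exp (- (of_real (gap * (1::real)) * 0)))"
    by (rule norm_ge_zero)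
  also have "\<dots> \<le> D0 * 1\<^sup>2 * ((1 + norm (0 :: complex)) ^ 2 * (1 + norm (0 :: complex)) ^ 2)"
    by (rule d_bound) (use n in auto)
  finally show ?thesis by simp
qed

lemma pair_le_prod:
  assumes "Suc i < k"
  shows "(1 + norm (z i)) ^ 2 * (1 + norm (z (Suc i))) ^ 2 \<le> quart z"
proof -
  have "(\<Prod>j\<in>{i, Suc i}. (1 + norm (z j)) ^ 2) \<le> (\<Prod>j<k. (1 + norm (z j)) ^ 2)"
    using assms by (intro prod_mono2) (auto intro: one_le_power)
  also have "\<dots> \<le> quart z" by (rule prod_power_mono) simp
  finally show ?thesis by simp
qed

text \<open>The exponential lowers the position of particle \<open>i\<close> by \<open>gap\<close>,
  which places it on its neighbour: \<open>X' i = X' (Suc i)\<close>. The leading collision term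
  thus integrates to zero exactly, not merely up to higher order.\<close>

lemma knl_collision:
  fixes h :: real
  assumes y: "y \<in> Y" and i: "i \<in> coll y" and s: "0 \<le> s"
  shows "lintk (\<lambda>z. knl h x s y z * ((z i - of_real q * z (Suc i)) * exp (- (of_real (gap * h) * z i)))) = 0"
    "integrable (leb) (\<lambda>u. knl h x s y (pt nest u) *
      ((pt nest u i - of_real q * pt nest u (Suc i)) * exp (- (of_real (gap * h) * pt nest u i))))"
proof -
  have ik: "Suc i < k" "y i = y (Suc i) + int gap" using coll[OF y i] by auto
  define X' where "X' j = (h * y j + x) + (- (v * h)) * s - (if j = i then gap * h else 0)" for j
  have eq: "knl h x s y z * ((z i - of_real q * z (Suc i)) * exp (- (of_real (gap * h) * z i)))
    = kern deg {..<k} (h\<^sup>2 * s) X' z * (z i - of_real q * z (Suc i))" for z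
  proof -
    have "of_real (X' j) * z j = of_real ((h * y j + x) + (- (v * h)) * s) * z j
      - (if j = i then of_real (gap * h) * z j else 0)" for j
      by (simp add: X'_def left_diff_distrib)
    then have "(\<Sum>j<k. of_real (h\<^sup>2 * s) * (z j)\<^sup>2 / 2 + of_real (X' j) * z j)
      = (\<Sum>j<k. of_real (h\<^sup>2 * s) * (z j)\<^sup>2 / 2 + of_real ((h * y j + x) + (- (v * h)) * s) * z j)
        + - (of_real (gap * h) * z i)"
      using ik by (simp only: sum.distrib sum_subtractf sum.delta finite_lessThan) simp
    then show ?thesis unfolding knl_def kern_def gexp_def by (simp only: exp_add mult_ac)
  qed
  have t: "0 \<le> h\<^sup>2 * s" using s by simp
  have "X' i = X' (Suc i)" using ik(2) by (simp add: X'_def algebra_simps)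
  then show "lintk (\<lambda>z. knl h x s y z * ((z i - of_real q * z (Suc i)) * exp (- (of_real (gap * h) * z i)))) = 0"
    unfolding eq by (intro kern_boundary[OF ik(1) _ t]) (simp_all add: deg_def)
  have M: "norm (z i - of_real q * z (Suc i)) \<le> 1 * quart z" for z :: "nat \<Rightarrow> complex"
  proof -
    have "norm (z i - of_real q * z (Suc i)) \<le> norm (z i) + norm (z (Suc i))"
      using q_pos q_less_1 by (intro order_trans[OF norm_triangle_ineq4]) (simp add: norm_mult mult_left_le_one_le)
    also have "\<dots> \<le> (1 + norm (z i)) ^ 2 * (1 + norm (z (Suc i))) ^ 2"
    proof -
      have "a + b \<le> (1 + a)\<^sup>2 * (1 + b)\<^sup>2" if "0 \<le> a" "0 \<le> b" for a b :: real
      proof -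
        have "a + b \<le> (1 + a) * (1 + b)" using that by (simp add: algebra_simps)
        also have "\<dots> \<le> (1 + a)\<^sup>2 * (1 + b)\<^sup>2" using that by (intro mult_mono) (auto simp: power2_eq_square algebra_simps)
        finally show ?thesis .
      qed
      then show ?thesis by simp
    qed
    also note pair_le_prod[OF ik(1)]
    finally show ?thesis by simp
  qed
  show "integrable (leb) (\<lambda>u. knl h x s y (pt nest u) *
      ((pt nest u i - of_real q * pt nest u (Suc i)) * exp (- (of_real (gap * h) * pt nest u i))))"
    unfolding eq
  proof (rule kern_mult_integrable[OF deg t _ M])
    show "(\<lambda>y. pt nest y i - of_real q * pt nest y (Suc i)) \<in> borel_measurable (leb)"
      using ik(1) by (intro borel_measurable_diff borel_measurable_times borel_measurable_const pt_measurable) auto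
  qed
qed

definition CV :: "real \<Rightarrow> real \<Rightarrow> real" where
  "CV tm R0 = Vk * G tm R0 * (k * exp (nest k) + W * D0)"

lemma CV_nonneg: "0 \<le> CV tm R0"
  using Vnorm_nonneg G_nonneg D0_nonneg W by (simp add: CV_def)

lemma lam_measurable: "j < k \<Longrightarrow> (\<lambda>y. lam h (pt nest y j)) \<in> borel_measurable (leb)"
  unfolding lam_def
  by (intro borel_measurable_add borel_measurable_times borel_measurable_const borel_measurable_diff
      borel_measurable_uminus measurable_compose[OF _ borel_measurable_exp] pt_measurable) auto

text \<open>In the bulk the symbol misses the heat operator by a cubic remainder. At a collision the
  leading term integrates to zero and \<open>d_bound\<close> leaves an error of order
  \<open>h\<^sup>2\<close>. Over times of order \<open>1 / h\<^sup>2\<close> the first sums up to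
  order \<open>h\<close>, but the second would not be small; it has to be compensated by the
  barrier.\<close>

lemma U_residual:
  assumes h: "0 < h" "h \<le> 1" and y: "y \<in> Y" and s: "0 \<le> s" "h\<^sup>2 * s \<le> tm" and x: "\<bar>x\<bar> \<le> R0"
  shows "\<bar>U' h x s y - gen (U h x s) y\<bar> \<le> CV tm R0 * (h ^ 3 + h\<^sup>2 * card (coll y)) * E h s y"
proof -
  let ?P = "leb" and ?g = "G tm R0 * E h s y"
  define M1 where "M1 z = (\<Sum>j<k. (of_real (h\<^sup>2) * (z j)\<^sup>2 / 2 + of_real (- (v * h)) * z j) - lam h (z j))" for z
  define m2 where "m2 i z = d h (z i) (z (Suc i))
    + of_real (L * h) * (z i - of_real q * z (Suc i)) * exp (- (of_real (gap * h) * z i))" for i z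
  define m3 :: "nat \<Rightarrow> (nat \<Rightarrow> complex) \<Rightarrow> complex" where "m3 i z = (z i - of_real q * z (Suc i)) * exp (- (of_real (gap * h) * z i))" for i z
  define M2 where "M2 z = (\<Sum>i\<in>coll y. of_real (wt y i) * m2 i z)" for z
  have fin: "finite (coll y)" by (rule coll_finite[OF y])
  have split: "\<theta> h z = sym h y z + M1 z + (M2 z - (\<Sum>i\<in>coll y. of_real (wt y i * L * h) * m3 i z))" for z
    unfolding \<theta>_def sym_def M1_def M2_def m2_def m3_def sum_subtractf[symmetric]
    by (simp add: sum_subtractf distrib_left sum.distrib mult.assoc)
  have pos: "0 \<le> nest j" "nest j \<le> nest k" if "j < k" for j
    using nest_ge_1[of j] nest_le[OF that] by auto
  have b1: "norm (M1 (pt nest u)) \<le> (k * exp (nest k) * h ^ 3) * quart (pt nest u)" for u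
  proof -
    have "norm (M1 (pt nest u)) \<le> (\<Sum>j<k. h ^ 3 * exp (nest k) * (1 + norm (pt nest u j)) ^ 4)"
      unfolding M1_def
    proof (rule sum_norm_le)
      fix j assume "j \<in> {..<k}"
      then have "norm (of_real (h\<^sup>2) * (pt nest u j)\<^sup>2 / 2 + of_real (- (v * h)) * pt nest u j - lam h (pt nest u j))
        \<le> h ^ 3 * exp (nest k) * norm (pt nest u j) ^ 3"
        using pos[of j] by (subst norm_minus_commute, intro lam_approx[OF h]) simp
      also have "\<dots> \<le> h ^ 3 * exp (nest k) * (1 + norm (pt nest u j)) ^ 4"
      proof (intro mult_left_mono)
        have "norm (pt nest u j) ^ 3 \<le> (1 + norm (pt nest u j)) ^ 3" by (intro power_mono) auto
        also have "\<dots> \<le> (1 + norm (pt nest u j)) ^ 4" by (intro power_increasing) auto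
        finally show "norm (pt nest u j) ^ 3 \<le> (1 + norm (pt nest u j)) ^ 4" .
      qed (use h in auto)
      finally show "norm (of_real (h\<^sup>2) * (pt nest u j)\<^sup>2 / 2 + of_real (- (v * h)) * pt nest u j - lam h (pt nest u j))
        \<le> h ^ 3 * exp (nest k) * (1 + norm (pt nest u j)) ^ 4" .
    qed
    also have "\<dots> \<le> h ^ 3 * exp (nest k) * (card {..<k} * quart (pt nest u))"
      unfolding sum_distrib_left[symmetric] using h
      by (intro mult_left_mono sum_le_card_mult_prod) (auto intro: one_le_power)
    finally show ?thesis by (simp add: mult_ac)
  qed
  have m1: "(\<lambda>u. M1 (pt nest u)) \<in> borel_measurable ?P"
    unfolding M1_def by (intro borel_measurable_sum borel_measurable_diff lam_measurable borel_measurable_add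
      borel_measurable_divide borel_measurable_times borel_measurable_power borel_measurable_const pt_measurable) auto
  have b2: "norm (m2 i (pt nest u)) \<le> (D0 * h\<^sup>2) * quart (pt nest u)" if i: "i \<in> coll y" for i u
  proof -
    have ik: "Suc i < k" using coll[OF y i] by auto
    have "norm (m2 i (pt nest u)) \<le> D0 * h\<^sup>2 * ((1 + norm (pt nest u i)) ^ 2 * (1 + norm (pt nest u (Suc i))) ^ 2)"
      unfolding m2_def by (rule d_bound[OF h]) (use pos[of i] pos[of "Suc i"] ik in auto)
    also have "\<dots> \<le> D0 * h\<^sup>2 * quart (pt nest u)"
      using D0_nonneg by (intro mult_left_mono pair_le_prod[OF ik]) auto
    finally show ?thesis .
  qed
  have m2: "(\<lambda>u. m2 i (pt nest u)) \<in> borel_measurable ?P" if i: "i \<in> coll y" for i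
  proof -
    have ik: "Suc i < k" using coll[OF y i] by auto
    show ?thesis unfolding m2_def using ik
      by (intro borel_measurable_add d_pt_measurable borel_measurable_times borel_measurable_const borel_measurable_diff
        borel_measurable_uminus measurable_compose[OF _ borel_measurable_exp] pt_measurable) auto
  qed
  have b2': "norm (M2 (pt nest u)) \<le> (card (coll y) * (W * (D0 * h\<^sup>2))) * quart (pt nest u)" for u
  proof -
    have "norm (M2 (pt nest u)) \<le> (\<Sum>i\<in>coll y. W * ((D0 * h\<^sup>2) * quart (pt nest u)))"
      unfolding M2_def
    proof (rule sum_norm_le)
      fix i assume i: "i \<in> coll y"
      show "norm (of_real (wt y i) * m2 i (pt nest u)) \<le> W * ((D0 * h\<^sup>2) * quart (pt nest u))"
        unfolding norm_mult using coll[OF y i] W by (intro mult_mono b2 i) auto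
    qed
    then show ?thesis by (simp add: mult_ac)
  qed
  have m2': "(\<lambda>u. M2 (pt nest u)) \<in> borel_measurable ?P"
    unfolding M2_def by (intro borel_measurable_sum borel_measurable_times borel_measurable_const m2)
  note i1 = knl_integrable[OF s(1) m1 b1, of h x y] and i2 = knl_integrable[OF s(1) m2' b2', of h x y]
  have i3: "integrable ?P (\<lambda>u. of_real (wt y i * L * h) * (knl h x s y (pt nest u) * m3 i (pt nest u)))" if "i \<in> coll y" for i
    unfolding m3_def by (intro integrable_mult_right knl_collision(2)[OF y that s(1)])
  have c3: "(LINT u|?P. of_real (wt y i * L * h) * (knl h x s y (pt nest u) * m3 i (pt nest u))) = 0" if "i \<in> coll y" for i
    using knl_collision(1)[OF y that s(1), of h x] unfolding m3_def lint_def by simp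
  let ?S = "\<lambda>z. \<Sum>i\<in>coll y. of_real (wt y i * L * h) * (knl h x s y z * m3 i z)"
  have pw: "knl h x s y z * \<theta> h z = (knl h x s y z * sym h y z + knl h x s y z * M1 z) + (knl h x s y z * M2 z
    - ?S z)" for z
    unfolding split by (simp add: distrib_left right_diff_distrib sum_distrib_left mult.left_commute)
  have S3: "integrable ?P (\<lambda>u. ?S (pt nest u))"
    "(LINT u|?P. ?S (pt nest u)) = 0"
  proof -
    show "integrable ?P (\<lambda>u. ?S (pt nest u))"
      by (intro Bochner_Integration.integrable_sum i3)
    have "(LINT u|?P. ?S (pt nest u))
      = (\<Sum>i\<in>coll y. LINT u|?P. of_real (wt y i * L * h) * (knl h x s y (pt nest u) * m3 i (pt nest u)))"
      by (rule Bochner_Integration.integral_sum[OF i3])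
    also have "\<dots> = 0" by (rule sum.neutral) (use c3 in blast)
    finally show "(LINT u|?P. ?S (pt nest u)) = 0" .
  qed
  note isy = gen_U(2)[OF y s(1), of h x]
  let ?I = "\<lambda>M. lintk (\<lambda>z. knl h x s y z * M z)"
  have "lintk (\<lambda>z. knl h x s y z * \<theta> h z) = lintk (\<lambda>z. knl h x s y z * sym h y z)
    + (?I M1 + ?I M2)"
    unfolding lint_def pw
    Bochner_Integration.integral_add[OF Bochner_Integration.integrable_add[OF isy i1] Bochner_Integration.integrable_diff[OF i2 S3(1)]]
    Bochner_Integration.integral_add[OF isy i1] Bochner_Integration.integral_diff[OF i2 S3(1)] S3(2) by simp
  then have eq: "U' h x s y - gen (U h x s) y = Re (of_real (Vk) *
    (?I M1 + ?I M2))"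
    unfolding gen_U(1)[OF y s(1)] U'_def by (simp add: algebra_simps)
  have "\<bar>U' h x s y - gen (U h x s) y\<bar> \<le> norm (of_real (Vk) *
    (?I M1 + ?I M2))"
    unfolding eq by (rule abs_Re_le_cmod)
  also have "\<dots> = Vk * norm (?I M1 + ?I M2)"
    using Vnorm_nonneg by (simp only: norm_mult norm_of_real abs_of_nonneg)
  also have "\<dots> \<le> Vk * ((k * exp (nest k) * h ^ 3) * ?g + (card (coll y) * (W * (D0 * h\<^sup>2))) * ?g)"
  proof (rule mult_left_mono[OF order_trans[OF norm_triangle_ineq add_mono] Vnorm_nonneg])
    show "norm (?I M1) \<le> (k * exp (nest k) * h ^ 3) * ?g"
      by (rule knl_lint_le[OF s x m1 b1]) (use h in simp)
    show "norm (?I M2) \<le> (card (coll y) * (W * (D0 * h\<^sup>2))) * ?g"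
      by (rule knl_lint_le[OF s x m2' b2']) (use W D0_nonneg in simp)
  qed
  also have "\<dots> \<le> Vk * ((k * exp (nest k) + W * D0) * (h ^ 3 + h\<^sup>2 * card (coll y)) * ?g)"
  proof -
    have "0 \<le> k * exp (nest k) * (h\<^sup>2 * card (coll y)) + W * D0 * h ^ 3" using h W D0_nonneg by simp
    then have "k * exp (nest k) * h ^ 3 + card (coll y) * (W * (D0 * h\<^sup>2)) \<le> (k * exp (nest k) + W * D0) * (h ^ 3 + h\<^sup>2 * card (coll y))"
      by (simp add: algebra_simps)
    moreover have "0 \<le> ?g" using G_nonneg by (simp add: E_def)
    ultimately show ?thesis
      unfolding distrib_right[symmetric] using Vnorm_nonneg by (intro mult_left_mono mult_right_mono)
  qed
  finally show ?thesis by (simp add: CV_def mult_ac)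
qed

lemma abs_U_le:
  assumes "0 \<le> s" "h\<^sup>2 * s \<le> tm" "\<bar>x\<bar> \<le> R0"
  shows "\<bar>U h x s y\<bar> \<le> Vk * (G tm R0 * E h s y)"
proof -
  have "norm (lintk (\<lambda>z. knl h x s y z * 1)) \<le> 1 * (G tm R0 * E h s y)"
    using assms by (intro knl_lint_le) (simp_all add: one_le_prod_bound)
  moreover have "U h x s y = Re (of_real (Vk) * lintk (\<lambda>z. knl h x s y z * 1))"
    unfolding U_def V_def knl_def by simp
  ultimately show ?thesis
    using abs_Re_le_cmod[of "of_real (Vk) * lintk (\<lambda>z. knl h x s y z * 1)"] Vnorm_nonneg
    by (simp add: norm_mult) (meson mult_left_mono order_trans Vnorm_nonneg)
qed

section \<open>The exponential barrier and the comparison theorem\<close>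

definition N1 :: real where "N1 = (\<Sum>j<k. nest j)"

definition K3 :: real where "K3 = (\<Sum>j<k. (nest j)\<^sup>2 / 2 + exp (nest k) * nest j ^ 3)"

text \<open>Half of a lower bound for the leading collision term at the abscissas
  \<open>nest\<close>, per unit of \<open>h\<close>; the other half absorbs the quadratic error of
  \<open>d_bound\<close> as soon as \<open>h \<le> h1\<close>.\<close>

definition L2 :: real where "L2 = L * exp (- (gap * nest k)) / 2"

definition h1 :: real where "h1 = min 1 (L2 / (D0 * (1 + nest k) ^ 4 + 1))"

lemma L2_pos: "0 < L2"
  using kappa by (simp add: L2_def)

lemma h1_pos: "0 < h1"
  using L2_pos D0_nonneg nest_ge_1[of k] by (simp add: h1_def add_nonneg_pos)

lemma K3_nonneg: "0 \<le> K3"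
proof -
  have "0 \<le> nest j" for j using nest_ge_1[of j] by simp
  then show ?thesis unfolding K3_def by (intro sum_nonneg) simp
qed

lemma N1_nonneg: "0 \<le> N1"
  unfolding N1_def by (intro sum_nonneg order_trans[OF zero_le_one nest_ge_1])

lemma E_eq: "E h s y = exp (- (v * h * N1) * s) * Re (exp (\<Sum>j<k. of_real (h * y j) * of_real (nest j)))"
proof -
  have "(\<Sum>j<k. complex_of_real (h * y j) * of_real (nest j)) = of_real (\<Sum>j<k. h * y j * nest j)" by simp
  moreover have "(\<Sum>j<k. (h * y j + (- (v * h)) * s) * nest j) = - (v * h * N1) * s + (\<Sum>j<k. h * y j * nest j)"
  proof -
    have "(h * y j + (- (v * h)) * s) * nest j = (- (v * h) * s) * nest j + h * y j * nest j" for j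
      by (simp add: algebra_simps)
    then have "(\<Sum>j<k. (h * y j + (- (v * h)) * s) * nest j) = (- (v * h) * s) * N1 + (\<Sum>j<k. h * y j * nest j)"
      by (simp only: sum.distrib sum_distrib_left N1_def)
    then show ?thesis by (simp only: mult_ac minus_mult_left)
  qed
  ultimately show ?thesis by (simp only: E_def exp_add exp_of_real Re_complex_of_real)
qed

lemma gen_E:
  assumes "y \<in> Y"
  shows "gen (E h s) y = E h s y * Re (nsym h y)"
proof -
  let ?e = "\<lambda>y. exp (\<Sum>j<k. of_real (h * real_of_int (y j)) * complex_of_real (nest j))"
  have r: "?e y = of_real (exp (\<Sum>j<k. h * y j * nest j))" for y
    by (simp add: exp_of_real[symmetric])
  have "gen (E h s) y = gen (\<lambda>y. exp (- (v * h * N1) * s) * Re (?e y)) y" unfolding E_eq[abs_def] ..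
  also have "\<dots> = exp (- (v * h * N1) * s) * gen (\<lambda>y. Re (?e y)) y" by (rule gen_scale)
  also have "gen (\<lambda>y. Re (?e y)) y = Re (gen ?e y)" unfolding gen_def by simp
  also have "gen ?e y = ?e y * nsym h y"
    unfolding sym_def lam_def by (rule gen_exp[OF assms])
  also have "Re (?e y * nsym h y) = Re (?e y) * Re (nsym h y)"
    unfolding r by simp
  finally show ?thesis unfolding E_eq by (simp only: mult.assoc)
qed

text \<open>At a collision \<open>nest i - q * nest (Suc i)\<close> equals \<open>- nest i\<close>,
  which is negative, so the correction lowers the exponential by a relative amount of order
  \<open>h\<close>. The barrier carries a further factor \<open>h\<close>, and the two together
  match the collision error.\<close>

lemma Re_sym_nest_le:
  assumes h: "0 < h" "h \<le> h1" and y: "y \<in> Y"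
  shows "Re (nsym h y) \<le> - (v * h * N1) + h\<^sup>2 * K3 - card (coll y) * (L2 * h)"
proof -
  have h': "h \<le> 1" using h by (simp add: h1_def)
  have pos: "0 \<le> nest j" "nest j \<le> nest k" "1 \<le> nest j" if "j \<le> k" for j
    using nest_ge_1[of j] nest_le[of j] that by (cases "j = k"; auto)+
  have e32: "h ^ 3 \<le> h\<^sup>2" using h h' by (intro power_decreasing) auto
  have l: "Re (lam h (of_real (nest j))) \<le> - (v * h) * nest j + h\<^sup>2 * ((nest j)\<^sup>2 / 2 + exp (nest k) * nest j ^ 3)" if "j < k" for j
  proof -
    let ?u = "complex_of_real (nest j)"
    let ?a = "of_real (h\<^sup>2) * ?u\<^sup>2 / 2 + of_real (- (v * h)) * ?u"
    have "Re (lam h ?u - ?a) \<le> norm (lam h ?u - ?a)" by (rule complex_Re_le_cmod)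
    also have "\<dots> \<le> h ^ 3 * exp (nest k) * norm ?u ^ 3"
      using pos[of j] that by (intro lam_approx[OF h(1) h']) auto
    also have "\<dots> \<le> h\<^sup>2 * exp (nest k) * nest j ^ 3"
      using pos[of j] that e32 by (simp add: mult_right_mono)
    finally have "Re (lam h ?u) \<le> Re ?a + h\<^sup>2 * exp (nest k) * nest j ^ 3" by simp
    moreover have "?a = of_real (h\<^sup>2 * (nest j)\<^sup>2 / 2 + (- (v * h)) * nest j)" by simp
    then have "Re ?a = h\<^sup>2 * (nest j)\<^sup>2 / 2 + (- (v * h)) * nest j" by (simp only: Re_complex_of_real)
    ultimately show ?thesis by (simp add: distrib_left mult.assoc)
  qed
  have c: "L2 * h \<le> wt y i * Re (d h (of_real (nest i)) (of_real (nest (Suc i))))" if i: "i \<in> coll y" for i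
  proof -
    have ik: "Suc i < k" "1 \<le> wt y i" using coll[OF y i] by auto
    let ?u = "complex_of_real (nest i)" and ?w = "complex_of_real (nest (Suc i))"
    let ?b = "of_real (L * h) * (?u - of_real q * ?w) * exp (- (of_real (gap * h) * ?u))"
    have qn: "q * nest (Suc i) = 2 * nest i" using q_pos by (simp add: nest_def)
    have "?b = of_real (L * h * (nest i - q * nest (Suc i)) * exp (- (gap * h * nest i)))"
      by (simp add: exp_of_real[symmetric])
    also have "\<dots> = of_real (- (L * h * nest i * exp (- (gap * h * nest i))))" unfolding qn by simp
    finally have Rb: "Re ?b = - (L * h * nest i * exp (- (gap * h * nest i)))" by (simp only: Re_complex_of_real)
    have "- Re (d h ?u ?w + ?b) \<le> norm (d h ?u ?w + ?b)" using abs_Re_le_cmod[of "d h ?u ?w + ?b"] by simp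
    also have "\<dots> \<le> D0 * h\<^sup>2 * ((1 + norm ?u) ^ 2 * (1 + norm ?w) ^ 2)"
      using pos[of i] pos[of "Suc i"] ik by (intro d_bound[OF h(1) h']) auto
    also have "\<dots> \<le> D0 * h\<^sup>2 * ((1 + nest k) ^ 2 * (1 + nest k) ^ 2)"
      using pos[of i] pos[of "Suc i"] ik D0_nonneg by (intro mult_left_mono mult_mono power_mono) auto
    also have "\<dots> = (D0 * (1 + nest k) ^ 4 * h) * h" by (simp add: power2_eq_square power4_eq_xxxx mult_ac)
    also have "\<dots> \<le> L2 * h"
    proof (intro mult_right_mono)
      have pd: "0 < D0 * (1 + nest k) ^ 4 + 1" using D0_nonneg pos[of k] by (simp add: add_nonneg_pos)
      have "h \<le> L2 / (D0 * (1 + nest k) ^ 4 + 1)" using h by (simp add: h1_def)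
      then have "h * (D0 * (1 + nest k) ^ 4 + 1) \<le> L2" using pd by (simp add: pos_le_divide_eq)
      then show "D0 * (1 + nest k) ^ 4 * h \<le> L2" using h by (simp add: algebra_simps)
    qed (use h in auto)
    finally have "- Re (d h ?u ?w) + L * h * nest i * exp (- (gap * h * nest i)) \<le> L2 * h"
      using Rb by simp
    moreover have "2 * L2 * h \<le> L * h * nest i * exp (- (gap * h * nest i))"
    proof -
      have "h * nest i \<le> 1 * nest k" using h h' pos[of i] ik by (intro mult_mono) auto
      then have "gap * (h * nest i) \<le> gap * nest k" by (intro mult_left_mono) auto
      then have "exp (- (gap * nest k)) \<le> exp (- (gap * h * nest i))" by (simp add: mult.assoc)
      then have "(L * h * 1) * exp (- (gap * nest k)) \<le> (L * h * nest i) * exp (- (gap * h * nest i))"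
        using kappa h pos[of i] ik by (intro mult_mono) auto
      then show ?thesis by (simp add: L2_def mult_ac)
    qed
    ultimately have "L2 * h \<le> Re (d h ?u ?w)" by simp
    then have "1 * (L2 * h) \<le> wt y i * Re (d h ?u ?w)"
      using ik L2_pos h by (intro mult_mono) auto
    then show ?thesis by simp
  qed
  have "Re (nsym h y) = (\<Sum>j<k. Re (lam h (of_real (nest j))))
    - (\<Sum>i\<in>coll y. wt y i * Re (d h (of_real (nest i)) (of_real (nest (Suc i)))))"
    unfolding sym_def by simp
  also have "\<dots> \<le> (\<Sum>j<k. - (v * h) * nest j + h\<^sup>2 * ((nest j)\<^sup>2 / 2 + exp (nest k) * nest j ^ 3)) - (\<Sum>i\<in>coll y. L2 * h)"
    by (intro diff_mono sum_mono l c) auto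
  also have "\<dots> = - (v * h * N1) + h\<^sup>2 * K3 - card (coll y) * (L2 * h)"
    by (simp only: sum.distrib sum_distrib_left[symmetric] N1_def K3_def sum_constant) simp
  finally show ?thesis .
qed

text \<open>The first summand pays for the bulk error. The second is the collision error divided by
  the relative decrease of the barrier at a collision.\<close>

definition K2 :: "real \<Rightarrow> real \<Rightarrow> real" where "K2 tm R0 = CV tm R0 + CV tm R0 / L2"

text \<open>The barrier: at a collision point it decreases at a rate of order \<open>h\<^sup>2\<close>, which absorbs the error
  of the collision terms.\<close>

definition bar :: "real \<Rightarrow> real \<Rightarrow> real \<Rightarrow> real \<Rightarrow> (nat \<Rightarrow> int) \<Rightarrow> real" where
  "bar tm R0 h s y = h * K2 tm R0 * exp ((K3 + 1) * h\<^sup>2 * s) * E h s y"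

lemma K2_nonneg: "0 \<le> K2 tm R0"
  using CV_nonneg L2_pos by (simp add: K2_def)

lemma E_has_derivative: "((\<lambda>s. E h s y) has_real_derivative - (v * h * N1) * E h s y) (at s)"
  unfolding E_eq
  by (rule DERIV_cong[OF DERIV_cmult_right[OF DERIV_chain2[OF DERIV_exp DERIV_cmult_Id]]]) (simp only: mult_ac)

lemma bar_has_derivative:
  "((\<lambda>s. bar tm R0 h s y) has_real_derivative ((K3 + 1) * h\<^sup>2 - v * h * N1) * bar tm R0 h s y) (at s)"
  unfolding bar_def
  by (rule DERIV_cong[OF DERIV_mult[OF DERIV_cmult[OF DERIV_chain2[OF DERIV_exp DERIV_cmult_Id]] E_has_derivative]])
    (simp add: algebra_simps)

lemma bar_super:
  assumes h: "0 < h" "h \<le> h1" and y: "y \<in> Y" and s: "0 \<le> s"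
  shows "gen (bar tm R0 h s) y + CV tm R0 * (h ^ 3 + h\<^sup>2 * card (coll y)) * E h s y
    \<le> ((K3 + 1) * h\<^sup>2 - v * h * N1) * bar tm R0 h s y"
proof -
  let ?b = "bar tm R0 h s y" and ?n = "card (coll y)"
  have Ep: "0 \<le> E h s y" by (simp add: E_def)
  have b0: "0 \<le> ?b" using h K2_nonneg Ep by (simp add: bar_def)
  have "gen (bar tm R0 h s) y = ?b * Re (nsym h y)"
    unfolding bar_def[abs_def] gen_scale gen_E[OF y] by (simp only: mult.assoc)
  also have "\<dots> \<le> ?b * (- (v * h * N1) + h\<^sup>2 * K3 - ?n * (L2 * h))"
    by (intro mult_left_mono Re_sym_nest_le h y b0)
  finally have 1: "gen (bar tm R0 h s) y \<le> ?b * (- (v * h * N1) + h\<^sup>2 * K3 - ?n * (L2 * h))" .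
  have "CV tm R0 * (h ^ 3 + h\<^sup>2 * ?n) = h * (CV tm R0 * h\<^sup>2 + CV tm R0 / L2 * (?n * (L2 * h)))"
    using L2_pos by (simp add: algebra_simps power2_eq_square power3_eq_cube)
  also have "\<dots> \<le> h * (K2 tm R0 * h\<^sup>2 + K2 tm R0 * (?n * (L2 * h)))"
    using h CV_nonneg L2_pos by (intro mult_left_mono add_mono mult_right_mono) (simp_all add: K2_def)
  finally have "CV tm R0 * (h ^ 3 + h\<^sup>2 * ?n) * E h s y \<le> (h * (K2 tm R0 * h\<^sup>2 + K2 tm R0 * (?n * (L2 * h)))) * E h s y"
    by (rule mult_right_mono[OF _ Ep])
  also have "\<dots> = (h * K2 tm R0 * E h s y) * (h\<^sup>2 + ?n * (L2 * h))" by (simp add: algebra_simps)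
  also have "\<dots> \<le> ?b * (h\<^sup>2 + ?n * (L2 * h))"
  proof (intro mult_right_mono)
    have "1 \<le> exp ((K3 + 1) * h\<^sup>2 * s)" using K3_nonneg s by simp
    then have "h * K2 tm R0 * E h s y * 1 \<le> h * K2 tm R0 * E h s y * exp ((K3 + 1) * h\<^sup>2 * s)"
      using h K2_nonneg Ep by (intro mult_left_mono) auto
    then show "h * K2 tm R0 * E h s y \<le> ?b" by (simp add: bar_def mult_ac)
  qed (use h L2_pos in auto)
  finally have "CV tm R0 * (h ^ 3 + h\<^sup>2 * ?n) * E h s y \<le> ?b * (h\<^sup>2 + ?n * (L2 * h))" .
  with 1 have "gen (bar tm R0 h s) y + CV tm R0 * (h ^ 3 + h\<^sup>2 * ?n) * E h s y
    \<le> ?b * (- (v * h * N1) + h\<^sup>2 * K3 - ?n * (L2 * h)) + ?b * (h\<^sup>2 + ?n * (L2 * h))" by linarith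
  also have "\<dots> = ((K3 + 1) * h\<^sup>2 - v * h * N1) * ?b" by (simp add: algebra_simps)
  finally show ?thesis .
qed

text \<open>The maximum principle for the difference of a perturbed combination of translates and
  the semigroup. Signed coefficients of total modulus at most 1 are allowed, so that the same
  statement, applied to the negative of the initial function, yields lower bounds.\<close>

theorem evol_le:
  assumes h: "0 < h" "h \<le> h1" and T: "0 \<le> T" "h\<^sup>2 * T \<le> tm"
    and a: "finite J" "(\<Sum>i\<in>J. \<bar>a i\<bar>) \<le> 1" and x: "\<And>i. i \<in> J \<Longrightarrow> \<bar>x i\<bar> \<le> R0"
    and f: "\<And>y. y \<in> Y \<Longrightarrow> \<bar>f y\<bar> \<le> 1" "\<And>y. y \<in> Y \<Longrightarrow> f y \<le> (\<Sum>i\<in>J. a i * U h (x i) 0 y) + \<eta>"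
    and y: "y \<in> Y"
  shows "evol f T y \<le> (\<Sum>i\<in>J. a i * U h (x i) T y) + \<eta> + h * K2 tm R0 * exp ((K3 + 1) * tm) * E h T y"
proof -
  have h': "h \<le> 1" using h by (simp add: h1_def)
  define w where "w s y = (\<Sum>i\<in>J. a i * U h (x i) s y) + \<eta> + bar tm R0 h s y - evol f s y" for s y
  define w' where "w' s y = (\<Sum>i\<in>J. a i * U' h (x i) s y) + ((K3 + 1) * h\<^sup>2 - v * h * N1) * bar tm R0 h s y - gen (evol f s) y" for s y
  \<comment> \<open>\<open>E h 0\<close> tends to zero when the positions go to minus infinity and
    so cannot dominate \<open>evol f\<close>, which is merely bounded; the summand 1 takes care of
    that part.\<close>
  define \<omega> where "\<omega> y = 1 + E h 0 y" for y
  define A where "A = \<bar>v\<bar> * N1 + K3 + c + 1"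
  define M where "M = 1 + \<bar>\<eta>\<bar> + Vk * (G tm R0 * exp (\<bar>v\<bar> * h * N1 * T))"
  have Ep: "0 \<le> E h s y" for s y by (simp add: E_def)
  have tm: "h\<^sup>2 * s \<le> tm" if "s \<le> T" for s using T(2) mult_left_mono[OF that, of "h\<^sup>2"] by simp
  have "0 \<le> w T y"
  proof (rule maximum_principle[where \<omega> = \<omega> and K = A and M = M and T = T and w = w and w' = w' and s = T and y = y])
    fix y assume y: "y \<in> Y"
    have fd: "((\<lambda>s. evol f s y) has_real_derivative gen (evol f s) y) (at s)" for s
      using evol_has_derivative[where f = f and B = 1 and y = y and s = s] evol_gen[where f = f and B = 1 and y = y and s = s] f(1) y by simp
    have "continuous_on {0..T} (\<lambda>s. evol f s y)" "continuous_on {0..T} (\<lambda>s. bar tm R0 h s y)"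
      by (rule DERIV_continuous_on, rule has_field_derivative_at_within, rule fd bar_has_derivative)+
    then show "continuous_on {0..T} (\<lambda>s. w s y)"
      unfolding w_def by (intro continuous_on_diff continuous_on_add continuous_on_sum continuous_on_mult continuous_on_const U_continuous)
    show "0 \<le> w 0 y"
      using f(2)[OF y] h K2_nonneg Ep[of 0 y] by (simp add: w_def evol_0 bar_def add_increasing2)
    show "0 \<le> \<omega> y" using Ep by (simp add: \<omega>_def)
    show "(\<Sum>m\<in>Mv. r y m * \<omega> (mv m y)) \<le> A * \<omega> y"
    proof -
      have "(\<Sum>m\<in>Mv. r y m * \<omega> (mv m y)) = gen \<omega> y + (\<Sum>m\<in>Mv. r y m) * \<omega> y"
        by (simp add: gen_real)
      also have "gen \<omega> y = E h 0 y * Re (nsym h y)"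
        unfolding \<omega>_def[abs_def] gen_add gen_E[OF y] by simp
      also have "\<dots> \<le> E h 0 y * (\<bar>v\<bar> * N1 + K3)"
      proof (intro mult_left_mono Ep)
        have "- (v * h * N1) \<le> \<bar>v\<bar> * 1 * N1"
        proof -
          have "- v * h \<le> \<bar>v\<bar> * 1" using h h' by (intro mult_mono) auto
          then have "- v * h * N1 \<le> \<bar>v\<bar> * 1 * N1" by (intro mult_right_mono N1_nonneg)
          then show ?thesis by simp
        qed
        moreover have "h\<^sup>2 * K3 \<le> 1 * K3" using h h' K3_nonneg by (intro mult_right_mono power_le_one) auto
        moreover have "0 \<le> card (coll y) * (L2 * h)" using L2_pos h by simp
        ultimately show "Re (nsym h y) \<le> \<bar>v\<bar> * N1 + K3"
          using Re_sym_nest_le[OF h y] by simp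
      qed
      also have "\<dots> \<le> \<omega> y * (\<bar>v\<bar> * N1 + K3)" using N1_nonneg K3_nonneg by (intro mult_right_mono) (auto simp: \<omega>_def)
      also have "(\<Sum>m\<in>Mv. r y m) * \<omega> y \<le> c * \<omega> y" using rate_le[OF y] Ep[of 0 y] by (intro mult_right_mono) (auto simp: \<omega>_def)
      finally have "(\<Sum>m\<in>Mv. r y m * \<omega> (mv m y)) \<le> \<omega> y * (\<bar>v\<bar> * N1 + K3) + c * \<omega> y" by simp
      then show ?thesis using Ep[of 0 y] by (simp add: A_def \<omega>_def algebra_simps)
    qed
    fix s :: real
    { assume s: "0 < s" "s < T"
      show "((\<lambda>s. w s y) has_real_derivative w' s y) (at s)"
      proof -
        have "((\<lambda>s. \<Sum>i\<in>J. a i * U h (x i) s y) has_real_derivative (\<Sum>i\<in>J. a i * U' h (x i) s y)) (at s)"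
          by (intro DERIV_sum DERIV_cmult U_has_derivative s)
        from DERIV_diff[OF DERIV_add[OF DERIV_add[OF this DERIV_const[of \<eta>]] bar_has_derivative] fd]
        show ?thesis unfolding w_def w'_def by (simp only: add_0_right)
      qed
      have "gen (w s) y = (\<Sum>i\<in>J. a i * gen (U h (x i) s) y) + gen (bar tm R0 h s) y - gen (evol f s) y"
        unfolding w_def[abs_def] gen_diff gen_add gen_sum gen_scale gen_const by simp
      moreover have "(\<Sum>i\<in>J. a i * gen (U h (x i) s) y) - (\<Sum>i\<in>J. a i * U' h (x i) s y)
        \<le> CV tm R0 * (h ^ 3 + h\<^sup>2 * card (coll y)) * E h s y" (is "_ \<le> ?R")
      proof -
        have R: "0 \<le> ?R" using CV_nonneg h Ep by simp
        have "(\<Sum>i\<in>J. a i * gen (U h (x i) s) y) - (\<Sum>i\<in>J. a i * U' h (x i) s y)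
          = (\<Sum>i\<in>J. a i * (gen (U h (x i) s) y - U' h (x i) s y))"
          by (simp add: sum_subtractf right_diff_distrib)
        also have "\<dots> \<le> (\<Sum>i\<in>J. \<bar>a i\<bar> * ?R)"
        proof (rule sum_mono)
          fix i assume i: "i \<in> J"
          have "\<bar>gen (U h (x i) s) y - U' h (x i) s y\<bar> \<le> ?R"
            using U_residual[OF h(1) h' y _ tm x[OF i], where s = s] s by (simp add: abs_minus_commute)
          then have "\<bar>a i * (gen (U h (x i) s) y - U' h (x i) s y)\<bar> \<le> \<bar>a i\<bar> * ?R"
            unfolding abs_mult by (intro mult_left_mono) auto
          then show "a i * (gen (U h (x i) s) y - U' h (x i) s y) \<le> \<bar>a i\<bar> * ?R" by linarith
        qed
        also have "\<dots> \<le> 1 * ?R" unfolding sum_distrib_right[symmetric] using a(2) R by (rule mult_right_mono)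
        finally show ?thesis by simp
      qed
      ultimately show "gen (w s) y \<le> w' s y"
        using bar_super[OF h y, where s = s and tm = tm and ?R0.0 = R0] s unfolding w'_def by linarith }
    { assume s: "0 \<le> s" "s \<le> T"
      have "E h s y \<le> exp (\<bar>v\<bar> * h * N1 * T) * E h 0 y"
      proof -
        have "- v * s \<le> \<bar>v\<bar> * T" using s by (intro mult_mono) auto
        then have "(- v * s) * (h * N1) \<le> (\<bar>v\<bar> * T) * (h * N1)" using h N1_nonneg by (intro mult_right_mono) auto
        then have "- (v * h * N1) * s \<le> \<bar>v\<bar> * h * N1 * T" by (simp add: mult_ac)
        then show ?thesis using Ep[of 0 y] unfolding E_eq by (simp add: mult_right_mono)
      qed
      then have E1: "E h s y \<le> exp (\<bar>v\<bar> * h * N1 * T) * \<omega> y" by (simp add: \<omega>_def distrib_left add_increasing)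
      have "\<bar>\<Sum>i\<in>J. a i * U h (x i) s y\<bar> \<le> (\<Sum>i\<in>J. \<bar>a i\<bar> * (Vk * (G tm R0 * E h s y)))"
        by (rule order_trans[OF sum_abs sum_mono])
          (auto simp: abs_mult intro!: mult_left_mono abs_U_le tm x s)
      also have "\<dots> \<le> 1 * (Vk * (G tm R0 * E h s y))"
        unfolding sum_distrib_right[symmetric] using a(2) Vnorm_nonneg G_nonneg Ep by (intro mult_right_mono) auto
      also have "\<dots> \<le> Vk * (G tm R0 * (exp (\<bar>v\<bar> * h * N1 * T) * \<omega> y))"
        using E1 Vnorm_nonneg G_nonneg by (simp add: mult_left_mono)
      finally have 1: "\<bar>\<Sum>i\<in>J. a i * U h (x i) s y\<bar> \<le> Vk * (G tm R0 * (exp (\<bar>v\<bar> * h * N1 * T) * \<omega> y))" .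
      have f1: "f y \<le> 1" if "y \<in> Y" for y using f(1)[OF that] by simp
      have f2: "-1 \<le> f y" if "y \<in> Y" for y using f(1)[OF that] by simp
      have 2: "evol f s y \<le> 1" by (rule evol_bounds(2)[OF f2 f1 y s(1)])
      have 3: "0 \<le> bar tm R0 h s y" using h K2_nonneg Ep by (simp add: bar_def)
      have "1 \<le> \<omega> y" using Ep by (simp add: \<omega>_def)
      then have "(1 + \<bar>\<eta>\<bar>) * 1 \<le> (1 + \<bar>\<eta>\<bar>) * \<omega> y" by (intro mult_left_mono) auto
      then have 4: "1 + \<bar>\<eta>\<bar> \<le> (1 + \<bar>\<eta>\<bar>) * \<omega> y" by (simp only: mult_1_right)
      have "M * \<omega> y = (1 + \<bar>\<eta>\<bar>) * \<omega> y + Vk * (G tm R0 * (exp (\<bar>v\<bar> * h * N1 * T) * \<omega> y))"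
        by (simp add: M_def algebra_simps)
      moreover have "- \<bar>\<eta>\<bar> \<le> \<eta>" by simp
      moreover have "- m \<le> S + \<eta> + b - e"
        if "m = P + Q" "- a \<le> \<eta>" "\<bar>S\<bar> \<le> Q" "e \<le> 1" "0 \<le> b" "1 + a \<le> P" for m a P Q S b e :: real
        using that by linarith
      ultimately show "- M * \<omega> y \<le> w s y" unfolding w_def minus_mult_left[symmetric] using 1 2 3 4 by blast }
  next
    show "0 \<le> M" using Vnorm_nonneg G_nonneg by (simp add: M_def)
    show "0 \<le> A" using N1_nonneg K3_nonneg c_pos by (simp add: A_def)
  qed (use y T in auto)
  then have "evol f T y \<le> (\<Sum>i\<in>J. a i * U h (x i) T y) + \<eta> + bar tm R0 h T y" by (simp add: w_def)
  also have "bar tm R0 h T y \<le> h * K2 tm R0 * exp ((K3 + 1) * tm) * E h T y"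
    unfolding bar_def using h K2_nonneg K3_nonneg T Ep
    by (intro mult_right_mono mult_left_mono) (auto simp: mult.assoc intro!: mult_left_mono)
  finally show ?thesis by simp
qed

end

section \<open>Averages of translates\<close>

context q_parameter begin

definition Vmax :: "nat \<Rightarrow> real" where
  "Vmax k = (SOME C. 0 \<le> C \<and> (\<forall>X. (\<forall>i<k. \<forall>j<k. i \<le> j \<longrightarrow> X j \<le> X i) \<longrightarrow> norm (V (k + 5) {..<k} 0 X) \<le> C))"

lemma Vmax:
  "0 \<le> Vmax k" "(\<And>i j. i \<le> j \<Longrightarrow> j < k \<Longrightarrow> X j \<le> X i) \<Longrightarrow> norm (V (k + 5) {..<k} 0 X) \<le> Vmax k"
proof -
  have "\<exists>C. 0 \<le> C \<and> (\<forall>X. (\<forall>i<k. \<forall>j<k. i \<le> j \<longrightarrow> X j \<le> X i) \<longrightarrow> norm (V (k + 5) {..<k} 0 X) \<le> C)"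
    using V_bounded[of "{..<k}" "k + 5"] by auto
  from someI_ex[OF this] show "0 \<le> Vmax k"
    "(\<And>i j. i \<le> j \<Longrightarrow> j < k \<Longrightarrow> X j \<le> X i) \<Longrightarrow> norm (V (k + 5) {..<k} 0 X) \<le> Vmax k"
    unfolding Vmax_def by blast+
qed

text \<open>The spacing exceeds the width \<open>2 * (k + 5)\<close> of the smoothing, so the
  windows are disjoint. The offset lies two units beyond \<open>k + 5\<close>: one compensates the
  lattice error \<open>h * M \<le> 1\<close>, the other makes the inequalities strict.\<close>

definition window :: "nat \<Rightarrow> nat \<Rightarrow> real" where
  "window k i = real (2 * (k + 5) + 1) * i + real (k + 5) + 2"

text \<open>An approximate limit, in which neither process appears. \<open>\<delta>\<close> compares
  the unit of the smoothing with the diffusive length; hence the heat time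
  \<open>(1 / \<delta>)\<^sup>2\<close> in units of the smoothing.\<close>

definition profile :: "nat \<Rightarrow> nat \<Rightarrow> real \<Rightarrow> real \<Rightarrow> real" where
  "profile k J \<delta> X = (\<Sum>i<J. (1 / J) * Re (V (k + 5) {..<k} ((1 / \<delta>)\<^sup>2) (\<lambda>j. X / \<delta> + window k i)))"

definition width :: "nat \<Rightarrow> nat \<Rightarrow> real" where
  "width k J = real (2 * (k + 5) + 1) * (real J - 1) + 2 * real (k + 5) + 4"

text \<open>\<open>window k i + window k (J - Suc i)\<close> equals \<open>width k J\<close>, so
  reversing the order of the windows and shifting by this amount replaces them by their negatives.
  One function thus describes the upper and the lower bound.\<close>

lemma profile_reflect:
  assumes "\<delta> \<noteq> 0"
  shows "profile k J \<delta> (X - \<delta> * width k J)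
    = (\<Sum>i<J. (1 / J) * Re (V (k + 5) {..<k} ((1 / \<delta>)\<^sup>2) (\<lambda>j. X / \<delta> + - window k i)))"
proof -
  have "(X - \<delta> * width k J) / \<delta> + window k (J - Suc i) = X / \<delta> + - window k i" if "i < J" for i
  proof -
    have "real (J - Suc i) = real J - 1 - real i" using that by (simp add: of_nat_diff)
    then show ?thesis using assms by (simp add: width_def window_def field_simps)
  qed
  then show ?thesis
    unfolding profile_def
    by (subst sum.nat_diff_reindex[symmetric]) (intro sum.cong refl, simp)
qed

text \<open>Only one of the windows can contain the last coordinate; all other terms of the average are
  \<open>0\<close> or \<open>1\<close>.\<close>

lemma average_bounds:
  fixes \<sigma> :: "nat \<Rightarrow> real"
  assumes k: "0 < k" and J: "0 < J" and X: "\<And>i j. i \<le> j \<Longrightarrow> j < k \<Longrightarrow> X j \<le> X i"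
    and \<sigma>: "\<And>i j. i < j \<Longrightarrow> j < J \<Longrightarrow> 2 * real (k + 5) < \<bar>\<sigma> i - \<sigma> j\<bar>"
  defines "A \<equiv> (\<Sum>i<J. (1 / J) * Re (V (k + 5) {..<k} 0 (\<lambda>j. X j + \<sigma> i)))"
  shows "- (Vmax k / J) \<le> A" "A \<le> 1 + Vmax k / J"
    "(\<And>i. i < J \<Longrightarrow> real (k + 5) < X (k - 1) + \<sigma> i) \<Longrightarrow> A = 1"
    "(\<And>i. i < J \<Longrightarrow> X (k - 1) + \<sigma> i < - real (k + 5)) \<Longrightarrow> A = 0"
proof -
  let ?v = "\<lambda>i. Re (V (k + 5) {..<k} 0 (\<lambda>j. X j + \<sigma> i))"
  have one: "?v i = 1" if "real (k + 5) < X (k - 1) + \<sigma> i" for i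
  proof -
    have "real (k + 5) < X j + \<sigma> i" if "j < k" for j
    proof -
      have "X (k - 1) \<le> X j" using k that by (intro X) auto
      then show ?thesis using \<open>real (k + 5) < X (k - 1) + \<sigma> i\<close> by linarith
    qed
    then show ?thesis using V_eq_1[of "{..<k}" "k + 5" "\<lambda>j. X j + \<sigma> i"] by simp
  qed
  have zero: "?v i = 0" if "X (k - 1) + \<sigma> i < - real (k + 5)" for i
    using V_eq_0[of "{..<k}" "k - 1" "k + 5" "\<lambda>j. X j + \<sigma> i"] that k by auto
  have b: "\<bar>?v i\<bar> \<le> Vmax k" for i
    by (rule order_trans[OF abs_Re_le_cmod Vmax(2)]) (simp add: X)
  define B where "B = {i\<in>{..<J}. \<bar>X (k - 1) + \<sigma> i\<bar> \<le> real (k + 5)}"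
  have Bf: "finite B" "B \<subseteq> {..<J}" unfolding B_def by (simp, blast)
  have B1: "card B \<le> 1"
  proof (rule ccontr)
    assume "\<not> card B \<le> 1"
    then obtain i j where ij: "i \<in> B" "j \<in> B" "i < j"
      by (metis card_le_Suc0_iff_eq Bf(1) One_nat_def linorder_neqE_nat)
    then show False using \<sigma>[of i j] by (auto simp: B_def abs_le_iff)
  qed
  have out: "?v i \<in> {0, 1}" if "i \<in> {..<J} - B" for i
    using that one[of i] zero[of i] unfolding B_def by (auto simp: abs_le_iff)
  have split: "(\<Sum>i<J. ?v i) = (\<Sum>i\<in>B. ?v i) + (\<Sum>i\<in>{..<J} - B. ?v i)"
    using sum.subset_diff[OF Bf(2), of ?v] by simp
  have "\<bar>\<Sum>i\<in>B. ?v i\<bar> \<le> (\<Sum>i\<in>B. Vmax k)" by (rule order_trans[OF sum_abs sum_mono]) (rule b)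
  also have "\<dots> \<le> 1 * Vmax k" using B1 Vmax(1)[of k] by (simp only: sum_constant) (intro mult_right_mono; simp)
  finally have inB: "\<bar>\<Sum>i\<in>B. ?v i\<bar> \<le> Vmax k" by simp
  have "0 \<le> (\<Sum>i\<in>{..<J} - B. ?v i)" using out by (intro sum_nonneg) force
  moreover have "(\<Sum>i\<in>{..<J} - B. ?v i) \<le> (\<Sum>i\<in>{..<J} - B. 1)" using out by (intro sum_mono) force
  then have "(\<Sum>i\<in>{..<J} - B. ?v i) \<le> J"
    using card_mono[of "{..<J}" "{..<J} - B"] by simp
  ultimately have S: "- Vmax k \<le> (\<Sum>i<J. ?v i)" "(\<Sum>i<J. ?v i) \<le> J + Vmax k" using inB split by auto
  have A: "A = (\<Sum>i<J. ?v i) / J" unfolding A_def sum_distrib_left[symmetric] by simp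
  show "- (Vmax k / J) \<le> A" "A \<le> 1 + Vmax k / J" unfolding A using S J by (simp_all add: field_simps)
  show "A = 1" if "\<And>i. i < J \<Longrightarrow> real (k + 5) < X (k - 1) + \<sigma> i" unfolding A using one[OF that] J by simp
  show "A = 0" if "\<And>i. i < J \<Longrightarrow> X (k - 1) + \<sigma> i < - real (k + 5)" unfolding A using zero[OF that] by simp
qed

lemma window_gap: "i < j \<Longrightarrow> 2 * real (k + 5) < \<bar>window k i - window k j\<bar>"
proof -
  assume "i < j"
  then have "real i + 1 \<le> real j" by linarith
  then have "real (2 * (k + 5) + 1) * (real i + 1) \<le> real (2 * (k + 5) + 1) * real j" by (intro mult_left_mono) auto
  then have "real (2 * (k + 5) + 1) \<le> window k j - window k i" by (simp add: window_def algebra_simps)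
  then show ?thesis by simp
qed

lemma window_ge: "real (k + 5) + 2 \<le> window k i"
  by (simp add: window_def)

end

locale scaling_limit = scaling_system +
  fixes f :: "(nat \<Rightarrow> int) \<Rightarrow> real"
  assumes k_pos: "0 < k"
    and chamber: "\<And>y i j. y \<in> Y \<Longrightarrow> i \<le> j \<Longrightarrow> j < k \<Longrightarrow> y j \<le> y i"
    and f_range: "\<And>y. y \<in> Y \<Longrightarrow> 0 \<le> f y \<and> f y \<le> 1"
    and f_limit: "\<And>\<eta>. 0 < \<eta> \<Longrightarrow> \<exists>M::nat. \<forall>y\<in>Y. (int M \<le> y (k - 1) \<longrightarrow> 1 - \<eta> \<le> f y) \<and> (y (k - 1) < - int M \<longrightarrow> f y \<le> \<eta>)"
begin

lemma deg_eq: "deg = k + 5"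
  by (simp add: deg_def)

text \<open>Translates by positive windows already have average 1 once the last position is at least
  \<open>- M\<close>, and those by negative windows still have average 0 while it is below
  \<open>M\<close>. Elsewhere \<open>f\<close> is within \<open>\<eta>\<close> of 0 or 1, and the
  averages leave [0, 1] by at most \<open>Vmax k / J\<close>.\<close>

lemma initial_sandwich:
  assumes \<eta>: "0 < \<eta>" and J: "0 < J" "Vmax k / J \<le> \<eta>"
  shows "\<exists>e>0. \<forall>h. 0 < h \<longrightarrow> h \<le> e \<longrightarrow> (\<forall>y\<in>Y.
    f y \<le> (\<Sum>i<J. (1 / J) * U h (window k i) 0 y) + 2 * \<eta> \<and>
    (\<Sum>i<J. (1 / J) * U h (- window k i) 0 y) - 2 * \<eta> \<le> f y)"
proof -
  from f_limit[OF \<eta>] obtain M :: nat where M: "\<And>y. y \<in> Y \<Longrightarrow> int M \<le> y (k - 1) \<Longrightarrow> 1 - \<eta> \<le> f y"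
    "\<And>y. y \<in> Y \<Longrightarrow> y (k - 1) < - int M \<Longrightarrow> f y \<le> \<eta>" by blast
  show ?thesis
  proof (intro exI[of _ "1 / (real M + 1)"] conjI allI impI ballI)
    fix h y assume h: "0 < h" "h \<le> 1 / (real M + 1)" and y: "y \<in> Y"
    have "h * (real M + 1) \<le> 1" using h by (simp add: pos_le_divide_eq)
    then have eM: "h * M \<le> 1" using h by (simp add: distrib_left)
    have X: "h * y j \<le> h * y i" if "i \<le> j" "j < k" for i j
      using chamber[OF y that] h by (intro mult_left_mono) auto
    have U0: "U h x 0 y = Re (V (k + 5) {..<k} 0 (\<lambda>j. h * y j + x))" for x by (simp add: U_def deg_eq)
    note up = average_bounds[where X = "\<lambda>j. h * y j" and \<sigma> = "window k" and k = k and J = J, OF k_pos J(1) X window_gap, folded U0]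
    have gap': "2 * real (k + 5) < \<bar>- window k i - - window k j\<bar>" if "i < j" for i j
      using window_gap[OF that, of k] by (simp add: abs_minus_commute)
    note lo = average_bounds[where X = "\<lambda>j. h * y j" and \<sigma> = "\<lambda>i. - window k i" and k = k and J = J, OF k_pos J(1) X gap', folded U0]
    have fr: "0 \<le> f y" "f y \<le> 1" using f_range[OF y] by auto
    show "f y \<le> (\<Sum>i<J. (1 / J) * U h (window k i) 0 y) + 2 * \<eta>"
    proof (cases "y (k - 1) < - int M")
      case True
      show ?thesis using M(2)[OF y True] up(1) J(2) \<eta> by linarith
    next
      case False
      have "h * (- real M) \<le> h * y (k - 1)" using False h by (intro mult_left_mono) linarith+
      then have "real (k + 5) < h * y (k - 1) + window k i" for i using window_ge[of k i] eM by simp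
      then show ?thesis using up(3) fr \<eta> by simp
    qed
    show "(\<Sum>i<J. (1 / J) * U h (- window k i) 0 y) - 2 * \<eta> \<le> f y"
    proof (cases "int M \<le> y (k - 1)")
      case True
      show ?thesis using M(1)[OF y True] lo(2) J(2) \<eta> by linarith
    next
      case False
      have "h * y (k - 1) \<le> h * real M" using False h by (intro mult_left_mono) linarith+
      then have "h * y (k - 1) + - window k i < - real (k + 5)" for i using window_ge[of k i] eM by simp
      then show ?thesis using lo(4) fr \<eta> by simp
    qed
  qed simp
qed

text \<open>The spacing \<open>h n = 1 / (\<delta> * sqrt (T n))\<close> keeps the heat time fixed
  at \<open>(1 / \<delta>)\<^sup>2\<close> while the barrier, of order \<open>h n\<close>, vanishes;
  the initial error \<open>2 * \<eta>\<close> and two small terms remain.\<close>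

theorem evol_profile:
  assumes \<eta>: "0 < \<eta>" and J: "0 < J" "Vmax k / J \<le> \<eta>" and \<delta>: "0 < \<delta>"
    and T: "filterlim T at_top sequentially" and y: "\<And>n. y n \<in> Y"
    and X: "\<And>j. j < k \<Longrightarrow> (\<lambda>n. (y n j - v * T n) / sqrt (T n)) \<longlonglongrightarrow> X"
  shows "\<forall>\<^sub>F n in sequentially. evol f (T n) (y n) \<le> profile k J \<delta> X + 3 * \<eta>"
    "\<forall>\<^sub>F n in sequentially. profile k J \<delta> (X - \<delta> * width k J) - 3 * \<eta> \<le> evol f (T n) (y n)"
proof -
  define h where "h n = 1 / (\<delta> * sqrt (T n))" for n
  define tm where "tm = (1 / \<delta>)\<^sup>2"
  define R0 where "R0 = window k J"
  obtain e where e: "0 < e" and init: "\<And>h y. 0 < h \<Longrightarrow> h \<le> e \<Longrightarrow> y \<in> Y \<Longrightarrow> f y \<le> (\<Sum>i<J. (1 / J) * U h (window k i) 0 y) + 2 * \<eta>"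
    "\<And>h y. 0 < h \<Longrightarrow> h \<le> e \<Longrightarrow> y \<in> Y \<Longrightarrow> (\<Sum>i<J. (1 / J) * U h (- window k i) 0 y) - 2 * \<eta> \<le> f y"
    using initial_sandwich[OF \<eta> J] by blast
  have sT: "filterlim (\<lambda>n. sqrt (T n)) at_top sequentially" by (rule filterlim_compose[OF sqrt_at_top T])
  have "filterlim (\<lambda>n. \<delta> * sqrt (T n)) at_top sequentially"
    by (rule filterlim_tendsto_pos_mult_at_top[OF tendsto_const \<delta> sT])
  then have h0: "h \<longlonglongrightarrow> 0" unfolding h_def by (rule real_tendsto_divide_at_top[OF tendsto_const])
  have Tpos: "\<forall>\<^sub>F n in sequentially. 0 < T n" using T by (simp add: filterlim_at_top_dense)
  have hpos: "\<forall>\<^sub>F n in sequentially. 0 < h n" using Tpos by eventually_elim (simp add: h_def \<delta>)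
  have he: "\<forall>\<^sub>F n in sequentially. h n < min e h1"
    using order_tendstoD(2)[OF h0, of "min e h1"] e h1_pos by simp
  have Z: "(\<lambda>n. h n * y n j + x + (- (v * h n)) * T n) \<longlonglongrightarrow> X / \<delta> + x" if "j < k" for j x
  proof -
    have A: "(\<lambda>n. (y n j - v * T n) / sqrt (T n) / \<delta> + x) \<longlonglongrightarrow> X / \<delta> + x"
      using \<delta> by (intro tendsto_intros X that) simp
    have eq: "(y n j - v * T n) / sqrt (T n) / \<delta> + x = h n * y n j + x + (- (v * h n)) * T n" for n
      by (simp add: h_def diff_divide_distrib mult.commute)
    show ?thesis using A unfolding eq .
  qed
  have hT: "\<forall>\<^sub>F n in sequentially. (h n)\<^sup>2 * T n = tm"
    using Tpos by eventually_elim (simp add: h_def tm_def power_divide power_mult_distrib)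
  have UX: "(\<lambda>n. U (h n) x (T n) (y n)) \<longlonglongrightarrow> Re (V (k + 5) {..<k} ((1 / \<delta>)\<^sup>2) (\<lambda>j. X / \<delta> + x))" for x
  proof -
    have "(\<lambda>n. Re (V (k + 5) {..<k} tm (\<lambda>j. (h n * y n j + x) + (- (v * h n)) * T n)))
      \<longlonglongrightarrow> Re (V (k + 5) {..<k} tm (\<lambda>j. X / \<delta> + x))"
      by (intro tendsto_Re V_tendsto tendsto_const Z) (auto simp: tm_def)
    moreover have "\<forall>\<^sub>F n in sequentially. Re (V (k + 5) {..<k} tm (\<lambda>j. (h n * y n j + x) + (- (v * h n)) * T n)) = U (h n) x (T n) (y n)"
      using hT by eventually_elim (simp add: U_def deg_eq)
    ultimately show ?thesis unfolding tm_def by (rule Lim_transform_eventually)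
  qed
  have err: "(\<lambda>n. h n * K2 tm R0 * exp ((K3 + 1) * tm) * E (h n) (T n) (y n)) \<longlonglongrightarrow> 0"
  proof -
    have "(\<lambda>n. E (h n) (T n) (y n)) \<longlonglongrightarrow> exp (\<Sum>j<k. (X / \<delta>) * nest j)"
      unfolding E_def
    proof (intro tendsto_exp tendsto_sum tendsto_mult tendsto_const)
      fix j assume "j \<in> {..<k}"
      then show "(\<lambda>n. h n * y n j + (- (v * h n)) * T n) \<longlonglongrightarrow> X / \<delta>" using Z[of j 0] by simp
    qed
    from tendsto_mult[OF tendsto_mult_left_zero[OF tendsto_mult_left_zero[OF h0]] this] show ?thesis by simp
  qed
  have errb: "\<forall>\<^sub>F n in sequentially. h n * K2 tm R0 * exp ((K3 + 1) * tm) * E (h n) (T n) (y n) < \<eta> / 2"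
    using order_tendstoD(2)[OF err, of "\<eta> / 2"] \<eta> by simp
  have R: "\<bar>window k i\<bar> \<le> R0" if "i < J" for i
  proof -
    have "0 \<le> window k i" using window_ge[of k i] by simp
    moreover have "window k i \<le> window k J" using that unfolding window_def by (intro add_right_mono mult_left_mono) auto
    ultimately show ?thesis by (simp add: R0_def)
  qed
  have f1: "\<bar>f y\<bar> \<le> 1" "\<bar>- f y\<bar> \<le> 1" if "y \<in> Y" for y using f_range[OF that] by auto
  have neg: "evol (\<lambda>y. - f y) s y = - evol f s y" if "y \<in> Y" for s y
    using evol_sum[of "{0 :: nat}" "\<lambda>_. f" 1 y "\<lambda>_. -1" s] f1(1) that by simp
  have J1: "(\<Sum>i<J. \<bar>1 / real J\<bar>) \<le> 1" "(\<Sum>i<J. \<bar>- (1 / real J)\<bar>) \<le> 1" using J(1) by auto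
  have P1: "(\<lambda>n. \<Sum>i<J. (1 / J) * U (h n) (window k i) (T n) (y n)) \<longlonglongrightarrow> profile k J \<delta> X"
    unfolding profile_def by (intro tendsto_sum tendsto_mult tendsto_const UX)
  have P2: "(\<lambda>n. \<Sum>i<J. (1 / J) * U (h n) (- window k i) (T n) (y n)) \<longlonglongrightarrow> profile k J \<delta> (X - \<delta> * width k J)"
    unfolding profile_reflect[OF less_imp_neq[OF \<delta>, symmetric]] by (intro tendsto_sum tendsto_mult tendsto_const UX)
  have "\<forall>\<^sub>F n in sequentially. (\<Sum>i<J. (1 / J) * U (h n) (window k i) (T n) (y n)) < profile k J \<delta> X + \<eta> / 2"
    using order_tendstoD(2)[OF P1, of "profile k J \<delta> X + \<eta> / 2"] \<eta> by simp
  then show "\<forall>\<^sub>F n in sequentially. evol f (T n) (y n) \<le> profile k J \<delta> X + 3 * \<eta>"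
    using Tpos hpos he hT errb
  proof eventually_elim
    case (elim n)
    have "evol f (T n) (y n) \<le> (\<Sum>i<J. (1 / J) * U (h n) (window k i) (T n) (y n)) + 2 * \<eta>
      + h n * K2 tm R0 * exp ((K3 + 1) * tm) * E (h n) (T n) (y n)"
      by (rule evol_le) (use elim J1 R f1 init y in auto)
    then show ?case using elim by linarith
  qed
  have "\<forall>\<^sub>F n in sequentially. profile k J \<delta> (X - \<delta> * width k J) - \<eta> / 2 < (\<Sum>i<J. (1 / J) * U (h n) (- window k i) (T n) (y n))"
    using order_tendstoD(1)[OF P2, of "profile k J \<delta> (X - \<delta> * width k J) - \<eta> / 2"] \<eta> by simp
  then show "\<forall>\<^sub>F n in sequentially. profile k J \<delta> (X - \<delta> * width k J) - 3 * \<eta> \<le> evol f (T n) (y n)"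
    using Tpos hpos he hT errb
  proof eventually_elim
    case (elim n)
    have i: "- f y \<le> (\<Sum>i<J. - (1 / J) * U (h n) (- window k i) 0 y) + 2 * \<eta>" if "y \<in> Y" for y
      using init(2)[OF _ _ that, of "h n"] elim by (simp add: sum_negf)
    have "evol (\<lambda>y. - f y) (T n) (y n) \<le> (\<Sum>i<J. - (1 / J) * U (h n) (- window k i) (T n) (y n)) + 2 * \<eta>
      + h n * K2 tm R0 * exp ((K3 + 1) * tm) * E (h n) (T n) (y n)"
      by (rule evol_le) (use elim J1 R f1 i y in auto)
    then show ?case using elim unfolding neg[OF y] by (simp add: sum_negf)
  qed
qed

end

section \<open>The two dual systems\<close>

lemma prod_upd_exp:
  fixes y :: "nat \<Rightarrow> int" and z :: "nat \<Rightarrow> complex" and h :: real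
  assumes "i < k"
  shows "exp (\<Sum>j<k. of_real (h * (y(i := y i + e)) j) * z j) = exp (\<Sum>j<k. of_real (h * y j) * z j) * exp (of_int e * of_real h * z i)"
proof -
  have "of_real (h * (y(i := y i + e)) j) * z j = of_real (h * y j) * z j + (if j = i then of_int e * of_real h * z j else 0)" for j
    by (simp add: algebra_simps)
  then have "(\<Sum>j<k. of_real (h * (y(i := y i + e)) j) * z j) = (\<Sum>j<k. of_real (h * y j) * z j) + of_int e * of_real h * z i"
    using assms by (simp only: sum.distrib sum.delta finite_lessThan) simp
  then show ?thesis by (simp only: exp_add)
qed

lemma power2_le_prod:
  fixes u w :: complex
  shows "(norm u)\<^sup>2 \<le> (1 + norm u) ^ 2 * (1 + norm w) ^ 2" "(norm w)\<^sup>2 \<le> (1 + norm u) ^ 2 * (1 + norm w) ^ 2"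
    "norm u * norm w \<le> (1 + norm u) ^ 2 * (1 + norm w) ^ 2"
proof -
  have s: "a\<^sup>2 \<le> (1 + a)\<^sup>2" "a \<le> (1 + a)\<^sup>2" "1 \<le> (1 + a)\<^sup>2" if "0 \<le> a" for a :: real
    using that by (auto simp: power2_eq_square algebra_simps)
  have p: "0 \<le> norm u" "0 \<le> norm w" by auto
  show "(norm u)\<^sup>2 \<le> (1 + norm u) ^ 2 * (1 + norm w) ^ 2"
    using mult_mono[OF s(1)[OF p(1)] s(3)[OF p(2)]] by simp
  show "(norm w)\<^sup>2 \<le> (1 + norm u) ^ 2 * (1 + norm w) ^ 2"
    using mult_mono[OF s(3)[OF p(1)] s(1)[OF p(2)]] by simp
  show "norm u * norm w \<le> (1 + norm u) ^ 2 * (1 + norm w) ^ 2"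
    by (rule mult_mono[OF s(2)[OF p(1)] s(2)[OF p(2)]]) auto
qed

context q_parameter begin

lemma exp_nest_le:
  assumes "0 < h" "h \<le> 1" "0 \<le> Re u" "Re u \<le> nest k"
  shows "norm (exp (of_real h * u)) \<le> exp (nest k)" "norm (exp (- (of_real h * u))) \<le> 1"
proof -
  have "h * Re u \<le> 1 * nest k" using assms by (intro mult_mono) auto
  then show "norm (exp (of_real h * u)) \<le> exp (nest k)" by simp
  show "norm (exp (- (of_real h * u))) \<le> 1" using assms by simp
qed

section \<open>The dual of the ASEP as a scaling system\<close>

definition as_coll :: "nat \<Rightarrow> (nat \<Rightarrow> int) \<Rightarrow> nat set" where
  "as_coll k y = {i. Suc i < k \<and> y (Suc i) = y i - 1}"

text \<open>The two jumps that exclusion suppresses for an adjacent pair. As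
  \<open>be = q * al\<close>, the linear part is \<open>- al * h * (u - q * w)\<close>, the boundary
  operator of the nested integral.\<close>

definition as_d :: "real \<Rightarrow> complex \<Rightarrow> complex \<Rightarrow> complex" where
  "as_d h u w = of_real al * (exp (- (of_real h * u)) - 1) + of_real be * (exp (of_real h * w) - 1)"

lemma as_d_bound:
  fixes h :: real
  assumes h: "0 < h" "h \<le> 1" and u: "0 \<le> Re u" "Re u \<le> nest k" and w: "0 \<le> Re w" "Re w \<le> nest k"
  shows "norm (as_d h u w + of_real (al * h) * (u - of_real q * w) * exp (- (of_real h * u)))
    \<le> (exp (nest k) + 5) * h\<^sup>2 * ((1 + norm u) ^ 2 * (1 + norm w) ^ 2)"
proof -
  let ?a = "of_real h * u" and ?b = "of_real h * w"
  let ?P = "h\<^sup>2 * ((1 + norm u) ^ 2 * (1 + norm w) ^ 2)"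
  note ea = exp_nest_le[OF h u] and eb = exp_nest_le[OF h w]
  have na: "norm ?a = h * norm u" "norm ?b = h * norm w" using h by (simp_all add: norm_mult)
  have pw: "(norm ?a)\<^sup>2 \<le> ?P" "(norm ?b)\<^sup>2 \<le> ?P" "norm ?b * norm ?a \<le> ?P"
    using mult_left_mono[OF power2_le_prod(1)[of u w], of "h\<^sup>2"] mult_left_mono[OF power2_le_prod(2)[where u = u and w = w], of "h\<^sup>2"]
      mult_left_mono[OF power2_le_prod(3)[of u w], of "h\<^sup>2"] unfolding na
    by (simp_all add: power_mult_distrib power2_eq_square mult_ac)
  have P0: "0 \<le> ?P" by simp
  have e1: "exp (- ?a) * exp ?a = 1" by (simp add: exp_minus)
  have 1: "norm (exp (- ?a) * (exp ?a - 1 - ?a)) \<le> 2 * ?P"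
  proof -
    have "norm (exp (- ?a) * (exp ?a - 1 - ?a)) \<le> norm (exp (- ?a)) * ((norm ?a)\<^sup>2 * (norm (exp ?a) + norm (exp (- ?a))))"
      unfolding norm_mult[of "exp (- ?a)"] by (intro mult_left_mono norm_exp_diff2_le) simp
    also have "\<dots> = (norm ?a)\<^sup>2 * (norm (exp (- ?a) * exp ?a) + norm (exp (- ?a)) * norm (exp (- ?a)))"
      by (simp only: norm_mult distrib_left mult_ac)
    also have "\<dots> \<le> ?P * (1 + 1 * 1)" unfolding e1
      using ea(2) P0 by (intro mult_mono pw add_mono) auto
    finally show ?thesis by simp
  qed
  have 2: "norm (exp ?b - 1 - ?b) \<le> ?P * (exp (nest k) + 1)"
    using eb P0 by (intro order_trans[OF norm_exp_diff2_le[of ?b]] mult_mono pw add_mono) auto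
  have 3: "norm (?b * (exp (- ?a) - 1)) \<le> ?P * 2"
  proof -
    have "norm (?b * (exp (- ?a) - 1)) \<le> norm ?b * (norm (- ?a) * (1 + norm (exp (- ?a))))"
      unfolding norm_mult[of ?b] by (intro mult_left_mono norm_exp_diff_le) simp
    also have "\<dots> = (norm ?b * norm ?a) * (1 + norm (exp (- ?a)))" by (simp only: norm_minus_cancel mult.assoc)
    also have "\<dots> \<le> ?P * 2" using ea(2) P0 by (intro mult_mono pw) auto
    finally show ?thesis .
  qed
  \<comment> \<open>With \<open>x\<close> for \<open>exp (- (h * u))\<close> and \<open>x'\<close>
    for its inverse, every bracket on the right is either a second-order remainder or a product of
    two first-order terms.\<close>
  have D: "a * (x - 1) + (q' * a) * (y - 1) + (a * e) * (u - q' * w) * x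
    = a * (- (x * (x' - 1 - e * u)) + q' * ((y - 1 - e * w) - e * w * (x - 1)))" if "x * x' = 1" for a x y q' e x' w :: complex
  proof -
    have "x * (x' - 1 - e * u) = 1 - x - x * e * u" using that by (simp add: algebra_simps)
    then show ?thesis by (simp only:) (simp add: algebra_simps)
  qed
  have "as_d h u w + of_real (al * h) * (u - of_real q * w) * exp (- ?a)
    = of_real al * (- (exp (- ?a) * (exp ?a - 1 - ?a)) + of_real q * ((exp ?b - 1 - ?b) - ?b * (exp (- ?a) - 1)))"
    unfolding as_d_def al_be(4) of_real_mult by (rule D[OF e1])
  also have "norm \<dots> \<le> 1 * (2 * ?P + 1 * (?P * (exp (nest k) + 1) + ?P * 2))"
  proof -
    have "al \<le> 1" using q_pos by (simp add: al_def)
    then have a1: "norm (complex_of_real al) \<le> 1" "norm (complex_of_real q) \<le> 1" using al_be(1) q_pos q_less_1 by auto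
    have i: "norm ((exp ?b - 1 - ?b) - ?b * (exp (- ?a) - 1)) \<le> ?P * (exp (nest k) + 1) + ?P * 2"
      by (rule order_trans[OF norm_triangle_ineq4 add_mono[OF 2 3]])
    have ii: "norm (of_real q * ((exp ?b - 1 - ?b) - ?b * (exp (- ?a) - 1))) \<le> 1 * (?P * (exp (nest k) + 1) + ?P * 2)"
      unfolding norm_mult[of "of_real q"] by (rule mult_mono[OF a1(2) i]) auto
    have iii: "norm (- (exp (- ?a) * (exp ?a - 1 - ?a)) + of_real q * ((exp ?b - 1 - ?b) - ?b * (exp (- ?a) - 1)))
      \<le> 2 * ?P + 1 * (?P * (exp (nest k) + 1) + ?P * 2)"
      by (rule order_trans[OF norm_triangle_ineq add_mono[OF _ ii]]) (simp only: norm_minus_cancel 1)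
    show ?thesis unfolding norm_mult[of "of_real al"] by (rule mult_mono[OF a1(1) iii]) auto
  qed
  also have "\<dots> = (exp (nest k) + 5) * ?P" by (simp add: algebra_simps)
  finally show ?thesis by (simp only: mult.assoc)
qed

lemma as_gen_exp:
  fixes h :: real and z :: "nat \<Rightarrow> complex"
  assumes y: "y \<in> strict_chamber k"
  shows "markov_generator.gen ({..<k} \<times> UNIV) (as_dual_rate k) hop (\<lambda>y. exp (\<Sum>j<k. of_real (h * y j) * z j)) y
    = exp (\<Sum>j<k. of_real (h * y j) * z j) *
      ((\<Sum>j<k. of_real al * (exp (- (of_real h * z j)) - 1) + of_real be * (exp (of_real h * z j) - 1))
        - (\<Sum>i\<in>as_coll k y. of_real 1 * as_d h (z i) (z (Suc i))))"
proof -
  let ?e = "\<lambda>y. exp (\<Sum>j<k. of_real (h * y j) * z j)"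
  have dn: "?e (hop (i, False) y) - ?e y = ?e y * (exp (- (of_real h * z i)) - 1)" if "i < k" for i
    using prod_upd_exp[OF that, of h y "-1" z] by (simp add: hop_def right_diff_distrib)
  have up: "?e (hop (i, True) y) - ?e y = ?e y * (exp (of_real h * z i) - 1)" if "i < k" for i
    using prod_upd_exp[OF that, of h y 1 z] by (simp add: hop_def right_diff_distrib)
  have 1: "(\<Sum>j<k. al *\<^sub>R (?e (hop (j, False) y) - ?e y) + be *\<^sub>R (?e (hop (j, True) y) - ?e y))
    = (\<Sum>j<k. ?e y * (of_real al * (exp (- (of_real h * z j)) - 1) + of_real be * (exp (of_real h * z j) - 1)))"
    by (intro sum.cong refl) (simp only: dn up lessThan_iff scaleR_conv_of_real distrib_left mult.left_commute)
  have 2: "(\<Sum>i | Suc i < k \<and> y (Suc i) = y i - 1. al *\<^sub>R (?e (hop (i, False) y) - ?e y) + be *\<^sub>R (?e (hop (Suc i, True) y) - ?e y))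
    = (\<Sum>i\<in>as_coll k y. ?e y * (of_real 1 * as_d h (z i) (z (Suc i))))"
  proof (intro sum.cong)
    fix i assume "i \<in> as_coll k y"
    then have "i < k" "Suc i < k" by (auto simp: as_coll_def)
    then show "al *\<^sub>R (?e (hop (i, False) y) - ?e y) + be *\<^sub>R (?e (hop (Suc i, True) y) - ?e y)
      = ?e y * (of_real 1 * as_d h (z i) (z (Suc i)))"
      by (simp only: dn up scaleR_conv_of_real as_d_def distrib_left mult.left_commute of_real_1 mult_1_left)
  qed (simp add: as_coll_def)
  show ?thesis unfolding as_dual_gen[OF y] 1 2 right_diff_distrib sum_distrib_left ..
qed

lemma as_d_measurable: "(\<lambda>z. as_d h (fst z) (snd z)) \<in> borel_measurable (borel \<Otimes>\<^sub>M borel)"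
  unfolding as_d_def by measurable

lemma as_step_count: "as_count asep_step u = nat u"
proof -
  have "{m. 1 \<le> m \<and> asep_step m \<le> u} = {1..nat u}" by (auto simp: asep_step_def)
  then show ?thesis by (simp add: as_count_def)
qed

lemma as_scaling:
  assumes k: "1 \<le> k"
  shows "scaling_limit q ({..<k} \<times> UNIV) (as_dual_rate k) hop (strict_chamber k) (real k) k 1 al be 1 al
    (exp (nest k) + 5) (as_coll k) (\<lambda>_ _. 1) as_d (as_dual k asep_step)"
proof -
  interpret G: markov_generator "{..<k} \<times> UNIV" "as_dual_rate k" hop "strict_chamber k" "real k"
    by (rule as_dual_generator[OF k])
  show ?thesis
  proof unfold_locales
    show "Suc i < k \<and> y i = y (Suc i) + int 1 \<and> 1 \<le> (1 :: real) \<and> (1 :: real) \<le> 1" if "i \<in> as_coll k y" for y i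
      using that by (simp add: as_coll_def)
    show "norm (as_d h u w + of_real (al * h) * (u - of_real q * w) * exp (- (of_real (real 1 * h) * u)))
      \<le> (exp (nest k) + 5) * h\<^sup>2 * ((1 + norm u) ^ 2 * (1 + norm w) ^ 2)"
      if "0 < h" "h \<le> 1" "0 \<le> Re u" "Re u \<le> nest k" "0 \<le> Re w" "Re w \<le> nest k" for h :: real and u w
      using as_d_bound[OF that] by simp
    fix y assume y: "y \<in> strict_chamber k"
    show mono: "y j \<le> y i" if "i \<le> j" "j < k" for i j
      using y that by (cases "i = j") (auto simp: strict_chamber_def less_imp_le)
    have Q: "0 \<le> as_Q x u \<and> as_Q x u \<le> 1" for x u
      using q_pos q_less_1 by (simp add: as_Q_def power_le_one)
    show "0 \<le> as_dual k asep_step y \<and> as_dual k asep_step y \<le> 1"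
      unfolding as_dual_def by (intro conjI prod_nonneg prod_le_1 ballI Q[THEN conjunct1] Q)
  next
    fix \<eta> :: real assume "0 < \<eta>"
    \<comment> \<open>In the step state \<open>nat (- y)\<close> particles are counted by
      \<open>as_Q\<close> at \<open>y\<close>: the dual function is 1 at nonnegative levels, and
      below \<open>- M\<close> its last factor alone is at most \<open>q ^ M\<close>.\<close>
    then obtain M where M: "q ^ M < \<eta>" using real_arch_pow_inv[OF _ q_less_1] by blast
    show "\<exists>M::nat. \<forall>y\<in>strict_chamber k. (int M \<le> y (k - 1) \<longrightarrow> 1 - \<eta> \<le> as_dual k asep_step y) \<and>
      (y (k - 1) < - int M \<longrightarrow> as_dual k asep_step y \<le> \<eta>)"
    proof (intro exI[of _ M] ballI conjI impI)
      fix y assume y: "y \<in> strict_chamber k"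
      have mono: "y j \<le> y i" if "i \<le> j" "j < k" for i j
        using y that by (cases "i = j") (auto simp: strict_chamber_def less_imp_le)
      have Q: "0 \<le> as_Q x u \<and> as_Q x u \<le> 1" for x u
        using q_pos q_less_1 by (simp add: as_Q_def power_le_one)
      { assume h: "int M \<le> y (k - 1)"
        have "as_Q asep_step (y j) = 1" if "j < k" for j
        proof -
          have "y (k - 1) \<le> y j" using that by (intro mono) auto
          then have "nat (- y j) = 0" using h by simp
          then show ?thesis by (simp only: as_Q_def as_step_count power_0)
        qed
        then show "1 - \<eta> \<le> as_dual k asep_step y" using \<open>0 < \<eta>\<close> by (simp add: as_dual_def) }
      { assume h: "y (k - 1) < - int M"
        have "as_dual k asep_step y = as_Q asep_step (y (k - 1)) * (\<Prod>j\<in>{..<k} - {k - 1}. as_Q asep_step (y j))"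
          unfolding as_dual_def using k by (intro prod.remove) auto
        also have "\<dots> \<le> as_Q asep_step (y (k - 1)) * 1"
          by (intro mult_left_mono prod_le_1 Q Q[THEN conjunct1])
        also have "\<dots> \<le> q ^ M" using h q_pos q_less_1 unfolding as_Q_def as_step_count
          by (simp add: power_decreasing)
        finally show "as_dual k asep_step y \<le> \<eta>" using M by simp }
    qed
  qed (use as_gen_exp as_d_measurable al_be k in auto)
qed

section \<open>The dual of the q-TAZRP as a scaling system\<close>

definition taz_coll :: "nat \<Rightarrow> (nat \<Rightarrow> int) \<Rightarrow> nat set" where
  "taz_coll k y = {i. Suc i < k \<and> y (Suc i) = y i}"

text \<open>The rate of the block of \<open>i\<close> if it ended at \<open>i\<close>, which is a
  partial sum of the geometric series.\<close>

definition taz_wt :: "(nat \<Rightarrow> int) \<Rightarrow> nat \<Rightarrow> real" where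
  "taz_wt y i = (1 - q ^ card {j. j \<le> i \<and> y j = y i}) / (1 - q)"

definition taz_d :: "real \<Rightarrow> complex \<Rightarrow> complex \<Rightarrow> complex" where
  "taz_d h u w = (exp (- (of_real h * u)) - 1) - of_real q * (exp (- (of_real h * w)) - 1)"

lemma taz_d_bound:
  fixes h :: real
  assumes h: "0 < h" "h \<le> 1" and u: "0 \<le> Re u" "Re u \<le> nest k" and w: "0 \<le> Re w" "Re w \<le> nest k"
  shows "norm (taz_d h u w + of_real h * (u - of_real q * w))
    \<le> (2 * (1 + exp (nest k))) * h\<^sup>2 * ((1 + norm u) ^ 2 * (1 + norm w) ^ 2)"
proof -
  let ?P = "h\<^sup>2 * ((1 + norm u) ^ 2 * (1 + norm w) ^ 2)" and ?a = "of_real h * u" and ?b = "of_real h * w"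
  have na: "norm (- ?a) = h * norm u" "norm (- ?b) = h * norm w" using h by (simp_all add: norm_mult)
  have pw: "(norm (- ?a))\<^sup>2 \<le> ?P" "(norm (- ?b))\<^sup>2 \<le> ?P"
    using mult_left_mono[OF power2_le_prod(1)[of u w], of "h\<^sup>2"] mult_left_mono[OF power2_le_prod(2)[where u = u and w = w], of "h\<^sup>2"]
    unfolding na by (simp_all add: power_mult_distrib)
  have P0: "0 \<le> ?P" by simp
  have b: "norm (exp (- c) - 1 - (- c)) \<le> ?P * (1 + exp (nest k))" if "c = ?a \<or> c = ?b" for c
    using that exp_nest_le[OF h u] exp_nest_le[OF h w] P0 pw
    by (intro order_trans[OF norm_exp_diff2_le[of "- c"]] mult_mono add_mono) auto
  have "taz_d h u w + of_real h * (u - of_real q * w)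
    = (exp (- ?a) - 1 - (- ?a)) - of_real q * (exp (- ?b) - 1 - (- ?b))"
    unfolding taz_d_def by (simp add: algebra_simps)
  also have "norm \<dots> \<le> ?P * (1 + exp (nest k)) + 1 * (?P * (1 + exp (nest k)))"
  proof (rule order_trans[OF norm_triangle_ineq4 add_mono])
    show "norm (exp (- ?a) - 1 - (- ?a)) \<le> ?P * (1 + exp (nest k))" by (rule b) simp
    show "norm (of_real q * (exp (- ?b) - 1 - (- ?b))) \<le> 1 * (?P * (1 + exp (nest k)))"
      unfolding norm_mult[of "of_real q"] using q_pos q_less_1 by (intro mult_mono b) auto
  qed
  also have "\<dots> = (2 * (1 + exp (nest k))) * ?P" by (simp add: algebra_simps)
  finally show ?thesis by (simp only: mult.assoc)
qed

text \<open>The rates of the blocks telescope: the partial sums \<open>w\<^sub>i\<close> of a geometric series satisfy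
  \<open>w\<^sub>i = 1 + q * w\<^sub>i\<^sub>-\<^sub>1\<close> inside a block.\<close>

lemma taz_wt_Suc:
  assumes y: "y \<in> weak_chamber k" and i: "Suc i < k"
  shows "taz_wt y (Suc i) = 1 + (if y (Suc i) = y i then q * taz_wt y i else 0)"
proof -
  have q1: "1 - q \<noteq> 0" using q_less_1 by simp
  show ?thesis
  proof (cases "y (Suc i) = y i")
    case True
    have "{j. j \<le> Suc i \<and> y j = y (Suc i)} = insert (Suc i) {j. j \<le> i \<and> y j = y i}"
      using True by (auto simp: le_Suc_eq)
    then have "card {j. j \<le> Suc i \<and> y j = y (Suc i)} = Suc (card {j. j \<le> i \<and> y j = y i})" by simp
    then show ?thesis using True q1 by (simp add: taz_wt_def field_simps)
  next
    case False
    have mono: "y b \<le> y a" if "a \<le> b" "b < k" for a b using y that by (simp add: weak_chamber_def)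
    have "y j \<noteq> y (Suc i)" if "j \<le> i" for j
    proof -
      have "y (Suc i) \<le> y i" "y i \<le> y j" using mono[of i "Suc i"] mono[of j i] that i by simp_all
      then show ?thesis using False by linarith
    qed
    then have "{j. j \<le> Suc i \<and> y j = y (Suc i)} = {Suc i}" by (auto simp: le_Suc_eq)
    then show ?thesis using False q1 by (simp add: taz_wt_def)
  qed
qed

lemma taz_wt_0: "taz_wt y 0 = 1"
proof -
  have "{j. j \<le> 0 \<and> y j = y 0} = {0 :: nat}" by auto
  then show ?thesis using q_less_1 by (simp add: taz_wt_def)
qed

lemma taz_wt_bounds: "1 \<le> taz_wt y i" "taz_wt y i \<le> 1 / (1 - q)"
proof -
  have "i \<in> {j. j \<le> i \<and> y j = y i}" "finite {j. j \<le> i \<and> y j = y i}" by auto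
  then have "1 \<le> card {j. j \<le> i \<and> y j = y i}" by (metis One_nat_def Suc_leI card_gt_0_iff empty_iff)
  then have "q ^ card {j. j \<le> i \<and> y j = y i} \<le> q ^ 1" using q_pos q_less_1 by (intro power_decreasing) auto
  then show "1 \<le> taz_wt y i" using q_less_1 by (simp add: taz_wt_def)
  show "taz_wt y i \<le> 1 / (1 - q)" unfolding taz_wt_def using q_pos q_less_1 by (intro divide_right_mono) auto
qed

lemma taz_dual_rate_eq:
  assumes y: "y \<in> weak_chamber k" and j: "j < k"
  shows "taz_dual_rate k y j = (if j \<in> taz_coll k y then 0 else taz_wt y j)"
proof (cases "cluster_end k y j")
  case True
  have "{i. i < k \<and> y i = y j} = {i. i \<le> j \<and> y i = y j}"
  proof -
    have "i \<le> j" if i: "i < k" "y i = y j" for i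
    proof (rule ccontr)
      assume "\<not> i \<le> j"
      then have ji: "Suc j \<le> i" by auto
      have mono: "y b \<le> y a" if "a \<le> b" "b < k" for a b using y that by (simp add: weak_chamber_def)
      have sk: "Suc j < k" using ji i by linarith
      have "y i \<le> y (Suc j)" by (rule mono[OF ji i(1)])
      moreover have "y (Suc j) \<le> y j" by (rule mono[OF _ sk]) simp
      moreover have "y (Suc j) \<noteq> y j" using True sk by (simp add: cluster_end_def)
      ultimately show False using i by linarith
    qed
    then show ?thesis using j by auto
  qed
  moreover have "j \<notin> taz_coll k y" using True by (auto simp: cluster_end_def taz_coll_def)
  ultimately show ?thesis using True by (simp add: taz_dual_rate_def cluster_size_def taz_wt_def)
next
  case False
  then show ?thesis by (auto simp: taz_dual_rate_def cluster_end_def taz_coll_def)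
qed

text \<open>The rates sit at the block ends. Spreading them as unit rates over all particles costs,
  at each collision, a multiple of \<open>X i - q * X (Suc i)\<close>, since inside a block
  \<open>taz_wt y j - 1\<close> is \<open>q\<close> times the preceding weight. This brings the
  cluster rule into the same boundary form as exclusion.\<close>

lemma taz_rate_telescope:
  fixes X :: "nat \<Rightarrow> complex"
  assumes y: "y \<in> weak_chamber k"
  shows "(\<Sum>j<k. of_real (taz_dual_rate k y j) * X j)
    = (\<Sum>j<k. X j) - (\<Sum>i\<in>taz_coll k y. of_real (taz_wt y i) * (X i - of_real q * X (Suc i)))"
proof -
  have fin: "finite (taz_coll k y)" "taz_coll k y \<subseteq> {..<k}"
    by (auto simp: taz_coll_def intro: finite_subset[of _ "{..<k}"])
  have "(\<Sum>i\<in>taz_coll k y. of_real (taz_wt y i) * (of_real q * X (Suc i)))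
    = (\<Sum>j\<in>Suc ` taz_coll k y. of_real (taz_wt y (j - 1)) * (of_real q * X j))"
    by (subst sum.reindex) auto
  also have "\<dots> = (\<Sum>j\<in>Suc ` taz_coll k y. of_real (taz_wt y j - 1) * X j)"
  proof (intro sum.cong refl)
    fix j assume "j \<in> Suc ` taz_coll k y"
    then obtain i where i: "j = Suc i" "Suc i < k" "y (Suc i) = y i" by (auto simp: taz_coll_def)
    show "of_real (taz_wt y (j - 1)) * (of_real q * X j) = of_real (taz_wt y j - 1) * X j"
      using taz_wt_Suc[OF y i(2)] i by simp
  qed
  also have "\<dots> = (\<Sum>j<k. of_real (taz_wt y j - 1) * X j)"
  proof (intro sum.mono_neutral_left)
    show "Suc ` taz_coll k y \<subseteq> {..<k}" by (auto simp: taz_coll_def)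
    show "\<forall>j\<in>{..<k} - Suc ` taz_coll k y. of_real (taz_wt y j - 1) * X j = 0"
    proof
      fix j assume j: "j \<in> {..<k} - Suc ` taz_coll k y"
      show "of_real (taz_wt y j - 1) * X j = 0"
      proof (cases j)
        case 0
        then show ?thesis by (simp add: taz_wt_0)
      next
        case (Suc i)
        then have "y (Suc i) \<noteq> y i" using j by (auto simp: taz_coll_def)
        then show ?thesis using taz_wt_Suc[OF y, of i] Suc j by simp
      qed
    qed
  qed simp
  finally have 1: "(\<Sum>i\<in>taz_coll k y. of_real (taz_wt y i) * (of_real q * X (Suc i))) = (\<Sum>j<k. of_real (taz_wt y j - 1) * X j)" .
  have 2: "(\<Sum>i\<in>taz_coll k y. of_real (taz_wt y i) * X i) = (\<Sum>j<k. if j \<in> taz_coll k y then of_real (taz_wt y j) * X j else 0)"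
    using fin by (simp add: sum.If_cases Int_absorb1)
  have "(\<Sum>j<k. of_real (taz_dual_rate k y j) * X j)
    = (\<Sum>j<k. X j - (if j \<in> taz_coll k y then of_real (taz_wt y j) * X j else 0) + of_real (taz_wt y j - 1) * X j)"
    by (intro sum.cong refl) (auto simp: taz_dual_rate_eq[OF y] algebra_simps)
  then show ?thesis
    by (simp add: sum.distrib sum_subtractf right_diff_distrib 1 2)
qed

lemma taz_step_Q: "taz_Q qtazrp_step u = (if u \<le> 0 then 0 else 1)"
  by (simp add: taz_Q_def taz_count_def qtazrp_step_def)

lemma taz_scaling:
  assumes k: "1 \<le> k"
  shows "scaling_limit q {..<k} (taz_dual_rate k) down (weak_chamber k) (real k) k 0 1 0 (1 / (1 - q)) 1
    (2 * (1 + exp (nest k))) (taz_coll k) taz_wt taz_d (taz_dual k qtazrp_step)"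
proof -
  interpret G: markov_generator "{..<k}" "taz_dual_rate k" down "weak_chamber k" "real k"
    by (rule taz_dual_generator[OF k])
  show ?thesis
  proof unfold_locales
    show "Suc i < k \<and> y i = y (Suc i) + int 0 \<and> 1 \<le> taz_wt y i \<and> taz_wt y i \<le> 1 / (1 - q)" if "i \<in> taz_coll k y" for y i
      using that taz_wt_bounds by (simp add: taz_coll_def)
    show "norm (taz_d h u w + of_real (1 * h) * (u - of_real q * w) * exp (- (of_real (real 0 * h) * u)))
      \<le> (2 * (1 + exp (nest k))) * h\<^sup>2 * ((1 + norm u) ^ 2 * (1 + norm w) ^ 2)"
      if "0 < h" "h \<le> 1" "0 \<le> Re u" "Re u \<le> nest k" "0 \<le> Re w" "Re w \<le> nest k" for h :: real and u w
      using taz_d_bound[OF that] by simp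
    show "(\<lambda>z. taz_d h (fst z) (snd z)) \<in> borel_measurable (borel \<Otimes>\<^sub>M borel)" for h
      unfolding taz_d_def by measurable
    fix y assume y: "y \<in> weak_chamber k"
    show mono: "y j \<le> y i" if "i \<le> j" "j < k" for i j
      using y that by (auto simp: weak_chamber_def)
    show "0 \<le> taz_dual k qtazrp_step y \<and> taz_dual k qtazrp_step y \<le> 1"
      unfolding taz_dual_def by (intro conjI prod_nonneg prod_le_1 ballI) (auto simp: taz_step_Q)
    fix z :: "nat \<Rightarrow> complex" and h :: real
    let ?e = "\<lambda>y. exp (\<Sum>j<k. of_real (h * real_of_int (y j)) * z j)"
    have "?e (down i y) - ?e y = ?e y * (exp (- (of_real h * z i)) - 1)" if "i < k" for i
      using prod_upd_exp[OF that, of h y "-1" z] by (simp add: down_def right_diff_distrib)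
    then have "G.gen ?e y = (\<Sum>j<k. ?e y * (of_real (taz_dual_rate k y j) * (exp (- (of_real h * z j)) - 1)))"
      unfolding G.gen_def scaleR_conv_of_real by (intro sum.cong refl) (simp only: lessThan_iff mult.left_commute)
    also have "\<dots> = ?e y * ((\<Sum>j<k. exp (- (of_real h * z j)) - 1)
      - (\<Sum>i\<in>taz_coll k y. of_real (taz_wt y i) * taz_d h (z i) (z (Suc i))))"
      unfolding sum_distrib_left[symmetric] taz_rate_telescope[OF y] taz_d_def ..
    finally show "G.gen ?e y = ?e y * ((\<Sum>j<k. of_real 1 * (exp (- (of_real h * z j)) - 1) + of_real 0 * (exp (of_real h * z j) - 1))
        - (\<Sum>i\<in>taz_coll k y. of_real (taz_wt y i) * taz_d h (z i) (z (Suc i))))" by simp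
  next
    fix \<eta> :: real assume \<eta>: "0 < \<eta>"
    show "\<exists>M::nat. \<forall>y\<in>weak_chamber k. (int M \<le> y (k - 1) \<longrightarrow> 1 - \<eta> \<le> taz_dual k qtazrp_step y) \<and>
      (y (k - 1) < - int M \<longrightarrow> taz_dual k qtazrp_step y \<le> \<eta>)"
    proof (intro exI[of _ 1] ballI conjI impI)
      fix y assume y: "y \<in> weak_chamber k"
      { assume h: "int 1 \<le> y (k - 1)"
        have "taz_Q qtazrp_step (y j) = 1" if "j < k" for j
        proof -
          have "y (k - 1) \<le> y j" using y that by (auto simp: weak_chamber_def)
          then show ?thesis using h by (simp add: taz_step_Q)
        qed
        then show "1 - \<eta> \<le> taz_dual k qtazrp_step y" using \<eta> by (simp add: taz_dual_def) }
      { assume h: "y (k - 1) < - int 1"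
        have "taz_dual k qtazrp_step y = 0"
          unfolding taz_dual_def using k h by (intro prod_zero bexI[of _ "k - 1"]) (auto simp: taz_step_Q)
        then show "taz_dual k qtazrp_step y \<le> \<eta>" using \<eta> by simp }
    qed
  qed (use k q_pos q_less_1 in auto)
qed

end

section \<open>Moments and tail probabilities\<close>

abbreviation expect :: "((nat \<times> 'e \<Rightarrow> real) \<Rightarrow> real) \<Rightarrow> real" where
  "expect \<equiv> integral\<^sup>L clocks"

section \<open>Poisson weights and abstract limits\<close>

lemma power_diff_le:
  fixes a b :: real
  assumes "0 \<le> b" "b \<le> a" "a \<le> 1"
  shows "a ^ k - b ^ k \<le> k * (a - b)"
proof (induction k)
  case (Suc k)
  have "a ^ Suc k - b ^ Suc k = a * (a ^ k - b ^ k) + b ^ k * (a - b)" by (simp add: algebra_simps)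
  also have "\<dots> \<le> 1 * (a ^ k - b ^ k) + 1 * (a - b)"
    using assms by (intro add_mono mult_right_mono power_le_one) (auto intro: power_mono)
  also have "\<dots> \<le> k * (a - b) + (a - b)" using Suc by simp
  finally show ?case by (simp add: algebra_simps)
qed simp

text \<open>From index \<open>m\<close> on, \<open>N + 1\<close> consecutive terms of the
  exponential series are at least \<open>exp (- 1)\<close> times the first of them, because each
  successive ratio is at least \<open>T / (T + N)\<close> and \<open>N * N \<le> T\<close>. Their
  sum is at most \<open>exp T\<close>.\<close>

lemma poisson_le_aux:
  fixes T :: real
  assumes T: "0 < T" and m: "real m \<le> T"
  shows "sqrt T * (T ^ m / fact m) \<le> exp 1 * exp T"
proof -
  define N where "N = nat \<lfloor>sqrt T\<rfloor>"
  have N: "real N \<le> sqrt T" "sqrt T \<le> real N + 1" using T by (auto simp: N_def)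
  define a where "a i = T ^ i / fact i" for i :: nat
  have a0: "0 \<le> a i" for i using T by (simp add: a_def)
  let ?r = "T / (T + N)"
  have r: "0 \<le> ?r" "?r \<le> 1" using T by auto
  have step: "a m * ?r ^ i \<le> a (m + i)" if "i \<le> N" for i
    using that
  proof (induction i)
    case (Suc i)
    have "a m * ?r ^ Suc i = (a m * ?r ^ i) * ?r" by simp
    also have "\<dots> \<le> a (m + i) * (T / (m + i + 1))"
      using Suc T m a0 by (intro mult_mono frac_le) auto
    also have "\<dots> = a (m + Suc i)" by (simp add: a_def field_simps)
    finally show ?case .
  qed simp
  have rN: "exp (- 1) \<le> ?r ^ N"
  proof -
    have "(1 + N / T) ^ N \<le> exp (N / T) ^ N" using T by (intro power_mono exp_ge_add_one_self) auto
    also have "\<dots> = exp (real N * (N / T))" by (simp only: exp_of_nat_mult)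
    also have "\<dots> \<le> exp 1"
    proof -
      have "real N * real N \<le> sqrt T * sqrt T" using N T by (intro mult_mono) auto
      then show ?thesis using T by (simp add: pos_divide_le_eq)
    qed
    finally have "inverse (exp 1) \<le> inverse ((1 + N / T) ^ N)" using T by (intro le_imp_inverse_le zero_less_power add_pos_nonneg) auto
    also have "\<dots> = ?r ^ N" using T by (simp add: power_inverse[symmetric] field_simps)
    finally show ?thesis by (simp add: exp_minus)
  qed
  have "a m * exp (- 1) \<le> a (m + i)" if "i \<le> N" for i
  proof -
    have "exp (- 1) \<le> ?r ^ i" by (rule order_trans[OF rN power_decreasing[OF that r]])
    then show ?thesis using step[OF that] a0[of m] by (meson mult_left_mono order_trans)
  qed
  then have "(\<Sum>i\<le>N. a m * exp (- 1)) \<le> (\<Sum>i\<le>N. a (m + i))" by (intro sum_mono) auto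
  also have "\<dots> = (\<Sum>i\<in>(+) m ` {..N}. a i)" by (subst sum.reindex) auto
  also have "\<dots> \<le> (\<Sum>i. a i)"
    using summable_exp[of T] a0 by (intro sum_le_suminf) (auto simp: a_def field_simps)
  also have "\<dots> = exp T" unfolding a_def exp_def by (simp add: divide_inverse_commute scaleR_conv_of_real)
  finally have 1: "(real N + 1) * (a m * exp (- 1)) \<le> exp T" by (simp add: add.commute)
  have "sqrt T * (a m * exp (- 1)) \<le> (real N + 1) * (a m * exp (- 1))"
    using N(2) a0 by (intro mult_right_mono) auto
  with 1 have "sqrt T * (a m * exp (- 1)) \<le> exp T" by simp
  then have "exp 1 * (sqrt T * (a m * exp (- 1))) \<le> exp 1 * exp T" by simp
  moreover have "exp 1 * (sqrt T * (a m * exp (- 1))) = (exp 1 * exp (- 1)) * (sqrt T * a m)" by (simp only: mult_ac)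
  moreover have "exp 1 * exp (- 1) = (1 :: real)" by (rule exp_minus_inverse)
  ultimately have "sqrt T * a m \<le> exp 1 * exp T" by (simp only: mult_1_left)
  then show ?thesis by (simp add: a_def)
qed

text \<open>Beyond \<open>T\<close> the terms of the exponential series decrease, so the bound is
  inherited from the preceding index.\<close>

lemma poisson_le:
  fixes T :: real
  assumes T: "0 < T"
  shows "exp (- T) * (T ^ m / fact m) \<le> exp 1 / sqrt T"
proof -
  have "sqrt T * (T ^ m / fact m) \<le> exp 1 * exp T"
  proof (induction m)
    case 0
    then show ?case using poisson_le_aux[OF T, of 0] T by simp
  next
    case (Suc m)
    show ?case
    proof (cases "real (Suc m) \<le> T")
      case False
      have "T ^ Suc m / fact (Suc m) = (T ^ m / fact m) * (T / Suc m)" by (simp add: field_simps)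
      also have "\<dots> \<le> (T ^ m / fact m) * 1" using False T by (intro mult_left_mono) auto
      finally have "sqrt T * (T ^ Suc m / fact (Suc m)) \<le> sqrt T * (T ^ m / fact m)" using T by (intro mult_left_mono) auto
      then show ?thesis using Suc by linarith
    qed (rule poisson_le_aux[OF T])
  qed
  then have "exp (- T) * (sqrt T * (T ^ m / fact m)) \<le> exp (- T) * (exp 1 * exp T)" by (intro mult_left_mono) auto
  also have "\<dots> = exp 1" by (simp add: exp_minus)
  finally show ?thesis using T by (simp add: pos_le_divide_eq mult_ac)
qed

text \<open>Rounding and a fixed shift are invisible on the diffusive scale. The shift
  \<open>c\<close> serves the neighbouring levels which the ASEP duality requires.\<close>

lemma ceiling_scaled_tendsto:
  fixes T :: "'a \<Rightarrow> real"
  assumes T: "filterlim T at_top F"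
  shows "((\<lambda>n. (of_int (\<lceil>v * T n + X * sqrt (T n)\<rceil> + c) - v * T n) / sqrt (T n)) \<longlongrightarrow> X) F"
proof (rule Lim_transform2[OF tendsto_const])
  have Tpos: "\<forall>\<^sub>F n in F. 0 < T n" using T by (simp add: filterlim_at_top_dense)
  show "((\<lambda>n. X - (of_int (\<lceil>v * T n + X * sqrt (T n)\<rceil> + c) - v * T n) / sqrt (T n)) \<longlongrightarrow> 0) F"
  proof (rule Lim_null_comparison)
    show "((\<lambda>n. (\<bar>c\<bar> + 1) / sqrt (T n)) \<longlongrightarrow> 0) F"
      by (rule real_tendsto_divide_at_top[OF tendsto_const filterlim_compose[OF sqrt_at_top T]])
    show "\<forall>\<^sub>F n in F. norm (X - (of_int (\<lceil>v * T n + X * sqrt (T n)\<rceil> + c) - v * T n) / sqrt (T n))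
        \<le> (\<bar>c\<bar> + 1) / sqrt (T n)"
      using Tpos
    proof eventually_elim
      case (elim n)
      let ?a = "v * T n + X * sqrt (T n)"
      have "X - (of_int (\<lceil>?a\<rceil> + c) - v * T n) / sqrt (T n) = (?a - of_int (\<lceil>?a\<rceil> + c)) / sqrt (T n)"
        using elim by (simp add: field_simps)
      moreover have "\<bar>?a - of_int (\<lceil>?a\<rceil> + c)\<bar> \<le> \<bar>real_of_int c\<bar> + 1"
        using le_of_int_ceiling[of ?a] of_int_ceiling_le_add_one[of ?a] unfolding of_int_add by linarith
      ultimately show ?case using elim by (simp add: divide_right_mono)
    qed
  qed
qed

lemma initial_segment_card:
  assumes "finite S" "\<And>i j. j \<in> S \<Longrightarrow> 1 \<le> i \<Longrightarrow> i \<le> j \<Longrightarrow> i \<in> S" "S \<subseteq> {1..}" "1 \<le> m"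
  shows "m \<in> S \<longleftrightarrow> m \<le> card S"
proof
  assume "m \<in> S"
  then have "{1..m} \<subseteq> S" using assms(2) by auto
  from card_mono[OF assms(1) this] show "m \<le> card S" by simp
next
  assume m: "m \<le> card S"
  show "m \<in> S"
  proof (rule ccontr)
    assume "m \<notin> S"
    then have "S \<subseteq> {1..<m}" using assms(2)[OF _ assms(4)] assms(3) by (force simp: not_le[symmetric])
    from card_mono[OF _ this] show False using m assms(4) by simp
  qed
qed

text \<open>A Cauchy criterion for many filters at once: approximate values shared by all of them
  force a shared limit, without a candidate for it. Filters on the reals cover sequences as well as
  limits in continuous time.\<close>

lemma common_limit:
  fixes \<F> :: "real filter set"
  assumes "\<And>e. 0 < e \<Longrightarrow> \<exists>c. \<forall>F\<in>\<F>. \<forall>\<^sub>F x in F. \<bar>x - c\<bar> \<le> e"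
  shows "\<exists>L. \<forall>F\<in>\<F>. F \<le> nhds L"
proof (cases "\<exists>F\<in>\<F>. F \<noteq> bot")
  case True
  then obtain F0 where F0: "F0 \<in> \<F>" "F0 \<noteq> bot" by blast
  have "\<exists>c. \<forall>F\<in>\<F>. \<forall>\<^sub>F x in F. \<bar>x - c\<bar> \<le> 1 / real (Suc i)" for i
    by (rule assms) simp
  then obtain c where c: "\<And>i F. F \<in> \<F> \<Longrightarrow> \<forall>\<^sub>F x in F. \<bar>x - c i\<bar> \<le> 1 / real (Suc i)" by metis
  have cl: "(\<lambda>i. 1 / real (Suc i)) \<longlonglongrightarrow> 0" by (rule LIMSEQ_Suc[OF lim_1_over_n])
  have "Cauchy c"
  proof (rule metric_CauchyI)
    fix e :: real assume e: "0 < e"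
    have "\<forall>\<^sub>F i in sequentially. 1 / real (Suc i) < e / 2" using order_tendstoD(2)[OF cl, of "e / 2"] e by simp
    then obtain M where M: "\<And>i. M \<le> i \<Longrightarrow> 1 / real (Suc i) < e / 2" by (auto simp: eventually_sequentially)
    show "\<exists>M. \<forall>i\<ge>M. \<forall>j\<ge>M. dist (c i) (c j) < e"
    proof (intro exI[of _ M] allI impI)
      fix i j assume ij: "M \<le> i" "M \<le> j"
      from eventually_happens'[OF F0(2) eventually_conj[OF c[OF F0(1), of i] c[OF F0(1), of j]]]
      obtain x where "\<bar>x - c i\<bar> \<le> 1 / real (Suc i)" "\<bar>x - c j\<bar> \<le> 1 / real (Suc j)" by auto
      then show "dist (c i) (c j) < e" using M[OF ij(1)] M[OF ij(2)] unfolding dist_real_def by linarith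
    qed
  qed
  then obtain L where L: "c \<longlonglongrightarrow> L" using Cauchy_convergent convergent_def by blast
  have "F \<le> nhds L" if F: "F \<in> \<F>" for F
  proof -
    have "((\<lambda>x. x) \<longlongrightarrow> L) F"
    proof (rule tendstoI)
      fix e :: real assume e: "0 < e"
      have "\<forall>\<^sub>F i in sequentially. 1 / real (Suc i) < e / 2" "\<forall>\<^sub>F i in sequentially. dist (c i) L < e / 2"
        using order_tendstoD(2)[OF cl, of "e / 2"] tendstoD[OF L, of "e / 2"] e by auto
      from eventually_happens'[OF sequentially_bot eventually_conj[OF this]]
      obtain i where i: "1 / real (Suc i) < e / 2" "dist (c i) L < e / 2" by auto
      show "\<forall>\<^sub>F x in F. dist x L < e"
        using c[OF F, of i] by eventually_elim (use i in \<open>unfold dist_real_def, linarith\<close>)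
    qed
    then show ?thesis by (simp add: filterlim_def)
  qed
  then show ?thesis by blast
next
  case False
  then show ?thesis by (intro exI[of _ 0]) auto
qed

section \<open>Moments and tails of the two processes\<close>

context q_parameter begin

abbreviation taz_process :: "real \<Rightarrow> (nat \<times> int \<Rightarrow> real) \<Rightarrow> nat \<Rightarrow> int" where
  "taz_process \<equiv> jump_process taz_rate qtazrp_move qtazrp_step"

abbreviation as_process :: "real \<Rightarrow> (nat \<times> nat \<times> direction \<Rightarrow> real) \<Rightarrow> nat \<Rightarrow> int" where
  "as_process \<equiv> jump_process as_rate asep_move asep_step"

lemma taz_process_in: "taz_process T w \<in> taz_states"
  unfolding jump_process_def
  using jump_system.S_in[OF taz_jump_system] jump_system.S_def[OF taz_jump_system] by metis

lemma as_process_in: "as_process T w \<in> as_states"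
  unfolding jump_process_def
  using jump_system.S_in[OF as_jump_system] jump_system.S_def[OF as_jump_system] by metis

lemma taz_Q_range: "0 \<le> taz_Q x y" "taz_Q x y \<le> 1"
  using q_pos q_less_1 by (auto simp: taz_Q_def power_le_one)

lemma as_Q_range: "0 \<le> as_Q x y" "as_Q x y \<le> 1"
  using q_pos q_less_1 by (auto simp: as_Q_def power_le_one)

definition taz_moment :: "nat \<Rightarrow> real \<Rightarrow> int \<Rightarrow> real" where
  "taz_moment k T y = markov_generator.evol {..<k} (taz_dual_rate k) down (real k) (taz_dual k qtazrp_step) T (\<lambda>_. y)"

text \<open>Dual particles of the ASEP cannot coincide, so they start at \<open>k\<close>
  consecutive levels; the shifts disappear in the scaling.\<close>

definition as_moment :: "nat \<Rightarrow> real \<Rightarrow> int \<Rightarrow> real" where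
  "as_moment k T y = markov_generator.evol ({..<k} \<times> UNIV) (as_dual_rate k) hop (real k) (as_dual k asep_step) T (\<lambda>j. y - int j)"

lemma taz_expectation:
  assumes k: "1 \<le> k" and T: "0 \<le> T"
  shows "expect (\<lambda>w. taz_Q (taz_process T w) y ^ k) = taz_moment k T y"
    "taz_process T \<in> measurable clocks (count_space UNIV)"
proof -
  have y: "(\<lambda>_. y) \<in> weak_chamber k" by (simp add: weak_chamber_def)
  have b: "\<bar>taz_dual k s y\<bar> \<le> 1" for s y
    unfolding taz_dual_def abs_prod using taz_Q_range by (intro prod_le_1) auto
  note D = jump_process_duality[where D = "taz_dual k" and B = 1, OF taz_jump_system taz_dual_generator[OF k] _ _ T y]
  have "expect (\<lambda>w. taz_dual k (taz_process T w) (\<lambda>_. y)) = taz_moment k T y"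
    unfolding taz_moment_def by (rule D(1)) (use b taz_duality[OF _ _ k] in auto)
  then show "expect (\<lambda>w. taz_Q (taz_process T w) y ^ k) = taz_moment k T y" by (simp add: taz_dual_def)
  show "taz_process T \<in> measurable clocks (count_space UNIV)"
    by (rule D(2)) (use b taz_duality[OF _ _ k] in auto)
qed

lemma as_expectation:
  assumes k: "1 \<le> k" and T: "0 \<le> T"
  shows "expect (\<lambda>w. \<Prod>j<k. as_Q (as_process T w) (y - int j)) = as_moment k T y"
    "as_process T \<in> measurable clocks (count_space UNIV)"
proof -
  have y: "(\<lambda>j. y - int j) \<in> strict_chamber k" by (simp add: strict_chamber_def)
  have b: "\<bar>as_dual k s y\<bar> \<le> 1" for s y
    unfolding as_dual_def abs_prod using as_Q_range by (intro prod_le_1) auto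
  note D = jump_process_duality[where D = "as_dual k" and B = 1, OF as_jump_system as_dual_generator[OF k] _ _ T y]
  have "expect (\<lambda>w. as_dual k (as_process T w) (\<lambda>j. y - int j)) = as_moment k T y"
    unfolding as_moment_def by (rule D(1)) (use b as_duality in auto)
  then show "expect (\<lambda>w. \<Prod>j<k. as_Q (as_process T w) (y - int j)) = as_moment k T y" by (simp add: as_dual_def)
  show "as_process T \<in> measurable clocks (count_space UNIV)"
    by (rule D(2)) (use b as_duality in auto)
qed

lemma integrable_clocks_bounded:
  assumes P: "P \<in> measurable clocks (count_space UNIV)" and f: "\<And>w. \<bar>f (P w)\<bar> \<le> (B :: real)"
  shows "integrable clocks (\<lambda>w. f (P w))"
proof -
  interpret prob_space clocks by (rule prob_space_clocks)
  have "f \<in> measurable (count_space UNIV) borel" by simp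
  from measurable_compose[OF P this] show ?thesis
    using f by (intro integrable_const_bound[where B = B]) auto
qed

lemma taz_Q_mono: "x \<in> taz_states \<Longrightarrow> y \<le> y' \<Longrightarrow> taz_Q x y \<le> taz_Q x y'"
proof -
  assume x: "x \<in> taz_states" and yy: "y \<le> y'"
  show ?thesis
  proof (cases "y \<le> 0")
    case True
    then show ?thesis using taz_Q_range(1)[of x y'] by (simp add: taz_Q_def[of x y])
  next
    case False
    have "taz_count x y' \<le> taz_count x y"
      unfolding taz_count_def using yy by (intro card_mono taz_count_finite[OF x]) (use False in auto)
    then show ?thesis using False yy q_pos q_less_1 by (simp add: taz_Q_def power_decreasing)
  qed
qed

lemma as_Q_mono: "x \<in> as_states \<Longrightarrow> y \<le> y' \<Longrightarrow> as_Q x y \<le> as_Q x y'"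
proof -
  assume x: "x \<in> as_states" and yy: "y \<le> y'"
  have "as_count x (- y') \<le> as_count x (- y)"
    unfolding as_count_def using yy by (intro card_mono as_count_finite[OF x]) auto
  then show ?thesis using q_pos q_less_1 by (simp add: as_Q_def power_decreasing)
qed

lemma as_expectation_mono:
  fixes k :: nat
  assumes "1 \<le> k" "0 \<le> T" "\<And>j. j < k \<Longrightarrow> g j \<le> g' j"
  shows "expect (\<lambda>w. \<Prod>j<k. as_Q (as_process T w) (g j)) \<le> expect (\<lambda>w. \<Prod>j<k. as_Q (as_process T w) (g' j))"
proof (rule integral_mono)
  have "integrable clocks (\<lambda>w. \<Prod>j<k. as_Q (as_process T w) (f j))" for f
    by (rule integrable_clocks_bounded[OF as_expectation(2)[OF assms(1,2)], where B = 1])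
      (use as_Q_range in \<open>auto simp: abs_prod intro!: prod_le_1\<close>)
  from this[of g] this[of g'] show "integrable clocks (\<lambda>w. \<Prod>j<k. as_Q (as_process T w) (g j))"
    "integrable clocks (\<lambda>w. \<Prod>j<k. as_Q (as_process T w) (g' j))" .
qed (use assms(3) in \<open>auto intro!: prod_mono as_Q_range as_Q_mono[OF as_process_in]\<close>)

text \<open>A single dual particle moves down at rate 1, so the dual is a Poisson process; the first
  moment becomes a Poisson distribution function.\<close>

lemma taz_step_1:
  "(markov_generator.step {..<1} (taz_dual_rate 1) down (real 1) ^^ i) f n = f (n(0 := n 0 - int i))"
proof -
  interpret G: markov_generator "{..<1}" "taz_dual_rate 1" down "weak_chamber 1" "real 1"
    by (rule taz_dual_generator) simp
  have "{j. j < 1 \<and> n j = n 0} = {0 :: nat}" for n :: "nat \<Rightarrow> int" by auto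
  then have r: "taz_dual_rate 1 n 0 = 1" for n
    using q_less_1 by (simp add: taz_dual_rate_def cluster_end_def cluster_size_def)
  have s: "G.step f n = f (n(0 := n 0 - 1))" for f n
    unfolding G.step_def G.gen_def using r by (simp add: down_def lessThan_Suc)
  show ?thesis
  proof (induction i arbitrary: f)
    case (Suc i)
    have "(G.step ^^ Suc i) f n = (G.step ^^ i) (G.step f) n" by (simp add: funpow_swap1)
    also have "\<dots> = G.step f (n(0 := n 0 - int i))" by (rule Suc)
    also have "\<dots> = f (n(0 := n 0 - int (Suc i)))" unfolding s by (simp add: algebra_simps)
    finally show ?case .
  qed simp
qed

lemma taz_moment_1: "taz_moment 1 T y = exp (- T) * (\<Sum>i<nat y. T ^ i / fact i)"
proof -
  have "taz_moment 1 T y = exp (- T) * (\<Sum>i. (if int i < y then 1 else 0) / fact i * T ^ i)"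
  proof -
    have 1: "taz_dual 1 qtazrp_step ((\<lambda>_. y)(0 := y - int i)) * real 1 ^ i / fact i = (if int i < y then 1 else 0) / fact i" for i
      by (simp add: taz_dual_def taz_step_Q lessThan_Suc)
    show ?thesis
      unfolding taz_moment_def markov_generator.evol_def[OF taz_dual_generator[OF order_refl]] taz_step_1 1 by simp
  qed
  also have "(\<Sum>i. (if int i < y then 1 else 0) / fact i * T ^ i) = (\<Sum>i<nat y. (if int i < y then 1 else 0) / fact i * T ^ i)"
    by (rule suminf_finite) auto
  also have "\<dots> = (\<Sum>i<nat y. T ^ i / fact i)" by (intro sum.cong) auto
  finally show ?thesis .
qed

text \<open>k-th powers of numbers in [0, 1] differ by at most \<open>k\<close> times the numbers,
  which reduces the k-th moment to the first; there every unit of level costs one Poisson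
  weight.\<close>

lemma taz_moment_modulus:
  assumes k: "1 \<le> k" and T: "0 < T" and yy: "y \<le> y'"
  shows "taz_moment k T y' - taz_moment k T y \<le> k * (exp 1 / sqrt T) * real_of_int (y' - y)"
proof -
  have T0: "0 \<le> T" using T by simp
  note m = taz_expectation(2)[OF k T0]
  have i: "integrable clocks (\<lambda>w. taz_Q (taz_process T w) y ^ k)" for y k
    by (rule integrable_clocks_bounded[OF m, where B = 1]) (simp add: taz_Q_range power_abs power_le_one)
  have "taz_moment k T y' - taz_moment k T y = expect (\<lambda>w. taz_Q (taz_process T w) y' ^ k - taz_Q (taz_process T w) y ^ k)"
    unfolding taz_expectation(1)[OF k T0, symmetric] by (rule Bochner_Integration.integral_diff[OF i i, symmetric])
  also have "\<dots> \<le> expect (\<lambda>w. k * (taz_Q (taz_process T w) y' ^ 1 - taz_Q (taz_process T w) y ^ 1))"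
  proof (rule integral_mono)
    fix w
    show "taz_Q (taz_process T w) y' ^ k - taz_Q (taz_process T w) y ^ k \<le> k * (taz_Q (taz_process T w) y' ^ 1 - taz_Q (taz_process T w) y ^ 1)"
      unfolding power_one_right by (intro power_diff_le taz_Q_range taz_Q_mono[OF taz_process_in yy])
  qed (intro Bochner_Integration.integrable_diff integrable_mult_right i)+
  also have "\<dots> = k * (taz_moment 1 T y' - taz_moment 1 T y)"
    unfolding taz_expectation(1)[OF order_refl T0, symmetric] integral_mult_right_zero Bochner_Integration.integral_diff[OF i i] ..
  also have "taz_moment 1 T y' - taz_moment 1 T y = (\<Sum>i\<in>{nat y..<nat y'}. exp (- T) * (T ^ i / fact i))"
    unfolding taz_moment_1 sum_distrib_left[symmetric] right_diff_distrib[symmetric]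
    using sum_diff_nat_ivl[of 0 "nat y" "nat y'" "\<lambda>i. T ^ i / fact i"] yy
    by (simp add: atLeast0LessThan nat_mono)
  also have "\<dots> \<le> (\<Sum>i\<in>{nat y..<nat y'}. exp 1 / sqrt T)" by (intro sum_mono poisson_le T)
  also have "\<dots> \<le> (exp 1 / sqrt T) * real_of_int (y' - y)"
  proof -
    have "real (nat y' - nat y) \<le> real_of_int (y' - y)" using yy by linarith
    then show ?thesis using T by (simp add: mult.commute divide_right_mono)
  qed
  finally show ?thesis by (simp add: mult_left_mono mult.assoc)
qed

text \<open>The conclusion of the comparison with all reference to a process removed, so that
  q-TAZRP and ASEP moments become instances of one property with one limit.\<close>

definition profiled :: "nat \<Rightarrow> real \<Rightarrow> (nat \<Rightarrow> real) \<Rightarrow> bool" where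
  "profiled k X P \<longleftrightarrow> (\<forall>\<eta>>0. \<forall>J \<delta>. 0 < J \<longrightarrow> Vmax k / real J \<le> \<eta> \<longrightarrow> 0 < \<delta> \<longrightarrow>
    (\<forall>\<^sub>F n in sequentially. P n \<le> profile k J \<delta> X + 3 * \<eta>) \<and>
    (\<forall>\<^sub>F n in sequentially. profile k J \<delta> (X - \<delta> * width k J) - 3 * \<eta> \<le> P n))"

lemma taz_profiled:
  assumes k: "1 \<le> k" and T: "filterlim T at_top sequentially" and X: "(\<lambda>n. (y n - T n) / sqrt (T n)) \<longlonglongrightarrow> X"
  shows "profiled k X (\<lambda>n. taz_moment k (T n) (y n))"
proof -
  interpret S: scaling_limit q "{..<k}" "taz_dual_rate k" down "weak_chamber k" "real k" k 0 1 0 "1 / (1 - q)" 1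
    "2 * (1 + exp (nest k))" "taz_coll k" taz_wt taz_d "taz_dual k qtazrp_step"
    by (rule taz_scaling[OF k])
  have v: "S.v = 1" by (simp add: S.v_def)
  have X': "(\<lambda>n. (y n - S.v * T n) / sqrt (T n)) \<longlonglongrightarrow> X" using X by (simp add: v)
  show ?thesis unfolding profiled_def taz_moment_def
    using S.evol_profile[where y = "\<lambda>n _. y n" and X = X, OF _ _ _ _ T _ X'] by (simp add: weak_chamber_def)
qed

lemma as_profiled:
  assumes k: "1 \<le> k" and T: "filterlim T at_top sequentially"
    and X: "\<And>c::int. (\<lambda>n. (of_int (y n + c) - (al - be) * T n) / sqrt (T n)) \<longlonglongrightarrow> X"
  shows "profiled k X (\<lambda>n. as_moment k (T n) (y n))"
proof -
  interpret S: scaling_limit q "{..<k} \<times> UNIV" "as_dual_rate k" hop "strict_chamber k" "real k" k 1 al be 1 al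
    "exp (nest k) + 5" "as_coll k" "\<lambda>_ _. 1" as_d "as_dual k asep_step"
    by (rule as_scaling[OF k])
  have v: "S.v = al - be" by (simp add: S.v_def)
  have X': "(\<lambda>n. (of_int (y n - int j) - S.v * T n) / sqrt (T n)) \<longlonglongrightarrow> X" for j
    using X[of "- int j"] by (simp add: v)
  show ?thesis unfolding profiled_def as_moment_def
    using S.evol_profile[where y = "\<lambda>n j. y n - int j" and X = X, OF _ _ _ _ T _ X'] by (simp add: strict_chamber_def)
qed

text \<open>The two bounds differ by a shift of the profile. Its cost is estimated through q-TAZRP
  moments: the profile at \<open>X\<close> lies below a moment at \<open>?X2\<close>, the profile at
  \<open>?X1\<close> above one at \<open>?X1\<close>, each up to \<open>3 * \<eta>\<close>, and
  \<open>taz_moment_modulus\<close> compares these moments.\<close>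

lemma profiled_close:
  assumes k: "1 \<le> k" and e: "0 < e"
  shows "\<exists>c. \<forall>P. profiled k X P \<longrightarrow> (\<forall>\<^sub>F n in sequentially. \<bar>P n - c\<bar> \<le> e)"
proof -
  \<comment> \<open>Nine units are spent on the comparison of the two profiles and three on the
    lower bound in \<open>profiled\<close>.\<close>
  define \<eta> where "\<eta> = e / 12"
  have \<eta>: "0 < \<eta>" using e by (simp add: \<eta>_def)
  obtain J :: nat where J: "Vmax k / \<eta> < J" using reals_Archimedean2 by blast
  moreover have "0 \<le> Vmax k / \<eta>" using Vmax(1) \<eta> by simp
  ultimately have J0: "0 < real J" by linarith
  have "Vmax k \<le> \<eta> * J" using J \<eta> by (simp add: pos_divide_less_eq mult.commute)
  then have J: "0 < J" "Vmax k / J \<le> \<eta>" using J0 by (simp_all add: pos_divide_le_eq)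
  have "0 \<le> real (2 * (k + 5) + 1) * (real J - 1)" using J by simp
  then have W: "0 < width k J" unfolding width_def by linarith
  \<comment> \<open>Chosen so that the modulus of continuity over the distance
    \<open>2 * (\<delta> * width k J)\<close> in diffusive units is \<open>2 * \<eta>\<close>;
    rounding the levels accounts for one more \<open>\<eta>\<close>.\<close>
  define \<delta> where "\<delta> = \<eta> / (k * exp 1 * width k J)"
  have \<delta>: "0 < \<delta>" "k * exp 1 * (\<delta> * width k J) = \<eta>" using \<eta> W k by (auto simp: \<delta>_def)
  let ?b = "\<lambda>X n. taz_moment k (real n) (\<lceil>1 * real n + X * sqrt (real n)\<rceil> + 0)"
  have T: "filterlim real at_top sequentially" by (rule filterlim_real_sequentially)
  have b: "profiled k X (?b X)" for X
    using ceiling_scaled_tendsto[OF T, of 1 X 0] by (intro taz_profiled k T) simp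
  let ?X1 = "X - \<delta> * width k J" and ?X2 = "X + \<delta> * width k J"
  have "\<forall>\<^sub>F n in sequentially. ?b ?X1 n \<le> profile k J \<delta> ?X1 + 3 * \<eta>"
    using b[of ?X1] \<eta> J \<delta>(1) unfolding profiled_def by blast
  moreover have "\<forall>\<^sub>F n in sequentially. profile k J \<delta> (?X2 - \<delta> * width k J) - 3 * \<eta> \<le> ?b ?X2 n"
    using b[of ?X2] \<eta> J \<delta>(1) unfolding profiled_def by blast
  moreover have "\<forall>\<^sub>F n in sequentially. k * exp 1 / sqrt (real n) < \<eta>"
  proof -
    have "(\<lambda>n. k * exp 1 / sqrt (real n)) \<longlonglongrightarrow> 0"
      by (rule real_tendsto_divide_at_top[OF tendsto_const filterlim_compose[OF sqrt_at_top T]])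
    then show ?thesis using \<eta> by (rule order_tendstoD)
  qed
  moreover have "\<forall>\<^sub>F n in sequentially. 0 < n" by (rule eventually_gt_at_top)
  ultimately have "\<forall>\<^sub>F n in sequentially. profile k J \<delta> X - 9 * \<eta> \<le> profile k J \<delta> ?X1"
  proof eventually_elim
    case (elim n)
    let ?y1 = "\<lceil>1 * real n + ?X1 * sqrt (real n)\<rceil> + 0" and ?y2 = "\<lceil>1 * real n + ?X2 * sqrt (real n)\<rceil> + 0"
    have s: "0 < sqrt (real n)" using elim by simp
    have "?X1 * sqrt (real n) \<le> ?X2 * sqrt (real n)" using W \<delta>(1) by (intro mult_right_mono) auto
    then have yy: "?y1 \<le> ?y2" by (simp add: ceiling_mono)
    have d: "real_of_int (?y2 - ?y1) \<le> 2 * (\<delta> * width k J) * sqrt (real n) + 1"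
    proof -
      let ?z1 = "1 * real n + ?X1 * sqrt (real n)" and ?z2 = "1 * real n + ?X2 * sqrt (real n)"
      have "?z2 - ?z1 = 2 * (\<delta> * width k J) * sqrt (real n)" by (simp add: algebra_simps)
      moreover have "real_of_int (?y2 - ?y1) = of_int \<lceil>?z2\<rceil> - of_int \<lceil>?z1\<rceil>" by simp
      ultimately show ?thesis
        using of_int_ceiling_le_add_one[of ?z2] le_of_int_ceiling[of ?z1] by linarith
    qed
    have "?b ?X2 n - ?b ?X1 n \<le> k * (exp 1 / sqrt (real n)) * real_of_int (?y2 - ?y1)"
      using elim by (intro taz_moment_modulus k yy) auto
    also have "\<dots> \<le> k * (exp 1 / sqrt (real n)) * (2 * (\<delta> * width k J) * sqrt (real n) + 1)"
      by (intro mult_left_mono d) simp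
    also have "\<dots> = 2 * (k * exp 1 * (\<delta> * width k J)) + k * exp 1 / sqrt (real n)" using s by (simp add: field_simps)
    also have "\<dots> \<le> 3 * \<eta>" using elim \<delta>(2) by simp
    finally have "?b ?X2 n - ?b ?X1 n \<le> 3 * \<eta>" .
    then show ?case using elim by simp
  qed
  then have c: "profile k J \<delta> X - 9 * \<eta> \<le> profile k J \<delta> ?X1" by simp
  show ?thesis
  proof (intro exI[of _ "profile k J \<delta> X"] allI impI)
    fix P assume P: "profiled k X P"
    have "\<forall>\<^sub>F n in sequentially. P n \<le> profile k J \<delta> X + 3 * \<eta>" "\<forall>\<^sub>F n in sequentially. profile k J \<delta> ?X1 - 3 * \<eta> \<le> P n"
      using P \<eta> J \<delta>(1) unfolding profiled_def by blast+
    then show "\<forall>\<^sub>F n in sequentially. \<bar>P n - profile k J \<delta> X\<bar> \<le> e"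
    proof eventually_elim
      case (elim n)
      have "e = 12 * \<eta>" by (simp add: \<eta>_def)
      then show ?case unfolding abs_le_iff using elim c \<eta> by linarith
    qed
  qed
qed

lemma profiled_limit:
  assumes k: "1 \<le> k"
  shows "\<exists>L. \<forall>P. profiled k X P \<longrightarrow> P \<longlonglongrightarrow> L"
proof -
  have "\<exists>L. \<forall>F\<in>{filtermap P sequentially |P. profiled k X P}. F \<le> nhds L"
  proof (rule common_limit)
    fix e :: real assume "0 < e"
    then show "\<exists>c. \<forall>F\<in>{filtermap P sequentially |P. profiled k X P}. \<forall>\<^sub>F x in F. \<bar>x - c\<bar> \<le> e"
      using profiled_close[OF k, of e X] by (fastforce simp: eventually_filtermap)
  qed
  then show ?thesis unfolding filterlim_def by blast
qed

lemma taz_moment_limit: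
  assumes k: "1 \<le> k"
  shows "\<exists>L. (\<forall>T y. filterlim T at_top sequentially \<longrightarrow> (\<lambda>n. (of_int (y n) - T n) / sqrt (T n)) \<longlonglongrightarrow> X \<longrightarrow>
      (\<lambda>n. expect (\<lambda>w. taz_Q (taz_process (T n) w) (y n) ^ k)) \<longlonglongrightarrow> L) \<and>
    (\<forall>T. filterlim T at_top sequentially \<longrightarrow>
      (\<lambda>n. expect (\<lambda>w. as_Q (as_process (T n) w) \<lceil>(al - be) * T n + X * sqrt (T n)\<rceil> ^ k)) \<longlonglongrightarrow> L)"
proof -
  obtain L where L: "\<And>P. profiled k X P \<Longrightarrow> P \<longlonglongrightarrow> L" using profiled_limit[OF k] by blast
  have 1: "(\<lambda>n. expect (\<lambda>w. taz_Q (taz_process (T n) w) (y n) ^ k)) \<longlonglongrightarrow> L"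
    if T: "filterlim T at_top sequentially" and y: "(\<lambda>n. (of_int (y n) - T n) / sqrt (T n)) \<longlonglongrightarrow> X" for T y
  proof (rule Lim_transform_eventually)
    show "(\<lambda>n. taz_moment k (T n) (y n)) \<longlonglongrightarrow> L" by (rule L[OF taz_profiled[OF k T y]])
    have "\<forall>\<^sub>F n in sequentially. 0 \<le> T n" using T by (simp add: filterlim_at_top)
    then show "\<forall>\<^sub>F n in sequentially. taz_moment k (T n) (y n) = expect (\<lambda>w. taz_Q (taz_process (T n) w) (y n) ^ k)"
      by eventually_elim (simp add: taz_expectation(1)[OF k])
  qed
  \<comment> \<open>Duality for the ASEP controls products over \<open>k\<close> neighbouring
    levels. By monotonicity the k-th power at one level lies between the product over the
    \<open>k\<close> levels ending there and the one over the \<open>k\<close> levels starting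
    there, and both have the limit \<open>L\<close>.\<close>
  have 2: "(\<lambda>n. expect (\<lambda>w. as_Q (as_process (T n) w) \<lceil>(al - be) * T n + X * sqrt (T n)\<rceil> ^ k)) \<longlonglongrightarrow> L"
    if T: "filterlim T at_top sequentially" for T
  proof (rule tendsto_sandwich)
    let ?y = "\<lambda>n. \<lceil>(al - be) * T n + X * sqrt (T n)\<rceil>"
    have A: "(\<lambda>n. as_moment k (T n) (?y n + c)) \<longlonglongrightarrow> L" for c :: int
    proof (rule L[OF as_profiled[OF k T]])
      fix d :: int
      show "(\<lambda>n. (of_int (?y n + c + d) - (al - be) * T n) / sqrt (T n)) \<longlonglongrightarrow> X"
        unfolding add.assoc by (rule ceiling_scaled_tendsto[OF T])
    qed
    show "(\<lambda>n. as_moment k (T n) (?y n + 0)) \<longlonglongrightarrow> L" "(\<lambda>n. as_moment k (T n) (?y n + int (k - 1))) \<longlonglongrightarrow> L"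
      by (rule A)+
    have T0: "\<forall>\<^sub>F n in sequentially. 0 \<le> T n" using T by (simp add: filterlim_at_top)
    show "\<forall>\<^sub>F n in sequentially. as_moment k (T n) (?y n + 0) \<le> expect (\<lambda>w. as_Q (as_process (T n) w) (?y n) ^ k)"
      using T0 by eventually_elim (use as_expectation_mono[OF k, where g' = "\<lambda>_. ?y _"] in \<open>simp add: as_expectation(1)[OF k, symmetric]\<close>)
    show "\<forall>\<^sub>F n in sequentially. expect (\<lambda>w. as_Q (as_process (T n) w) (?y n) ^ k) \<le> as_moment k (T n) (?y n + int (k - 1))"
      using T0 by eventually_elim (use as_expectation_mono[OF k, where g = "\<lambda>_. ?y _"] in \<open>simp add: as_expectation(1)[OF k, symmetric] of_nat_diff\<close>)
  qed
  from 1 2 show ?thesis by blast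
qed

text \<open>The values \<open>q ^ i\<close> avoid the open interval from \<open>q ^ m\<close> to
  \<open>q ^ (m - 1)\<close>, so the ramp \<open>g\<close> over it is continuous and agrees with the
  indicator at all of them. Uniformity in \<open>i\<close> lets the estimate be integrated against
  any law of the count.\<close>

lemma polynomial_step_approximation:
  assumes m: "1 \<le> m" and e: "0 < e"
  shows "\<exists>(a :: nat \<Rightarrow> real) d. \<forall>i. \<bar>of_bool (m \<le> i) - (\<Sum>j\<le>d. a j * (q ^ i) ^ j)\<bar> \<le> e"
proof -
  define g where "g u = max 0 (min 1 ((q ^ (m - 1) - u) / (q ^ (m - 1) - q ^ m)))" for u
  have lt: "q ^ m < q ^ (m - 1)" using m q_pos q_less_1 by (intro power_strict_decreasing) auto
  have "continuous_on {0..1} g" unfolding g_def using lt by (intro continuous_intros) auto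
  from Stone_Weierstrass_real_polynomial_function[OF compact_Icc this e]
  obtain p where p: "real_polynomial_function p" "\<And>x. x \<in> {0..1} \<Longrightarrow> \<bar>g x - p x\<bar> < e" by metis
  obtain a d where ad: "p = (\<lambda>x. \<Sum>j\<le>d. a j * x ^ j)" using p(1) unfolding real_polynomial_function_iff_sum by blast
  have gi: "g (q ^ i) = of_bool (m \<le> i)" for i
  proof (cases "m \<le> i")
    case True
    have "q ^ i \<le> q ^ m" using True q_pos q_less_1 by (intro power_decreasing) auto
    then have "1 \<le> (q ^ (m - 1) - q ^ i) / (q ^ (m - 1) - q ^ m)" using lt by (simp add: pos_le_divide_eq)
    then show ?thesis using True by (simp add: g_def)
  next
    case False
    have "q ^ (m - 1) \<le> q ^ i" using False q_pos q_less_1 by (intro power_decreasing) auto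
    then have "(q ^ (m - 1) - q ^ i) / (q ^ (m - 1) - q ^ m) \<le> 0" using lt by (intro divide_nonpos_pos) auto
    then show ?thesis using False by (simp add: g_def)
  qed
  have "\<bar>of_bool (m \<le> i) - (\<Sum>j\<le>d. a j * (q ^ i) ^ j)\<bar> \<le> e" for i
    using p(2)[of "q ^ i"] q_pos q_less_1 unfolding ad gi by (simp add: power_le_one less_imp_le)
  then show ?thesis by blast
qed

lemma tail_moment_approximation:
  fixes P :: "(nat \<times> 'e \<Rightarrow> real) \<Rightarrow> 's" and N :: "'s \<Rightarrow> nat"
  assumes P: "P \<in> measurable clocks (count_space UNIV)"
    and a: "\<And>i. \<bar>of_bool (m \<le> i) - (\<Sum>j\<le>d. a j * (q ^ i) ^ j)\<bar> \<le> e"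
  shows "\<bar>measure clocks {w. m \<le> N (P w)} - (\<Sum>j\<le>d. a j * expect (\<lambda>w. (q ^ N (P w)) ^ j))\<bar> \<le> e"
proof -
  interpret prob_space "clocks :: (nat \<times> 'e \<Rightarrow> real) measure" by (rule prob_space_clocks)
  have i1: "integrable clocks (\<lambda>w. of_bool (m \<le> N (P w)) :: real)"
    by (rule integrable_clocks_bounded[OF P, of "\<lambda>x. of_bool (m \<le> N x)" 1]) simp
  have i2: "integrable clocks (\<lambda>w. (q ^ N (P w)) ^ j)" for j
    by (rule integrable_clocks_bounded[OF P, of "\<lambda>x. (q ^ N x) ^ j" 1])
      (use q_pos q_less_1 in \<open>auto intro!: power_le_one\<close>)
  have "(\<lambda>w. of_bool (m \<le> N (P w)) :: real) = indicator {w. m \<le> N (P w)}" by (auto simp: fun_eq_iff indicator_def)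
  then have "measure clocks {w. m \<le> N (P w)} = expect (\<lambda>w. of_bool (m \<le> N (P w)))"
    using Bochner_Integration.integral_indicator[of clocks "{w. m \<le> N (P w)}"] by simp
  moreover have "(\<Sum>j\<le>d. a j * expect (\<lambda>w. (q ^ N (P w)) ^ j)) = expect (\<lambda>w. \<Sum>j\<le>d. a j * (q ^ N (P w)) ^ j)"
    by (subst Bochner_Integration.integral_sum) (auto intro: i2)
  ultimately have "measure clocks {w. m \<le> N (P w)} - (\<Sum>j\<le>d. a j * expect (\<lambda>w. (q ^ N (P w)) ^ j))
    = expect (\<lambda>w. of_bool (m \<le> N (P w)) - (\<Sum>j\<le>d. a j * (q ^ N (P w)) ^ j))"
    by (simp only: Bochner_Integration.integral_diff[OF i1 Bochner_Integration.integrable_sum[OF integrable_mult_right[OF i2]]])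
  also have "\<bar>expect (\<lambda>w. of_bool (m \<le> N (P w)) - (\<Sum>j\<le>d. a j * (q ^ N (P w)) ^ j))\<bar>
    \<le> expect (\<lambda>w. \<bar>of_bool (m \<le> N (P w)) - (\<Sum>j\<le>d. a j * (q ^ N (P w)) ^ j)\<bar>)"
    by (rule integral_abs_bound)
  also have "\<dots> \<le> expect (\<lambda>_ :: nat \<times> 'e \<Rightarrow> real. e)"
    by (intro integral_mono integrable_abs Bochner_Integration.integrable_diff i1 Bochner_Integration.integrable_sum
        integrable_mult_right i2 a) simp
  also have "\<dots> = e" by (simp add: prob_space[simplified])
  finally show ?thesis .
qed

text \<open>Positions are integers, so a strict bound \<open>n\<close> becomes the level
  \<open>n + 1\<close>; as positions decrease with the label, the labels at or beyond a level form
  an initial segment.\<close>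

lemma taz_tail_iff:
  assumes "1 \<le> m"
  shows "int n < taz_process T w m \<longleftrightarrow> m \<le> taz_count (taz_process T w) (int n + 1)"
proof -
  let ?x = "taz_process T w"
  have "m \<in> {m. 1 \<le> m \<and> int n + 1 \<le> ?x m} \<longleftrightarrow> m \<le> card {m. 1 \<le> m \<and> int n + 1 \<le> ?x m}"
  proof (rule initial_segment_card[OF _ _ _ assms])
    show "finite {m. 1 \<le> m \<and> int n + 1 \<le> ?x m}" by (rule taz_count_finite[OF taz_process_in]) simp
    show "i \<in> {m. 1 \<le> m \<and> int n + 1 \<le> ?x m}" if "j \<in> {m. 1 \<le> m \<and> int n + 1 \<le> ?x m}" "1 \<le> i" "i \<le> j" for i j
      using that taz_statesD(1)[OF taz_process_in that(2,3), of T w] by auto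
  qed auto
  then show ?thesis using assms by (auto simp: taz_count_def)
qed

lemma as_tail_iff:
  assumes "1 \<le> m"
  shows "as_process T w m \<le> u \<longleftrightarrow> m \<le> as_count (as_process T w) u"
proof -
  let ?x = "as_process T w"
  have "m \<in> {m. 1 \<le> m \<and> ?x m \<le> u} \<longleftrightarrow> m \<le> card {m. 1 \<le> m \<and> ?x m \<le> u}"
  proof (rule initial_segment_card[OF _ _ _ assms])
    show "finite {m. 1 \<le> m \<and> ?x m \<le> u}" by (rule as_count_finite[OF as_process_in])
    show "i \<in> {m. 1 \<le> m \<and> ?x m \<le> u}" if "j \<in> {m. 1 \<le> m \<and> ?x m \<le> u}" "1 \<le> i" "i \<le> j" for i j
      using that as_statesD(1)[OF as_process_in that(2), of j T w] by (cases "i = j") auto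
  qed auto
  then show ?thesis using assms by (auto simp: as_count_def)
qed

theorem common_tail_limit:
  assumes m: "1 \<le> m"
  shows "\<exists>L. (\<lambda>n::nat. measure clocks {w. int n < taz_process (real n - \<tau> * sqrt (real n)) w m}) \<longlonglongrightarrow> L \<and>
    ((\<lambda>T. measure clocks {w. as_process T w m \<le> - \<lceil>(al - be) * T + \<tau> * sqrt T\<rceil>}) \<longlongrightarrow> L) at_top"
proof -
  define Tn where "Tn n = real n - \<tau> * sqrt (real n)" for n
  have Tn: "filterlim Tn at_top sequentially" unfolding Tn_def by real_asymp
  \<comment> \<open>The dual drift has speed 1, so at time \<open>n - \<tau> * sqrt n\<close> the
    level \<open>n + 1\<close> is asymptotically \<open>\<tau>\<close> diffusive units above the
    drifting level.\<close>
  have Xn: "(\<lambda>n. (of_int (int n + 1) - Tn n) / sqrt (Tn n)) \<longlonglongrightarrow> \<tau>"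
  proof -
    have "(\<lambda>n. (1 + \<tau> * sqrt (real n)) / sqrt (real n - \<tau> * sqrt (real n))) \<longlonglongrightarrow> \<tau>" by real_asymp
    then show ?thesis by (simp add: Tn_def)
  qed
  define y where "y T = \<lceil>(al - be) * T + \<tau> * sqrt T\<rceil>" for T
  define E1 where "E1 n j = expect (\<lambda>w. (q ^ taz_count (taz_process (Tn n) w) (int n + 1)) ^ j)" for n j
  define E2 where "E2 T j = expect (\<lambda>w. (q ^ as_count (as_process T w) (- y T)) ^ j)" for T j
  have "\<exists>\<mu>. (\<lambda>n. E1 n j) \<longlonglongrightarrow> \<mu> \<and> ((\<lambda>T. E2 T j) \<longlongrightarrow> \<mu>) at_top" for j
  proof (cases "j = 0")
    case True
    then show ?thesis unfolding E1_def E2_def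
      by (auto simp: prob_space.prob_space[OF prob_space_clocks, simplified])
  next
    case False
    then have j: "1 \<le> j" by simp
    from taz_moment_limit[OF j, of \<tau>] obtain L where
      L1: "\<And>T y. filterlim T at_top sequentially \<Longrightarrow> (\<lambda>n. (of_int (y n) - T n) / sqrt (T n)) \<longlonglongrightarrow> \<tau> \<Longrightarrow>
        (\<lambda>n. expect (\<lambda>w. taz_Q (taz_process (T n) w) (y n) ^ j)) \<longlonglongrightarrow> L"
      and L2: "\<And>T. filterlim T at_top sequentially \<Longrightarrow>
        (\<lambda>n. expect (\<lambda>w. as_Q (as_process (T n) w) \<lceil>(al - be) * T n + \<tau> * sqrt (T n)\<rceil> ^ j)) \<longlonglongrightarrow> L"
      by blast
    have "(\<lambda>n. E1 n j) \<longlonglongrightarrow> L"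
      using L1[OF Tn Xn] unfolding E1_def taz_Q_def by simp
    moreover have "((\<lambda>T. E2 T j) \<longlongrightarrow> L) at_top"
    proof (rule tendsto_at_topI_sequentially)
      fix T :: "nat \<Rightarrow> real" assume "filterlim T at_top sequentially"
      from L2[OF this] show "(\<lambda>n. E2 (T n) j) \<longlonglongrightarrow> L" unfolding E2_def y_def as_Q_def .
    qed
    ultimately show ?thesis by blast
  qed
  then obtain \<mu> where \<mu>: "\<And>j. (\<lambda>n. E1 n j) \<longlonglongrightarrow> \<mu> j" "\<And>j. ((\<lambda>T. E2 T j) \<longlongrightarrow> \<mu> j) at_top" by metis
  let ?P1 = "\<lambda>n::nat. measure clocks {w. int n < taz_process (Tn n) w m}"
  let ?P2 = "\<lambda>T. measure clocks {w. as_process T w m \<le> - y T}"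
  have "\<exists>L. \<forall>F\<in>{filtermap ?P1 sequentially, filtermap ?P2 at_top}. F \<le> nhds L"
  proof (rule common_limit)
    fix e :: real assume e: "0 < e"
    from polynomial_step_approximation[OF m, of "e / 2"] e obtain a d where
      a: "\<And>i. \<bar>of_bool (m \<le> i) - (\<Sum>j\<le>d. a j * (q ^ i) ^ j)\<bar> \<le> e / 2" by auto
    define c where "c = (\<Sum>j\<le>d. a j * \<mu> j)"
    have 1: "(\<lambda>n. \<Sum>j\<le>d. a j * E1 n j) \<longlonglongrightarrow> c" and 2: "((\<lambda>T. \<Sum>j\<le>d. a j * E2 T j) \<longlongrightarrow> c) at_top"
      unfolding c_def by (intro tendsto_sum tendsto_mult tendsto_const \<mu>)+
    have T1: "\<forall>\<^sub>F n in sequentially. 0 \<le> Tn n" using Tn by (simp add: filterlim_at_top)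
    have "\<forall>\<^sub>F n in sequentially. dist (\<Sum>j\<le>d. a j * E1 n j) c < e / 2" by (rule tendstoD[OF 1]) (use e in simp)
    then have A: "\<forall>\<^sub>F n in sequentially. \<bar>?P1 n - c\<bar> \<le> e"
      using T1
    proof eventually_elim
      case (elim n)
      have "\<bar>?P1 n - (\<Sum>j\<le>d. a j * E1 n j)\<bar> \<le> e / 2"
        unfolding E1_def taz_tail_iff[OF m]
        by (rule tail_moment_approximation[OF taz_expectation(2)[OF order_refl elim(2)] a])
      then show ?case using elim(1) unfolding dist_real_def by linarith
    qed
    have "\<forall>\<^sub>F T in at_top. dist (\<Sum>j\<le>d. a j * E2 T j) c < e / 2" by (rule tendstoD[OF 2]) (use e in simp)
    then have B: "\<forall>\<^sub>F T in at_top. \<bar>?P2 T - c\<bar> \<le> e"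
      using eventually_ge_at_top[of 0]
    proof eventually_elim
      case (elim T)
      have "\<bar>?P2 T - (\<Sum>j\<le>d. a j * E2 T j)\<bar> \<le> e / 2"
        unfolding E2_def as_tail_iff[OF m]
        by (rule tail_moment_approximation[OF as_expectation(2)[OF order_refl elim(2)] a])
      then show ?case using elim(1) unfolding dist_real_def by linarith
    qed
    from A B show "\<exists>c. \<forall>F\<in>{filtermap ?P1 sequentially, filtermap ?P2 at_top}. \<forall>\<^sub>F x in F. \<bar>x - c\<bar> \<le> e"
      by (auto simp: eventually_filtermap)
  qed
  then show ?thesis unfolding Tn_def y_def filterlim_def by simp
qed

end

text \<open>\<open>b = 1\<close> forces \<open>a = 1 / (1 - q)\<close>. The level of the ASEP drifts
  with speed \<open>\<gamma> = al - be\<close>, whence the time \<open>t / \<gamma>\<close>. Writing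
  \<open>\<tau> * sqrt (t / \<gamma>)\<close> as \<open>\<tau> / \<gamma>\<close> times
  \<open>sqrt \<gamma> * sqrt t\<close> produces the factor
  \<open>(1 + q) / (1 - q)\<close>.\<close>

theorem tail_limits:
  fixes q \<tau> :: real and a b :: "int \<Rightarrow> real"
  assumes q: "0 < q" "q < 1" and ab: "\<And>x. b x = (1 - q) * a x" "\<And>x. b x = 1" and m: "1 \<le> m"
  defines "\<gamma> \<equiv> (1 - q) / (1 + q)"
  shows "\<exists>L :: real.
    (\<lambda>n :: nat. \<P>(w in clocks. int n < qtazrp q a m (real n - \<tau> * sqrt (real n)) w)) \<longlonglongrightarrow> L \<and>
    ((\<lambda>t :: real. \<P>(w in clocks.
      (real_of_int (asep (q / (1 + q)) (1 / (1 + q)) m (t / \<gamma>) w) + t)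
        / (\<gamma> powr (1 / 2) * t powr (1 / 2)) \<le> - (\<tau> * (1 + q) / (1 - q)))) \<longlongrightarrow> L) at_top"
proof -
  interpret q_parameter q by unfold_locales (use q in auto)
  let ?A = "\<lambda>t w. real_of_int (asep (q / (1 + q)) (1 / (1 + q)) m (t / \<gamma>) w) + t"
  have a: "a = (\<lambda>_. 1 / (1 - q))"
  proof
    fix x
    show "a x = 1 / (1 - q)" using ab[of x] q by (simp add: field_simps)
  qed
  have "0 < \<gamma>" "(1 + q) / (1 - q) = 1 / \<gamma>" using q by (simp_all add: \<gamma>_def)
  moreover have "al - be = \<gamma>" by (simp add: \<gamma>_def al_def be_def diff_divide_distrib)
  ultimately have \<gamma>: "0 < \<gamma>" "al - be = \<gamma>" "(1 + q) / (1 - q) = 1 / \<gamma>" by simp_all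
  obtain L where L1: "(\<lambda>n::nat. measure clocks {w. int n < taz_process (real n - \<tau> * sqrt (real n)) w m}) \<longlonglongrightarrow> L"
    and L2: "((\<lambda>T. measure clocks {w. as_process T w m \<le> - \<lceil>(al - be) * T + \<tau> * sqrt T\<rceil>}) \<longlongrightarrow> L) at_top"
    using common_tail_limit[OF m] by blast
  have "filterlim (\<lambda>t. t / \<gamma>) at_top at_top"
    using \<gamma>(1) by real_asymp
  from filterlim_compose[OF L2 this]
  have L3: "((\<lambda>t. measure clocks {w. as_process (t / \<gamma>) w m \<le> - \<lceil>(al - be) * (t / \<gamma>) + \<tau> * sqrt (t / \<gamma>)\<rceil>}) \<longlongrightarrow> L) at_top" .
  have iff: "as_process (t / \<gamma>) w m \<le> - \<lceil>(al - be) * (t / \<gamma>) + \<tau> * sqrt (t / \<gamma>)\<rceil> \<longleftrightarrow>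
    ?A t w
        / (\<gamma> powr (1 / 2) * t powr (1 / 2)) \<le> - (\<tau> * (1 + q) / (1 - q))" if t: "0 < t" for t w
  proof -
    let ?x = "as_process (t / \<gamma>) w m"
    have x: "asep (q / (1 + q)) (1 / (1 + q)) m (t / \<gamma>) w = ?x" by (simp add: asep_def al_def be_def)
    have p: "\<gamma> powr (1 / 2) * t powr (1 / 2) = sqrt \<gamma> * sqrt t" using \<gamma>(1) t by (simp add: powr_half_sqrt)
    have s: "sqrt (t / \<gamma>) = sqrt \<gamma> * sqrt t / \<gamma>" using \<gamma>(1) t by (simp add: real_sqrt_divide field_simps)
    have "?x \<le> - \<lceil>(al - be) * (t / \<gamma>) + \<tau> * sqrt (t / \<gamma>)\<rceil> \<longleftrightarrow> \<lceil>t + \<tau> * sqrt (t / \<gamma>)\<rceil> \<le> - ?x"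
      using \<gamma> by auto
    also have "\<dots> \<longleftrightarrow> real_of_int ?x + t \<le> - (\<tau> * sqrt (t / \<gamma>))" by (simp add: ceiling_le_iff) linarith
    also have "\<dots> \<longleftrightarrow> real_of_int ?x + t \<le> - (\<tau> * (1 / \<gamma>)) * (sqrt \<gamma> * sqrt t)" unfolding s by simp
    also have "\<dots> \<longleftrightarrow> (real_of_int ?x + t) / (sqrt \<gamma> * sqrt t) \<le> - (\<tau> * (1 / \<gamma>))"
      using \<gamma>(1) t by (intro pos_divide_le_eq[symmetric]) simp
    finally show ?thesis unfolding x p \<gamma>(3)[symmetric] times_divide_eq_right .
  qed
  have "((\<lambda>t :: real. \<P>(w in clocks.
      ?A t w
        / (\<gamma> powr (1 / 2) * t powr (1 / 2)) \<le> - (\<tau> * (1 + q) / (1 - q)))) \<longlongrightarrow> L) at_top"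
  proof (rule Lim_transform_eventually[OF L3])
    show "\<forall>\<^sub>F t in at_top. measure clocks {w. as_process (t / \<gamma>) w m \<le> - \<lceil>(al - be) * (t / \<gamma>) + \<tau> * sqrt (t / \<gamma>)\<rceil>}
      = \<P>(w in clocks. ?A t w
        / (\<gamma> powr (1 / 2) * t powr (1 / 2)) \<le> - (\<tau> * (1 + q) / (1 - q)))"
      using eventually_gt_at_top[of 0] by eventually_elim (simp only: iff space_clocks UNIV_I simp_thms)
  qed
  moreover have "(\<lambda>n :: nat. \<P>(w in clocks. int n < qtazrp q a m (real n - \<tau> * sqrt (real n)) w)) \<longlonglongrightarrow> L"
    using L1 by (simp add: qtazrp_def a taz_rate_def)
  ultimately show ?thesis by blast
qed

section \<open>Fredholm determinants\<close>

definition det_of :: "nat \<Rightarrow> (nat \<Rightarrow> nat \<Rightarrow> complex) \<Rightarrow> complex" where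
  "det_of n f = Determinant.det (Matrix.mat n n (\<lambda>(i, j). f i j))"

lemma det_of_sum: "det_of n f = (\<Sum>p | p permutes {..<n}. of_int (sign p) * (\<Prod>i<n. f i (p i)))"
proof -
  have "(\<Prod>i<n. Matrix.mat n n (\<lambda>(i, j). f i j) $$ (i, p i)) = (\<Prod>i<n. f i (p i))" if "p permutes {..<n}" for p
    using permutes_in_image[OF that] by (intro prod.cong) auto
  then show ?thesis unfolding det_of_def det_def'[OF mat_carrier] atLeast0LessThan by simp
qed

lemma fredholm_minor_eq: "fredholm_minor K n x = det_of n (\<lambda>i j. K (x i) (x j))"
  by (simp only: fredholm_minor_def det_of_def)

lemma det_of_transpose: "det_of n (\<lambda>i j. f j i) = det_of n f"
proof -
  have "Matrix.mat n n (\<lambda>(i, j). f j i) = transpose_mat (Matrix.mat n n (\<lambda>(i, j). f i j))" by (rule eq_matI) auto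
  then show ?thesis unfolding det_of_def by (simp add: det_transpose[OF mat_carrier])
qed

lemma det_of_scale: "det_of n (\<lambda>i j. b i * c j * f i j) = (\<Prod>i<n. b i) * (\<Prod>j<n. c j) * det_of n f"
proof -
  have "(\<Prod>i<n. c (p i)) = (\<Prod>j<n. c j)" if "p permutes {..<n}" for p
    using prod.permute[OF that, of c] by (simp add: o_def)
  then show ?thesis unfolding det_of_sum sum_distrib_left
    by (intro sum.cong refl) (simp add: prod.distrib mult_ac)
qed

text \<open>Hadamard's inequality for entries of modulus at most one: the eigenvalues of \<open>M M\<^sup>*\<close> are
  nonnegative with sum at most \<open>n\<^sup>2\<close>, and \<open>x \<le> exp (x - 1)\<close>.\<close>

lemma norm_det_of_le:
  assumes m: "\<And>i j. i < n \<Longrightarrow> j < n \<Longrightarrow> norm (m i j) \<le> 1"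
  shows "norm (det_of n m) \<le> sqrt n ^ n"
proof (cases "n = 0")
  case False
  define M where "M = Matrix.mat n n (\<lambda>(i, j). m i j)"
  define N where "N = Matrix.mat n n (\<lambda>(i, j). cnj (m j i))"
  define G where "G = M * N"
  have carr: "M \<in> carrier_mat n n" "N \<in> carrier_mat n n" "G \<in> carrier_mat n n" by (auto simp: M_def N_def G_def)
  have "Determinant.det N = det_of n (\<lambda>i j. cnj (m j i))" by (simp add: N_def det_of_def)
  also have "\<dots> = det_of n (\<lambda>i j. cnj (m i j))" by (rule det_of_transpose)
  also have "\<dots> = cnj (det_of n m)" by (simp add: det_of_sum)
  finally have detG: "Determinant.det G = det_of n m * cnj (det_of n m)"
    unfolding G_def det_mult[OF carr(1,2)] by (simp add: M_def det_of_def)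
  have Gij: "G $$ (i, j) = (\<Sum>k<n. m i k * cnj (m j k))" if "i < n" "j < n" for i j
    using that by (simp add: G_def M_def N_def scalar_prod_def atLeast0LessThan)
  obtain es where "char_poly G = (\<Prod>a\<leftarrow>es. [:- a, 1:])" using char_poly_factorized[OF carr(3)] by blast
  from schur_decomposition_exists[OF carr(3) this] obtain B where
    B: "B \<in> carrier_mat n n" "upper_triangular B" "similar_mat G B" by blast
  \<comment> \<open>Rayleigh quotient: pairing the eigenvector \<open>w\<close> of
    \<open>G = M * N\<close> with itself gives the squared norm of \<open>u\<close>, which is
    \<open>N\<close> applied to \<open>w\<close>.\<close>
  have pos: "\<exists>l\<ge>0. B $$ (i, i) = of_real l" if i: "i < n" for i
  proof -
    have "poly (char_poly G) (B $$ (i, i)) = 0"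
      unfolding char_poly_similar[OF B(3)] char_poly_upper_triangular[OF B(1,2)] using i B(1)
      by (auto simp: poly_prod_list prod_list_zero_iff diag_mat_def image_iff intro!: bexI[of _ i])
    then have "eigenvalue G (B $$ (i, i))" by (simp add: eigenvalue_root_char_poly[OF carr(3)])
    then obtain w where w: "w \<in> carrier_vec n" "w \<noteq> 0\<^sub>v n" "G *\<^sub>v w = B $$ (i, i) \<cdot>\<^sub>v w"
      using carr(3) unfolding eigenvalue_def eigenvector_def by auto
    let ?W = "\<Sum>a<n. (norm (vec_index w a))\<^sup>2"
    have nsq: "cnj x * x = of_real ((norm x)\<^sup>2)" for x by (simp only: complex_norm_square mult.commute)
    define u where "u k = (\<Sum>j<n. cnj (m j k) * vec_index w j)" for k
    have "(\<Sum>j<n. G $$ (a, j) * vec_index w j) = B $$ (i, i) * vec_index w a" if "a < n" for a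
      using arg_cong[OF w(3), of "\<lambda>v. vec_index v a"] that w(1) carr(3)
      by (simp add: scalar_prod_def atLeast0LessThan)
    then have "(\<Sum>a<n. cnj (vec_index w a) * (\<Sum>j<n. G $$ (a, j) * vec_index w j))
      = (\<Sum>a<n. cnj (vec_index w a) * (B $$ (i, i) * vec_index w a))" by (intro sum.cong) auto
    also have "\<dots> = B $$ (i, i) * of_real ?W"
      unfolding of_real_sum sum_distrib_left nsq[symmetric] by (intro sum.cong) (simp_all add: mult_ac)
    also have "(\<Sum>a<n. cnj (vec_index w a) * (\<Sum>j<n. G $$ (a, j) * vec_index w j))
      = (\<Sum>a<n. \<Sum>j<n. \<Sum>k<n. (cnj (vec_index w a) * m a k) * (cnj (m j k) * vec_index w j))"
      by (simp add: Gij sum_distrib_left sum_distrib_right mult_ac)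
    also have "\<dots> = (\<Sum>k<n. \<Sum>a<n. \<Sum>j<n. (cnj (vec_index w a) * m a k) * (cnj (m j k) * vec_index w j))"
      by (subst sum.swap[of _ "{..<n}" "{..<n}"], subst sum.swap, intro sum.cong refl sum.swap)
    also have "\<dots> = (\<Sum>k<n. cnj (u k) * u k)"
      unfolding u_def cnj_sum sum_product by (simp add: mult_ac)
    also have "\<dots> = of_real (\<Sum>k<n. (norm (u k))\<^sup>2)" by (simp only: nsq of_real_sum)
    finally have e: "of_real (\<Sum>k<n. (norm (u k))\<^sup>2) = B $$ (i, i) * of_real ?W" .
    obtain a where a: "a < n" "vec_index w a \<noteq> 0" using w(1,2) by (metis carrier_vecD eq_vecI index_zero_vec)
    then have a: "0 < ?W" by (intro sum_pos2[of _ a]) auto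
    then have "B $$ (i, i) = of_real ((\<Sum>k<n. (norm (u k))\<^sup>2) / ?W)"
    proof -
      have "y = of_real (x / w)" if "of_real x = y * of_real w" "0 < w" for x w :: real and y :: complex
        using that by (simp add: field_simps)
      from this[OF e] a show ?thesis by blast
    qed
    moreover have "0 \<le> (\<Sum>k<n. (norm (u k))\<^sup>2) / ?W"
      by (intro divide_nonneg_nonneg sum_nonneg) auto
    ultimately show ?thesis by blast
  qed
  then obtain l where l: "\<And>i. i < n \<Longrightarrow> 0 \<le> l i" "\<And>i. i < n \<Longrightarrow> B $$ (i, i) = of_real (l i)" by metis
  \<comment> \<open>Invariance of the trace under similarity, obtained by moving \<open>Q\<close>
    around cyclically; it turns the eigenvalue sum into the sum of the squared entries.\<close>
  have "(\<Sum>i<n. B $$ (i, i)) = (\<Sum>i<n. G $$ (i, i))"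
  proof -
    from similar_matD[OF B(3)] obtain n' P Q where PQ: "{G, B, P, Q} \<subseteq> carrier_mat n' n'" "Q * P = 1\<^sub>m n'" "G = P * B * Q" by blast
    have n': "n' = n" using PQ(1) B(1) by auto
    have P: "P \<in> carrier_mat n n" "Q \<in> carrier_mat n n" using PQ(1) n' by auto
    have "(\<Sum>i<n. G $$ (i, i)) = (\<Sum>i<n. \<Sum>a<n. \<Sum>b<n. P $$ (i, a) * (B $$ (a, b) * Q $$ (b, i)))"
      using P B(1) unfolding PQ(3) by (simp add: scalar_prod_def atLeast0LessThan sum_distrib_left)
    also have "\<dots> = (\<Sum>a<n. \<Sum>b<n. \<Sum>i<n. P $$ (i, a) * (B $$ (a, b) * Q $$ (b, i)))"
      by (subst sum.swap, intro sum.cong refl sum.swap)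
    also have "\<dots> = (\<Sum>a<n. \<Sum>b<n. B $$ (a, b) * (Q * P) $$ (b, a))"
      using P by (simp add: scalar_prod_def atLeast0LessThan sum_distrib_left mult_ac)
    also have "\<dots> = (\<Sum>a<n. \<Sum>b<n. if b = a then B $$ (a, b) else 0)"
      unfolding PQ(2) n' by (intro sum.cong) auto
    also have "\<dots> = (\<Sum>i<n. B $$ (i, i))" by simp
    finally show ?thesis ..
  qed
  then have "of_real (\<Sum>i<n. l i) = (\<Sum>i<n. \<Sum>k<n. complex_of_real ((norm (m i k))\<^sup>2))"
    by (simp add: l Gij complex_norm_square del: of_real_power)
  then have tr: "(\<Sum>i<n. l i) = (\<Sum>i<n. \<Sum>k<n. (norm (m i k))\<^sup>2)"
    unfolding of_real_sum[symmetric] of_real_eq_iff .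
  also have "\<dots> \<le> (\<Sum>i<n. \<Sum>k<n. 1)" by (intro sum_mono power_le_one m) auto
  finally have tr: "(\<Sum>i<n. l i) \<le> n * n" by simp
  have "of_real (\<Prod>i<n. l i) = Determinant.det G"
    unfolding det_similar[OF B(3)] det_upper_triangular[OF B(2,1)] prod_list_diag_prod
    using B(1) l(2) by (simp add: atLeast0LessThan)
  also have "\<dots> = of_real ((norm (det_of n m))\<^sup>2)" unfolding detG by (simp only: complex_norm_square)
  finally have "(norm (det_of n m))\<^sup>2 = (\<Prod>i<n. l i)" unfolding of_real_eq_iff ..
  also have "\<dots> = (\<Prod>i<n. n * (l i / n))" using False by simp
  also have "\<dots> \<le> (\<Prod>i<n. n * exp (l i / n - 1))"
    using l(1) by (intro prod_mono conjI mult_left_mono) (auto intro: order_trans[OF _ exp_ge_add_one_self])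
  also have "\<dots> = real n ^ n * exp ((\<Sum>i<n. l i) / n - n)"
    by (simp add: prod.distrib exp_sum[symmetric] sum_subtractf sum_divide_distrib)
  also have "\<dots> \<le> real n ^ n * 1" using tr False by (intro mult_left_mono) (auto simp: divide_le_eq)
  also have "\<dots> = (sqrt n ^ n)\<^sup>2"
  proof -
    have "(sqrt n ^ n)\<^sup>2 = sqrt n ^ (2 * n)" by (rule power_even_eq[symmetric])
    also have "\<dots> = ((sqrt n)\<^sup>2) ^ n" by (rule power_mult)
    finally show ?thesis by simp
  qed
  finally show ?thesis by (rule power2_le_imp_le) simp
qed (simp add: det_of_sum)

lemma integrable_pair_mult:
  fixes f g :: "_ \<Rightarrow> real"
  assumes "pair_sigma_finite M1 M2" and f: "integrable M1 f" and g: "integrable M2 g"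
  shows "integrable (M1 \<Otimes>\<^sub>M M2) (\<lambda>(x, y). f x * g y)"
proof -
  interpret pair_sigma_finite M1 M2 by fact
  have [measurable]: "f \<in> borel_measurable M1" "g \<in> borel_measurable M2" using f g by auto
  show ?thesis
    by (rule Fubini_integrable) (use f g in \<open>auto simp: abs_mult intro!: integrable_mult_left integrable_abs\<close>)
qed

text \<open>By \<open>n ^ n / fact n \<le> exp n\<close> the n-th term is at most the n-th power of
  \<open>exp 1 * \<bar>C\<bar> / sqrt n\<close>, which is eventually below one half.\<close>

lemma summable_hadamard: "summable (\<lambda>n. sqrt n ^ n * C ^ n / fact n :: real)"
proof (rule summable_comparison_test_ev[where g = "\<lambda>n. (1 / 2) ^ n"])
  have "\<forall>\<^sub>F n in sequentially. (2 * exp 1 * \<bar>C\<bar>)\<^sup>2 \<le> real n"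
    using filterlim_real_sequentially by (simp add: filterlim_at_top)
  then show "\<forall>\<^sub>F n in sequentially. norm (sqrt n ^ n * C ^ n / fact n) \<le> (1 / 2) ^ n"
    using eventually_gt_at_top[of 0]
  proof eventually_elim
    case (elim n)
    have "real n ^ n / fact n \<le> exp (real n)"
    proof -
      have "(\<Sum>i\<in>{n}. real n ^ i / fact i) \<le> (\<Sum>i. real n ^ i / fact i)"
        using summable_exp[of "real n"] by (intro sum_le_suminf) (auto simp: field_simps)
      also have "\<dots> = exp (real n)" unfolding exp_def by (simp add: divide_inverse_commute)
      finally show ?thesis by simp
    qed
    then have fn: "1 / fact n \<le> exp 1 ^ n / real n ^ n" using elim(2) by (simp add: field_simps exp_of_nat_mult[symmetric])
    have s: "2 * exp 1 * \<bar>C\<bar> \<le> sqrt n" using elim(1) by (rule real_le_rsqrt)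
    have "norm (sqrt n ^ n * C ^ n / fact n) = (sqrt n * \<bar>C\<bar>) ^ n * (1 / fact n)"
      by (simp add: abs_mult power_abs power_mult_distrib)
    also have "\<dots> \<le> (sqrt n * \<bar>C\<bar>) ^ n * (exp 1 ^ n / real n ^ n)" by (intro mult_left_mono fn) auto
    also have "\<dots> = (sqrt n * \<bar>C\<bar> * exp 1 / real n) ^ n" by (simp add: power_mult_distrib power_divide)
    also have "\<dots> \<le> (1 / 2) ^ n"
    proof (intro power_mono)
      have "sqrt n * (2 * exp 1 * \<bar>C\<bar>) \<le> sqrt n * sqrt n" by (intro mult_left_mono s) auto
      then show "sqrt n * \<bar>C\<bar> * exp 1 / real n \<le> 1 / 2" using elim(2) by (simp add: divide_le_eq mult_ac)
    qed auto
    finally show ?case .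
  qed
qed (simp add: summable_geometric)

text \<open>The identity \<open>det (I + AB) = det (I + BA)\<close> for integral operators, term by term in the
  Fredholm series. The factors \<open>b\<close> and \<open>c\<close> leave a bounded kernel \<open>m\<close>, to which Hadamard's
  inequality applies.\<close>

locale fredholm_factorisation =
  fixes A B m :: "real \<Rightarrow> real \<Rightarrow> complex" and b c g :: "real \<Rightarrow> real"
  assumes A_meas: "(\<lambda>(s, z). A s z) \<in> borel_measurable (lborel \<Otimes>\<^sub>M lborel)"
    and B_meas: "(\<lambda>(z, t). B z t) \<in> borel_measurable (lborel \<Otimes>\<^sub>M lborel)"
    and B_eq: "B z t = of_real (b z) * of_real (c t) * m z t" and m_le: "norm (m z t) \<le> 1" and b_pos: "0 < b z"
    and c_nonneg: "0 \<le> c t" and A_le: "norm (A s z) * b z \<le> g z"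
    and c_int: "integrable lborel c" and g_int: "integrable lborel g"
begin

text \<open>The common ancestor of both series: by multilinearity of the determinant, integrating
  out \<open>z\<close> gives the minors of \<open>KA\<close> and integrating out \<open>s\<close>
  those of \<open>KB\<close>, so their integrals agree by Fubini's theorem.\<close>

definition F :: "nat \<Rightarrow> (nat \<Rightarrow> real) \<Rightarrow> (nat \<Rightarrow> real) \<Rightarrow> complex" where
  "F n s z = (\<Prod>i<n. A (s i) (z i)) * det_of n (\<lambda>i j. B (z i) (s j))"

abbreviation P :: "nat \<Rightarrow> (nat \<Rightarrow> real) measure" where "P n \<equiv> PiM {..<n} (\<lambda>_. lborel)"

lemma g_nonneg: "0 \<le> g z"
  by (rule order_trans[OF _ A_le[of 0 z]]) (simp add: less_imp_le[OF b_pos])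

text \<open>Row factors \<open>b (z i)\<close> and column factors \<open>c (s j)\<close> are pulled
  out, and Hadamard's inequality bounds what is left by \<open>sqrt n ^ n\<close>. Each
  \<open>b (z i)\<close> is combined with \<open>A (s i) (z i)\<close>, which is why
  \<open>A_le\<close> asks for a bound independent of \<open>s\<close>.\<close>

lemma F_le: "norm (F n s z) \<le> sqrt n ^ n * ((\<Prod>i<n. c (s i)) * (\<Prod>i<n. g (z i)))"
proof -
  have "det_of n (\<lambda>i j. B (z i) (s j)) = (\<Prod>i<n. of_real (b (z i))) * (\<Prod>j<n. of_real (c (s j))) * det_of n (\<lambda>i j. m (z i) (s j))"
    unfolding B_eq by (rule det_of_scale)
  then have "norm (F n s z) = (\<Prod>i<n. norm (A (s i) (z i)) * b (z i)) * (\<Prod>j<n. c (s j)) * norm (det_of n (\<lambda>i j. m (z i) (s j)))"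
    using c_nonneg abs_of_pos[OF b_pos] by (simp add: F_def norm_mult prod_norm[symmetric] prod.distrib mult_ac)
  also have "\<dots> \<le> (\<Prod>i<n. g (z i)) * (\<Prod>j<n. c (s j)) * sqrt n ^ n"
    by (intro mult_mono prod_mono norm_det_of_le conjI A_le m_le mult_nonneg_nonneg prod_nonneg ballI c_nonneg g_nonneg) (auto simp: less_imp_le[OF b_pos])
  finally show ?thesis by (simp add: mult_ac)
qed

lemma sigma: "product_sigma_finite (\<lambda>_ :: nat. lborel :: real measure)"
  by (rule product_sigma_finite.intro) (rule sigma_finite_lborel)

lemma pair_sigma: "pair_sigma_finite (P n) (P n)"
  by (rule pair_sigma_finite.intro; rule product_sigma_finite.sigma_finite[OF sigma finite_lessThan])

lemma F_integrable: "integrable (P n \<Otimes>\<^sub>M P n) (\<lambda>(s, z). F n s z)"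
proof (rule Bochner_Integration.integrable_bound)
  have ci: "integrable (P n) (\<lambda>s. \<Prod>i<n. c (s i))" and gi: "integrable (P n) (\<lambda>z. \<Prod>i<n. g (z i))"
    by (intro product_sigma_finite.product_integrable_prod[OF sigma] c_int g_int; simp)+
  show "integrable (P n \<Otimes>\<^sub>M P n) (\<lambda>x. sqrt n ^ n * (case x of (s, z) \<Rightarrow> (\<Prod>i<n. c (s i)) * (\<Prod>i<n. g (z i))))"
    by (intro integrable_mult_right integrable_pair_mult pair_sigma ci gi)
  have p: "(\<lambda>x. (fst x i, snd x j)) \<in> P n \<Otimes>\<^sub>M P n \<rightarrow>\<^sub>M lborel \<Otimes>\<^sub>M lborel"
    "(\<lambda>x. (snd x i, fst x j)) \<in> P n \<Otimes>\<^sub>M P n \<rightarrow>\<^sub>M lborel \<Otimes>\<^sub>M lborel" if "i < n" "j < n" for i j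
    using that by (intro measurable_Pair measurable_compose[OF measurable_fst measurable_component_singleton]
      measurable_compose[OF measurable_snd measurable_component_singleton]; simp)+
  have a: "(\<lambda>x. A (fst x i) (snd x i)) \<in> borel_measurable (P n \<Otimes>\<^sub>M P n)" if "i < n" for i
    using measurable_compose[OF p(1)[OF that that] A_meas] by simp
  have b: "(\<lambda>x. B (snd x i) (fst x j)) \<in> borel_measurable (P n \<Otimes>\<^sub>M P n)" if "i < n" "j < n" for i j
    using measurable_compose[OF p(2)[OF that] B_meas] by simp
  show "(\<lambda>(s, z). F n s z) \<in> borel_measurable (P n \<Otimes>\<^sub>M P n)"
    unfolding F_def det_of_sum case_prod_beta
    by (intro borel_measurable_times borel_measurable_prod borel_measurable_sum borel_measurable_const a b)
      (auto dest: permutes_in_image)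
  show "AE x in P n \<Otimes>\<^sub>M P n. norm (case x of (s, z) \<Rightarrow> F n s z) \<le>
    norm (sqrt n ^ n * (case x of (s, z) \<Rightarrow> (\<Prod>i<n. c (s i)) * (\<Prod>i<n. g (z i))))"
    using F_le c_nonneg g_nonneg by (auto simp: abs_mult prod_nonneg)
qed

lemma entry_integrable:
  "integrable lborel (\<lambda>z. A s z * B z t)" "integrable lborel (\<lambda>t. A t z' * B z t)"
proof -
  have ab: "norm (A s z' * B z t) \<le> (b z / b z') * (c t * g z')" for s z z' t
  proof -
    have "norm (A s z' * B z t) = (b z / b z') * (c t * (norm (A s z') * b z') * norm (m z t))"
      using c_nonneg b_pos[of z] b_pos[of z'] by (simp add: B_eq norm_mult)
    also have "\<dots> \<le> (b z / b z') * (c t * g z' * 1)"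
      using b_pos[of z] b_pos[of z'] by (intro mult_left_mono mult_mono A_le m_le c_nonneg mult_nonneg_nonneg g_nonneg) auto
    finally show ?thesis by simp
  qed
  have ma: "(\<lambda>z. A s z) \<in> borel_measurable lborel" "(\<lambda>s. A s z) \<in> borel_measurable lborel" for s z
    using measurable_compose[OF measurable_Pair1' A_meas, of s] measurable_compose[OF measurable_Pair2' A_meas, of z] by simp_all
  have mb: "(\<lambda>z. B s z) \<in> borel_measurable lborel" "(\<lambda>s. B s z) \<in> borel_measurable lborel" for s z
    using measurable_compose[OF measurable_Pair1' B_meas, of s] measurable_compose[OF measurable_Pair2' B_meas, of z] by simp_all
  show "integrable lborel (\<lambda>z. A s z * B z t)"
  proof (rule Bochner_Integration.integrable_bound[OF integrable_mult_right[OF g_int, of "c t"]])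
    show "AE z in lborel. norm (A s z * B z t) \<le> norm (c t * g z)"
      using ab[of s z z t for z] b_pos g_nonneg c_nonneg by (auto simp: abs_mult less_imp_neq[symmetric])
  qed (intro borel_measurable_times ma mb)
  show "integrable lborel (\<lambda>t. A t z' * B z t)"
  proof (rule Bochner_Integration.integrable_bound[OF integrable_mult_right[OF c_int, of "b z / b z' * g z'"]])
    show "AE t in lborel. norm (A t z' * B z t) \<le> norm (b z / b z' * g z' * c t)"
      using ab[of _ z' z] b_pos[of z] b_pos[of z'] g_nonneg c_nonneg by (auto simp: abs_mult mult_ac)
  qed (intro borel_measurable_times ma mb)
qed

text \<open>Row \<open>i\<close> depends on its own variable \<open>z i\<close> alone, so every
  permutation term is a product of one-dimensional integrals.\<close>

lemma det_of_integral:
  assumes "\<And>i j. i < n \<Longrightarrow> j < n \<Longrightarrow> integrable lborel (\<lambda>z. u i z * w j z)"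
  shows "(LINT z|P n. (\<Prod>i<n. u i (z i)) * det_of n (\<lambda>i j. w j (z i))) = det_of n (\<lambda>i j. LINT z|lborel. u i z * w j z)"
proof -
  have i: "integrable lborel (\<lambda>z. u i z * w (p i) z)" if "p permutes {..<n}" "i < n" for p i
    using assms[OF that(2)] permutes_in_image[OF that(1), of i] that(2) by simp
  have "(LINT z|P n. (\<Prod>i<n. u i (z i)) * det_of n (\<lambda>i j. w j (z i)))
    = (LINT z|P n. (\<Sum>p | p permutes {..<n}. of_int (sign p) * (\<Prod>i<n. u i (z i) * w (p i) (z i))))"
    by (simp add: det_of_sum sum_distrib_left prod.distrib mult.left_commute)
  also have "\<dots> = (\<Sum>p | p permutes {..<n}. LINT z|P n. of_int (sign p) * (\<Prod>i<n. u i (z i) * w (p i) (z i)))"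
    by (intro Bochner_Integration.integral_sum integrable_mult_right product_sigma_finite.product_integrable_prod[OF sigma] i) auto
  also have "\<dots> = (\<Sum>p | p permutes {..<n}. of_int (sign p) * (\<Prod>i<n. LINT z|lborel. u i z * w (p i) z))"
  proof (intro sum.cong refl)
    fix p assume p: "p \<in> {p. p permutes {..<n}}"
    have "(LINT z|P n. (\<Prod>i<n. u i (z i) * w (p i) (z i))) = (\<Prod>i<n. LINT z|lborel. u i z * w (p i) z)"
      using p by (intro product_sigma_finite.product_integral_prod[OF sigma, where f = "\<lambda>i z. u i z * w (p i) z"] i) auto
    then show "(LINT z|P n. of_int (sign p) * (\<Prod>i<n. u i (z i) * w (p i) (z i)))
      = of_int (sign p) * (\<Prod>i<n. LINT z|lborel. u i z * w (p i) z)" by simp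
  qed
  finally show ?thesis by (simp only: det_of_sum)
qed

definition KA :: "real \<Rightarrow> real \<Rightarrow> complex" where "KA s t = (LINT z|lborel. A s z * B z t)"

definition KB :: "real \<Rightarrow> real \<Rightarrow> complex" where "KB z z' = (LINT t|lborel. A t z' * B z t)"

lemma minor_KA: "fredholm_minor KA n s = (LINT z|P n. F n s z)"
proof -
  have "(LINT z|P n. (\<Prod>i<n. A (s i) (z i)) * det_of n (\<lambda>i j. B (z i) (s j)))
    = det_of n (\<lambda>i j. LINT z|lborel. A (s i) z * B z (s j))"
    by (rule det_of_integral[where u = "\<lambda>i. A (s i)" and w = "\<lambda>j z. B z (s j)"]) (rule entry_integrable)
  then show ?thesis by (simp only: fredholm_minor_eq KA_def F_def)
qed

text \<open>Here the integration variable \<open>s i\<close> labels a column of \<open>B\<close>;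
  transposing the determinant turns it into a row, as \<open>det_of_integral\<close>
  requires.\<close>

lemma minor_KB: "fredholm_minor KB n z = (LINT s|P n. F n s z)"
proof -
  have F: "F n s z = (\<Prod>i<n. A (s i) (z i)) * det_of n (\<lambda>i j. B (z j) (s i))" for s
    unfolding F_def by (subst det_of_transpose[where f = "\<lambda>i j. B (z i) (s j)", symmetric]) (rule refl)
  have "fredholm_minor KB n z = det_of n (\<lambda>i j. LINT t|lborel. A t (z j) * B (z i) t)"
    by (simp only: fredholm_minor_eq KB_def)
  also have "\<dots> = det_of n (\<lambda>i j. LINT t|lborel. A t (z i) * B (z j) t)"
    by (rule det_of_transpose[where f = "\<lambda>i j. LINT t|lborel. A t (z j) * B (z i) t", symmetric])
  also have "\<dots> = (LINT s|P n. (\<Prod>i<n. A (s i) (z i)) * det_of n (\<lambda>i j. B (z j) (s i)))"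
    by (rule det_of_integral[where u = "\<lambda>i t. A t (z i)" and w = "\<lambda>j. B (z j)", symmetric]) (rule entry_integrable)
  finally show ?thesis by (simp only: F)
qed

lemma fredholm_term_eq: "fredholm_term lborel KA n = fredholm_term lborel KB n"
proof -
  have "(LINT s|P n. fredholm_minor KA n s) = (LINT z|P n. fredholm_minor KB n z)"
    using pair_sigma_finite.Fubini_integral[OF pair_sigma, where f = "F n", OF F_integrable] by (simp only: minor_KA minor_KB)
  then show ?thesis by (simp only: fredholm_term_def)
qed

lemma norm_fredholm_term_le:
  "norm (fredholm_term lborel KA n) \<le> sqrt n ^ n * (integral\<^sup>L lborel c * integral\<^sup>L lborel g) ^ n / fact n"
proof -
  have gi: "integrable (P n) (\<lambda>z. \<Prod>i<n. g (z i))" and ci: "integrable (P n) (\<lambda>z. \<Prod>i<n. c (z i))"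
    by (intro product_sigma_finite.product_integrable_prod[OF sigma] c_int g_int; simp)+
  have I: "(LINT z|P n. (\<Prod>i<n. g (z i))) = integral\<^sup>L lborel g ^ n" "(LINT z|P n. (\<Prod>i<n. c (z i))) = integral\<^sup>L lborel c ^ n"
    using product_sigma_finite.product_integral_prod[OF sigma, of "{..<n}" "\<lambda>_. g"]
      product_sigma_finite.product_integral_prod[OF sigma, of "{..<n}" "\<lambda>_. c"] c_int g_int by simp_all
  have "norm (fredholm_minor KA n s) \<le> sqrt n ^ n * (\<Prod>i<n. c (s i)) * integral\<^sup>L lborel g ^ n" for s
  proof (cases "integrable (P n) (F n s)")
    case True
    have "norm (fredholm_minor KA n s) \<le> (LINT z|P n. norm (F n s z))" unfolding minor_KA by (rule integral_norm_bound)
    also have "\<dots> \<le> (LINT z|P n. sqrt n ^ n * (\<Prod>i<n. c (s i)) * (\<Prod>i<n. g (z i)))"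
      using F_le True gi by (intro integral_mono integrable_norm integrable_mult_right) (auto simp: mult.assoc)
    finally show ?thesis by (simp add: I)
  next
    \<comment> \<open>Where the section is not integrable the integral is 0 by convention, and the
      bound holds because its right-hand side is nonnegative.\<close>
    case False
    then show ?thesis
      by (simp add: minor_KA not_integrable_integral_eq prod_nonneg c_nonneg g_nonneg integral_nonneg_AE)
  qed
  then have "norm (LINT s|P n. fredholm_minor KA n s) \<le> (LINT s|P n. sqrt n ^ n * (\<Prod>i<n. c (s i)) * integral\<^sup>L lborel g ^ n)"
    using pair_sigma_finite.integrable_fst[OF pair_sigma F_integrable, of n] ci
    by (intro order_trans[OF integral_norm_bound] integral_mono integrable_norm integrable_mult_left integrable_mult_right)
      (auto simp: minor_KA[abs_def])
  also have "\<dots> = sqrt n ^ n * (integral\<^sup>L lborel c * integral\<^sup>L lborel g) ^ n" by (simp add: I power_mult_distrib)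
  finally show ?thesis by (simp add: fredholm_term_def norm_divide divide_right_mono)
qed

theorem fredholm_swap:
  "fredholm_convergent lborel KA" "fredholm_convergent lborel KB" "fredholm_det lborel KA = fredholm_det lborel KB"
proof -
  have S: "summable (\<lambda>n. norm (fredholm_term lborel KA n))"
    by (rule summable_comparison_test'[OF summable_hadamard[of "integral\<^sup>L lborel c * integral\<^sup>L lborel g"], of 0])
      (use norm_fredholm_term_le in simp)
  have I: "integrable (P n) (fredholm_minor KA n)" "integrable (P n) (fredholm_minor KB n)" for n
  proof -
    show "integrable (P n) (fredholm_minor KA n)" unfolding minor_KA[abs_def] by (rule pair_sigma_finite.integrable_fst[OF pair_sigma F_integrable])
    show "integrable (P n) (fredholm_minor KB n)" unfolding minor_KB[abs_def] by (rule pair_sigma_finite.integrable_snd[OF pair_sigma F_integrable])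
  qed
  show "fredholm_convergent lborel KA" "fredholm_convergent lborel KB" "fredholm_det lborel KA = fredholm_det lborel KB"
    using S I by (simp_all add: fredholm_convergent_def fredholm_det_def fredholm_term_eq)
qed

end

section \<open>Factorisation of the two kernels\<close>

lemma exp_tail_integral:
  fixes p :: complex and a :: real
  assumes p: "0 < Re p"
  shows "set_integrable lborel {a<..} (\<lambda>z. exp (- (p * of_real z)))"
    "(LINT z:{a<..}|lborel. exp (- (p * of_real z))) = exp (- (p * of_real a)) / p"
proof -
  have E: "einterval (ereal a) \<infinity> = {a<..}" by (auto simp: einterval_def)
  have lim: "((\<lambda>z. - (exp (- (Re p * z)) / Re p)) \<longlongrightarrow> 0) at_top" using p by real_asymp
  have "set_integrable lborel (einterval (ereal a) \<infinity>) (\<lambda>z. exp (- (Re p * z)))"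
  proof (rule interval_integral_FTC_nonneg(1)[where F = "\<lambda>z. - (exp (- (Re p * z)) / Re p)"])
    show "DERIV (\<lambda>z. - (exp (- (Re p * z)) / Re p)) z :> exp (- (Re p * z))" for z
      using p by (auto intro!: derivative_eq_intros)
    show "(((\<lambda>z. - (exp (- (Re p * z)) / Re p)) \<circ> real_of_ereal) \<longlongrightarrow> - (exp (- (Re p * a)) / Re p)) (at_right (ereal a))"
      unfolding ereal_tendsto_simps using p by (intro tendsto_intros) auto
    show "(((\<lambda>z. - (exp (- (Re p * z)) / Re p)) \<circ> real_of_ereal) \<longlongrightarrow> 0) (at_left \<infinity>)"
      unfolding ereal_tendsto_simps by (rule lim)
  qed (auto intro!: continuous_intros)
  then have i: "set_integrable lborel {a<..} (\<lambda>z. exp (- (Re p * z)))" unfolding E .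
  show I: "set_integrable lborel {a<..} (\<lambda>z. exp (- (p * of_real z)))"
    unfolding set_integrable_def
  proof (rule Bochner_Integration.integrable_bound[OF i[unfolded set_integrable_def]])
    show "(\<lambda>z. indicat_real {a<..} z *\<^sub>R exp (- (p * of_real z))) \<in> borel_measurable lborel"
      by (intro borel_measurable_scaleR borel_measurable_indicator) (auto intro!: borel_measurable_continuous_onI continuous_intros)
  qed (auto simp: indicator_def)
  have nz: "p \<noteq> 0" using p by auto
  have "(LBINT z=ereal a..\<infinity>. exp (- (p * of_real z))) = 0 - (- (exp (- (p * of_real a)) / p))"
  proof (rule interval_integral_FTC_integrable[where F = "\<lambda>z. - (exp (- (p * of_real z)) / p)"])
    fix z :: real
    have "((\<lambda>w. - (exp (- (p * w)) / p)) has_field_derivative exp (- (p * of_real z))) (at (of_real z))"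
      using nz by (auto intro!: derivative_eq_intros)
    then show "((\<lambda>z. - (exp (- (p * of_real z)) / p)) has_vector_derivative exp (- (p * of_real z))) (at z)"
      by (rule has_vector_derivative_real_field)
    show "isCont (\<lambda>z. exp (- (p * of_real z))) z" by (intro continuous_intros)
  next
    show "set_integrable lborel (einterval (ereal a) \<infinity>) (\<lambda>z. exp (- (p * of_real z)))" unfolding E by (rule I)
    show "(((\<lambda>z. - (exp (- (p * of_real z)) / p)) \<circ> real_of_ereal) \<longlongrightarrow> - (exp (- (p * of_real a)) / p)) (at_right (ereal a))"
      unfolding ereal_tendsto_simps using nz by (intro tendsto_intros) auto
    show "(((\<lambda>z. - (exp (- (p * of_real z)) / p)) \<circ> real_of_ereal) \<longlongrightarrow> 0) (at_left \<infinity>)"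
      unfolding ereal_tendsto_simps
    proof (rule tendsto_norm_zero_cancel)
      have "norm (- (exp (- (p * of_real z)) / p)) = exp (- (Re p * z)) / norm p" for z by (simp add: norm_divide)
      moreover have "0 < norm p" using nz by simp
      then have "((\<lambda>z. exp (- (Re p * z)) / norm p) \<longlongrightarrow> 0) at_top" using p by real_asymp
      ultimately show "((\<lambda>z. norm (- (exp (- (p * of_real z)) / p))) \<longlongrightarrow> 0) at_top" by simp
    qed
  qed simp
  then show "(LINT z:{a<..}|lborel. exp (- (p * of_real z))) = exp (- (p * of_real a)) / p"
    by (simp add: interval_lebesgue_integral_def E)
qed

text \<open>The characteristic function of the standard normal distribution, with the normalisation
  of the density removed.\<close>

lemma gaussian_fourier:
  "(LINT t|lborel. exp (of_real (- t\<^sup>2 / 2) + \<i> * of_real (y * t))) = of_real (sqrt (2 * pi) * exp (- y\<^sup>2 / 2))"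
proof -
  have "of_real (exp (- y\<^sup>2 / 2)) = (LINT t|std_normal_distribution. iexp (y * t))"
    using char_std_normal_distribution by (simp add: char_def fun_eq_iff)
  also have "\<dots> = (LINT t|lborel. std_normal_density t *\<^sub>R iexp (y * t))"
    by (subst integral_density) (auto intro!: borel_measurable_continuous_onI continuous_intros)
  also have "\<dots> = (LINT t|lborel. of_real (1 / sqrt (2 * pi)) * exp (of_real (- t\<^sup>2 / 2) + \<i> * of_real (y * t)))"
    by (intro Bochner_Integration.integral_cong refl)
      (simp only: std_normal_density_def scaleR_conv_of_real exp_add exp_of_real of_real_mult mult.assoc)
  also have "\<dots> = of_real (1 / sqrt (2 * pi)) * (LINT t|lborel. exp (of_real (- t\<^sup>2 / 2) + \<i> * of_real (y * t)))"
    by simp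
  finally show ?thesis by (simp add: field_simps)
qed

text \<open>\<open>P = q * w s - w t\<close> has real part \<open>1 - q\<close>, so
  \<open>1 / P\<close> is a Laplace integral over a half line whose integrand splits into
  \<open>\<alpha> s z\<close> and \<open>\<beta> z t\<close>. In the opposite order the variable of
  the line is integrated first, and the result is a Gaussian Fourier transform.\<close>

theorem fredholm_determinants:
  fixes q \<tau> :: real and \<zeta> :: complex
  assumes q: "0 < q" "q < 1"
  defines "A \<equiv> (\<lambda>s t. \<zeta> * contour_kernel contour_infty (K_minus q \<tau>) s t)"
    and "B \<equiv> (\<lambda>z z'. \<zeta> * complex_of_real (K_hat q z z' * indicat_real {\<tau> * (1 + q) / (1 - q) <..} z'))"
  shows "fredholm_convergent lborel A \<and> fredholm_convergent lborel B \<and> fredholm_det lborel A = fredholm_det lborel B"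
proof -
  define a where "a = \<tau> * (1 + q) / (1 - q)"
  \<comment> \<open>The affine map sends the cut-off \<open>a\<close> to 0 and turns the Laplace
    variable into the variable of \<open>K_hat\<close>.\<close>
  define x where "x z = z / (1 + q) - \<tau> / (1 - q)" for z
  \<comment> \<open>Conjugation by \<open>exp (\<kappa> * z\<^sup>2)\<close> leaves the determinant
    unchanged; with this value the coefficients of \<open>z\<^sup>2\<close> and
    \<open>z'\<^sup>2\<close> in the Gaussian exponent become equal, as in
    \<open>K_hat\<close>.\<close>
  define \<kappa> where "\<kappa> = (1 - q) / (4 * (1 + q))"
  define w where "w t = contour_infty t" for t
  define e where "e z t = (w t)\<^sup>2 / 2 + of_real \<tau> * w t + of_real (x z) * w t + of_real (\<kappa> * z\<^sup>2)" for z t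
  define \<alpha> where "\<alpha> s z = of_real (indicat_real {a<..} z) * exp (- (of_real (q * x z) * w s) - of_real (\<kappa> * z\<^sup>2))" for s z
  define \<beta> where "\<beta> z t = \<zeta> / of_real (2 * pi * (1 + q)) * exp (e z t)" for z t
  define c where "c t = norm \<zeta> / (2 * pi * (1 + q)) * exp (1 / 2 - \<tau>) * exp (- t\<^sup>2 / 2)" for t
  \<comment> \<open>On the line of real part -1 the two factors have sizes
    \<open>exp (q * x z)\<close> and \<open>exp (- x z)\<close> once the conjugation cancels; as
    \<open>q < 1\<close> and \<open>x z\<close> is positive beyond the cut-off, the product is
    integrable.\<close>
  define g where "g z = indicat_real {a<..} z * exp (- ((1 - q) * x z))" for z
  have w: "Re (w t) = -1" "Im (w t) = - t" for t by (simp_all add: w_def contour_infty_def)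
  have Re_e: "Re (e z t) = (1 / 2 - \<tau>) + - t\<^sup>2 / 2 + (- x z + \<kappa> * z\<^sup>2)" for z t
    by (simp add: e_def w power2_eq_square field_simps)
  have wm: "w \<in> borel_measurable borel" unfolding w_def contour_infty_def by measurable
  have xm: "x \<in> borel_measurable borel" unfolding x_def by measurable
  interpret S: fredholm_factorisation \<alpha> \<beta> "\<lambda>z t. sgn \<zeta> * cis (Im (e z t))" "\<lambda>z. exp (- x z + \<kappa> * z\<^sup>2)" c g
  proof
    have [measurable]: "w \<in> borel_measurable borel" "x \<in> borel_measurable borel" by (rule wm xm)+
    show "(\<lambda>(s, z). \<alpha> s z) \<in> borel_measurable (lborel \<Otimes>\<^sub>M lborel)"
      "(\<lambda>(z, t). \<beta> z t) \<in> borel_measurable (lborel \<Otimes>\<^sub>M lborel)"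
      unfolding \<alpha>_def \<beta>_def e_def by measurable
    show "\<beta> z t = of_real (exp (- x z + \<kappa> * z\<^sup>2)) * of_real (c t) * (sgn \<zeta> * cis (Im (e z t)))" for z t
    proof -
      have z: "\<zeta> = of_real (norm \<zeta>) * sgn \<zeta>" by (simp add: sgn_eq)
      have "exp (e z t) = of_real (exp (1 / 2 - \<tau>) * exp (- t\<^sup>2 / 2) * exp (- x z + \<kappa> * z\<^sup>2)) * cis (Im (e z t))"
        unfolding exp_eq_polar[of "e z t"] Re_e exp_add ..
      then show ?thesis unfolding \<beta>_def c_def by (subst z) (simp add: field_simps)
    qed
    show "norm (sgn \<zeta> * cis (Im (e z t))) \<le> 1" for z t by (simp add: norm_mult norm_sgn)
    show "norm (\<alpha> s z) * exp (- x z + \<kappa> * z\<^sup>2) \<le> g z" for s z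
      by (simp add: \<alpha>_def g_def norm_mult w mult_exp_exp algebra_simps split: split_indicator)
    show "0 \<le> c t" for t using q by (simp add: c_def)
    show "integrable lborel c"
    proof -
      have "integrable lborel (\<lambda>t. sqrt (2 * pi) * std_normal_density t)" by simp
      then have "integrable lborel (\<lambda>t :: real. exp (- t\<^sup>2 / 2))" by (simp add: std_normal_density_def)
      then show ?thesis unfolding c_def by (intro integrable_mult_right)
    qed
    show "integrable lborel g"
    proof -
      have p: "0 < Re (of_real ((1 - q) / (1 + q)))" using q by simp
      have i: "integrable lborel (\<lambda>z. exp \<tau> * Re (indicat_real {a<..} z *\<^sub>R exp (- (of_real ((1 - q) / (1 + q)) * of_real z))))"
        using exp_tail_integral(1)[OF p, of a] unfolding set_integrable_def by (intro integrable_mult_right integrable_Re)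
      have eq: "exp \<tau> * Re (indicat_real {a<..} z *\<^sub>R exp (- (of_real ((1 - q) / (1 + q)) * of_real z))) = g z" for z
      proof -
        have "- ((1 - q) * x z) = \<tau> + - ((1 - q) / (1 + q) * z)" using q by (simp add: x_def right_diff_distrib)
        moreover have "complex_of_real ((1 - q) / (1 + q)) * of_real z = of_real ((1 - q) / (1 + q) * z)" by simp
        ultimately show ?thesis by (simp only: g_def exp_add of_real_minus[symmetric] exp_of_real scaleR_complex.sel Re_complex_of_real mult.left_commute)
      qed
      show ?thesis using i unfolding eq .
    qed
  qed simp
  have KA: "S.KA = A"
  proof (intro ext)
    fix s t
    define P where "P = of_real q * w s - w t"
    have P: "0 < Re P" "P \<noteq> 0" using q by (auto simp: P_def w complex_eq_iff)
    have p: "0 < Re (P / of_real (1 + q))" using P(1) q by (simp add: Re_divide_of_real del: of_real_add)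
    have e1: "\<alpha> s z * \<beta> z t = \<zeta> / of_real (2 * pi * (1 + q)) * exp ((w t)\<^sup>2 / 2 + of_real \<tau> * w t) * exp (P * of_real (\<tau> / (1 - q)))
      * (indicat_real {a<..} z *\<^sub>R exp (- (P / of_real (1 + q) * of_real z)))" for z
    proof -
      have "(- (of_real (q * x z) * w s) - of_real (\<kappa> * z\<^sup>2)) + e z t
        = ((w t)\<^sup>2 / 2 + of_real \<tau> * w t) + P * of_real (\<tau> / (1 - q)) + - (P / of_real (1 + q) * of_real z)"
        by (simp add: e_def P_def x_def algebra_simps diff_divide_distrib)
      then have "exp (- (of_real (q * x z) * w s) - of_real (\<kappa> * z\<^sup>2)) * exp (e z t)
        = exp ((w t)\<^sup>2 / 2 + of_real \<tau> * w t) * exp (P * of_real (\<tau> / (1 - q))) * exp (- (P / of_real (1 + q) * of_real z))"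
        by (simp only: exp_add[symmetric])
      then show ?thesis by (simp add: \<alpha>_def \<beta>_def split: split_indicator)
    qed
    have ea: "P * of_real (\<tau> / (1 - q)) = P / of_real (1 + q) * of_real a"
    proof -
      have "p * t = p / u * v" if "v = t * u" "u \<noteq> 0" for p t u v :: complex using that by simp
      moreover have "complex_of_real a = of_real (\<tau> / (1 - q)) * of_real (1 + q)"
        unfolding of_real_mult[symmetric] by (simp add: a_def)
      moreover have "complex_of_real (1 + q) \<noteq> 0" using q unfolding of_real_eq_0_iff by simp
      ultimately show ?thesis by blast
    qed
    have "S.KA s t = \<zeta> / of_real (2 * pi * (1 + q)) * exp ((w t)\<^sup>2 / 2 + of_real \<tau> * w t) * exp (P * of_real (\<tau> / (1 - q)))
      * (exp (- (P / of_real (1 + q) * of_real a)) / (P / of_real (1 + q)))"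
      unfolding S.KA_def e1 integral_mult_right_zero using exp_tail_integral(2)[OF p, of a] by (simp only: set_lebesgue_integral_def)
    also have "\<dots> = \<zeta> / of_real (2 * pi * (1 + q)) * exp ((w t)\<^sup>2 / 2 + of_real \<tau> * w t) / (P / of_real (1 + q))"
      unfolding ea by (simp add: exp_minus)
    also have "\<dots> = \<zeta> * (exp ((w t)\<^sup>2 / 2 + of_real \<tau> * w t) / - P * (- \<i>) / (2 * of_real pi * \<i>))"
    proof -
      have "\<zeta> / (2 * p * u) * E / (P / u) = \<zeta> * (E / - P * (- \<i>) / (2 * p * \<i>))"
        if "u \<noteq> 0" "p \<noteq> 0" for p u E :: complex using that P(2) by (simp add: field_simps)
      moreover have "complex_of_real (2 * pi * (1 + q)) = 2 * of_real pi * of_real (1 + q)"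
        by (simp only: of_real_mult of_real_numeral)
      moreover have "complex_of_real (1 + q) \<noteq> 0" using q unfolding of_real_eq_0_iff by simp
      moreover have "complex_of_real pi \<noteq> 0" by simp
      ultimately show ?thesis by metis
    qed
    also have "\<dots> = A s t"
    proof -
      have "(contour_infty has_vector_derivative - \<i>) (at t)"
        unfolding contour_infty_def[abs_def] by (auto intro!: derivative_eq_intros)
      then have "vector_derivative contour_infty (at t) = - \<i>" by (rule vector_derivative_at)
      then show ?thesis by (simp only: A_def contour_kernel_def K_minus_def w_def P_def minus_diff_eq)
    qed
    finally show "S.KA s t = A s t" .
  qed
  have KB: "S.KB = B"
  proof (intro ext)
    fix z z' :: real
    define y where "y = (z - q * z') / (1 + q)"
    have "q * (\<tau> / (1 - q)) = \<tau> / (1 - q) - \<tau>" using q by (simp add: field_simps)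
    \<comment> \<open>\<open>y\<close> is the total coefficient of \<open>w t\<close> in the
      exponent of the product, which the integration over the line turns into
      \<open>- y\<^sup>2 / 2\<close>.\<close>
    then have yx: "y = \<tau> + x z - q * x z'"
      unfolding y_def x_def diff_divide_distrib right_diff_distrib by simp
    have e1: "\<alpha> t z' * \<beta> z t = \<zeta> / of_real (2 * pi * (1 + q)) * of_real (indicat_real {a<..} z') * of_real (exp (\<kappa> * z\<^sup>2 - \<kappa> * z'\<^sup>2 + (1 / 2 - y)))
      * exp (of_real (- t\<^sup>2 / 2) + \<i> * of_real ((1 - y) * t))" for t
    proof -
      have "(- (of_real (q * x z') * w t) - of_real (\<kappa> * z'\<^sup>2)) + e z t
        = of_real (\<kappa> * z\<^sup>2 - \<kappa> * z'\<^sup>2 + (1 / 2 - y)) + (of_real (- t\<^sup>2 / 2) + \<i> * of_real ((1 - y) * t))"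
        by (rule complex_eqI) (simp_all add: e_def w yx power2_eq_square algebra_simps diff_divide_distrib)
      then have "exp (- (of_real (q * x z') * w t) - of_real (\<kappa> * z'\<^sup>2)) * exp (e z t)
        = of_real (exp (\<kappa> * z\<^sup>2 - \<kappa> * z'\<^sup>2 + (1 / 2 - y))) * exp (of_real (- t\<^sup>2 / 2) + \<i> * of_real ((1 - y) * t))"
        by (simp only: exp_add[symmetric] exp_of_real[symmetric])
      moreover have "(i * u) * (k * v) = k * i * r * s" if "u * v = r * s" for i u k v r s :: complex
        using arg_cong[OF that, of "\<lambda>x. k * i * x"] by (simp add: mult_ac)
      ultimately show ?thesis unfolding \<alpha>_def \<beta>_def by blast
    qed
    have "S.KB z z' = \<zeta> / of_real (2 * pi * (1 + q)) * of_real (indicat_real {a<..} z') * of_real (exp (\<kappa> * z\<^sup>2 - \<kappa> * z'\<^sup>2 + (1 / 2 - y)))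
      * of_real (sqrt (2 * pi) * exp (- (1 - y)\<^sup>2 / 2))"
      unfolding S.KB_def e1 integral_mult_right_zero gaussian_fourier ..
    also have "\<dots> = \<zeta> * of_real ((sqrt (2 * pi) / (2 * pi * (1 + q))) * (exp (\<kappa> * z\<^sup>2 - \<kappa> * z'\<^sup>2 + (1 / 2 - y)) * exp (- (1 - y)\<^sup>2 / 2)) * indicat_real {a<..} z')"
      by simp
    also have "exp (\<kappa> * z\<^sup>2 - \<kappa> * z'\<^sup>2 + (1 / 2 - y)) * exp (- (1 - y)\<^sup>2 / 2)
      = exp (- ((1 + q\<^sup>2) / (1 + q)\<^sup>2) * ((z\<^sup>2 + z'\<^sup>2) / 4) + q / (1 + q)\<^sup>2 * z * z')"
    proof -
      have k: "\<kappa> = (1 - q) * (1 + q) / (4 * (1 + q)\<^sup>2)" using q by (simp add: \<kappa>_def power2_eq_square)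
      have "\<kappa> * z\<^sup>2 - \<kappa> * z'\<^sup>2 + (1 / 2 - y) + - (1 - y)\<^sup>2 / 2 = \<kappa> * z\<^sup>2 - \<kappa> * z'\<^sup>2 - y\<^sup>2 / 2"
        by (simp add: power2_eq_square field_simps)
      also have "y\<^sup>2 / 2 = (z - q * z')\<^sup>2 / (2 * (1 + q)\<^sup>2)" by (simp add: y_def power_divide)
      also have "\<kappa> * z\<^sup>2 - \<kappa> * z'\<^sup>2 - (z - q * z')\<^sup>2 / (2 * (1 + q)\<^sup>2)
        = - ((1 + q\<^sup>2) / (1 + q)\<^sup>2) * ((z\<^sup>2 + z'\<^sup>2) / 4) + q / (1 + q)\<^sup>2 * z * z'"
      proof -
        have "r * z\<^sup>2 - r * z'\<^sup>2 - (z - q * z')\<^sup>2 / (2 * d) = - ((1 + q\<^sup>2) / d) * ((z\<^sup>2 + z'\<^sup>2) / 4) + q / d * z * z'"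
          if "r = (1 - q) * (1 + q) / (4 * d)" "d \<noteq> 0" for r d
          using that(2) unfolding that(1) by (simp add: divide_simps) (simp add: power2_eq_square algebra_simps)
        from this[OF k] show ?thesis using q by simp
      qed
      finally show ?thesis by (simp only: exp_add[symmetric])
    qed
    also have "sqrt (2 * pi) / (2 * pi * (1 + q)) = 1 / (sqrt (2 * pi) * (1 + q))"
    proof -
      have "sqrt (2 * pi) * sqrt (2 * pi) = 2 * pi" by simp
      then show ?thesis using q by (simp add: frac_eq_eq del: real_sqrt_mult_self)
    qed
    finally show "S.KB z z' = B z z'" unfolding B_def K_hat_def a_def .
  qed
  show ?thesis using S.fredholm_swap unfolding KA KB by blast
qed

theorem corollary1p5:
  fixes q \<tau> :: real
  assumes "0 < q" and "q < 1"
  shows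
    "(\<forall>\<zeta> :: complex.
        let A = (\<lambda>s t. \<zeta> * contour_kernel contour_infty (K_minus q \<tau>) s t);
            B = (\<lambda>z z'. \<zeta> * complex_of_real
                   (K_hat q z z' * indicat_real {\<tau> * (1 + q) / (1 - q) <..} z'))
        in fredholm_convergent lborel A \<and> fredholm_convergent lborel B \<and>
           fredholm_det lborel A = fredholm_det lborel B)
     \<and>
     (\<forall>(a :: int \<Rightarrow> real) (b :: int \<Rightarrow> real) (m :: nat).
        (\<forall>x. 0 < a x) \<and> (\<forall>x. b x = (1 - q) * a x) \<and> (\<forall>x. b x = 1) \<and> 1 \<le> m \<longrightarrow>
        (let \<gamma> = (1 - q) / (1 + q) in
         \<exists>L :: real.
           (\<lambda>n :: nat. \<P>(\<omega> in clocks. int n < qtazrp q a m (real n - \<tau> * sqrt (real n)) \<omega>))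
             \<longlonglongrightarrow> L \<and>
           ((\<lambda>t :: real. \<P>(\<omega> in clocks.
               (real_of_int (asep (q / (1 + q)) (1 / (1 + q)) m (t / \<gamma>) \<omega>) + t)
                 / (\<gamma> powr (1 / 2) * t powr (1 / 2))
               \<le> - (\<tau> * (1 + q) / (1 - q))))
             \<longlongrightarrow> L) at_top))"
proof (intro conjI allI impI)
  fix \<zeta> :: complex
  show "let A = (\<lambda>s t. \<zeta> * contour_kernel contour_infty (K_minus q \<tau>) s t);
            B = (\<lambda>z z'. \<zeta> * complex_of_real
                   (K_hat q z z' * indicat_real {\<tau> * (1 + q) / (1 - q) <..} z'))
        in fredholm_convergent lborel A \<and> fredholm_convergent lborel B \<and>
           fredholm_det lborel A = fredholm_det lborel B"
    unfolding Let_def by (rule fredholm_determinants[OF assms])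
next
  fix a b :: "int \<Rightarrow> real" and m :: nat
  assume "(\<forall>x. 0 < a x) \<and> (\<forall>x. b x = (1 - q) * a x) \<and> (\<forall>x. b x = 1) \<and> 1 \<le> m"
  then show "let \<gamma> = (1 - q) / (1 + q) in
         \<exists>L :: real.
           (\<lambda>n :: nat. \<P>(\<omega> in clocks. int n < qtazrp q a m (real n - \<tau> * sqrt (real n)) \<omega>))
             \<longlonglongrightarrow> L \<and>
           ((\<lambda>t :: real. \<P>(\<omega> in clocks.
               (real_of_int (asep (q / (1 + q)) (1 / (1 + q)) m (t / \<gamma>) \<omega>) + t)
                 / (\<gamma> powr (1 / 2) * t powr (1 / 2))
               \<le> - (\<tau> * (1 + q) / (1 - q))))
             \<longlongrightarrow> L) at_top"
    unfolding Let_def by (intro tail_limits[OF assms, where b = b]) auto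
qed

end
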